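(* Let $k\in\mathbb Z_{>0}$ and $p=1+\frac{k+2}{(k+1)n}$. Let $u_0\in L^1_1(\mathbb R^n)\cap L^\infty(\mathbb R^n)$ and let $u$ be the global solution with initial datum $u_0$. Then for every $q\in[1,\infty]$ there exists $C>0$ such that $$t^{\frac n2(1-\frac1q)}\|u(t)-\widetilde{\mathcal A}_{0,k+1}(t)\|_q\le Ct^{-\frac12}\quad\text{for all }t>2^{k+1},$$ where $\widetilde{\mathcal A}_{0,k+1}(t)=\mathcal A_{0,k}(t)+\sum_{j=1}^na_j\int_1^t\Lambda_{e_j,0}\big(t;f(\mathcal A_{0,k}(s))-f(\mathcal A_{0,k-1}(s))\big)ds.$
   Context: Let $n\ge1$, $a=(a_1,\dots,a_n)\in\mathbb R^n\setminus\{0\}$, $p\in(1,\infty)$, and let $f\in C^1(\mathbb R)$, $f\not\equiv0$, $f(0)=0$, satisfy $|f(\xi)-f(\eta)|\le C(|\xi|^{p-1}+|\eta|^{p-1})|\xi-\eta|$ for all $\xi,\eta$. $\|\cdot\|_q$ is the $L^q(\mathbb R^n)$ norm; $L^1_1(\mathbb R^n)=\{\varphi\in L^1: x_j\varphi\in L^1,\ j=1,\dots,n\}$. $G_t(x)=(4\pi t)^{-n/2}e^{-|x|^2/(4t)}$, $e^{t\Delta}\varphi=G_t*\varphi$ ($t>0$). For $u_0\in L^1\cap L^\infty$, the global solution of $\partial_tu-\Delta u=a\cdot\nabla f(u)$, $u(0)=u_0$, is the unique $u\in (C\cap L^\infty)([0,\infty);L^1)\cap(C\cap L^\infty)((0,\infty);L^\infty)$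 with $u(t)=e^{t\Delta}u_0+\int_0^ta\cdot\nabla e^{(t-s)\Delta}f(u(s))ds$ for all $t>0$. Dilation $(\delta_t\varphi)(x)=t^{-n/2}\varphi(t^{-1/2}x)$; $\mathcal M_0(\varphi)=\int\varphi\,dx$; $\mathcal A_0(t)=\mathcal M_0(u_0)G_t$; $\sigma=\frac n2(p-1)-\frac12$. $\mathcal A_{0,0}=\mathcal A_0$, and for $k\ge1$, $\mathcal A_{0,k}(t)=\mathcal A_0(t)+\int_0^1a\cdot\nabla e^{(t-s)\Delta}f(\mathcal A_0(s))ds+\int_1^ta\cdot\nabla e^{(t-s)\Delta}f(\mathcal A_{0,k-1}(s))ds$. For $\varphi\in L^1$, $\Lambda_{e_j,0}(t;\varphi)=-\frac12t^{-1/2}\mathcal M_0(\varphi)\,\delta_t(x_jG_1)$, where $x_jG_1$ denotes $x\mapsto x_jG_1(x)$. *)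

theory Defs
  imports "HOL-Analysis.Analysis" "HOL-Probability.Essential_Supremum"
begin

text \<open>Functions on R^n are modelled as functions on a Euclidean space 'a,
  with n = DIM('a). All integrals in x are Lebesgue integrals w.r.t. lborel.\<close>

text \<open>L^q norm, q in [1,\<infinity>], valued in ennreal (value \<infinity> means "not in L^q").\<close>
definition Lnorm :: "ereal \<Rightarrow> ('a::euclidean_space \<Rightarrow> real) \<Rightarrow> ennreal" where
  "Lnorm q f =
     (if q = \<infinity> then esssup lborel (\<lambda>x. ennreal \<bar>f x\<bar>)
      else (let I = (\<integral>\<^sup>+ x. ennreal (\<bar>f x\<bar> powr real_of_ereal q) \<partial>lborel)
            in if I = \<infinity> then \<infinity> else ennreal (enn2real I powr (1 / real_of_ereal q))))"

definition heatG :: "real \<Rightarrow> 'a::euclidean_space \<Rightarrow> real" where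
  "heatG t x = (4 * pi * t) powr (- real DIM('a) / 2) * exp (- (norm x)\<^sup>2 / (4 * t))"

definition heat :: "real \<Rightarrow> ('a::euclidean_space \<Rightarrow> real) \<Rightarrow> 'a \<Rightarrow> real" where
  "heat t \<phi> x = (\<integral> y. heatG t (x - y) * \<phi> y \<partial>lborel)"

text \<open>a\<cdot>\<nabla>G_t(x) = -(a\<cdot>x)/(2t) G_t(x), and a\<cdot>\<nabla>e^{t\<Delta>}\<phi> = (a\<cdot>\<nabla>G_t) * \<phi>.\<close>
definition dheatG :: "'a::euclidean_space \<Rightarrow> real \<Rightarrow> 'a \<Rightarrow> real" where
  "dheatG a t x = - (a \<bullet> x) / (2 * t) * heatG t x"

definition gradheat :: "'a::euclidean_space \<Rightarrow> real \<Rightarrow> ('a \<Rightarrow> real) \<Rightarrow> 'a \<Rightarrow> real" where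
  "gradheat a t \<phi> x = (\<integral> y. dheatG a t (x - y) * \<phi> y \<partial>lborel)"

definition duhamel :: "'a::euclidean_space \<Rightarrow> (real \<Rightarrow> real) \<Rightarrow> (real \<Rightarrow> 'a \<Rightarrow> real)
    \<Rightarrow> real \<Rightarrow> real \<Rightarrow> real \<Rightarrow> 'a \<Rightarrow> real" where
  "duhamel a f F t0 t1 t x =
     (LINT s:{t0..t1}|lborel. gradheat a (t - s) (\<lambda>y. f (F s y)) x)"

definition mass :: "('a::euclidean_space \<Rightarrow> real) \<Rightarrow> real" where
  "mass \<phi> = (\<integral> x. \<phi> x \<partial>lborel)"

definition A0 :: "('a::euclidean_space \<Rightarrow> real) \<Rightarrow> real \<Rightarrow> 'a \<Rightarrow> real" where
  "A0 u0 t x = mass u0 * heatG t x"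

fun A0k :: "'a::euclidean_space \<Rightarrow> (real \<Rightarrow> real) \<Rightarrow> ('a \<Rightarrow> real) \<Rightarrow> nat \<Rightarrow> real \<Rightarrow> 'a \<Rightarrow> real" where
  "A0k a f u0 0 t x = A0 u0 t x"
| "A0k a f u0 (Suc k) t x =
     A0 u0 t x + duhamel a f (A0 u0) 0 1 t x + duhamel a f (A0k a f u0 k) 1 t t x"

definition dil :: "real \<Rightarrow> ('a::euclidean_space \<Rightarrow> real) \<Rightarrow> 'a \<Rightarrow> real" where
  "dil t \<psi> x = t powr (- real DIM('a) / 2) * \<psi> (t powr (-1/2) *\<^sub>R x)"

definition Lam :: "'a::euclidean_space \<Rightarrow> real \<Rightarrow> ('a \<Rightarrow> real) \<Rightarrow> 'a \<Rightarrow> real" where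
  "Lam b t \<phi> x = - (1/2) * t powr (-1/2) * mass \<phi> * dil t (\<lambda>y. (y \<bullet> b) * heatG 1 y) x"

text \<open>\<tilde>A_{0,k+1}(t) for k \<ge> 1.\<close>
definition Atil :: "'a::euclidean_space \<Rightarrow> (real \<Rightarrow> real) \<Rightarrow> ('a \<Rightarrow> real) \<Rightarrow> nat \<Rightarrow> real \<Rightarrow> 'a \<Rightarrow> real" where
  "Atil a f u0 k t x = A0k a f u0 k t x +
     (\<Sum>b\<in>Basis. (a \<bullet> b) *
        (LINT s:{1..t}|lborel.
           Lam b t (\<lambda>y. f (A0k a f u0 k s y) - f (A0k a f u0 (k - 1) s y)) x))"

text \<open>Global solution: u \<in> (C\<inter>L^\<infinity>)([0,\<infinity>);L^1) \<inter> (C\<inter>L^\<infinity>)((0,\<infinity>);L^\<infinity>), u(0)=u_0,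
  and the Duhamel formula holds (as an identity in L^1, i.e. a.e.) for all t > 0.\<close>
definition global_solution ::
  "'a::euclidean_space \<Rightarrow> (real \<Rightarrow> real) \<Rightarrow> ('a \<Rightarrow> real) \<Rightarrow> (real \<Rightarrow> 'a \<Rightarrow> real) \<Rightarrow> bool" where
  "global_solution a f u0 u \<longleftrightarrow>
     (\<forall>t\<ge>0. integrable lborel (u t)) \<and>
     (\<forall>t0\<ge>0. ((\<lambda>t. Lnorm 1 (\<lambda>x. u t x - u t0 x)) \<longlongrightarrow> 0) (at t0 within {0..})) \<and>
     (\<exists>M. \<forall>t\<ge>0. Lnorm 1 (u t) \<le> ennreal M) \<and>
     (\<forall>t>0. Lnorm \<infinity> (u t) < \<infinity>) \<and>
     (\<forall>t0>0. ((\<lambda>t. Lnorm \<infinity> (\<lambda>x. u t x - u t0 x)) \<longlongrightarrow> 0) (at t0 within {0<..})) \<and>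
     (\<exists>M. \<forall>t>0. Lnorm \<infinity> (u t) \<le> ennreal M) \<and>
     (AE x in lborel. u 0 x = u0 x) \<and>
     (\<forall>t>0. AE x in lborel. u t x = heat t u0 x + duhamel a f u 0 t t x)"

end

theory Submission
  imports Defs "HOL-Probability.Distributions"
begin

text \<open>
  Large solutions decay because of the conservation-law structure. By Duhamel's formula the solution
  is Lipschitz under translations, uniformly for t >= 1, and then the flux contributes only
  O(h^(3/2)) to the change of the squared L2 norm over a time step h: with F' = f, the integral of
  F(u(x - z)) - F(u(x)) over x vanishes. The heat semigroup meanwhile removes at least a fixed amount per unit time
  as long as the L2 norm stays away from 0. So the L2 norm, and by the Lipschitz bound also the sup norm,
  becomes arbitrarily small. Since sigma > 0, a bootstrap in Duhamel's formula then gives the decay rate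
  t^(-n/2) of the heat kernel.

  Once this decay is known, each iteration of Duhamel's formula improves the error u - A_(0,j) by a factor
  t^(-sigma), and (k + 1) sigma = 1/2. At j = k + 1 the source terms are integrable in time, so the error is
  O(t^(-1/2)). The increment A_(0,k+1) - A_(0,k) has a source of L1 size 1/s; replacing
  the propagated source by its mass times a.grad G_t costs its first moment, of size s^(1/2) / s, divided by t,
  which integrates to O(t^(-1/2)).
\<close>

section \<open>Gaussian kernels\<close>

text \<open>With n(p - 1)/2 = 1/2 + sigma, the flux is Lipschitz with constant s^(-1/2 - sigma) on
  functions of size s^(-n/2), while the Duhamel kernel costs (t - s)^(-1/2); the time integral of
  the product is t^(-sigma), which is the gain per iteration. The obstacle is that k + 1 gains add
  up to exactly 1/2: at that point the time integral of the source is logarithmic, and a direct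
  estimate of A_(0,k+1) - A_(0,k) yields only t^(-1/2) log t. The correction in \<open>Atil\<close>
  isolates the logarithm as an explicit multiple of a.grad G_t. To bound what is left, first moments
  of the increments have to be carried through the induction along with the L1 and sup norms.

  The solution itself is never differentiated: energy is compared over finite time steps, and the
  bound on translates stands in for a gradient bound. Everything is done on a version of the
  solution that is jointly measurable and satisfies Duhamel's formula at every point, because Fubini
  in time and space is used throughout and the sup bounds are pointwise.\<close>

lemma lborel_reflect: "distr lborel borel (\<lambda>y. x - y) = (lborel :: 'a::euclidean_space measure)"
  using lborel_affine[of "-1" x] by (simp add: density_1)

lemma nn_integral_reflect:
  fixes f :: "'a::euclidean_space \<Rightarrow> ennreal"
  assumes [measurable]: "f \<in> borel_measurable borel"
  shows "(\<integral>\<^sup>+y. f (x - y) \<partial>lborel) = (\<integral>\<^sup>+y. f y \<partial>lborel)"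
  by (subst (2) lborel_reflect[of x, symmetric]) (simp add: nn_integral_distr)

lemma nn_integral_translate:
  fixes f :: "'a::euclidean_space \<Rightarrow> ennreal"
  assumes [measurable]: "f \<in> borel_measurable borel"
  shows "(\<integral>\<^sup>+y. f (y - x) \<partial>lborel) = (\<integral>\<^sup>+y. f y \<partial>lborel)"
  by (subst (2) lborel_distr_plus[of "-x", symmetric]) (simp add: nn_integral_distr)

lemma integral_reflect:
  fixes f :: "'a::euclidean_space \<Rightarrow> real"
  assumes [measurable]: "f \<in> borel_measurable borel"
  shows "(\<integral>y. f (x - y) \<partial>lborel) = (\<integral>y. f y \<partial>lborel)"
  by (subst (2) lborel_reflect[of x, symmetric]) (simp add: integral_distr)

lemma integral_translate:
  fixes f :: "'a::euclidean_space \<Rightarrow> real"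
  assumes [measurable]: "f \<in> borel_measurable borel"
  shows "(\<integral>y. f (y - x) \<partial>lborel) = (\<integral>y. f y \<partial>lborel)"
  by (subst (2) lborel_distr_plus[of "-x", symmetric]) (simp add: integral_distr)

lemma integrable_translate:
  fixes f :: "'a::euclidean_space \<Rightarrow> real"
  assumes "integrable lborel f"
  shows "integrable lborel (\<lambda>y. f (y - x))"
  using assms borel_measurable_integrable[OF assms]
  by (subst (asm) lborel_distr_plus[of "-x", symmetric]) (simp add: integrable_distr_eq)

lemma integrable_reflect:
  fixes f :: "'a::euclidean_space \<Rightarrow> real"
  assumes "integrable lborel f"
  shows "integrable lborel (\<lambda>y. f (x - y))"
  using assms borel_measurable_integrable[OF assms]
  by (subst (asm) lborel_reflect[of x, symmetric]) (simp add: integrable_distr_eq)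

lemma heatG_measurable [measurable]: "(\<lambda>(t, x). heatG t x) \<in> borel_measurable (borel \<Otimes>\<^sub>M borel)"
  unfolding heatG_def by measurable

lemma dheatG_measurable [measurable]: "(\<lambda>(t, x). dheatG a t x) \<in> borel_measurable (borel \<Otimes>\<^sub>M borel)"
  unfolding dheatG_def heatG_def by measurable

lemma heatG_nonneg [simp]: "0 \<le> heatG t x"
  unfolding heatG_def by simp

lemma heatG_le: "0 < t \<Longrightarrow> heatG t (x::'a::euclidean_space) \<le> t powr (- real DIM('a) / 2)"
proof -
  assume t: "0 < t"
  have "(4 * pi * t) powr (- real DIM('a) / 2) \<le> t powr (- real DIM('a) / 2)"
    using t pi_gt3 by (intro powr_mono2') auto
  moreover have "exp (- (norm x)\<^sup>2 / (4 * t)) \<le> 1" using t by simp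
  ultimately show ?thesis unfolding heatG_def
    using mult_mono[of "(4 * pi * t) powr (- real DIM('a) / 2)" _ "exp (- (norm x)\<^sup>2 / (4 * t))" 1] by simp
qed

text \<open>Reduction to one dimension: G_t is the product over the coordinates of centred normal
  densities of variance 2t, each of total mass 1.\<close>

lemma nn_integral_heatG:
  assumes t: "0 < t"
  shows "(\<integral>\<^sup>+x. ennreal (heatG t (x::'a::euclidean_space)) \<partial>lborel) = 1"
proof -
  have n1: "(\<integral>\<^sup>+x. ennreal (normal_density 0 (sqrt (2*t)) x) \<partial>lborel) = 1"
    by (subst nn_integral_eq_integral) (use t in \<open>auto intro: integrable_normal_density\<close>)
  have eq: "heatG t x = (\<Prod>b\<in>Basis. normal_density 0 (sqrt (2*t)) (x \<bullet> b))" for x :: 'a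
  proof -
    have "(\<Prod>b\<in>Basis. normal_density 0 (sqrt (2*t)) (x \<bullet> b)) =
        (1 / sqrt (4 * pi * t)) ^ DIM('a) * (\<Prod>b\<in>Basis. exp (- (x \<bullet> b)\<^sup>2 / (4*t)))"
      using t by (simp add: normal_density_def prod.distrib prod_dividef power_divide mult_ac)
    also have "(\<Prod>b\<in>Basis. exp (- (x \<bullet> b)\<^sup>2 / (4*t))) = exp (\<Sum>b\<in>Basis. - (x \<bullet> b)\<^sup>2 / (4*t))"
      by (simp add: exp_sum)
    also have "(\<Sum>b\<in>Basis. - (x \<bullet> b)\<^sup>2 / (4*t)) = - (norm x)\<^sup>2 / (4*t)"
      by (simp add: norm_eq_sqrt_inner euclidean_inner[of x x] sum_divide_distrib sum_negf power2_eq_square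
          sum_nonneg)
    also have "(1 / sqrt (4 * pi * t)) ^ DIM('a) = (4 * pi * t) powr (- real DIM('a) / 2)"
      using t by (simp add: powr_half_sqrt[symmetric] powr_realpow[symmetric] powr_powr powr_minus_divide power_divide
          del: powr_half_sqrt powr_realpow)
    finally show ?thesis by (simp add: heatG_def)
  qed
  have "(\<integral>\<^sup>+x. ennreal (heatG t (x::'a)) \<partial>lborel) =
    (\<integral>\<^sup>+x. (\<Prod>b\<in>Basis. ennreal (normal_density 0 (sqrt (2*t)) (x \<bullet> b))) \<partial>(lborel :: 'a measure))"
    by (simp add: eq prod_ennreal)
  also have "\<dots> = 1" by (subst nn_integral_lborel_prod) (auto simp: n1)
  finally show ?thesis .
qed

lemma integrable_heatG: "0 < t \<Longrightarrow> integrable lborel (heatG t :: 'a::euclidean_space \<Rightarrow> real)"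
  by (rule integrableI_nonneg) (auto simp: nn_integral_heatG)

lemma integral_heatG: "0 < t \<Longrightarrow> (\<integral>x. heatG t (x::'a::euclidean_space) \<partial>lborel) = 1"
  by (subst integral_eq_nn_integral) (auto simp: nn_integral_heatG)

lemma heatG_minus [simp]: "heatG t (- x) = heatG t x"
  by (simp add: heatG_def)

lemma dheatG_minus [simp]: "dheatG a t (- x) = - dheatG a t x"
  by (simp add: dheatG_def)

lemma heatG_scale_le:
  assumes "0 < t" "t \<le> r"
  shows "heatG t (x::'a::euclidean_space) \<le> (r / t) powr (real DIM('a) / 2) * heatG r x"
proof -
  have "(4 * pi * t) powr (- real DIM('a) / 2) = (r / t) powr (real DIM('a) / 2) * (4 * pi * r) powr (- real DIM('a) / 2)"
    using assms by (simp add: powr_minus powr_divide powr_mult field_simps)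
  moreover have "exp (- (norm x)\<^sup>2 / (4 * t)) \<le> exp (- (norm x)\<^sup>2 / (4 * r))"
    using assms by (auto intro!: divide_left_mono)
  ultimately show ?thesis unfolding heatG_def
    by (simp add: mult.assoc mult_left_mono)
qed

text \<open>The factor 2^(n/2) is the cost of doubling the time in the Gaussian prefactor; the other
  factor 2 pays for absorbing one power of |x| in \<open>norm_mult_heatG_le\<close>. Larger
  constants are formed from powers of it, without aiming at sharpness.\<close>

definition gauss_const :: "'a::euclidean_space itself \<Rightarrow> real" where
  "gauss_const _ = 2 * 2 powr (real DIM('a) / 2)"

lemma gauss_const_ge: "2 \<le> gauss_const TYPE('a::euclidean_space)"
  unfolding gauss_const_def by (simp add: ge_one_powr_ge_zero)

text \<open>In the variable z = |x| / sqrt t this is z exp(-z^2/4) <= 2 exp(-z^2/8): half of the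
  Gaussian exponent absorbs the factor z, and the other half is the Gaussian at doubled
  time.\<close>

lemma norm_mult_heatG_le:
  assumes t: "0 < t"
  shows "norm x * heatG t (x::'a::euclidean_space) \<le> gauss_const TYPE('a) * (sqrt t * heatG (2*t) x)"
proof -
  define z where "z = norm x / sqrt t"
  have z: "(norm x)\<^sup>2 / t = z\<^sup>2" "norm x = z * sqrt t" using t by (auto simp: z_def power_divide)
  \<comment> \<open>A consequence of (z - 2)^2 >= 0, arranged for the inequality 1 + w <= exp
    w.\<close>
  have "z \<le> 2 * (1 + z\<^sup>2 / 8)"
    using zero_le_power2[of "z - 2"] by (simp add: power2_eq_square algebra_simps)
  also have "\<dots> \<le> 2 * exp (z\<^sup>2 / 8)" by (intro mult_left_mono exp_ge_add_one_self) auto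
  finally have "z * exp (- z\<^sup>2 / 4) \<le> 2 * exp (z\<^sup>2 / 8) * exp (- z\<^sup>2 / 4)"
    by (intro mult_right_mono) auto
  also have "\<dots> = 2 * exp (- z\<^sup>2 / 8)" by (simp add: exp_add[symmetric] mult.assoc)
  finally have *: "z * exp (- z\<^sup>2 / 4) \<le> 2 * exp (- z\<^sup>2 / 8)" .
  have h: "heatG t x = (4 * pi * t) powr (- real DIM('a) / 2) * exp (- z\<^sup>2 / 4)"
    by (simp add: heatG_def z(1)[symmetric])
  have h2: "heatG (2*t) x = (4 * pi * (2*t)) powr (- real DIM('a) / 2) * exp (- z\<^sup>2 / 8)"
    by (simp add: heatG_def z(1)[symmetric])
  have c: "(4 * pi * t) powr (- real DIM('a) / 2) = 2 powr (real DIM('a) / 2) * (4 * pi * (2*t)) powr (- real DIM('a) / 2)"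
    using t powr_mult[of "4 * pi * t" 2 "- real DIM('a) / 2"] by (simp add: powr_minus field_simps)
  have "norm x * heatG t x = (sqrt t * (4 * pi * t) powr (- real DIM('a) / 2)) * (z * exp (- z\<^sup>2 / 4))"
    by (simp add: h z(2))
  also have "\<dots> \<le> (sqrt t * (4 * pi * t) powr (- real DIM('a) / 2)) * (2 * exp (- z\<^sup>2 / 8))"
    using t by (intro mult_left_mono *) auto
  also have "\<dots> = gauss_const TYPE('a) * (sqrt t * heatG (2*t) x)"
    unfolding h2 c gauss_const_def by simp
  finally show ?thesis .
qed

lemma heatG_double_le: "0 < t \<Longrightarrow> heatG t (x::'a::euclidean_space) \<le> gauss_const TYPE('a) * heatG (2*t) x"
proof -
  assume t: "0 < t"
  have "heatG t x \<le> 2 powr (real DIM('a) / 2) * heatG (2*t) x"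
    using heatG_scale_le[of t "2*t" x] t by simp
  also have "\<dots> \<le> gauss_const TYPE('a) * heatG (2*t) x"
    unfolding gauss_const_def by (intro mult_right_mono) auto
  finally show ?thesis .
qed

lemma abs_dheatG_le:
  assumes t: "0 < t"
  shows "\<bar>dheatG a t (x::'a::euclidean_space)\<bar> \<le> gauss_const TYPE('a) * norm a * t powr (-1/2) * heatG (2*t) x"
proof -
  have "\<bar>dheatG a t x\<bar> = \<bar>a \<bullet> x\<bar> / (2*t) * heatG t x"
    using t by (simp add: dheatG_def abs_mult)
  also have "\<dots> \<le> (norm a * norm x) / (2*t) * heatG t x"
    using t by (intro mult_right_mono divide_right_mono Cauchy_Schwarz_ineq2) auto
  also have "\<dots> = norm a / (2*t) * (norm x * heatG t x)" by simp
  also have "\<dots> \<le> norm a / (2*t) * (gauss_const TYPE('a) * (sqrt t * heatG (2*t) x))"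
    using t norm_mult_heatG_le[OF t, of x] by (intro mult_left_mono) auto
  also have "\<dots> = (gauss_const TYPE('a) * norm a * (sqrt t / t) * heatG (2*t) x) / 2" by (simp add: field_simps)
  also have "\<dots> \<le> gauss_const TYPE('a) * norm a * (sqrt t / t) * heatG (2*t) x"
  proof -
    have "0 \<le> gauss_const TYPE('a) * norm a * (sqrt t / t) * heatG (2*t) x"
      using t gauss_const_ge[where 'a='a] by (intro mult_nonneg_nonneg) auto
    then show ?thesis using field_sum_of_halves[of "gauss_const TYPE('a) * norm a * (sqrt t / t) * heatG (2*t) x"]
      by (metis add_increasing2 divide_nonneg_nonneg order_refl zero_le_numeral)
  qed
  also have "sqrt t / t = t powr (-1/2)"
    using t by (simp add: powr_minus_divide powr_half_sqrt divide_simps)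
  finally show ?thesis .
qed

text \<open>Each further power of |x| is absorbed by another doubling of the time and improves the
  power of t by 1/2: the kernel alone is of order t^(-1/2) with time 2t, with |x| of order 1 with
  time 4t, with |x|^2 of order sqrt t with time 8t.\<close>

lemma norm_dheatG_le:
  assumes t: "0 < t"
  shows "norm x * \<bar>dheatG a t (x::'a::euclidean_space)\<bar> \<le> 2 * (gauss_const TYPE('a))\<^sup>2 * norm a * heatG (4*t) x"
proof -
  let ?k = "gauss_const TYPE('a)"
  have k: "0 \<le> ?k" using gauss_const_ge[where 'a='a] by simp
  have "norm x * \<bar>dheatG a t x\<bar> \<le> norm x * (?k * norm a * t powr (-1/2) * heatG (2*t) x)"
    by (intro mult_left_mono abs_dheatG_le t) auto
  also have "\<dots> = ?k * norm a * t powr (-1/2) * (norm x * heatG (2*t) x)" by simp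
  also have "\<dots> \<le> ?k * norm a * t powr (-1/2) * (?k * (sqrt (2*t) * heatG (2*(2*t)) x))"
    using t k norm_mult_heatG_le[of "2*t" x] by (intro mult_left_mono) auto
  also have "\<dots> = (?k\<^sup>2 * norm a * heatG (4*t) x) * (t powr (-1/2) * sqrt (2*t))"
    by (simp add: power2_eq_square)
  also have "t powr (-1/2) * sqrt (2*t) = sqrt 2"
    using t by (simp add: powr_minus_divide powr_half_sqrt real_sqrt_mult)
  also have "(?k\<^sup>2 * norm a * heatG (4*t) x) * sqrt 2 \<le> (?k\<^sup>2 * norm a * heatG (4*t) x) * 2"
    by (intro mult_left_mono) (auto simp: real_le_lsqrt)
  finally show ?thesis by (simp add: mult_ac)
qed

lemma norm2_dheatG_le:
  assumes t: "0 < t"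
  shows "(norm x)\<^sup>2 * \<bar>dheatG a t (x::'a::euclidean_space)\<bar> \<le> 4 * (gauss_const TYPE('a))^3 * norm a * sqrt t * heatG (8*t) x"
proof -
  let ?k = "gauss_const TYPE('a)"
  have k: "0 \<le> ?k" using gauss_const_ge[where 'a='a] by simp
  have "(norm x)\<^sup>2 * \<bar>dheatG a t x\<bar> = norm x * (norm x * \<bar>dheatG a t x\<bar>)" by (simp add: power2_eq_square)
  also have "\<dots> \<le> norm x * (2 * ?k\<^sup>2 * norm a * heatG (4*t) x)"
    by (intro mult_left_mono norm_dheatG_le t) auto
  also have "\<dots> = 2 * ?k\<^sup>2 * norm a * (norm x * heatG (4*t) x)" by simp
  also have "\<dots> \<le> 2 * ?k\<^sup>2 * norm a * (?k * (sqrt (4*t) * heatG (2*(4*t)) x))"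
    using t k norm_mult_heatG_le[of "4*t" x] by (intro mult_left_mono) auto
  also have "\<dots> = 4 * ?k^3 * norm a * sqrt t * heatG (8*t) x"
    by (simp add: power2_eq_square power3_eq_cube real_sqrt_mult)
  finally show ?thesis .
qed

lemma integrable_dheatG:
  assumes t: "0 < t" shows "integrable lborel (dheatG a t :: 'a::euclidean_space \<Rightarrow> real)"
  by (rule Bochner_Integration.integrable_bound[where f="\<lambda>x. gauss_const TYPE('a) * norm a * t powr (-1/2) * heatG (2*t) x"])
     (use t abs_dheatG_le[OF t] integrable_heatG[of "2*t"] gauss_const_ge[where 'a='a] in \<open>auto intro!: AE_I2 simp: abs_mult\<close>)

lemma integral_dheatG: "(\<integral>x. dheatG a t (x::'a::euclidean_space) \<partial>lborel) = 0"
proof -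
  have "(\<integral>x. dheatG a t (x::'a) \<partial>lborel) = (\<integral>x. dheatG a t (0 - x) \<partial>lborel)"
    by (rule integral_reflect[symmetric]) simp
  then show ?thesis by simp
qed


section \<open>Increments of the kernels in space and time\<close>

text \<open>A mean value bound alone would leave the supremum of a Gaussian over a segment. For |y|
  <= sqrt r the intermediate point can be replaced by x at doubled time. For |y| > sqrt r both
  values are estimated separately and sqrt r is traded for |y|. This is why Gaussians at x and at x
  - y both appear.\<close>

lemma segment_gaussian_bound:
  fixes \<Psi> :: "'a::euclidean_space \<Rightarrow> real"
  assumes r: "0 < r" and Q: "0 \<le> Q"
    and small: "\<And>z. \<bar>\<Psi> z\<bar> \<le> Q * sqrt r * heatG r z"
    and der: "\<And>\<theta>. ((\<lambda>\<theta>. \<Psi> (x - \<theta> *\<^sub>R y)) has_real_derivative D \<theta>) (at \<theta>)"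
    and D: "\<And>\<theta>. \<bar>D \<theta>\<bar> \<le> Q * norm y * heatG r (x - \<theta> *\<^sub>R y)"
  shows "\<bar>\<Psi> (x - y) - \<Psi> x\<bar> \<le> exp 1 * gauss_const TYPE('a) * Q * norm y * (heatG (2*r) x + heatG (2*r) (x - y))"
proof (cases "norm y \<le> sqrt r")
  case True
  obtain z where z: "0 < z" "z < 1" "\<Psi> (x - y) - \<Psi> x = D z"
    using MVT2[of 0 1 "\<lambda>\<theta>. \<Psi> (x - \<theta> *\<^sub>R y)" D] der by auto
  let ?z = "x - z *\<^sub>R y"
  have "norm x \<le> norm ?z + norm y"
  proof -
    have "norm x \<le> norm ?z + norm (z *\<^sub>R y)" by (metis diff_add_cancel norm_triangle_ineq)
    also have "norm (z *\<^sub>R y) \<le> norm y" using z by (simp add: mult_left_le_one_le)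
    finally show ?thesis by simp
  qed
  then have "(norm x)\<^sup>2 \<le> (norm ?z + norm y)\<^sup>2" by (intro power_mono) auto
  also have "\<dots> \<le> 2 * (norm ?z)\<^sup>2 + 2 * (norm y)\<^sup>2"
    using zero_le_power2[of "norm ?z - norm y"] by (simp add: power2_eq_square algebra_simps)
  also have "(norm y)\<^sup>2 \<le> r" using power_mono[OF True, of 2] r by simp
  finally have nx: "(norm x)\<^sup>2 \<le> 2 * (norm ?z)\<^sup>2 + 2 * r" by simp
  \<comment> \<open>Since |x|^2 <= 2 |z|^2 + 2r, the exponent at x is halved, which means time 2r,
    and the term 2r costs less than a factor e.\<close>
  have "heatG r ?z \<le> exp 1 * gauss_const TYPE('a) * heatG (2*r) x"
  proof -
    have "- (norm ?z)\<^sup>2 / (4*r) \<le> 1 + - (norm x)\<^sup>2 / (4 * (2*r))"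
      using nx r by (simp add: field_simps)
    then have e: "exp (- (norm ?z)\<^sup>2 / (4*r)) \<le> exp 1 * exp (- (norm x)\<^sup>2 / (4 * (2*r)))"
      by (simp add: exp_add[symmetric])
    have c: "(4 * pi * r) powr (- real DIM('a) / 2) = 2 powr (real DIM('a) / 2) * (4 * pi * (2*r)) powr (- real DIM('a) / 2)"
      using r powr_mult[of "4 * pi * r" 2 "- real DIM('a) / 2"] by (simp add: powr_minus field_simps)
    have "heatG r ?z = 2 powr (real DIM('a) / 2) * (4 * pi * (2*r)) powr (- real DIM('a) / 2) * exp (- (norm ?z)\<^sup>2 / (4*r))"
      unfolding heatG_def c by simp
    also have "\<dots> \<le> 2 powr (real DIM('a) / 2) * (4 * pi * (2*r)) powr (- real DIM('a) / 2) * (exp 1 * exp (- (norm x)\<^sup>2 / (4 * (2*r))))"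
      by (intro mult_left_mono e) auto
    also have "\<dots> = exp 1 * 2 powr (real DIM('a) / 2) * heatG (2*r) x"
      unfolding heatG_def by simp
    also have "\<dots> \<le> exp 1 * gauss_const TYPE('a) * heatG (2*r) x"
      unfolding gauss_const_def by (intro mult_right_mono mult_left_mono) auto
    finally show ?thesis .
  qed
  then have "\<bar>\<Psi> (x - y) - \<Psi> x\<bar> \<le> Q * norm y * (exp 1 * gauss_const TYPE('a) * heatG (2*r) x)"
    unfolding z(3) using D[of z] Q by (meson mult_left_mono mult_nonneg_nonneg norm_ge_zero order_trans)
  also have "\<dots> \<le> Q * norm y * (exp 1 * gauss_const TYPE('a) * (heatG (2*r) x + heatG (2*r) (x - y)))"
    using Q gauss_const_ge[where 'a='a] by (intro mult_left_mono) auto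
  finally show ?thesis by (simp add: mult_ac)
next
  case False
  have le: "\<bar>\<Psi> z\<bar> \<le> Q * norm y * (gauss_const TYPE('a) * heatG (2*r) z)" for z
  proof -
    have "\<bar>\<Psi> z\<bar> \<le> Q * sqrt r * heatG r z" by (rule small)
    also have "\<dots> \<le> Q * norm y * (gauss_const TYPE('a) * heatG (2*r) z)"
      using False Q r by (intro mult_mono mult_left_mono heatG_double_le) auto
    finally show ?thesis .
  qed
  have "\<bar>\<Psi> (x - y) - \<Psi> x\<bar> \<le> \<bar>\<Psi> x\<bar> + \<bar>\<Psi> (x - y)\<bar>" by simp
  also have "\<dots> \<le> Q * norm y * (gauss_const TYPE('a) * heatG (2*r) x) + Q * norm y * (gauss_const TYPE('a) * heatG (2*r) (x - y))"
    by (intro add_mono le)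
  also have "\<dots> = 1 * (gauss_const TYPE('a) * Q * norm y * (heatG (2*r) x + heatG (2*r) (x - y)))"
    by (simp add: algebra_simps)
  also have "\<dots> \<le> exp 1 * (gauss_const TYPE('a) * Q * norm y * (heatG (2*r) x + heatG (2*r) (x - y)))"
    using Q gauss_const_ge[where 'a='a] by (intro mult_right_mono) auto
  finally show ?thesis by (simp add: mult_ac)
qed

lemma has_derivative_heatG_line:
  assumes t: "0 < t"
  shows "((\<lambda>\<theta>. heatG t (x - \<theta> *\<^sub>R y)) has_real_derivative - dheatG y t (x - \<theta> *\<^sub>R y)) (at \<theta>)"
proof -
  have "((\<lambda>\<theta>. (norm (x - \<theta> *\<^sub>R y))\<^sup>2) has_real_derivative - 2 * (y \<bullet> (x - \<theta> *\<^sub>R y))) (at \<theta>)"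
    unfolding power2_norm_eq_inner has_field_derivative_def
    by (rule has_derivative_eq_rhs, (rule derivative_intros)+) (auto simp: fun_eq_iff inner_diff inner_commute algebra_simps)
  from DERIV_cmult[OF DERIV_fun_exp[OF DERIV_cdivide[OF DERIV_minus[OF this], of "4 * t"]]]
  show ?thesis
    unfolding heatG_def dheatG_def by (rule DERIV_cong) (use t in \<open>auto simp: field_simps\<close>)
qed

lemma heatG_diff_le:
  assumes t: "0 < t"
  shows "\<bar>heatG t (x - y) - heatG t (x::'a::euclidean_space)\<bar> \<le>
    exp 1 * (gauss_const TYPE('a))\<^sup>2 * t powr (-1/2) * norm y * (heatG (4*t) x + heatG (4*t) (x - y))"
proof -
  have st: "t powr (-1/2) * sqrt (2*t) = sqrt 2"
    using t by (simp add: powr_minus_divide powr_half_sqrt real_sqrt_mult)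
  have "\<bar>heatG t (x - y) - heatG t x\<bar> \<le>
    exp 1 * gauss_const TYPE('a) * (gauss_const TYPE('a) * t powr (-1/2)) * norm y * (heatG (2*(2*t)) x + heatG (2*(2*t)) (x - y))"
  proof (rule segment_gaussian_bound)
    show "\<bar>heatG t z\<bar> \<le> gauss_const TYPE('a) * t powr (-1/2) * sqrt (2*t) * heatG (2*t) z" for z :: 'a
    proof -
      have "\<bar>heatG t z\<bar> \<le> gauss_const TYPE('a) * heatG (2*t) z" using heatG_double_le[OF t] by simp
      also have "\<dots> \<le> (gauss_const TYPE('a) * sqrt 2) * heatG (2*t) z"
        using gauss_const_ge[where 'a='a] by (intro mult_right_mono) auto
      finally show ?thesis using st by (simp add: mult.assoc)
    qed
    show "((\<lambda>\<theta>. heatG t (x - \<theta> *\<^sub>R y)) has_real_derivative - dheatG y t (x - \<theta> *\<^sub>R y)) (at \<theta>)" for \<theta>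
      by (rule has_derivative_heatG_line[OF t])
    show "\<bar>- dheatG y t (x - \<theta> *\<^sub>R y)\<bar> \<le> gauss_const TYPE('a) * t powr (-1/2) * norm y * heatG (2*t) (x - \<theta> *\<^sub>R y)" for \<theta>
      using abs_dheatG_le[OF t, of y "x - \<theta> *\<^sub>R y"] by (simp add: mult_ac)
  qed (use t gauss_const_ge[where 'a='a] in auto)
  then show ?thesis by (simp add: power2_eq_square mult_ac)
qed

lemma dheatG_diff_le:
  obtains C where "0 \<le> C" "\<And>t x y. 0 < t \<Longrightarrow> \<bar>dheatG a t (x - y) - dheatG a t (x::'a::euclidean_space)\<bar> \<le>
    C / t * norm y * (heatG (8*t) x + heatG (8*t) (x - y))"
proof
  let ?k = "gauss_const TYPE('a)"
  have k: "2 \<le> ?k" by (rule gauss_const_ge)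
  define Q where "Q = 2 * ?k^2 * norm a"
  have Q: "0 \<le> Q" using k by (simp add: Q_def)
  show "0 \<le> exp 1 * ?k * Q" using k Q by simp
  fix t :: real and x y :: 'a assume t: "0 < t"
  have st: "t powr (-1/2) = sqrt t / t"
    using t by (simp add: powr_minus_divide powr_half_sqrt divide_simps)
  have "\<bar>dheatG a t (x - y) - dheatG a t x\<bar> \<le>
    exp 1 * ?k * (Q / t) * norm y * (heatG (2*(4*t)) x + heatG (2*(4*t)) (x - y))"
  proof (rule segment_gaussian_bound)
    show "\<bar>dheatG a t z\<bar> \<le> Q / t * sqrt (4*t) * heatG (4*t) z" for z :: 'a
    proof -
      have "\<bar>dheatG a t z\<bar> \<le> ?k * norm a * t powr (-1/2) * heatG (2*t) z" by (rule abs_dheatG_le[OF t])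
      also have "\<dots> \<le> ?k * norm a * t powr (-1/2) * (?k * heatG (2*(2*t)) z)"
        using t k by (intro mult_left_mono heatG_double_le) auto
      also have "\<dots> = (?k^2 * norm a * heatG (4*t) z) * (sqrt t / t)"
        unfolding st by (simp add: power2_eq_square)
      also have "\<dots> \<le> (?k^2 * norm a * heatG (4*t) z) * (4 * (sqrt t / t))"
        using t k by (intro mult_left_mono) (auto simp: field_simps)
      also have "\<dots> = Q / t * sqrt (4*t) * heatG (4*t) z"
        by (simp add: Q_def real_sqrt_mult field_simps)
      finally show ?thesis .
    qed
    \<comment> \<open>Product rule along the segment: the linear factor has constant derivative, and
      the Gaussian has derivative \<open>- dheatG y t\<close>.\<close>
    define D where "D = (\<lambda>\<theta>. (a \<bullet> y) / (2*t) * heatG t (x - \<theta> *\<^sub>R y) + (a \<bullet> (x - \<theta> *\<^sub>R y)) / (2*t) * dheatG y t (x - \<theta> *\<^sub>R y))"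
    show "((\<lambda>\<theta>. dheatG a t (x - \<theta> *\<^sub>R y)) has_real_derivative D \<theta>) (at \<theta>)" for \<theta>
    proof -
      have "((\<lambda>\<theta>. - (a \<bullet> (x - \<theta> *\<^sub>R y)) / (2*t)) has_real_derivative (a \<bullet> y) / (2*t)) (at \<theta>)"
        unfolding inner_diff_right inner_scaleR_right using t
        by (auto intro!: derivative_eq_intros)
      from DERIV_mult[OF this has_derivative_heatG_line[OF t, of x y \<theta>]]
      show ?thesis unfolding dheatG_def[of a] D_def by (simp add: algebra_simps)
    qed
    show "\<bar>D \<theta>\<bar> \<le> Q / t * norm y * heatG (4*t) (x - \<theta> *\<^sub>R y)" for \<theta>
    proof -
      let ?z = "x - \<theta> *\<^sub>R y"
      have "\<bar>D \<theta>\<bar> \<le> \<bar>a \<bullet> y\<bar> / (2*t) * heatG t ?z + \<bar>a \<bullet> ?z\<bar> / (2*t) * \<bar>dheatG y t ?z\<bar>"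
        unfolding D_def by (rule order_trans[OF abs_triangle_ineq]) (use t in \<open>simp add: abs_mult\<close>)
      also have "\<dots> \<le> (norm a * norm y) / (2*t) * heatG t ?z + (norm a * norm ?z) / (2*t) * \<bar>dheatG y t ?z\<bar>"
        using t by (intro add_mono mult_right_mono divide_right_mono Cauchy_Schwarz_ineq2) auto
      also have "\<dots> = norm a / (2*t) * (norm y * heatG t ?z + norm ?z * \<bar>dheatG y t ?z\<bar>)"
        by (simp add: field_simps add_divide_distrib)
      also have "\<dots> \<le> norm a / (2*t) * (norm y * (?k * (?k * heatG (2*(2*t)) ?z)) + 2 * ?k\<^sup>2 * norm y * heatG (4*t) ?z)"
      proof (intro mult_left_mono add_mono norm_dheatG_le t)
        have "heatG t ?z \<le> ?k * heatG (2*t) ?z" by (rule heatG_double_le[OF t])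
        also have "\<dots> \<le> ?k * (?k * heatG (2*(2*t)) ?z)" using t k by (intro mult_left_mono heatG_double_le) auto
        finally show "heatG t ?z \<le> ?k * (?k * heatG (2*(2*t)) ?z)" .
      qed (use t in auto)
      also have "\<dots> = (3/2) * (norm a * ?k\<^sup>2 * norm y * heatG (4*t) ?z / t)"
        using t by (simp add: field_simps power2_eq_square)
      also have "\<dots> \<le> 2 * (norm a * ?k\<^sup>2 * norm y * heatG (4*t) ?z / t)"
        using t by (intro mult_right_mono) auto
      finally show ?thesis by (simp add: Q_def mult_ac)
    qed
  qed (use t Q in auto)
  then show "\<bar>dheatG a t (x - y) - dheatG a t x\<bar> \<le> exp 1 * ?k * Q / t * norm y * (heatG (8*t) x + heatG (8*t) (x - y))"
    by simp
qed

text \<open>Mean value theorem in time. The time derivative of the kernel is of order r^(-3/2), and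
  s <= t/2 keeps all intermediate times between t/2 and t, so that one Gaussian at time 8t dominates
  them all.\<close>

lemma dheatG_time_diff_le:
  obtains C where "0 \<le> C" "\<And>t s x. 0 \<le> s \<Longrightarrow> s \<le> t / 2 \<Longrightarrow> 0 < t \<Longrightarrow>
    \<bar>dheatG a (t - s) x - dheatG a t (x::'a::euclidean_space)\<bar> \<le> C * s * t powr (-3/2) * heatG (8*t) x"
proof
  let ?k = "gauss_const TYPE('a)" and ?d = "real DIM('a) / 2"
  have k: "2 \<le> ?k" by (rule gauss_const_ge)
  define Q where "Q = norm a * ((?d + 1) * ?k^3 + ?k^3)"
  have Q: "0 \<le> Q" using k by (simp add: Q_def)
  show "0 \<le> Q * 2 powr (3/2) * ?k" using k Q by simp
  fix t s :: real and x :: 'a assume s: "0 \<le> s" "s \<le> t / 2" and t: "0 < t"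
  \<comment> \<open>The r-derivative of \<open>dheatG a r x\<close>: its logarithmic derivative is
    -(n/2 + 1)/r + |x|^2/(4 r^2).\<close>
  define D where "D = (\<lambda>r. dheatG a r x * ((- ?d - 1) / r + (norm x)\<^sup>2 / (4 * r\<^sup>2)))"
  have D: "((\<lambda>r. dheatG a r x) has_real_derivative D r) (at r)" if r: "0 < r" for r
  proof -
    have "((\<lambda>r. (4*pi*r) powr (-?d)) has_real_derivative (-?d) * (4*pi*r) powr (-?d) / r) (at r)"
    proof -
      have "((\<lambda>r. (4*pi*r) powr (-?d)) has_real_derivative (-?d) * (4*pi*r) powr (-?d - 1) * (4*pi)) (at r)"
        using r by (auto intro!: derivative_eq_intros simp: powr_diff)
      also have "(-?d) * (4*pi*r) powr (-?d - 1) * (4*pi) = (-?d) * (4*pi*r) powr (-?d) / r"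
        using r powr_diff[of "4*pi*r" "-?d" 1] by simp
      finally show ?thesis .
    qed
    moreover have "((\<lambda>r. exp (- (norm x)\<^sup>2 / (4*r))) has_real_derivative exp (- (norm x)\<^sup>2 / (4*r)) * ((norm x)\<^sup>2 / (4 * r\<^sup>2))) (at r)"
      using r by (auto intro!: derivative_eq_intros simp: power2_eq_square)
    moreover have "((\<lambda>r. - (a \<bullet> x) / (2*r)) has_real_derivative (a \<bullet> x) / (2*r\<^sup>2)) (at r)"
      using r by (auto intro!: derivative_eq_intros simp: power2_eq_square)
    ultimately have "((\<lambda>r. - (a \<bullet> x) / (2*r) * ((4*pi*r) powr (-?d) * exp (- (norm x)\<^sup>2 / (4*r)))) has_real_derivative
       ((a \<bullet> x) / (2*r\<^sup>2)) * ((4*pi*r) powr (-?d) * exp (- (norm x)\<^sup>2 / (4*r))) +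
        (((-?d) * (4*pi*r) powr (-?d) / r) * exp (- (norm x)\<^sup>2 / (4*r)) +
          (exp (- (norm x)\<^sup>2 / (4*r)) * ((norm x)\<^sup>2 / (4 * r\<^sup>2))) * (4*pi*r) powr (-?d)) * (- (a \<bullet> x) / (2*r))) (at r)"
      by (intro DERIV_mult)
    moreover have "(\<lambda>r. - (a \<bullet> x) / (2*r) * ((4*pi*r) powr (-?d) * exp (- (norm x)\<^sup>2 / (4*r)))) = (\<lambda>r. dheatG a r x)"
      by (simp add: dheatG_def heatG_def fun_eq_iff)
    moreover have "((a \<bullet> x) / (2*r\<^sup>2)) * (P * E) + (((-?d) * P / r) * E + (E * ((norm x)\<^sup>2 / (4 * r\<^sup>2))) * P) * (- (a \<bullet> x) / (2*r))
       = - (a \<bullet> x) / (2*r) * (P * E) * ((- ?d - 1) / r + (norm x)\<^sup>2 / (4 * r\<^sup>2))" for P E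
      using r by (simp add: field_simps power2_eq_square)
    ultimately show ?thesis unfolding D_def dheatG_def heatG_def by simp
  qed
  have Db: "\<bar>D r\<bar> \<le> Q * 2 powr (3/2) * ?k * t powr (-3/2) * heatG (8*t) x" if r: "t / 2 \<le> r" "r \<le> t" for r
  proof -
    have r0: "0 < r" using r t by simp
    have st: "r powr (-1/2) = sqrt r / r"
      using r0 by (simp add: powr_minus_divide powr_half_sqrt divide_simps)
    have st3: "r powr (-3/2) = sqrt r / r\<^sup>2"
    proof -
      have "r powr (-3/2) = r powr (-1/2) * r powr (-1)" using powr_add[of r "-1/2" "-1"] by simp
      then show ?thesis unfolding st using r0 by (simp add: powr_minus_divide power2_eq_square)
    qed
    have "\<bar>D r\<bar> \<le> \<bar>dheatG a r x\<bar> * ((?d + 1) / r + (norm x)\<^sup>2 / (4 * r\<^sup>2))"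
      unfolding D_def abs_mult
      by (intro mult_left_mono order_trans[OF abs_triangle_ineq] add_mono) (use r0 in \<open>auto simp: add.commute\<close>)
    also have "\<dots> = (?d + 1) / r * \<bar>dheatG a r x\<bar> + 1 / (4 * r\<^sup>2) * ((norm x)\<^sup>2 * \<bar>dheatG a r x\<bar>)"
      by (simp add: field_simps)
    also have "\<dots> \<le> (?d + 1) / r * (?k * norm a * r powr (-1/2) * (?k * (?k * heatG (8*r) x))) + 1 / (4 * r\<^sup>2) * (4 * ?k^3 * norm a * sqrt r * heatG (8*r) x)"
    proof (intro add_mono mult_left_mono norm2_dheatG_le r0)
      have "\<bar>dheatG a r x\<bar> \<le> ?k * norm a * r powr (-1/2) * heatG (2*r) x" by (rule abs_dheatG_le[OF r0])
      also have "heatG (2*r) x \<le> ?k * heatG (2*(2*r)) x" by (rule heatG_double_le) (use r0 in simp)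
      also have "heatG (2*(2*r)) x \<le> ?k * heatG (2*(2*(2*r))) x" by (rule heatG_double_le) (use r0 in simp)
      finally show "\<bar>dheatG a r x\<bar> \<le> ?k * norm a * r powr (-1/2) * (?k * (?k * heatG (8*r) x))"
        using k by (simp add: mult_left_mono)
    qed (use r0 in auto)
    also have "\<dots> = Q * r powr (-3/2) * heatG (8*r) x"
      unfolding st st3 Q_def using r0 by (simp add: field_simps power2_eq_square power3_eq_cube)
    also have "\<dots> \<le> Q * (2 powr (3/2) * t powr (-3/2)) * (?k * heatG (8*t) x)"
    proof (intro mult_mono mult_left_mono Q)
      have "r powr (-3/2) \<le> (t/2) powr (-3/2)" using r t by (intro powr_mono2') auto
      also have "\<dots> = 2 powr (3/2) * t powr (-3/2)" using t by (simp add: powr_divide powr_minus divide_simps)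
      finally show "r powr (-3/2) \<le> 2 powr (3/2) * t powr (-3/2)" .
      have "heatG (8*r) x \<le> (8*t / (8*r)) powr ?d * heatG (8*t) x"
        using heatG_scale_le[of "8*r" "8*t" x] r r0 by simp
      also have "\<dots> \<le> 2 powr ?d * heatG (8*t) x"
        using r r0 by (intro mult_right_mono powr_mono2) (auto simp: field_simps)
      also have "\<dots> \<le> ?k * heatG (8*t) x" unfolding gauss_const_def by (intro mult_right_mono) auto
      finally show "heatG (8*r) x \<le> ?k * heatG (8*t) x" .
    qed (use Q t in auto)
    finally show ?thesis by (simp add: mult_ac)
  qed
  show "\<bar>dheatG a (t - s) x - dheatG a t x\<bar> \<le> Q * 2 powr (3/2) * ?k * s * t powr (-3/2) * heatG (8*t) x"
  proof (cases "s = 0")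
    case False
    then obtain z where z: "t - s < z" "z < t" "dheatG a t x - dheatG a (t - s) x = (t - (t - s)) * D z"
      using MVT2[of "t - s" t "\<lambda>r. dheatG a r x" D] D s t by auto
    have "\<bar>dheatG a (t - s) x - dheatG a t x\<bar> = s * \<bar>D z\<bar>"
      using z(3) s by (metis abs_minus_commute abs_mult abs_of_nonneg diff_diff_cancel add_diff_cancel_left' diff_add_cancel)
    also have "\<dots> \<le> s * (Q * 2 powr (3/2) * ?k * t powr (-3/2) * heatG (8*t) x)"
      using s z by (intro mult_left_mono Db) auto
    finally show ?thesis by (simp add: mult_ac)
  qed simp
qed


section \<open>Scaled bounds\<close>

text \<open>A non-integrable function has Bochner integral 0 by convention, so that case is covered
  too. L1 estimates can therefore come before integrability is known.\<close>

lemma ennreal_abs_integral_le: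
  fixes f :: "'b \<Rightarrow> real"
  shows "ennreal \<bar>\<integral>x. f x \<partial>M\<bar> \<le> (\<integral>\<^sup>+x. ennreal \<bar>f x\<bar> \<partial>M)"
proof (cases "integrable M f")
  case True
  then show ?thesis using integral_norm_bound_ennreal[OF True] by simp
qed (simp add: not_integrable_integral_eq)

lemma ennreal_abs_set_integral_le:
  fixes f :: "'b \<Rightarrow> real"
  shows "ennreal \<bar>LINT x:S|M. f x\<bar> \<le> (\<integral>\<^sup>+x\<in>S. ennreal \<bar>f x\<bar> \<partial>M)"
  unfolding set_lebesgue_integral_def
  by (rule order_trans[OF ennreal_abs_integral_le]) (auto intro!: nn_integral_mono simp: indicator_def)

text \<open>The endpoint cases q = 1 and q = infinity at parabolic time scale theta; intermediate q follow by
  interpolation.\<close>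

definition sbound :: "real \<Rightarrow> ('a::euclidean_space \<Rightarrow> real) \<Rightarrow> real \<Rightarrow> bool" where
  "sbound \<theta> \<phi> r \<longleftrightarrow> \<phi> \<in> borel_measurable borel \<and> 0 \<le> r \<and> (\<integral>\<^sup>+x. ennreal \<bar>\<phi> x\<bar> \<partial>lborel) \<le> ennreal r
     \<and> (\<forall>x. \<bar>\<phi> x\<bar> \<le> r * \<theta> powr (- real DIM('a) / 2))"

lemma sboundI:
  fixes \<phi> :: "'a::euclidean_space \<Rightarrow> real"
  assumes "\<phi> \<in> borel_measurable borel" "0 \<le> r" "(\<integral>\<^sup>+x. ennreal \<bar>\<phi> x\<bar> \<partial>lborel) \<le> ennreal r"
    "\<And>x. \<bar>\<phi> x\<bar> \<le> r * \<theta> powr (- real DIM('a) / 2)"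
  shows "sbound \<theta> \<phi> r"
  using assms unfolding sbound_def by blast

lemma sboundD:
  fixes \<phi> :: "'a::euclidean_space \<Rightarrow> real"
  assumes "sbound \<theta> \<phi> r"
  shows "\<phi> \<in> borel_measurable borel" "0 \<le> r" "(\<integral>\<^sup>+x. ennreal \<bar>\<phi> x\<bar> \<partial>lborel) \<le> ennreal r"
    "\<bar>\<phi> x\<bar> \<le> r * \<theta> powr (- real DIM('a) / 2)"
  using assms unfolding sbound_def by blast+

lemma sbound_integrable: "sbound \<theta> \<phi> r \<Longrightarrow> integrable lborel \<phi>"
  using sboundD[of \<theta> \<phi> r] by (intro integrableI_bounded) (auto simp: ennreal_less_top le_less_trans)

lemma integral_abs_le:
  fixes \<phi> :: "'b \<Rightarrow> real"
  assumes "(\<integral>\<^sup>+x. ennreal \<bar>\<phi> x\<bar> \<partial>M) \<le> ennreal r" "0 \<le> r"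
  shows "(\<integral>x. \<bar>\<phi> x\<bar> \<partial>M) \<le> r"
proof -
  have "ennreal (\<integral>x. \<bar>\<phi> x\<bar> \<partial>M) \<le> ennreal r"
    using order_trans[OF ennreal_abs_integral_le[of M "\<lambda>x. \<bar>\<phi> x\<bar>"]] assms(1) by simp
  then show ?thesis using assms(2) by (simp add: ennreal_le_iff)
qed

lemma sbound_integral: "sbound \<theta> \<phi> r \<Longrightarrow> (\<integral>x. \<bar>\<phi> x\<bar> \<partial>lborel) \<le> r"
  by (intro integral_abs_le sboundD)

lemma sbound_mono: "sbound \<theta> \<phi> r \<Longrightarrow> r \<le> r' \<Longrightarrow> sbound \<theta> \<phi> r'"
  using sboundD(1-3)[of \<theta> \<phi> r]
  by (intro sboundI) (auto intro: order_trans[OF _ ennreal_leI] intro!: order_trans[OF sboundD(4)[of \<theta> \<phi> r]] mult_right_mono)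

lemma sbound_time: "sbound \<theta> \<phi> r \<Longrightarrow> 0 < \<theta>' \<Longrightarrow> \<theta>' \<le> \<theta> \<Longrightarrow> sbound \<theta>' \<phi> r"
  using sboundD(1-3)[of \<theta> \<phi> r]
  by (intro sboundI) (auto intro!: order_trans[OF sboundD(4)[of \<theta> \<phi> r]] mult_left_mono powr_mono2')

lemma sbound_dom:
  assumes "sbound \<theta> \<eta> r" "\<phi> \<in> borel_measurable borel" "\<And>x. \<bar>\<phi> x\<bar> \<le> \<eta> x"
  shows "sbound \<theta> \<phi> r"
proof (intro sboundI)
  have "(\<integral>\<^sup>+x. ennreal \<bar>\<phi> x\<bar> \<partial>lborel) \<le> (\<integral>\<^sup>+x. ennreal \<bar>\<eta> x\<bar> \<partial>lborel)"
    using assms(3) by (intro nn_integral_mono ennreal_leI) (meson abs_ge_self order_trans)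
  then show "(\<integral>\<^sup>+x. ennreal \<bar>\<phi> x\<bar> \<partial>lborel) \<le> ennreal r" using sboundD(3)[OF assms(1)] by simp
  show "\<bar>\<phi> x\<bar> \<le> r * \<theta> powr (- real DIM('a) / 2)" for x :: 'a
    using assms(3)[of x] sboundD(4)[OF assms(1), of x] by linarith
qed (use sboundD[OF assms(1)] assms(2) in auto)

lemma sbound_abs: "sbound \<theta> \<phi> r \<Longrightarrow> sbound \<theta> (\<lambda>x. \<bar>\<phi> x\<bar>) r"
  unfolding sbound_def by auto

lemma sbound_add:
  assumes "sbound \<theta> \<phi> r" "sbound \<theta> \<eta> r'"
  shows "sbound \<theta> (\<lambda>x. \<phi> x + \<eta> x) (r + r')"
proof (intro sboundI)
  note [measurable] = sboundD(1)[OF assms(1)] sboundD(1)[OF assms(2)]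
  show "(\<lambda>x. \<phi> x + \<eta> x) \<in> borel_measurable borel" by measurable
  show "0 \<le> r + r'" using sboundD(2)[OF assms(1)] sboundD(2)[OF assms(2)] by simp
  have "(\<integral>\<^sup>+x. ennreal \<bar>\<phi> x + \<eta> x\<bar> \<partial>lborel) \<le> (\<integral>\<^sup>+x. ennreal \<bar>\<phi> x\<bar> + ennreal \<bar>\<eta> x\<bar> \<partial>lborel)"
    by (intro nn_integral_mono) (simp add: ennreal_plus[symmetric] abs_triangle_ineq del: ennreal_plus)
  also have "\<dots> = (\<integral>\<^sup>+x. ennreal \<bar>\<phi> x\<bar> \<partial>lborel) + (\<integral>\<^sup>+x. ennreal \<bar>\<eta> x\<bar> \<partial>lborel)"
    by (intro nn_integral_add) auto
  also have "\<dots> \<le> ennreal (r + r')"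
    using sboundD(2,3)[OF assms(1)] sboundD(2,3)[OF assms(2)] by (simp add: add_mono)
  finally show "(\<integral>\<^sup>+x. ennreal \<bar>\<phi> x + \<eta> x\<bar> \<partial>lborel) \<le> ennreal (r + r')" .
  show "\<bar>\<phi> x + \<eta> x\<bar> \<le> (r + r') * \<theta> powr (- real DIM('a) / 2)" for x :: 'a
    using sboundD(4)[OF assms(1), of x] sboundD(4)[OF assms(2), of x] by (simp add: distrib_right)
qed

lemma sbound_cmult:
  assumes "sbound \<theta> \<phi> r"
  shows "sbound \<theta> (\<lambda>x. c * \<phi> x) (\<bar>c\<bar> * r)"
proof (intro sboundI)
  note [measurable] = sboundD(1)[OF assms(1)]
  show "(\<lambda>x. c * \<phi> x) \<in> borel_measurable borel" by measurable
  show "0 \<le> \<bar>c\<bar> * r" using sboundD(2)[OF assms] by simp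
  have "(\<integral>\<^sup>+x. ennreal \<bar>c * \<phi> x\<bar> \<partial>lborel) = (\<integral>\<^sup>+x. ennreal \<bar>c\<bar> * ennreal \<bar>\<phi> x\<bar> \<partial>lborel)"
    by (simp add: abs_mult ennreal_mult)
  also have "\<dots> = ennreal \<bar>c\<bar> * (\<integral>\<^sup>+x. ennreal \<bar>\<phi> x\<bar> \<partial>lborel)"
    by (intro nn_integral_cmult) auto
  also have "\<dots> \<le> ennreal (\<bar>c\<bar> * r)"
    using sboundD(2,3)[OF assms(1)] by (simp add: ennreal_mult mult_left_mono)
  finally show "(\<integral>\<^sup>+x. ennreal \<bar>c * \<phi> x\<bar> \<partial>lborel) \<le> ennreal (\<bar>c\<bar> * r)" .
  show "\<bar>c * \<phi> x\<bar> \<le> (\<bar>c\<bar> * r) * \<theta> powr (- real DIM('a) / 2)" for x :: 'a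
    using mult_left_mono[OF sboundD(4)[OF assms(1), of x], of "\<bar>c\<bar>"] by (simp add: abs_mult)
qed

lemma sbound_diff:
  assumes "sbound \<theta> \<phi> r" "sbound \<theta> \<eta> r'"
  shows "sbound \<theta> (\<lambda>x. \<phi> x - \<eta> x) (r + r')"
  using sbound_add[OF assms(1) sbound_cmult[OF assms(2), of "-1"]] by simp

lemma sbound_translate:
  assumes "sbound \<theta> \<phi> r" shows "sbound \<theta> (\<lambda>x. \<phi> (x - y)) r"
proof (intro sboundI)
  note [measurable] = sboundD(1)[OF assms(1)]
  show "(\<lambda>x. \<phi> (x - y)) \<in> borel_measurable borel" by measurable
  show "(\<integral>\<^sup>+x. ennreal \<bar>\<phi> (x - y)\<bar> \<partial>lborel) \<le> ennreal r"
    using sboundD(3)[OF assms] nn_integral_translate[of "\<lambda>x. ennreal \<bar>\<phi> x\<bar>" y] by simp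
qed (use sboundD[OF assms] in auto)

lemma convolution_measurable:
  fixes K \<phi> :: "'a::euclidean_space \<Rightarrow> real"
  assumes [measurable]: "K \<in> borel_measurable borel" "\<phi> \<in> borel_measurable borel"
  shows "(\<lambda>x. \<integral>y. K (x - y) * \<phi> y \<partial>lborel) \<in> borel_measurable borel"
  by measurable

lemma nn_integral_convolution:
  fixes K \<phi> :: "'a::euclidean_space \<Rightarrow> ennreal"
  assumes [measurable]: "K \<in> borel_measurable borel" "\<phi> \<in> borel_measurable borel"
  shows "(\<integral>\<^sup>+x. \<integral>\<^sup>+y. K (x - y) * \<phi> y \<partial>lborel \<partial>lborel) = (\<integral>\<^sup>+x. K x \<partial>lborel) * (\<integral>\<^sup>+x. \<phi> x \<partial>lborel)"
proof -
  have "(\<integral>\<^sup>+x. \<integral>\<^sup>+y. K (x - y) * \<phi> y \<partial>lborel \<partial>lborel) = (\<integral>\<^sup>+y. \<integral>\<^sup>+x. K (x - y) * \<phi> y \<partial>lborel \<partial>lborel)"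
    by (rule lborel_pair.Fubini') measurable
  also have "\<dots> = (\<integral>\<^sup>+y. (\<integral>\<^sup>+x. K x \<partial>lborel) * \<phi> y \<partial>lborel)"
    by (simp add: nn_integral_multc nn_integral_translate)
  also have "\<dots> = (\<integral>\<^sup>+x. K x \<partial>lborel) * (\<integral>\<^sup>+x. \<phi> x \<partial>lborel)"
    by (intro nn_integral_cmult) measurable
  finally show ?thesis .
qed

lemma nn_integral_abs_convolution_le:
  fixes K \<phi> :: "'a::euclidean_space \<Rightarrow> real"
  assumes [measurable]: "K \<in> borel_measurable borel" "\<phi> \<in> borel_measurable borel"
  shows "(\<integral>\<^sup>+x. ennreal \<bar>\<integral>y. K (x - y) * \<phi> y \<partial>lborel\<bar> \<partial>lborel)
    \<le> (\<integral>\<^sup>+x. ennreal \<bar>K x\<bar> \<partial>lborel) * (\<integral>\<^sup>+x. ennreal \<bar>\<phi> x\<bar> \<partial>lborel)"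
proof -
  have "(\<integral>\<^sup>+x. ennreal \<bar>\<integral>y. K (x - y) * \<phi> y \<partial>lborel\<bar> \<partial>lborel)
    \<le> (\<integral>\<^sup>+x. \<integral>\<^sup>+y. ennreal \<bar>K (x - y)\<bar> * ennreal \<bar>\<phi> y\<bar> \<partial>lborel \<partial>lborel)"
    by (intro nn_integral_mono order_trans[OF ennreal_abs_integral_le]) (simp add: abs_mult ennreal_mult)
  also have "\<dots> = (\<integral>\<^sup>+x. ennreal \<bar>K x\<bar> \<partial>lborel) * (\<integral>\<^sup>+x. ennreal \<bar>\<phi> x\<bar> \<partial>lborel)"
    by (rule nn_integral_convolution) measurable
  finally show ?thesis .
qed

text \<open>Young's inequality for a kernel below c G_t: from L1 to L1 with norm c, from L1 to sup
  with norm c t^(-n/2). Only the L1 norm of the source enters.\<close>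

lemma heat_kernel_dominated_L1:
  fixes K \<phi> :: "'a::euclidean_space \<Rightarrow> real"
  assumes K[measurable]: "K \<in> borel_measurable borel" and \<phi>[measurable]: "\<phi> \<in> borel_measurable borel"
    and t: "0 < t" and c: "0 \<le> c" "\<And>z. \<bar>K z\<bar> \<le> c * heatG t z"
    and r: "0 \<le> r" "(\<integral>\<^sup>+x. ennreal \<bar>\<phi> x\<bar> \<partial>lborel) \<le> ennreal r"
  shows "sbound t (\<lambda>x. \<integral>y. K (x - y) * \<phi> y \<partial>lborel) (c * r)"
proof (intro sboundI)
  show "(\<lambda>x. \<integral>y. K (x - y) * \<phi> y \<partial>lborel) \<in> borel_measurable borel" by measurable
  show "0 \<le> c * r" using c r by simp
  have "(\<integral>\<^sup>+x. ennreal \<bar>K x\<bar> \<partial>lborel) \<le> (\<integral>\<^sup>+x. ennreal c * ennreal (heatG t (x::'a)) \<partial>lborel)"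
  proof (rule nn_integral_mono)
    show "ennreal \<bar>K x\<bar> \<le> ennreal c * ennreal (heatG t x)" for x
      using c(1) c(2)[of x] by (simp add: ennreal_mult[symmetric] ennreal_leI)
  qed
  also have "\<dots> = ennreal c" using nn_integral_heatG[OF t, where 'a='a] by (simp add: nn_integral_cmult)
  finally have "(\<integral>\<^sup>+x. ennreal \<bar>K x\<bar> \<partial>lborel) * (\<integral>\<^sup>+x. ennreal \<bar>\<phi> x\<bar> \<partial>lborel) \<le> ennreal c * ennreal r"
    using r by (intro mult_mono) auto
  with nn_integral_abs_convolution_le[OF K \<phi>]
  show "(\<integral>\<^sup>+x. ennreal \<bar>\<integral>y. K (x - y) * \<phi> y \<partial>lborel\<bar> \<partial>lborel) \<le> ennreal (c * r)"
    using c r by (simp add: ennreal_mult)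
  fix x
  have "ennreal \<bar>\<integral>y. K (x - y) * \<phi> y \<partial>lborel\<bar> \<le> (\<integral>\<^sup>+y. ennreal \<bar>K (x - y) * \<phi> y\<bar> \<partial>lborel)"
    by (rule ennreal_abs_integral_le)
  also have "\<dots> \<le> (\<integral>\<^sup>+y. ennreal (c * t powr (- real DIM('a) / 2)) * ennreal \<bar>\<phi> y\<bar> \<partial>lborel)"
  proof (intro nn_integral_mono)
    fix y
    have "\<bar>K (x - y)\<bar> \<le> c * t powr (- real DIM('a) / 2)"
      using c(2)[of "x - y"] mult_left_mono[OF heatG_le[OF t, of "x - y"] c(1)] by simp
    then show "ennreal \<bar>K (x - y) * \<phi> y\<bar> \<le> ennreal (c * t powr (- real DIM('a) / 2)) * ennreal \<bar>\<phi> y\<bar>"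
      using c by (simp add: abs_mult ennreal_mult[symmetric] mult_right_mono)
  qed
  also have "\<dots> = ennreal (c * t powr (- real DIM('a) / 2)) * (\<integral>\<^sup>+y. ennreal \<bar>\<phi> y\<bar> \<partial>lborel)"
    by (intro nn_integral_cmult) measurable
  also have "\<dots> \<le> ennreal (c * t powr (- real DIM('a) / 2)) * ennreal r"
    using r by (intro mult_left_mono) auto
  also have "\<dots> = ennreal (c * r * t powr (- real DIM('a) / 2))"
    using c r by (simp add: ennreal_mult[symmetric] mult_ac)
  finally show "\<bar>\<integral>y. K (x - y) * \<phi> y \<partial>lborel\<bar> \<le> c * r * t powr (- real DIM('a) / 2)"
    using c r by (simp add: ennreal_le_iff)
qed

text \<open>The source bound is required only almost everywhere, as is natural for the initial datum
  and the given solution; the conclusion holds at every point.\<close>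

lemma heat_kernel_dominated_sup:
  fixes K \<phi> :: "'a::euclidean_space \<Rightarrow> real"
  assumes K[measurable]: "K \<in> borel_measurable borel" and \<phi>[measurable]: "\<phi> \<in> borel_measurable borel"
    and t: "0 < t" and c: "0 \<le> c" "\<And>z. \<bar>K z\<bar> \<le> c * heatG t z"
    and B: "0 \<le> B" "AE x in lborel. \<bar>\<phi> x\<bar> \<le> B"
  shows "\<bar>\<integral>y. K (x - y) * \<phi> y \<partial>lborel\<bar> \<le> c * B"
proof -
  have "ennreal \<bar>\<integral>y. K (x - y) * \<phi> y \<partial>lborel\<bar> \<le> (\<integral>\<^sup>+y. ennreal \<bar>K (x - y) * \<phi> y\<bar> \<partial>lborel)"
    by (rule ennreal_abs_integral_le)
  also have "\<dots> \<le> (\<integral>\<^sup>+y. ennreal (c * B) * ennreal (heatG t (x - y)) \<partial>lborel)"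
  proof (intro nn_integral_mono_AE, use B(2) in eventually_elim)
    fix y assume y: "\<bar>\<phi> y\<bar> \<le> B"
    have "\<bar>K (x - y) * \<phi> y\<bar> \<le> (c * heatG t (x - y)) * B"
      unfolding abs_mult using c y by (intro mult_mono) auto
    then show "ennreal \<bar>K (x - y) * \<phi> y\<bar> \<le> ennreal (c * B) * ennreal (heatG t (x - y))"
      using c B by (simp add: ennreal_mult[symmetric] ennreal_leI mult_ac)
  qed
  also have "\<dots> = ennreal (c * B) * (\<integral>\<^sup>+y. ennreal (heatG t (x - y)) \<partial>lborel)"
    by (intro nn_integral_cmult) measurable
  also have "\<dots> = ennreal (c * B)"
    using nn_integral_heatG[OF t, where 'a='a] nn_integral_reflect[of "\<lambda>y. ennreal (heatG t y)" x] by simp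
  finally show ?thesis using c B by (simp add: ennreal_le_iff)
qed

text \<open>The sup norm has two bounds, with t^(-n/2) from the kernel and with
  \<open>\<tau>\<close>^(-n/2) from the source. The better one is governed by max(t,
  \<open>\<tau>\<close>) >= (t + \<open>\<tau>\<close>)/2, which makes parabolic scales additive
  under convolution.\<close>

lemma heat_kernel_dominated:
  fixes K \<phi> :: "'a::euclidean_space \<Rightarrow> real"
  assumes K: "K \<in> borel_measurable borel"
    and t: "0 < t" and c: "0 \<le> c" "\<And>z. \<bar>K z\<bar> \<le> c * heatG t z"
    and \<tau>: "0 < \<tau>" and \<phi>: "sbound \<tau> \<phi> r"
  shows "sbound (t + \<tau>) (\<lambda>x. \<integral>y. K (x - y) * \<phi> y \<partial>lborel) (c * gauss_const TYPE('a) * r)"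
proof (intro sboundI)
  note \<phi>D = sboundD[OF \<phi>]
  let ?d = "real DIM('a) / 2"
  have k: "1 \<le> gauss_const TYPE('a)" using gauss_const_ge[where 'a='a] by simp
  have L: "sbound t (\<lambda>x. \<integral>y. K (x - y) * \<phi> y \<partial>lborel) (c * r)"
    by (rule heat_kernel_dominated_L1[OF K \<phi>D(1) t c \<phi>D(2,3)])
  have cr: "c * r \<le> c * gauss_const TYPE('a) * r" using k c \<phi>D(2)
    by (metis mult.commute mult.left_commute mult_left_mono mult_nonneg_nonneg mult_1)
  show "(\<lambda>x. \<integral>y. K (x - y) * \<phi> y \<partial>lborel) \<in> borel_measurable borel"
    by (rule convolution_measurable[OF K \<phi>D(1)])
  show "0 \<le> c * gauss_const TYPE('a) * r" using k c \<phi>D(2) by simp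
  show "(\<integral>\<^sup>+x. ennreal \<bar>\<integral>y. K (x - y) * \<phi> y \<partial>lborel\<bar> \<partial>lborel) \<le> ennreal (c * gauss_const TYPE('a) * r)"
    using sboundD(3)[OF L] ennreal_leI[OF cr] by (rule order_trans)
  fix x
  have 1: "\<bar>\<integral>y. K (x - y) * \<phi> y \<partial>lborel\<bar> \<le> c * r * t powr (-?d)" using sboundD(4)[OF L, of x] by simp
  have 2: "\<bar>\<integral>y. K (x - y) * \<phi> y \<partial>lborel\<bar> \<le> c * (r * \<tau> powr (-?d))"
    using heat_kernel_dominated_sup[OF K \<phi>D(1) t c, of "r * \<tau> powr (-?d)" x] \<phi>D(2,4) by simp
  have "\<bar>\<integral>y. K (x - y) * \<phi> y \<partial>lborel\<bar> \<le> c * r * (max t \<tau>) powr (-?d)"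
    using 1 2 by (cases "t \<le> \<tau>") (auto simp: max_def)
  also have "\<dots> \<le> c * r * ((t + \<tau>) / 2) powr (-?d)"
    using t \<tau> c \<phi>D(2) by (intro mult_left_mono powr_mono2') auto
  also have "((t + \<tau>) / 2) powr (-?d) = 2 powr ?d * (t + \<tau>) powr (-?d)"
    using t \<tau> by (simp add: powr_divide powr_minus divide_simps)
  also have "c * r * (2 powr ?d * (t + \<tau>) powr (-?d)) \<le> c * r * (gauss_const TYPE('a) * (t + \<tau>) powr (-?d))"
    using c \<phi>D(2) unfolding gauss_const_def by (intro mult_left_mono mult_right_mono) auto
  finally show "\<bar>\<integral>y. K (x - y) * \<phi> y \<partial>lborel\<bar> \<le> c * gauss_const TYPE('a) * r * (t + \<tau>) powr (- real DIM('a) / 2)"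
    by (simp add: mult_ac)
qed

lemma sbound_heat:
  fixes \<phi> :: "'a::euclidean_space \<Rightarrow> real"
  assumes "0 < t" "0 < \<tau>" "sbound \<tau> \<phi> r"
  shows "sbound (t + \<tau>) (heat t \<phi>) (gauss_const TYPE('a) * r)"
  unfolding heat_def using heat_kernel_dominated[of "heatG t" t 1 \<tau> \<phi> r] assms by simp

lemma sbound_gradheat:
  fixes \<phi> :: "'a::euclidean_space \<Rightarrow> real"
  assumes t: "0 < t" and \<tau>: "0 < \<tau>" and \<phi>: "sbound \<tau> \<phi> r"
  shows "sbound (t + \<tau>) (gradheat a t \<phi>) ((gauss_const TYPE('a))\<^sup>2 * norm a * t powr (-1/2) * r)"
proof -
  have "sbound (2*t + \<tau>) (gradheat a t \<phi>) ((gauss_const TYPE('a) * norm a * t powr (-1/2)) * gauss_const TYPE('a) * r)"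
    unfolding gradheat_def
    by (rule heat_kernel_dominated) (use assms abs_dheatG_le[OF t] gauss_const_ge[where 'a='a] in auto)
  then show ?thesis using sbound_time[of "2*t + \<tau>" _ _ "t + \<tau>"] t \<tau>
    by (simp add: power2_eq_square mult_ac)
qed

section \<open>Time integrals of curves of functions\<close>

text \<open>Minkowski's inequality in both endpoint norms. As the sup bounds hold at every x, so
  does integrability in time, without an exceptional null set.\<close>

lemma sbound_curve_integral:
  fixes k :: "real \<Rightarrow> 'a::euclidean_space \<Rightarrow> real"
  assumes k[measurable]: "case_prod k \<in> borel_measurable (borel \<Otimes>\<^sub>M borel)"
    and S[measurable]: "S \<in> sets borel" and \<beta>[measurable]: "\<beta> \<in> borel_measurable borel"
    and b: "\<And>s. s \<in> S \<Longrightarrow> sbound \<theta> (k s) (\<beta> s)"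
    and P: "0 \<le> P" "(\<integral>\<^sup>+s\<in>S. ennreal (\<beta> s) \<partial>lborel) \<le> ennreal P"
  shows "sbound \<theta> (\<lambda>x. LINT s:S|lborel. k s x) P" "set_integrable lborel S (\<lambda>s. k s x)"
proof -
  let ?d = "real DIM('a) / 2"
  have sup: "(\<integral>\<^sup>+s\<in>S. ennreal \<bar>k s x\<bar> \<partial>lborel) \<le> ennreal (P * \<theta> powr (-?d))" for x
  proof -
    have "(\<integral>\<^sup>+s\<in>S. ennreal \<bar>k s x\<bar> \<partial>lborel) \<le> (\<integral>\<^sup>+s. (ennreal (\<beta> s) * indicator S s) * ennreal (\<theta> powr (-?d)) \<partial>lborel)"
    proof (intro nn_integral_mono)
      fix s show "ennreal \<bar>k s x\<bar> * indicator S s \<le> (ennreal (\<beta> s) * indicator S s) * ennreal (\<theta> powr (-?d))"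
        using sboundD(2)[OF b, of s] sboundD(4)[OF b, of s x] by (auto simp: indicator_def ennreal_mult[symmetric] ennreal_leI)
    qed
    also have "\<dots> = (\<integral>\<^sup>+s. (ennreal (\<beta> s) * indicator S s) \<partial>lborel) * ennreal (\<theta> powr (-?d))"
      by (intro nn_integral_multc) measurable
    also have "\<dots> \<le> ennreal (P * \<theta> powr (-?d))" using P by (simp add: ennreal_mult mult_right_mono)
    finally show ?thesis .
  qed
  show "set_integrable lborel S (\<lambda>s. k s x)" for x
    unfolding set_integrable_def
  proof (intro integrableI_bounded)
    have "(\<integral>\<^sup>+s. ennreal (norm (indicator S s *\<^sub>R k s x)) \<partial>lborel) = (\<integral>\<^sup>+s\<in>S. ennreal \<bar>k s x\<bar> \<partial>lborel)"
      by (intro nn_integral_cong) (auto simp: indicator_def)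
    also have "\<dots> < \<infinity>" using sup[of x] by (auto intro: le_less_trans)
    finally show "(\<integral>\<^sup>+s. ennreal (norm (indicator S s *\<^sub>R k s x)) \<partial>lborel) < \<infinity>" .
  qed measurable
  show "sbound \<theta> (\<lambda>x. LINT s:S|lborel. k s x) P"
  proof (intro sboundI P)
    show "(\<lambda>x. LINT s:S|lborel. k s x) \<in> borel_measurable borel"
      unfolding set_lebesgue_integral_def by measurable
    have "(\<integral>\<^sup>+x. ennreal \<bar>LINT s:S|lborel. k s x\<bar> \<partial>lborel) \<le> (\<integral>\<^sup>+x. (\<integral>\<^sup>+s\<in>S. ennreal \<bar>k s x\<bar> \<partial>lborel) \<partial>lborel)"
      by (intro nn_integral_mono ennreal_abs_set_integral_le)
    also have "\<dots> = (\<integral>\<^sup>+s. (\<integral>\<^sup>+x. ennreal \<bar>k s x\<bar> * indicator S s \<partial>lborel) \<partial>lborel)"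
      by (rule lborel_pair.Fubini') measurable
    also have "\<dots> \<le> (\<integral>\<^sup>+s\<in>S. ennreal (\<beta> s) \<partial>lborel)"
    proof (intro nn_integral_mono)
      fix s show "(\<integral>\<^sup>+x. ennreal \<bar>k s x\<bar> * indicator S s \<partial>lborel) \<le> ennreal (\<beta> s) * indicator S s"
        using sboundD(3)[OF b, of s] by (auto simp: indicator_def)
    qed
    finally show "(\<integral>\<^sup>+x. ennreal \<bar>LINT s:S|lborel. k s x\<bar> \<partial>lborel) \<le> ennreal P" using P by simp
    show "\<bar>LINT s:S|lborel. k s x\<bar> \<le> P * \<theta> powr (- real DIM('a) / 2)" for x
      using order_trans[OF ennreal_abs_set_integral_le sup[of x]] P by (simp add: ennreal_le_iff)
  qed
qed

lemma gradheat_measurable [measurable (raw)]: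
  fixes h :: "real \<Rightarrow> 'a::euclidean_space \<Rightarrow> real"
  assumes [measurable]: "case_prod h \<in> borel_measurable (borel \<Otimes>\<^sub>M borel)"
  shows "(\<lambda>(s, x). gradheat a (t - s) (h s) x) \<in> borel_measurable (borel \<Otimes>\<^sub>M borel)"
  unfolding gradheat_def by measurable

text \<open>Duhamel integrals run over closed intervals, but bounds on their integrands hold at
  interior times: at s = t the kernel time is 0, and at s = 0 the source may be singular.\<close>

lemma set_integral_closed_open:
  fixes g :: "real \<Rightarrow> real"
  assumes [measurable]: "g \<in> borel_measurable borel"
  shows "(LINT s:{t0..t1}|lborel. g s) = (LINT s:{t0<..<t1}|lborel. g s)"
    and "set_integrable lborel {t0..t1} g \<longleftrightarrow> set_integrable lborel {t0<..<t1} g"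
proof -
  have ae: "AE s in lborel. indicator {t0..t1} s *\<^sub>R g s = indicator {t0<..<t1} s *\<^sub>R g s"
    using AE_lborel_singleton[of t0] AE_lborel_singleton[of t1]
    by eventually_elim (auto simp: indicator_def)
  show "(LINT s:{t0..t1}|lborel. g s) = (LINT s:{t0<..<t1}|lborel. g s)"
    unfolding set_lebesgue_integral_def by (rule integral_cong_AE) (use ae in auto)
  show "set_integrable lborel {t0..t1} g \<longleftrightarrow> set_integrable lborel {t0<..<t1} g"
    unfolding set_integrable_def by (rule integrable_cong_AE) (use ae in auto)
qed

text \<open>The scales (t - s) of the kernel and (s + tau) of the source add up to t + tau, so the time
  integral need not be split.\<close>

lemma sbound_duhamel:
  fixes h :: "real \<Rightarrow> 'a::euclidean_space \<Rightarrow> real"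
  assumes h[measurable]: "case_prod h \<in> borel_measurable (borel \<Otimes>\<^sub>M borel)"
    and \<psi>[measurable]: "\<psi> \<in> borel_measurable borel"
    and \<tau>: "0 \<le> \<tau>" and t: "0 \<le> t0" "t1 \<le> t"
    and b: "\<And>s. t0 < s \<Longrightarrow> s < t1 \<Longrightarrow> sbound (s + \<tau>) (h s) (\<psi> s)"
    and I: "0 \<le> I" "(\<integral>\<^sup>+s\<in>{t0<..<t1}. ennreal ((t - s) powr (-1/2) * \<psi> s) \<partial>lborel) \<le> ennreal I"
  shows "sbound (t + \<tau>) (\<lambda>x. LINT s:{t0..t1}|lborel. gradheat a (t - s) (h s) x) ((gauss_const TYPE('a))\<^sup>2 * norm a * I)"
    and "set_integrable lborel {t0..t1} (\<lambda>s. gradheat a (t - s) (h s) x)"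
proof -
  let ?c = "(gauss_const TYPE('a))\<^sup>2 * norm a"
  have m: "(\<lambda>s. gradheat a (t - s) (h s) x) \<in> borel_measurable borel" for x
    unfolding gradheat_def by measurable
  have b': "sbound (t + \<tau>) (gradheat a (t - s) (h s)) (?c * ((t - s) powr (-1/2) * \<psi> s))" if "s \<in> {t0<..<t1}" for s
    using sbound_gradheat[of "t - s" "s + \<tau>" "h s" "\<psi> s" a] b[of s] that t \<tau> by (simp add: mult_ac)
  have P: "(\<integral>\<^sup>+s\<in>{t0<..<t1}. ennreal (?c * ((t - s) powr (-1/2) * \<psi> s)) \<partial>lborel) \<le> ennreal (?c * I)"
  proof -
    have "(\<integral>\<^sup>+s\<in>{t0<..<t1}. ennreal (?c * ((t - s) powr (-1/2) * \<psi> s)) \<partial>lborel)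
       = (\<integral>\<^sup>+s. ennreal ?c * (ennreal ((t - s) powr (-1/2) * \<psi> s) * indicator {t0<..<t1} s) \<partial>lborel)"
    proof (intro nn_integral_cong)
      fix s show "ennreal (?c * ((t - s) powr (-1/2) * \<psi> s)) * indicator {t0<..<t1} s =
         ennreal ?c * (ennreal ((t - s) powr (-1/2) * \<psi> s) * indicator {t0<..<t1} s)"
        using sboundD(2)[OF b, of s] by (auto simp: indicator_def ennreal_mult[symmetric])
    qed
    also have "\<dots> = ennreal ?c * (\<integral>\<^sup>+s\<in>{t0<..<t1}. ennreal ((t - s) powr (-1/2) * \<psi> s) \<partial>lborel)"
      by (intro nn_integral_cmult) measurable
    also have "\<dots> \<le> ennreal (?c * I)" using I by (simp add: ennreal_mult mult_left_mono)
    finally show ?thesis .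
  qed
  note * = sbound_curve_integral[OF gradheat_measurable[OF h] _ _ b' _ P]
  have "sbound (t + \<tau>) (\<lambda>x. LINT s:{t0<..<t1}|lborel. gradheat a (t - s) (h s) x) (?c * I)"
    by (rule *(1)) (use I in auto)
  then show "sbound (t + \<tau>) (\<lambda>x. LINT s:{t0..t1}|lborel. gradheat a (t - s) (h s) x) (?c * I)"
    using set_integral_closed_open(1)[OF m] by simp
  have "set_integrable lborel {t0<..<t1} (\<lambda>s. gradheat a (t - s) (h s) x)"
    by (rule *(2)) (use I in auto)
  then show "set_integrable lborel {t0..t1} (\<lambda>s. gradheat a (t - s) (h s) x)"
    using set_integral_closed_open(2)[OF m] by simp
qed

section \<open>Singular time integrals\<close>

lemma nn_integral_powr_from_0:
  assumes "0 \<le> \<alpha>" "\<alpha> < 1" "0 \<le> b"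
  shows "(\<integral>\<^sup>+s\<in>{0<..<b}. ennreal (s powr (-\<alpha>)) \<partial>lborel) \<le> ennreal (b powr (1 - \<alpha>) / (1 - \<alpha>))"
proof -
  have "((\<lambda>s. s powr (-\<alpha>)) has_integral (b powr (-\<alpha> + 1) / (-\<alpha> + 1))) {0..b}"
    by (rule has_integral_powr_from_0) (use assms in auto)
  then have "(\<integral>\<^sup>+s\<in>{0..b}. ennreal (s powr (-\<alpha>)) \<partial>lborel) = ennreal (b powr (-\<alpha> + 1) / (-\<alpha> + 1))"
    by (intro nn_integral_has_integral_lebesgue') auto
  moreover have "(\<integral>\<^sup>+s\<in>{0<..<b}. ennreal (s powr (-\<alpha>)) \<partial>lborel) \<le> (\<integral>\<^sup>+s\<in>{0..b}. ennreal (s powr (-\<alpha>)) \<partial>lborel)"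
    by (intro nn_integral_mono) (auto simp: indicator_def)
  ultimately show ?thesis by (simp add: add.commute)
qed

text \<open>Halving the interval separates two difficulties. Before t/2 the kernel is at most 2
  t^(-1/2), so only the integral of \<open>\<psi>\<close> matters; after t/2 the source is at most
  m, and the kernel singularity integrates to 2 t^(1/2).\<close>

lemma nn_integral_singular_split:
  assumes t: "0 < t" and \<psi>: "\<psi> \<in> borel_measurable borel" and J: "0 \<le> J" and m: "0 \<le> m"
    and J': "(\<integral>\<^sup>+s\<in>{0<..<t/2}. ennreal (\<psi> s) \<partial>lborel) \<le> ennreal J"
    and m': "\<And>s. t / 2 \<le> s \<Longrightarrow> s < t \<Longrightarrow> \<psi> s \<le> m"
  shows "(\<integral>\<^sup>+s\<in>{0<..<t}. ennreal ((t - s) powr (-1/2) * \<psi> s) \<partial>lborel) \<le> ennreal (2 * t powr (-1/2) * J + 2 * t powr (1/2) * m)"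
proof -
  note [measurable] = \<psi>
  have st: "(t/2) powr (-1/2) \<le> 2 * t powr (-1/2)"
  proof -
    have "(t/2) powr (-1/2) = 2 powr (1/2) * t powr (-1/2)" using t by (simp add: powr_divide powr_minus divide_simps)
    also have "2 powr (1/2) \<le> (2::real)" by (simp add: powr_half_sqrt real_le_lsqrt)
    finally show ?thesis by (simp add: mult_right_mono)
  qed
  have sing: "(\<integral>\<^sup>+s\<in>{0<..<t}. ennreal ((t - s) powr (-1/2)) \<partial>lborel) \<le> ennreal (2 * t powr (1/2))"
  proof -
    have "(\<integral>\<^sup>+s\<in>{0<..<t}. ennreal ((t - s) powr (-1/2)) \<partial>lborel) = (\<integral>\<^sup>+s. ennreal ((t - s) powr (-1/2)) * indicator {0<..<t} (t - s) \<partial>lborel)"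
      by (intro nn_integral_cong) (auto simp: indicator_def)
    also have "\<dots> = (\<integral>\<^sup>+s. ennreal (s powr (-1/2)) * indicator {0<..<t} s \<partial>lborel)"
      by (rule nn_integral_reflect[of "\<lambda>s. ennreal (s powr (-1/2)) * indicator {0<..<t} s" t]) measurable
    also have "\<dots> \<le> ennreal (2 * t powr (1/2))"
      using nn_integral_powr_from_0[of "1/2" t] t by (simp add: mult.commute)
    finally show ?thesis .
  qed
  have "(\<integral>\<^sup>+s\<in>{0<..<t}. ennreal ((t - s) powr (-1/2) * \<psi> s) \<partial>lborel) \<le>
     (\<integral>\<^sup>+s. ennreal (2 * t powr (-1/2)) * (ennreal (\<psi> s) * indicator {0<..<t/2} s)
         + ennreal m * (ennreal ((t - s) powr (-1/2)) * indicator {0<..<t} s) \<partial>lborel)"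
  proof (intro nn_integral_mono)
    fix s
    consider "s \<notin> {0<..<t}" | "0 < s" "s < t/2" | "t/2 \<le> s" "s < t" by fastforce
    then show "ennreal ((t - s) powr (-1/2) * \<psi> s) * indicator {0<..<t} s \<le>
      ennreal (2 * t powr (-1/2)) * (ennreal (\<psi> s) * indicator {0<..<t/2} s)
         + ennreal m * (ennreal ((t - s) powr (-1/2)) * indicator {0<..<t} s)"
    proof cases
      case 2
      have "(t - s) powr (-1/2) \<le> (t/2) powr (-1/2)" using 2 t by (intro powr_mono2') auto
      then have "(t - s) powr (-1/2) \<le> 2 * t powr (-1/2)" using st by simp
      then have "ennreal ((t - s) powr (-1/2) * \<psi> s) \<le> ennreal (2 * t powr (-1/2)) * ennreal (\<psi> s)"
        by (cases "0 \<le> \<psi> s") (auto simp: ennreal_mult[symmetric] ennreal_leI mult_right_mono ennreal_neg mult_nonneg_nonpos)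
      then show ?thesis using 2 t by (auto simp: indicator_def intro: order_trans[OF _ le_add_same_cancel1[THEN iffD2]] add_increasing2)
    next
      case 3
      have "ennreal ((t - s) powr (-1/2) * \<psi> s) \<le> ennreal m * ennreal ((t - s) powr (-1/2))"
        using m'[OF 3] m by (simp add: ennreal_mult[symmetric] ennreal_leI mult_right_mono mult.commute)
      then show ?thesis using 3 t by (auto simp: indicator_def intro: add_increasing)
    qed (auto simp: indicator_def)
  qed
  also have "\<dots> = ennreal (2 * t powr (-1/2)) * (\<integral>\<^sup>+s\<in>{0<..<t/2}. ennreal (\<psi> s) \<partial>lborel)
      + ennreal m * (\<integral>\<^sup>+s\<in>{0<..<t}. ennreal ((t - s) powr (-1/2)) \<partial>lborel)"
    by (subst nn_integral_add) (auto simp: nn_integral_cmult)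
  also have "\<dots> \<le> ennreal (2 * t powr (-1/2)) * ennreal J + ennreal m * ennreal (2 * t powr (1/2))"
    by (intro add_mono mult_left_mono J' sing) auto
  also have "\<dots> = ennreal (2 * t powr (-1/2) * J + 2 * t powr (1/2) * m)"
    using J m by (simp add: ennreal_mult[symmetric] ennreal_plus[symmetric] mult_ac del: ennreal_plus)
  finally show ?thesis .
qed

text \<open>Up to the constant this is the Beta integral B(1/2, 1 - \<open>\<alpha>\<close>) t^(1/2
  - \<open>\<alpha>\<close>). The two halves contribute 2/(1 - \<open>\<alpha>\<close>) and 4, and 4
  <= 4/(1 - \<open>\<alpha>\<close>).\<close>

lemma nn_integral_beta:
  assumes \<alpha>: "0 \<le> \<alpha>" "\<alpha> < 1" and t: "0 < t"
  shows "(\<integral>\<^sup>+s\<in>{0<..<t}. ennreal ((t - s) powr (-1/2) * s powr (-\<alpha>)) \<partial>lborel) \<le> ennreal (6 / (1 - \<alpha>) * t powr (1/2 - \<alpha>))"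
proof -
  have "(\<integral>\<^sup>+s\<in>{0<..<t}. ennreal ((t - s) powr (-1/2) * s powr (-\<alpha>)) \<partial>lborel)
    \<le> ennreal (2 * t powr (-1/2) * ((t/2) powr (1 - \<alpha>) / (1 - \<alpha>)) + 2 * t powr (1/2) * (t/2) powr (-\<alpha>))"
    by (rule nn_integral_singular_split) (use assms in \<open>auto intro!: nn_integral_powr_from_0 powr_mono2'\<close>)
  also have "\<dots> \<le> ennreal (6 / (1 - \<alpha>) * t powr (1/2 - \<alpha>))"
  proof (rule ennreal_leI)
    have 1: "(t/2) powr (1 - \<alpha>) \<le> t powr (1 - \<alpha>)" using \<alpha> t by (intro powr_mono2) auto
    have 2: "(t/2) powr (-\<alpha>) \<le> 2 * t powr (-\<alpha>)"
    proof -
      have "(t/2) powr (-\<alpha>) = 2 powr \<alpha> * t powr (-\<alpha>)" using t by (simp add: powr_divide powr_minus divide_simps)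
      also have "2 powr \<alpha> \<le> 2 powr 1" using \<alpha> by (intro powr_mono) auto
      finally show ?thesis by (simp add: mult_right_mono)
    qed
    have "2 * t powr (-1/2) * ((t/2) powr (1 - \<alpha>) / (1 - \<alpha>)) + 2 * t powr (1/2) * (t/2) powr (-\<alpha>)
      \<le> 2 * t powr (-1/2) * (t powr (1 - \<alpha>) / (1 - \<alpha>)) + 2 * t powr (1/2) * (2 * t powr (-\<alpha>))"
      using 1 2 \<alpha> by (intro add_mono mult_left_mono divide_right_mono) auto
    also have "\<dots> = 2 / (1 - \<alpha>) * (t powr (-1/2) * t powr (1 - \<alpha>)) + 4 * (t powr (1/2) * t powr (-\<alpha>))"
      by simp
    also have "t powr (-1/2) * t powr (1 - \<alpha>) = t powr (1/2 - \<alpha>)" by (simp add: powr_add[symmetric])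
    also have "t powr (1/2) * t powr (-\<alpha>) = t powr (1/2 - \<alpha>)" by (simp add: powr_add[symmetric])
    also have "2 / (1 - \<alpha>) * t powr (1/2 - \<alpha>) + 4 * t powr (1/2 - \<alpha>) \<le> 2 / (1 - \<alpha>) * t powr (1/2 - \<alpha>) + 4 / (1 - \<alpha>) * t powr (1/2 - \<alpha>)"
      using \<alpha> by (intro add_mono mult_right_mono) (auto simp: field_simps)
    also have "\<dots> = 6 / (1 - \<alpha>) * t powr (1/2 - \<alpha>)" by (simp add: algebra_simps add_divide_distrib[symmetric])
    finally show "2 * t powr (-1/2) * ((t/2) powr (1 - \<alpha>) / (1 - \<alpha>)) + 2 * t powr (1/2) * (t/2) powr (-\<alpha>)
      \<le> 6 / (1 - \<alpha>) * t powr (1/2 - \<alpha>)" .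
  qed
  finally show ?thesis .
qed


section \<open>Moments, adjoints and the semigroup law\<close>

text \<open>Valued in \<open>ennreal\<close>, so that the bounds for sums, convolutions and time
  integrals are free of finiteness side conditions.\<close>

definition moment :: "('a::euclidean_space \<Rightarrow> real) \<Rightarrow> ennreal" where
  "moment \<phi> = (\<integral>\<^sup>+x. ennreal (norm x * \<bar>\<phi> x\<bar>) \<partial>lborel)"

lemma moment_dom: "(\<And>x. \<bar>\<phi> x\<bar> \<le> \<bar>\<eta> x\<bar>) \<Longrightarrow> moment \<phi> \<le> moment \<eta>"
  unfolding moment_def by (intro nn_integral_mono ennreal_leI mult_left_mono) auto

lemma moment_add:
  assumes [measurable]: "\<phi> \<in> borel_measurable borel" "\<eta> \<in> borel_measurable borel"
  shows "moment (\<lambda>x. \<phi> x + \<eta> x) \<le> moment \<phi> + moment \<eta>"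
proof -
  have "moment (\<lambda>x. \<phi> x + \<eta> x) \<le> (\<integral>\<^sup>+x. ennreal (norm x * \<bar>\<phi> x\<bar>) + ennreal (norm x * \<bar>\<eta> x\<bar>) \<partial>lborel)"
    unfolding moment_def
    by (intro nn_integral_mono) (simp add: ennreal_plus[symmetric] distrib_left[symmetric] mult_left_mono abs_triangle_ineq del: ennreal_plus)
  also have "\<dots> = moment \<phi> + moment \<eta>"
    unfolding moment_def by (intro nn_integral_add) auto
  finally show ?thesis .
qed

lemma moment_cmult:
  assumes [measurable]: "\<phi> \<in> borel_measurable borel" and c: "0 \<le> c"
  shows "moment (\<lambda>x. c * \<phi> x) = ennreal c * moment \<phi>"
  unfolding moment_def
  by (subst nn_integral_cmult[symmetric]) (use c in \<open>auto simp: abs_mult ennreal_mult[symmetric] mult_ac\<close>)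

lemma moment_heatG: "0 < t \<Longrightarrow> moment (heatG t :: 'a::euclidean_space \<Rightarrow> real) \<le> ennreal (gauss_const TYPE('a) * sqrt t)"
proof -
  assume t: "0 < t"
  have "moment (heatG t :: 'a \<Rightarrow> real) \<le> (\<integral>\<^sup>+x. ennreal (gauss_const TYPE('a) * sqrt t) * ennreal (heatG (2*t) (x::'a)) \<partial>lborel)"
    unfolding moment_def
    using norm_mult_heatG_le[OF t, where 'a='a] t gauss_const_ge[where 'a='a]
    by (intro nn_integral_mono) (simp add: ennreal_mult[symmetric] ennreal_leI mult_ac)
  also have "\<dots> = ennreal (gauss_const TYPE('a) * sqrt t)"
    using t nn_integral_heatG[of "2*t", where 'a='a] by (simp add: nn_integral_cmult)
  finally show ?thesis .
qed

text \<open>By |x| <= |x - y| + |y| the weight falls either on the kernel or on the source.\<close>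

lemma moment_convolution:
  fixes K \<phi> :: "'a::euclidean_space \<Rightarrow> real"
  assumes [measurable]: "K \<in> borel_measurable borel" "\<phi> \<in> borel_measurable borel"
  shows "moment (\<lambda>x. \<integral>y. K (x - y) * \<phi> y \<partial>lborel) \<le>
    moment K * (\<integral>\<^sup>+x. ennreal \<bar>\<phi> x\<bar> \<partial>lborel) + (\<integral>\<^sup>+x. ennreal \<bar>K x\<bar> \<partial>lborel) * moment \<phi>"
proof -
  have "moment (\<lambda>x. \<integral>y. K (x - y) * \<phi> y \<partial>lborel) \<le>
    (\<integral>\<^sup>+x. (\<integral>\<^sup>+y. ennreal (norm (x - y) * \<bar>K (x - y)\<bar>) * ennreal \<bar>\<phi> y\<bar> + ennreal \<bar>K (x - y)\<bar> * ennreal (norm y * \<bar>\<phi> y\<bar>) \<partial>lborel) \<partial>lborel)"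
    unfolding moment_def
  proof (intro nn_integral_mono)
    fix x :: 'a
    have "ennreal (norm x * \<bar>\<integral>y. K (x - y) * \<phi> y \<partial>lborel\<bar>) \<le> ennreal (norm x) * (\<integral>\<^sup>+y. ennreal \<bar>K (x - y) * \<phi> y\<bar> \<partial>lborel)"
      by (simp add: ennreal_mult mult_left_mono ennreal_abs_integral_le)
    also have "\<dots> = (\<integral>\<^sup>+y. ennreal (norm x) * ennreal \<bar>K (x - y) * \<phi> y\<bar> \<partial>lborel)"
      by (rule nn_integral_cmult[symmetric]) measurable
    also have "\<dots> \<le> (\<integral>\<^sup>+y. ennreal (norm (x - y) * \<bar>K (x - y)\<bar>) * ennreal \<bar>\<phi> y\<bar> + ennreal \<bar>K (x - y)\<bar> * ennreal (norm y * \<bar>\<phi> y\<bar>) \<partial>lborel)"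
    proof (intro nn_integral_mono)
      fix y :: 'a
      have "norm x \<le> norm (x - y) + norm y" by (metis diff_add_cancel norm_triangle_ineq)
      then have "norm x * \<bar>K (x - y) * \<phi> y\<bar> \<le> (norm (x - y) + norm y) * \<bar>K (x - y) * \<phi> y\<bar>"
        by (intro mult_right_mono) auto
      also have "\<dots> = norm (x - y) * \<bar>K (x - y)\<bar> * \<bar>\<phi> y\<bar> + \<bar>K (x - y)\<bar> * (norm y * \<bar>\<phi> y\<bar>)"
        by (simp add: abs_mult algebra_simps)
      finally show "ennreal (norm x) * ennreal \<bar>K (x - y) * \<phi> y\<bar> \<le>
          ennreal (norm (x - y) * \<bar>K (x - y)\<bar>) * ennreal \<bar>\<phi> y\<bar> + ennreal \<bar>K (x - y)\<bar> * ennreal (norm y * \<bar>\<phi> y\<bar>)"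
        by (simp add: ennreal_mult[symmetric] ennreal_plus[symmetric] del: ennreal_plus)
    qed
    finally show "ennreal (norm x * \<bar>\<integral>y. K (x - y) * \<phi> y \<partial>lborel\<bar>) \<le>
      (\<integral>\<^sup>+y. ennreal (norm (x - y) * \<bar>K (x - y)\<bar>) * ennreal \<bar>\<phi> y\<bar> + ennreal \<bar>K (x - y)\<bar> * ennreal (norm y * \<bar>\<phi> y\<bar>) \<partial>lborel)" .
  qed
  also have "\<dots> = (\<integral>\<^sup>+x. (\<integral>\<^sup>+y. ennreal (norm (x - y) * \<bar>K (x - y)\<bar>) * ennreal \<bar>\<phi> y\<bar> \<partial>lborel) \<partial>lborel)
      + (\<integral>\<^sup>+x. (\<integral>\<^sup>+y. ennreal \<bar>K (x - y)\<bar> * ennreal (norm y * \<bar>\<phi> y\<bar>) \<partial>lborel) \<partial>lborel)"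
    by (subst nn_integral_add[symmetric]) (auto intro!: nn_integral_cong nn_integral_add)
  also have "\<dots> = moment K * (\<integral>\<^sup>+x. ennreal \<bar>\<phi> x\<bar> \<partial>lborel) + (\<integral>\<^sup>+x. ennreal \<bar>K x\<bar> \<partial>lborel) * moment \<phi>"
    unfolding moment_def
    by (subst (1) nn_integral_convolution[of "\<lambda>z. ennreal (norm z * \<bar>K z\<bar>)"], measurable,
        subst nn_integral_convolution[of "\<lambda>z. ennreal \<bar>K z\<bar>"]) auto
  finally show ?thesis .
qed

text \<open>The kernel a.grad G_t has L1 norm of order t^(-1/2) but a first moment bounded uniformly
  in t. Hence only the moment of the source meets a time singularity, not its L1 norm.\<close>

lemma moment_gradheat:
  fixes \<phi> :: "'a::euclidean_space \<Rightarrow> real"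
  assumes t: "0 < t" and [measurable]: "\<phi> \<in> borel_measurable borel"
    and r: "0 \<le> r" "(\<integral>\<^sup>+x. ennreal \<bar>\<phi> x\<bar> \<partial>lborel) \<le> ennreal r"
    and m: "0 \<le> m" "moment \<phi> \<le> ennreal m"
  shows "moment (gradheat a t \<phi>) \<le> ennreal (2 * (gauss_const TYPE('a))\<^sup>2 * norm a * (r + t powr (-1/2) * m))"
proof -
  let ?k = "gauss_const TYPE('a)"
  have k: "2 \<le> ?k" by (rule gauss_const_ge)
  have k2: "?k * norm a \<le> 2 * ?k\<^sup>2 * norm a"
    using k by (intro mult_right_mono) (auto simp: power2_eq_square)
  have 1: "moment (dheatG a t :: 'a \<Rightarrow> real) \<le> ennreal (2 * ?k\<^sup>2 * norm a)"
  proof -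
    have "moment (dheatG a t :: 'a \<Rightarrow> real) \<le> (\<integral>\<^sup>+x. ennreal (2 * ?k\<^sup>2 * norm a) * ennreal (heatG (4*t) (x::'a)) \<partial>lborel)"
      unfolding moment_def
      using norm_dheatG_le[OF t, of _ a] by (intro nn_integral_mono) (simp add: ennreal_mult[symmetric] ennreal_leI)
    also have "\<dots> = ennreal (2 * ?k\<^sup>2 * norm a)"
      using t nn_integral_heatG[of "4*t", where 'a='a] by (simp add: nn_integral_cmult)
    finally show ?thesis .
  qed
  have 2: "(\<integral>\<^sup>+x. ennreal \<bar>dheatG a t (x::'a)\<bar> \<partial>lborel) \<le> ennreal (2 * ?k\<^sup>2 * norm a * t powr (-1/2))"
  proof -
    have "(\<integral>\<^sup>+x. ennreal \<bar>dheatG a t (x::'a)\<bar> \<partial>lborel) \<le> (\<integral>\<^sup>+x. ennreal (?k * norm a * t powr (-1/2)) * ennreal (heatG (2*t) (x::'a)) \<partial>lborel)"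
      using abs_dheatG_le[OF t, of a] k by (intro nn_integral_mono) (simp add: ennreal_mult[symmetric] ennreal_leI)
    also have "\<dots> = ennreal (?k * norm a * t powr (-1/2))"
      using t nn_integral_heatG[of "2*t", where 'a='a] by (simp add: nn_integral_cmult)
    also have "\<dots> \<le> ennreal (2 * ?k\<^sup>2 * norm a * t powr (-1/2))"
      by (intro ennreal_leI mult_right_mono k2) auto
    finally show ?thesis .
  qed
  have "moment (gradheat a t \<phi>) \<le> moment (dheatG a t :: 'a \<Rightarrow> real) * (\<integral>\<^sup>+x. ennreal \<bar>\<phi> x\<bar> \<partial>lborel) + (\<integral>\<^sup>+x. ennreal \<bar>dheatG a t (x::'a)\<bar> \<partial>lborel) * moment \<phi>"
    unfolding gradheat_def by (rule moment_convolution) measurable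
  also have "\<dots> \<le> ennreal (2 * ?k\<^sup>2 * norm a) * ennreal r + ennreal (2 * ?k\<^sup>2 * norm a * t powr (-1/2)) * ennreal m"
    by (intro add_mono mult_mono 1 2 r m) auto
  also have "\<dots> = ennreal (2 * ?k\<^sup>2 * norm a * (r + t powr (-1/2) * m))"
    using r m k by (simp add: ennreal_mult[symmetric] ennreal_plus[symmetric] algebra_simps del: ennreal_plus)
  finally show ?thesis .
qed

lemma moment_curve_integral:
  fixes k :: "real \<Rightarrow> 'a::euclidean_space \<Rightarrow> real"
  assumes k[measurable]: "case_prod k \<in> borel_measurable (borel \<Otimes>\<^sub>M borel)"
    and S[measurable]: "S \<in> sets borel"
  shows "moment (\<lambda>x. LINT s:S|lborel. k s x) \<le> (\<integral>\<^sup>+s\<in>S. moment (k s) \<partial>lborel)"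
proof -
  have "moment (\<lambda>x. LINT s:S|lborel. k s x) \<le> (\<integral>\<^sup>+x. (\<integral>\<^sup>+s. ennreal (norm x * \<bar>k s x\<bar>) * indicator S s \<partial>lborel) \<partial>lborel)"
    unfolding moment_def
  proof (intro nn_integral_mono)
    fix x :: 'a
    have "ennreal (norm x * \<bar>LINT s:S|lborel. k s x\<bar>) \<le> ennreal (norm x) * (\<integral>\<^sup>+s\<in>S. ennreal \<bar>k s x\<bar> \<partial>lborel)"
      by (simp add: ennreal_mult mult_left_mono ennreal_abs_set_integral_le)
    also have "\<dots> = (\<integral>\<^sup>+s. ennreal (norm x * \<bar>k s x\<bar>) * indicator S s \<partial>lborel)"
      by (subst nn_integral_cmult[symmetric]) (auto simp: ennreal_mult mult.assoc)
    finally show "ennreal (norm x * \<bar>LINT s:S|lborel. k s x\<bar>) \<le> (\<integral>\<^sup>+s. ennreal (norm x * \<bar>k s x\<bar>) * indicator S s \<partial>lborel)" .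
  qed
  also have "\<dots> = (\<integral>\<^sup>+s. (\<integral>\<^sup>+x. ennreal (norm x * \<bar>k s x\<bar>) * indicator S s \<partial>lborel) \<partial>lborel)"
    by (rule lborel_pair.Fubini') measurable
  also have "\<dots> = (\<integral>\<^sup>+s\<in>S. moment (k s) \<partial>lborel)"
    unfolding moment_def by (intro nn_integral_cong nn_integral_multc) measurable
  finally show ?thesis .
qed

lemma moment_duhamel:
  fixes h :: "real \<Rightarrow> 'a::euclidean_space \<Rightarrow> real"
  assumes h[measurable]: "case_prod h \<in> borel_measurable (borel \<Otimes>\<^sub>M borel)"
    and \<psi>[measurable]: "\<psi> \<in> borel_measurable borel" and \<mu>[measurable]: "\<mu> \<in> borel_measurable borel"
    and t: "t1 \<le> t"
    and b: "\<And>s. t0 < s \<Longrightarrow> s < t1 \<Longrightarrow> 0 \<le> \<psi> s \<and> (\<integral>\<^sup>+x. ennreal \<bar>h s x\<bar> \<partial>lborel) \<le> ennreal (\<psi> s)"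
    and m: "\<And>s. t0 < s \<Longrightarrow> s < t1 \<Longrightarrow> 0 \<le> \<mu> s \<and> moment (h s) \<le> ennreal (\<mu> s)"
    and I: "0 \<le> I" "(\<integral>\<^sup>+s\<in>{t0<..<t1}. ennreal (\<psi> s) \<partial>lborel) \<le> ennreal I"
    and J: "0 \<le> J" "(\<integral>\<^sup>+s\<in>{t0<..<t1}. ennreal ((t - s) powr (-1/2) * \<mu> s) \<partial>lborel) \<le> ennreal J"
  shows "moment (\<lambda>x. LINT s:{t0..t1}|lborel. gradheat a (t - s) (h s) x) \<le> ennreal (2 * (gauss_const TYPE('a))\<^sup>2 * norm a * (I + J))"
proof -
  let ?c = "2 * (gauss_const TYPE('a))\<^sup>2 * norm a"
  have mm: "(\<lambda>s. gradheat a (t - s) (h s) x) \<in> borel_measurable borel" for x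
    unfolding gradheat_def by measurable
  have "moment (\<lambda>x. LINT s:{t0..t1}|lborel. gradheat a (t - s) (h s) x) = moment (\<lambda>x. LINT s:{t0<..<t1}|lborel. gradheat a (t - s) (h s) x)"
    by (simp add: set_integral_closed_open(1)[OF mm])
  also have "\<dots> \<le> (\<integral>\<^sup>+s\<in>{t0<..<t1}. moment (gradheat a (t - s) (h s)) \<partial>lborel)"
    by (rule moment_curve_integral[OF gradheat_measurable[OF h]]) auto
  also have "\<dots> \<le> (\<integral>\<^sup>+s. ennreal ?c * (ennreal (\<psi> s) * indicator {t0<..<t1} s + ennreal ((t - s) powr (-1/2) * \<mu> s) * indicator {t0<..<t1} s) \<partial>lborel)"
  proof (intro nn_integral_mono)
    fix s
    show "moment (gradheat a (t - s) (h s)) * indicator {t0<..<t1} s \<le>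
      ennreal ?c * (ennreal (\<psi> s) * indicator {t0<..<t1} s + ennreal ((t - s) powr (-1/2) * \<mu> s) * indicator {t0<..<t1} s)"
    proof (cases "s \<in> {t0<..<t1}")
      case True
      then have "moment (gradheat a (t - s) (h s)) \<le> ennreal (?c * (\<psi> s + (t - s) powr (-1/2) * \<mu> s))"
        using b[of s] m[of s] t by (intro moment_gradheat) auto
      then show ?thesis using True b[of s] m[of s]
        by (simp add: ennreal_mult[symmetric] ennreal_plus[symmetric] del: ennreal_plus)
    qed simp
  qed
  also have "\<dots> = ennreal ?c * ((\<integral>\<^sup>+s\<in>{t0<..<t1}. ennreal (\<psi> s) \<partial>lborel) + (\<integral>\<^sup>+s\<in>{t0<..<t1}. ennreal ((t - s) powr (-1/2) * \<mu> s) \<partial>lborel))"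
    by (subst nn_integral_cmult, measurable, subst nn_integral_add) auto
  also have "\<dots> \<le> ennreal ?c * (ennreal I + ennreal J)"
    by (intro mult_left_mono add_mono I J) auto
  also have "\<dots> = ennreal (?c * (I + J))"
    using I J by (simp add: ennreal_mult ennreal_plus[symmetric] del: ennreal_plus)
  finally show ?thesis .
qed

section \<open>Duality and the semigroup law of the kernels\<close>

lemma integrable_kernel_product:
  fixes K :: "'a::euclidean_space \<Rightarrow> 'b::euclidean_space \<Rightarrow> real"
  assumes K[measurable]: "case_prod K \<in> borel_measurable (borel \<Otimes>\<^sub>M borel)" and B: "\<And>x y. \<bar>K x y\<bar> \<le> B"
    and \<phi>: "integrable lborel \<phi>" and \<eta>: "integrable lborel \<eta>"
  shows "integrable (lborel \<Otimes>\<^sub>M lborel) (\<lambda>(x, y). \<eta> x * K x y * \<phi> y)"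
proof (rule integrableI_bounded)
  have [measurable]: "\<phi> \<in> borel_measurable borel" "\<eta> \<in> borel_measurable borel" using \<phi> \<eta> by auto
  have B0: "0 \<le> B" using B[of undefined undefined] by linarith
  show "(\<lambda>(x, y). \<eta> x * K x y * \<phi> y) \<in> borel_measurable (lborel \<Otimes>\<^sub>M lborel)" by measurable
  have "(\<integral>\<^sup>+z. ennreal (norm (case z of (x, y) \<Rightarrow> \<eta> x * K x y * \<phi> y)) \<partial>(lborel \<Otimes>\<^sub>M lborel))
     = (\<integral>\<^sup>+x. \<integral>\<^sup>+y. ennreal \<bar>\<eta> x * K x y * \<phi> y\<bar> \<partial>lborel \<partial>lborel)"
    by (subst lborel.nn_integral_fst[symmetric]) auto
  also have "\<dots> \<le> (\<integral>\<^sup>+x. \<integral>\<^sup>+y. ennreal (B * \<bar>\<eta> x\<bar>) * ennreal \<bar>\<phi> y\<bar> \<partial>lborel \<partial>lborel)"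
  proof (intro nn_integral_mono)
    fix x y
    have "\<bar>\<eta> x * K x y * \<phi> y\<bar> \<le> \<bar>\<eta> x\<bar> * B * \<bar>\<phi> y\<bar>"
      unfolding abs_mult by (intro mult_mono mult_left_mono B) (use B0 in auto)
    then show "ennreal \<bar>\<eta> x * K x y * \<phi> y\<bar> \<le> ennreal (B * \<bar>\<eta> x\<bar>) * ennreal \<bar>\<phi> y\<bar>"
      using B0 by (simp add: ennreal_mult[symmetric] ennreal_leI mult_ac)
  qed
  also have "\<dots> = ennreal B * (\<integral>\<^sup>+x. ennreal \<bar>\<eta> x\<bar> \<partial>lborel) * (\<integral>\<^sup>+y. ennreal \<bar>\<phi> y\<bar> \<partial>lborel)"
    using B0 by (simp add: nn_integral_cmult nn_integral_multc ennreal_mult)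
  also have "\<dots> < \<infinity>"
    using \<phi> \<eta> unfolding integrable_iff_bounded by (simp add: ennreal_mult_less_top)
  finally show "(\<integral>\<^sup>+z. ennreal (norm (case z of (x, y) \<Rightarrow> \<eta> x * K x y * \<phi> y)) \<partial>(lborel \<Otimes>\<^sub>M lborel)) < \<infinity>" .
qed

lemma convolution_adjoint:
  fixes K \<phi> \<eta> :: "'a::euclidean_space \<Rightarrow> real"
  assumes [measurable]: "K \<in> borel_measurable borel" and B: "\<And>z. \<bar>K z\<bar> \<le> B"
    and \<phi>: "integrable lborel \<phi>" and \<eta>: "integrable lborel \<eta>"
  shows "(\<integral>x. \<eta> x * (\<integral>y. K (x - y) * \<phi> y \<partial>lborel) \<partial>lborel) = (\<integral>y. \<phi> y * (\<integral>x. K (x - y) * \<eta> x \<partial>lborel) \<partial>lborel)"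
proof -
  have "integrable (lborel \<Otimes>\<^sub>M lborel) (\<lambda>(x, y). \<eta> x * K (x - y) * \<phi> y)"
    by (rule integrable_kernel_product[OF _ _ \<phi> \<eta>, of "\<lambda>x y. K (x - y)" B]) (use B in measurable)
  from lborel_pair.Fubini_integral[OF this]
  have "(\<integral>x. \<integral>y. \<eta> x * (K (x - y) * \<phi> y) \<partial>lborel \<partial>lborel) = (\<integral>y. \<integral>x. \<phi> y * (K (x - y) * \<eta> x) \<partial>lborel \<partial>lborel)"
    by (simp add: mult_ac)
  then show ?thesis by simp
qed

lemma abs_heatG_bound: "0 < t \<Longrightarrow> \<bar>heatG t (z::'a::euclidean_space)\<bar> \<le> t powr (- real DIM('a) / 2)"
  using heatG_le[of t z] by simp

lemma abs_dheatG_bound: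
  assumes t: "0 < t"
  shows "\<bar>dheatG a t (z::'a::euclidean_space)\<bar> \<le> gauss_const TYPE('a) * norm a * t powr (-1/2) * (2*t) powr (- real DIM('a) / 2)"
proof -
  have "\<bar>dheatG a t z\<bar> \<le> gauss_const TYPE('a) * norm a * t powr (-1/2) * heatG (2*t) z" by (rule abs_dheatG_le[OF t])
  also have "\<dots> \<le> gauss_const TYPE('a) * norm a * t powr (-1/2) * (2*t) powr (- real DIM('a) / 2)"
    using t gauss_const_ge[where 'a='a] by (intro mult_left_mono heatG_le) auto
  finally show ?thesis .
qed

lemma heatG_diff_commute: "heatG t (x - y) = heatG t (y - x)"
  by (metis heatG_minus minus_diff_eq)

lemma dheatG_diff_commute: "dheatG a t (x - y) = - dheatG a t (y - x)"
  by (metis dheatG_minus minus_diff_eq)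

lemma heat_adjoint:
  assumes t: "0 < t" and "integrable lborel \<phi>" "integrable lborel \<eta>"
  shows "(\<integral>x. \<eta> x * heat t \<phi> x \<partial>lborel) = (\<integral>x. \<phi> x * heat t \<eta> x \<partial>lborel)"
  unfolding heat_def
  by (subst convolution_adjoint[OF _ abs_heatG_bound[OF t]])
     (use assms in \<open>auto simp: heatG_diff_commute\<close>)

text \<open>The minus sign is that of integration by parts; it comes from the oddness of a.grad G_t,
  whereas G_t is even.\<close>

lemma gradheat_adjoint:
  assumes t: "0 < t" and "integrable lborel \<phi>" "integrable lborel \<eta>"
  shows "(\<integral>x. \<eta> x * gradheat a t \<phi> x \<partial>lborel) = - (\<integral>x. \<phi> x * gradheat a t \<eta> x \<partial>lborel)"
proof -
  have "(\<integral>x. \<eta> x * gradheat a t \<phi> x \<partial>lborel) = (\<integral>y. \<phi> y * (\<integral>x. dheatG a t (x - y) * \<eta> x \<partial>lborel) \<partial>lborel)"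
    unfolding gradheat_def by (rule convolution_adjoint[OF _ abs_dheatG_bound[OF t]]) (use assms in auto)
  also have "\<dots> = (\<integral>y. - (\<phi> y * gradheat a t \<eta> y) \<partial>lborel)"
    unfolding gradheat_def by (subst dheatG_diff_commute) (simp add: mult.commute)
  finally show ?thesis by simp
qed

text \<open>Completing the square in z. The second factor is a probability density centred at s w/(s
  + t), with time s t/(s + t); the convolution identities then need only its total mass and the
  vanishing of its centred first moment.\<close>

lemma heatG_mult:
  fixes z w :: "'a::euclidean_space"
  assumes s: "0 < s" and t: "0 < t"
  shows "heatG s z * heatG t (w - z) = heatG (s + t) w * heatG (s * t / (s + t)) (z - (s / (s + t)) *\<^sub>R w)"
proof -
  let ?m = "(s / (s + t)) *\<^sub>R w" and ?\<rho> = "s * t / (s + t)"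
  have st: "s + t \<noteq> 0" using s t by simp
  have "(norm z)\<^sup>2 / (4 * s) + (norm (w - z))\<^sup>2 / (4*t) = (norm w)\<^sup>2 / (4*(s+t)) + (norm (z - ?m))\<^sup>2 / (4 * ?\<rho>)"
  proof -
    define W Z X where "W = w \<bullet> w" and "Z = z \<bullet> z" and "X = z \<bullet> w"
    have "(norm (w - z))\<^sup>2 = W + Z - 2 * X"
      by (simp add: power2_norm_eq_inner inner_diff inner_commute W_def Z_def X_def)
    moreover have "(norm (z - ?m))\<^sup>2 = Z - 2 * (s / (s+t)) * X + (s/(s+t))\<^sup>2 * W"
    proof -
      have "(norm (z - c *\<^sub>R w))\<^sup>2 = Z - 2 * c * X + c * c * W" for c
        by (simp add: power2_norm_eq_inner inner_diff inner_commute W_def Z_def X_def algebra_simps)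
      then show ?thesis by (simp add: power2_eq_square)
    qed
    moreover have "(norm z)\<^sup>2 = Z" "(norm w)\<^sup>2 = W" by (simp_all add: power2_norm_eq_inner Z_def W_def)
    moreover have "Z / (4 * s) + (W + Z - 2 * X) / (4*t) = W / (4*(s+t)) + (Z - 2 * (s / (s+t)) * X + (s/(s+t))\<^sup>2 * W) / (4 * ?\<rho>)"
      using s t st by (simp add: divide_simps power2_eq_square) (simp add: algebra_simps)
    ultimately show ?thesis by simp
  qed
  then have e: "exp (- (norm z)\<^sup>2 / (4 * s)) * exp (- (norm (w - z))\<^sup>2 / (4*t)) = exp (- (norm w)\<^sup>2 / (4*(s+t))) * exp (- (norm (z - ?m))\<^sup>2 / (4 * ?\<rho>))"
    by (simp add: exp_add[symmetric])
  have "(4 * pi * s) * (4 * pi * t) = (4 * pi * (s+t)) * (4 * pi * ?\<rho>)"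
    using st by (simp add: field_simps)
  then have c: "(4 * pi * s) powr (- real DIM('a) / 2) * (4 * pi * t) powr (- real DIM('a) / 2) = (4 * pi * (s+t)) powr (- real DIM('a) / 2) * (4 * pi * ?\<rho>) powr (- real DIM('a) / 2)"
    using powr_mult[of "4 * pi * s" "4 * pi * t" "- real DIM('a) / 2"] powr_mult[of "4 * pi * (s+t)" "4 * pi * ?\<rho>" "- real DIM('a) / 2"]
    by metis
  have "heatG s z * heatG t (w - z) = ((4 * pi * s) powr (- real DIM('a) / 2) * (4 * pi * t) powr (- real DIM('a) / 2)) * (exp (- (norm z)\<^sup>2 / (4 * s)) * exp (- (norm (w - z))\<^sup>2 / (4*t)))"
    unfolding heatG_def by (simp only: mult_ac)
  also have "\<dots> = heatG (s + t) w * heatG ?\<rho> (z - ?m)"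
    unfolding c e unfolding heatG_def by (simp only: mult_ac)
  finally show ?thesis .
qed

lemma heatG_convolution:
  fixes w :: "'a::euclidean_space"
  assumes s: "0 < s" and t: "0 < t"
  shows "(\<integral>z. heatG s z * heatG t (w - z) \<partial>lborel) = heatG (s + t) w"
proof -
  have r: "0 < s * t / (s + t)" using s t by simp
  have "(\<integral>z. heatG (s * t / (s + t)) (z - (s / (s + t)) *\<^sub>R w) \<partial>lborel) = 1"
    using integral_translate[of "heatG (s * t / (s + t))" "(s / (s + t)) *\<^sub>R w"] integral_heatG[OF r, where 'a='a] by simp
  then show ?thesis by (simp add: heatG_mult[OF s t])
qed

text \<open>Splitting a.z at the centre s w/(s + t) of the product Gaussian: the centred part is odd
  and integrates to 0, the remaining part is a constant times a probability density.\<close>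

lemma dheatG_convolution:
  fixes w :: "'a::euclidean_space"
  assumes s: "0 < s" and t: "0 < t"
  shows "(\<integral>z. dheatG a s z * heatG t (w - z) \<partial>lborel) = dheatG a (s + t) w"
proof -
  let ?m = "(s / (s + t)) *\<^sub>R w" and ?\<rho> = "s * t / (s + t)"
  have r: "0 < ?\<rho>" using s t by simp
  have eq: "dheatG a s z * heatG t (w - z) =
     (heatG (s + t) w * ?\<rho> / s) * dheatG a ?\<rho> (z - ?m) + dheatG a (s + t) w * heatG ?\<rho> (z - ?m)" for z
  proof -
    have "dheatG a s z * heatG t (w - z) = - (a \<bullet> z) / (2 * s) * (heatG (s + t) w * heatG ?\<rho> (z - ?m))"
      unfolding dheatG_def heatG_mult[OF s t, symmetric] by simp
    also have "a \<bullet> z = a \<bullet> (z - ?m) + s / (s + t) * (a \<bullet> w)" by (simp add: inner_diff_right)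
    also have "- (a \<bullet> (z - ?m) + s / (s + t) * (a \<bullet> w)) / (2 * s) = (?\<rho> / s) * (- (a \<bullet> (z - ?m)) / (2 * ?\<rho>)) + - (a \<bullet> w) / (2 * (s + t))"
    proof -
      define P where "P = a \<bullet> (z - ?m)"
      have "s + t \<noteq> 0" using s t by simp
      then show ?thesis unfolding P_def[symmetric] using s t by (simp add: divide_simps) (simp add: algebra_simps)
    qed
    finally have e: "dheatG a s z * heatG t (w - z) = ((?\<rho> / s) * (- (a \<bullet> (z - ?m)) / (2 * ?\<rho>)) + - (a \<bullet> w) / (2 * (s + t)))
        * (heatG (s + t) w * heatG ?\<rho> (z - ?m))" .
    have gen: "(r / s * P + Q) * (A * B) = A * r / s * (P * B) + Q * A * B" for r P Q A B :: real
      by (simp add: algebra_simps)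
    show ?thesis unfolding e unfolding dheatG_def by (rule gen)
  qed
  have i1: "integrable lborel (\<lambda>z. dheatG a ?\<rho> (z - ?m))" by (rule integrable_translate[OF integrable_dheatG[OF r]])
  have i2: "integrable lborel (\<lambda>z. heatG ?\<rho> (z - ?m))" by (rule integrable_translate[OF integrable_heatG[OF r]])
  have "(\<integral>z. heatG ?\<rho> (z - ?m) \<partial>lborel) = 1"
    using integral_translate[of "heatG ?\<rho>" ?m] integral_heatG[OF r, where 'a='a] by simp
  moreover have "(\<integral>z. dheatG a ?\<rho> (z - ?m) \<partial>lborel) = 0"
    using integral_translate[of "dheatG a ?\<rho>" ?m] integral_dheatG[of a ?\<rho>] by simp
  ultimately show ?thesis unfolding eq using i1 i2 by simp
qed

lemma convolution_assoc:
  fixes K1 K2 \<phi> :: "'a::euclidean_space \<Rightarrow> real"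
  assumes [measurable]: "K1 \<in> borel_measurable borel" "K2 \<in> borel_measurable borel"
    and K1: "integrable lborel K1" and B: "\<And>z. \<bar>K2 z\<bar> \<le> B" and \<phi>: "integrable lborel \<phi>"
  shows "(\<integral>z. K1 (x - z) * (\<integral>y. K2 (z - y) * \<phi> y \<partial>lborel) \<partial>lborel) = (\<integral>y. (\<integral>z. K2 z * K1 ((x - y) - z) \<partial>lborel) * \<phi> y \<partial>lborel)"
proof -
  have "(\<integral>z. K1 (x - z) * (\<integral>y. K2 (z - y) * \<phi> y \<partial>lborel) \<partial>lborel) = (\<integral>y. \<phi> y * (\<integral>z. K2 (z - y) * K1 (x - z) \<partial>lborel) \<partial>lborel)"
    by (rule convolution_adjoint[OF _ B \<phi>]) (auto intro: integrable_reflect[OF K1])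
  also have "(\<lambda>y. \<integral>z. K2 (z - y) * K1 (x - z) \<partial>lborel) = (\<lambda>y. \<integral>z. K2 z * K1 ((x - y) - z) \<partial>lborel)"
  proof
    fix y
    show "(\<integral>z. K2 (z - y) * K1 (x - z) \<partial>lborel) = (\<integral>z. K2 z * K1 ((x - y) - z) \<partial>lborel)"
      using integral_translate[of "\<lambda>z. K2 z * K1 ((x - y) - z)" y] by simp
  qed
  finally show ?thesis by (simp add: mult.commute)
qed

lemma heat_heat:
  assumes "0 < s" "0 < t" "integrable lborel \<phi>"
  shows "heat t (heat s \<phi>) x = heat (s + t) \<phi> x"
  unfolding heat_def
  by (subst convolution_assoc[OF _ _ integrable_heatG abs_heatG_bound])
     (use assms in \<open>auto simp: heatG_convolution\<close>)

lemma heat_gradheat: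
  assumes "0 < s" "0 < t" "integrable lborel \<phi>"
  shows "heat t (gradheat a s \<phi>) x = gradheat a (s + t) \<phi> x"
  unfolding heat_def gradheat_def
  by (subst convolution_assoc[OF _ _ integrable_heatG abs_dheatG_bound])
     (use assms in \<open>auto simp: dheatG_convolution\<close>)

lemma gradheat_heat:
  fixes \<phi> :: "'a::euclidean_space \<Rightarrow> real"
  assumes s: "0 < s" and t: "0 < t" and \<phi>: "integrable lborel \<phi>"
  shows "gradheat a s (heat t \<phi>) x = gradheat a (s + t) \<phi> x"
proof -
  have "(\<integral>z. heatG t z * dheatG a s (w - z) \<partial>lborel) = dheatG a (s + t) w" for w :: 'a
    using integral_reflect[of "\<lambda>z. dheatG a s z * heatG t (w - z)" w] dheatG_convolution[OF s t, of a w]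
    by (simp add: mult.commute)
  then show ?thesis unfolding heat_def gradheat_def
    by (subst convolution_assoc[OF _ _ integrable_dheatG[OF s] abs_heatG_bound[OF t] \<phi>]) auto
qed


section \<open>A regular version of the solution\<close>

lemma Lnorm_1: "Lnorm 1 \<phi> = (\<integral>\<^sup>+x. ennreal \<bar>\<phi> x\<bar> \<partial>lborel)"
  unfolding Lnorm_def by (auto simp: Let_def infinity_ennreal_def less_top)

lemma Lnorm_infinity_AE:
  assumes "\<phi> \<in> borel_measurable lborel" "Lnorm \<infinity> \<phi> \<le> ennreal M" "0 \<le> M"
  shows "AE x in lborel. \<bar>\<phi> x\<bar> \<le> M"
proof -
  have "AE x in lborel. ennreal \<bar>\<phi> x\<bar> \<le> Lnorm \<infinity> \<phi>"
    unfolding Lnorm_def using esssup_AE by auto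
  then show ?thesis
  proof eventually_elim
    case (elim x)
    then have "ennreal \<bar>\<phi> x\<bar> \<le> ennreal M" using assms(2) by (rule order_trans)
    then show ?case using assms(3) by (simp add: ennreal_le_iff)
  qed
qed

text \<open>Fubini for a time integral paired with a bounded test function. The L1 norms need only
  an integrable bound in time, which admits the kernel singularity.\<close>

lemma pairing_curve_integral:
  fixes k :: "real \<Rightarrow> 'a::euclidean_space \<Rightarrow> real"
  assumes k[measurable]: "case_prod k \<in> borel_measurable (borel \<Otimes>\<^sub>M borel)"
    and S[measurable]: "S \<in> sets borel" and \<beta>[measurable]: "\<beta> \<in> borel_measurable borel"
    and b: "\<And>s. s \<in> S \<Longrightarrow> sbound \<theta> (k s) (\<beta> s)"
    and P: "(\<integral>\<^sup>+s\<in>S. ennreal (\<beta> s) \<partial>lborel) < \<infinity>"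
    and g[measurable]: "g \<in> borel_measurable borel" and B: "\<And>y. \<bar>g y\<bar> \<le> B"
  shows "(\<integral>y. g y * (LINT s:S|lborel. k s y) \<partial>lborel) = (LINT s:S|lborel. \<integral>y. g y * k s y \<partial>lborel)"
    and "integrable lborel (\<lambda>y. g y * (LINT s:S|lborel. k s y))"
    and "set_integrable lborel S (\<lambda>s. \<integral>y. g y * k s y \<partial>lborel)"
proof -
  let ?F = "\<lambda>(y, s). indicator S s * (g y * k s y)"
  have B0: "0 \<le> B" using B[of 0] by linarith
  have int: "integrable (lborel \<Otimes>\<^sub>M lborel) ?F"
  proof (rule integrableI_bounded)
    show "?F \<in> borel_measurable (lborel \<Otimes>\<^sub>M lborel)" by measurable
    have "(\<integral>\<^sup>+z. ennreal (norm (?F z)) \<partial>(lborel \<Otimes>\<^sub>M lborel)) = (\<integral>\<^sup>+s. \<integral>\<^sup>+y. ennreal \<bar>indicator S s * (g y * k s y)\<bar> \<partial>lborel \<partial>lborel)"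
      by (subst lborel_pair.nn_integral_snd[symmetric]) auto
    also have "\<dots> \<le> (\<integral>\<^sup>+s. ennreal B * (ennreal (\<beta> s) * indicator S s) \<partial>lborel)"
    proof (intro nn_integral_mono)
      fix s
      show "(\<integral>\<^sup>+y. ennreal \<bar>indicator S s * (g y * k s y)\<bar> \<partial>lborel) \<le> ennreal B * (ennreal (\<beta> s) * indicator S s)"
      proof (cases "s \<in> S")
        case True
        have "(\<integral>\<^sup>+y. ennreal \<bar>indicator S s * (g y * k s y)\<bar> \<partial>lborel) \<le> (\<integral>\<^sup>+y. ennreal B * ennreal \<bar>k s y\<bar> \<partial>lborel)"
          using True B B0 by (intro nn_integral_mono) (auto simp: abs_mult ennreal_mult[symmetric] intro!: ennreal_leI mult_right_mono)
        also have "\<dots> = ennreal B * (\<integral>\<^sup>+y. ennreal \<bar>k s y\<bar> \<partial>lborel)" by (intro nn_integral_cmult) measurable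
        also have "\<dots> \<le> ennreal B * ennreal (\<beta> s)" by (intro mult_left_mono sboundD(3)[OF b] True) auto
        finally show ?thesis using True by simp
      qed simp
    qed
    also have "\<dots> = ennreal B * (\<integral>\<^sup>+s\<in>S. ennreal (\<beta> s) \<partial>lborel)" by (intro nn_integral_cmult) measurable
    also have "\<dots> < \<infinity>" using P by (simp add: ennreal_mult_less_top)
    finally show "(\<integral>\<^sup>+z. ennreal (norm (?F z)) \<partial>(lborel \<Otimes>\<^sub>M lborel)) < \<infinity>" .
  qed
  have e1: "(\<lambda>y. g y * (LINT s:S|lborel. k s y)) = (\<lambda>y. \<integral>s. indicator S s * (g y * k s y) \<partial>lborel)"
  proof
    fix y
    have "(\<lambda>s. indicator S s * (g y * k s y)) = (\<lambda>s. g y * (indicator S s * k s y))" by (simp add: fun_eq_iff)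
    then show "g y * (LINT s:S|lborel. k s y) = (\<integral>s. indicator S s * (g y * k s y) \<partial>lborel)"
      unfolding set_lebesgue_integral_def by simp
  qed
  have e2: "(\<lambda>s. indicator S s *\<^sub>R (\<integral>y. g y * k s y \<partial>lborel)) = (\<lambda>s. \<integral>y. indicator S s * (g y * k s y) \<partial>lborel)"
    by (simp add: fun_eq_iff)
  show "(\<integral>y. g y * (LINT s:S|lborel. k s y) \<partial>lborel) = (LINT s:S|lborel. \<integral>y. g y * k s y \<partial>lborel)"
    unfolding e1 unfolding set_lebesgue_integral_def e2
    using lborel_pair.Fubini_integral[OF int] by simp
  show "integrable lborel (\<lambda>y. g y * (LINT s:S|lborel. k s y))"
    unfolding e1 using lborel_pair.integrable_fst[OF int] by simp
  show "set_integrable lborel S (\<lambda>s. \<integral>y. g y * k s y \<partial>lborel)"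
    unfolding set_integrable_def e2 using lborel_pair.integrable_snd[OF int] by simp
qed

lemma integrable_bounded_mult:
  fixes g \<phi> :: "'a::euclidean_space \<Rightarrow> real"
  assumes "g \<in> borel_measurable borel" "\<And>y. \<bar>g y\<bar> \<le> B" "integrable lborel \<phi>"
  shows "integrable lborel (\<lambda>y. g y * \<phi> y)"
proof (rule Bochner_Integration.integrable_bound[where f="\<lambda>y. B * \<phi> y"])
  show "AE y in lborel. norm (g y * \<phi> y) \<le> norm (B * \<phi> y)"
    using order_trans[OF assms(2) abs_ge_self] by (intro AE_I2) (simp add: abs_mult mult_right_mono)
qed (use assms in auto)

lemma nn_integral_const_singular:
  assumes "0 < t" "0 \<le> B"
  shows "(\<integral>\<^sup>+s\<in>{0<..<t}. ennreal ((t - s) powr (-1/2) * B) \<partial>lborel) \<le> ennreal (6 * B * t powr (1/2))"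
proof -
  have "(\<integral>\<^sup>+s\<in>{0<..<t}. ennreal ((t - s) powr (-1/2) * B) \<partial>lborel) =
     (\<integral>\<^sup>+s. ennreal B * (ennreal ((t - s) powr (-1/2) * s powr (-0)) * indicator {0<..<t} s) \<partial>lborel)"
    using assms by (intro nn_integral_cong) (auto simp: indicator_def ennreal_mult[symmetric] mult_ac)
  also have "\<dots> = ennreal B * (\<integral>\<^sup>+s\<in>{0<..<t}. ennreal ((t - s) powr (-1/2) * s powr (-0)) \<partial>lborel)"
    by (intro nn_integral_cmult) measurable
  also have "\<dots> \<le> ennreal B * ennreal (6 / (1 - 0) * t powr (1/2 - 0))"
    by (intro mult_left_mono nn_integral_beta) (use assms in auto)
  also have "\<dots> = ennreal (6 * B * t powr (1/2))" using assms by (simp add: ennreal_mult[symmetric] mult_ac)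
  finally show ?thesis .
qed

text \<open>The heat flow over time t is applied to Duhamel's formula at time T; the semigroup law
  turns it into the part s <= T of the formula at T + t, and a shift of the time variable gives the
  rest. The source \<open>H\<close> is not tied to \<open>V\<close>, so that a truncated
  nonlinearity can be inserted.\<close>

lemma mild_restart:
  fixes H V :: "real \<Rightarrow> 'a::euclidean_space \<Rightarrow> real"
  assumes H[measurable]: "case_prod H \<in> borel_measurable (borel \<Otimes>\<^sub>M borel)"
    and B: "\<And>s. 0 < s \<Longrightarrow> sbound 1 (H s) B" and u0: "integrable lborel u0"
    and V: "\<And>t x. 0 < t \<Longrightarrow> V t x = heat t u0 x + (LINT s:{0..t}|lborel. gradheat a (t - s) (H s) x)"
    and T: "0 < T" and t: "0 < t"
  shows "V (T + t) x = heat t (V T) x + (LINT s:{0..t}|lborel. gradheat a (t - s) (H (T + s)) x)"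
proof -
  have B0: "0 \<le> B" using sboundD(2)[OF B[of 1]] by simp
  \<comment> \<open>The Duhamel estimate expects the scale s + 1 in place of 1. On a bounded time
    interval (s + 1)^(-n/2) is bounded below, and the loss goes into the constant.\<close>
  have b: "sbound (s + 1) (H s) (B * 2 powr (real DIM('a) / 2) * (r + 1) powr (real DIM('a) / 2))" if s: "0 < s" "s < r" for r s
  proof -
    have "1 \<le> 2 powr (real DIM('a) / 2) * (r + 1) powr (real DIM('a) / 2) * (s + 1) powr (- real DIM('a) / 2)"
    proof -
      have "1 \<le> ((r + 1) / (s + 1)) powr (real DIM('a) / 2)" using s by (intro ge_one_powr_ge_zero) auto
      also have "\<dots> = (r + 1) powr (real DIM('a) / 2) * (s + 1) powr (- real DIM('a) / 2)"
        using s by (simp add: powr_divide powr_minus divide_simps)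
      also have "\<dots> \<le> 2 powr (real DIM('a) / 2) * \<dots>"
        by (intro mult_le_cancel_right1[THEN iffD2]) (auto simp: ge_one_powr_ge_zero mult_less_0_iff)
      finally show ?thesis by (simp add: mult_ac)
    qed
    then have 1: "B \<le> B * 2 powr (real DIM('a) / 2) * (r + 1) powr (real DIM('a) / 2) * (s + 1) powr (- real DIM('a) / 2)"
      using B0 by (metis mult.assoc mult.right_neutral mult_left_mono)
    have 2: "B \<le> B * 2 powr (real DIM('a) / 2) * (r + 1) powr (real DIM('a) / 2)"
    proof -
      have "1 * 1 \<le> 2 powr (real DIM('a) / 2) * (r + 1) powr (real DIM('a) / 2)"
        using s by (intro mult_mono ge_one_powr_ge_zero) auto
      then show ?thesis using B0 by (metis mult.assoc mult.right_neutral mult_left_mono)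
    qed
    show ?thesis
      using sboundD[OF B[OF s(1)]] 1 2 B0
      by (intro sboundI) (auto intro: order_trans ennreal_leI)
  qed
  define C where "C = B * 2 powr (real DIM('a) / 2) * (T + t + 1) powr (real DIM('a) / 2)"
  have C0: "0 \<le> C" using B0 by (simp add: C_def)
  have b: "sbound (s + 1) (H s) C" if "0 < s" "s < T + t" for s using b[OF that] by (simp add: C_def)
  have set1: "set_integrable lborel {0..r} (\<lambda>s. gradheat a (q - s) (H s) y)" if "0 < r" "r \<le> q" "q \<le> T + t" for r q y
  proof (rule sbound_duhamel(2)[OF H, of "\<lambda>_. C" 1 0 r q "6 * C * q powr (1/2)"])
    show "(\<integral>\<^sup>+s\<in>{0<..<r}. ennreal ((q - s) powr (-1/2) * C) \<partial>lborel) \<le> ennreal (6 * C * q powr (1/2))"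
    proof (rule order_trans[OF _ nn_integral_const_singular])
      show "(\<integral>\<^sup>+s\<in>{0<..<r}. ennreal ((q - s) powr (-1/2) * C) \<partial>lborel) \<le> (\<integral>\<^sup>+s\<in>{0<..<q}. ennreal ((q - s) powr (-1/2) * C) \<partial>lborel)"
        using that by (intro nn_integral_mono) (auto simp: indicator_def)
    qed (use that C0 in auto)
  qed (use that b C0 in auto)
  define k where "k = (\<lambda>s y. gradheat a (T - s) (H s) y)"
  have km[measurable]: "case_prod k \<in> borel_measurable (borel \<Otimes>\<^sub>M borel)"
    unfolding k_def using gradheat_measurable[OF H, of a T] by simp
  define D where "D = (\<lambda>y. LINT s:{0..T}|lborel. k s y)"
  have Do: "D = (\<lambda>y. LINT s:{0<..<T}|lborel. k s y)"
    unfolding D_def by (intro ext set_integral_closed_open) measurable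
  have kb: "sbound (T + 1) (k s) ((gauss_const TYPE('a))\<^sup>2 * norm a * (T - s) powr (-1/2) * C)" if "s \<in> {0<..<T}" for s
    using sbound_gradheat[of "T - s" "s + 1" "H s" C a] b[of s] that t by (simp add: k_def)
  have kP: "(\<integral>\<^sup>+s\<in>{0<..<T}. ennreal ((gauss_const TYPE('a))\<^sup>2 * norm a * (T - s) powr (-1/2) * C) \<partial>lborel) < \<infinity>"
  proof -
    have "(\<integral>\<^sup>+s\<in>{0<..<T}. ennreal ((gauss_const TYPE('a))\<^sup>2 * norm a * (T - s) powr (-1/2) * C) \<partial>lborel)
       = (\<integral>\<^sup>+s\<in>{0<..<T}. ennreal ((T - s) powr (-1/2) * ((gauss_const TYPE('a))\<^sup>2 * norm a * C)) \<partial>lborel)"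
      by (simp add: mult_ac)
    also have "\<dots> \<le> ennreal (6 * ((gauss_const TYPE('a))\<^sup>2 * norm a * C) * T powr (1/2))"
      by (rule nn_integral_const_singular) (use T C0 in auto)
    finally show ?thesis by (auto intro: le_less_trans)
  qed
  note pair = pairing_curve_integral[OF km _ _ kb kP, of "\<lambda>y. heatG t (x - y)" "t powr (- real DIM('a) / 2)"]
  \<comment> \<open>The heat flow passes under the time integral by Fubini, and
    \<open>heat_gradheat\<close> merges T - s and t into the kernel time T + t - s.\<close>
  have heatD: "(\<integral>y. heatG t (x - y) * D y \<partial>lborel) = (LINT s:{0..T}|lborel. gradheat a (T + t - s) (H s) x)"
  proof -
    have "(\<integral>y. heatG t (x - y) * D y \<partial>lborel) = (LINT s:{0<..<T}|lborel. \<integral>y. heatG t (x - y) * k s y \<partial>lborel)"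
      unfolding Do by (rule pair(1)) (use t abs_heatG_bound[OF t, where 'a='a] in auto)
    also have "\<dots> = (LINT s:{0<..<T}|lborel. gradheat a (T + t - s) (H s) x)"
    proof (rule set_lebesgue_integral_cong)
      show "\<forall>s. s \<in> {0<..<T} \<longrightarrow> (\<integral>y. heatG t (x - y) * k s y \<partial>lborel) = gradheat a (T + t - s) (H s) x"
      proof (intro allI impI)
        fix s assume s: "s \<in> {0<..<T}"
        have "(\<integral>y. heatG t (x - y) * k s y \<partial>lborel) = heat t (gradheat a (T - s) (H s)) x"
          by (simp add: heat_def k_def)
        also have "\<dots> = gradheat a ((T - s) + t) (H s) x"
          by (rule heat_gradheat) (use s t sbound_integrable[OF B] in auto)
        finally show "(\<integral>y. heatG t (x - y) * k s y \<partial>lborel) = gradheat a (T + t - s) (H s) x" by (simp add: algebra_simps)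
      qed
    qed auto
    also have "\<dots> = (LINT s:{0..T}|lborel. gradheat a (T + t - s) (H s) x)"
      by (rule set_integral_closed_open(1)[symmetric]) (simp add: gradheat_def)
    finally show ?thesis .
  qed
  have "heat t (V T) x = (\<integral>y. heatG t (x - y) * heat T u0 y + heatG t (x - y) * D y \<partial>lborel)"
    unfolding heat_def[of t] by (simp add: V[OF T] D_def k_def algebra_simps)
  also have "\<dots> = (\<integral>y. heatG t (x - y) * heat T u0 y \<partial>lborel) + (\<integral>y. heatG t (x - y) * D y \<partial>lborel)"
  proof (rule Bochner_Integration.integral_add)
    have "sbound T (heat T u0) (1 * (\<integral>y. \<bar>u0 y\<bar> \<partial>lborel))"
      unfolding heat_def by (rule heat_kernel_dominated_L1) (use T u0 in \<open>auto simp: nn_integral_eq_integral\<close>)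
    then have "integrable lborel (heat T u0)" by (rule sbound_integrable)
    then show "integrable lborel (\<lambda>y. heatG t (x - y) * heat T u0 y)"
      by (rule integrable_bounded_mult[rotated 2]) (use abs_heatG_bound[OF t, where 'a='a] in auto)
    show "integrable lborel (\<lambda>y. heatG t (x - y) * D y)"
      unfolding Do by (rule pair(2)) (use t abs_heatG_bound[OF t, where 'a='a] in auto)
  qed
  also have "(\<integral>y. heatG t (x - y) * heat T u0 y \<partial>lborel) = heat (T + t) u0 x"
    using heat_heat[OF T t u0, of x] by (simp add: heat_def[of t])
  finally have h: "heat t (V T) x = heat (T + t) u0 x + (LINT s:{0..T}|lborel. gradheat a (T + t - s) (H s) x)"
    unfolding heatD .
  have "(LINT s:{0..t}|lborel. gradheat a (t - s) (H (T + s)) x) = (LINT s:{T..T+t}|lborel. gradheat a (T + t - s) (H s) x)"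
  proof -
    have "(LINT s:{T..T+t}|lborel. gradheat a (T + t - s) (H s) x) = (\<integral>s. indicator {T..T+t} (T + s) *\<^sub>R gradheat a (T + t - (T + s)) (H (T + s)) x \<partial>lborel)"
      unfolding set_lebesgue_integral_def
      using lborel_integral_real_affine[of 1 "\<lambda>s. indicator {T..T+t} s *\<^sub>R gradheat a (T + t - s) (H s) x" T] by simp
    also have "\<dots> = (LINT s:{0..t}|lborel. gradheat a (t - s) (H (T + s)) x)"
      unfolding set_lebesgue_integral_def
      by (intro Bochner_Integration.integral_cong) (auto simp: indicator_def)
    finally show ?thesis by simp
  qed
  moreover have "(LINT s:{0..T+t}|lborel. gradheat a (T + t - s) (H s) x) =
     (LINT s:{0..T}|lborel. gradheat a (T + t - s) (H s) x) + (LINT s:{T..T+t}|lborel. gradheat a (T + t - s) (H s) x)"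
  proof -
    have I: "set_integrable lborel {0..T+t} (\<lambda>s. gradheat a (T + t - s) (H s) x)"
      by (rule set1) (use T t in auto)
    have m: "(\<lambda>s. gradheat a (T + t - s) (H s) x) \<in> borel_measurable borel" by (simp add: gradheat_def)
    have u: "{0..T+t} = {0..T} \<union> {T<..T+t}" using T t by auto
    have "(LINT s:{0..T+t}|lborel. gradheat a (T + t - s) (H s) x) = (LINT s:{0..T}|lborel. gradheat a (T + t - s) (H s) x) + (LINT s:{T<..T+t}|lborel. gradheat a (T + t - s) (H s) x)"
      unfolding u by (rule set_integral_Un) (auto intro: set_integrable_subset[OF I] simp: u)
    also have "(LINT s:{T<..T+t}|lborel. gradheat a (T + t - s) (H s) x) = (LINT s:{T..T+t}|lborel. gradheat a (T + t - s) (H s) x)"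
      unfolding set_lebesgue_integral_def
      by (rule integral_cong_AE) (use AE_lborel_singleton[of T] m in \<open>auto simp: indicator_def\<close>)
    finally show ?thesis .
  qed
  ultimately show ?thesis using V[of "T + t" x] T t h by simp
qed


lemma gradheat_cong_AE:
  assumes "AE y in lborel. \<phi> y = \<eta> y" "\<phi> \<in> borel_measurable borel" "\<eta> \<in> borel_measurable borel"
  shows "gradheat a t \<phi> x = gradheat a t \<eta> x"
  unfolding gradheat_def by (rule integral_cong_AE) (use assms in auto)

lemma gradheat_diff:
  assumes t: "0 < t" and "integrable lborel \<phi>" "integrable lborel \<eta>"
  shows "gradheat a t (\<lambda>y. \<phi> y - \<eta> y) x = gradheat a t \<phi> x - gradheat a t \<eta> x"
proof -
  have "integrable lborel (\<lambda>y. dheatG a t (x - y) * g y)" if "integrable lborel g" for g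
    by (rule integrable_bounded_mult[OF _ _ that]) (use abs_dheatG_bound[OF t, of a] in auto)
  then show ?thesis unfolding gradheat_def right_diff_distrib using assms by simp
qed

lemma abs_gradheat_le_L1:
  fixes \<phi> :: "'a::euclidean_space \<Rightarrow> real"
  assumes t: "0 < t" and \<phi>: "integrable lborel \<phi>"
  shows "\<bar>gradheat a t \<phi> x\<bar> \<le> gauss_const TYPE('a) * norm a * t powr (-1/2) * (2*t) powr (- real DIM('a) / 2) * (\<integral>y. \<bar>\<phi> y\<bar> \<partial>lborel)"
proof -
  have "sbound (2*t) (gradheat a t \<phi>) (gauss_const TYPE('a) * norm a * t powr (-1/2) * (\<integral>y. \<bar>\<phi> y\<bar> \<partial>lborel))"
    unfolding gradheat_def
    by (rule heat_kernel_dominated_L1) (use t \<phi> abs_dheatG_le[OF t, of a] gauss_const_ge[where 'a='a] in \<open>auto simp: nn_integral_eq_integral\<close>)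
  from sboundD(4)[OF this, of x] show ?thesis by (simp add: mult_ac)
qed

text \<open>f is Lipschitz only on bounded sets and the solution bounded only almost everywhere.
  Truncating the argument makes the source globally Lipschitz and bounded at every point, without
  change on values up to M.\<close>

definition truncate_at :: "real \<Rightarrow> real \<Rightarrow> real" where
  "truncate_at M z = max (- M) (min M z)"

lemma truncate_at_simps: "0 \<le> M \<Longrightarrow> \<bar>truncate_at M z\<bar> \<le> M" "\<bar>z\<bar> \<le> M \<Longrightarrow> truncate_at M z = z"
    "\<bar>truncate_at M z - truncate_at M w\<bar> \<le> \<bar>z - w\<bar>" "0 \<le> M \<Longrightarrow> \<bar>truncate_at M z\<bar> \<le> \<bar>z\<bar>"
  unfolding truncate_at_def by (auto simp: max_def min_def)

lemma truncate_at_measurable [measurable]: "truncate_at M \<in> borel_measurable borel"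
  unfolding truncate_at_def[abs_def] by measurable

text \<open>A global solution need not be jointly measurable in time and space, but its Duhamel integrand is
  a pointwise limit of those of step functions in time.\<close>

lemma jointly_measurable_solution:
  fixes a :: "'a::euclidean_space"
  assumes sol: "global_solution a f u0 u"
    and f[measurable]: "f \<in> borel_measurable borel"
    and M: "0 \<le> M" "\<And>t. 0 < t \<Longrightarrow> AE x in lborel. \<bar>u t x\<bar> \<le> M"
    and L: "\<And>x y. \<bar>x\<bar> \<le> M \<Longrightarrow> \<bar>y\<bar> \<le> M \<Longrightarrow> \<bar>f x - f y\<bar> \<le> L * \<bar>x - y\<bar>" and f0: "f 0 = 0"
    and u0[measurable]: "u0 \<in> borel_measurable borel"
  shows "\<exists>U. case_prod U \<in> borel_measurable (borel \<Otimes>\<^sub>M borel) \<and>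
    (\<forall>t>0. AE x in lborel. U t x = u t x) \<and>
    (\<forall>t>0. \<forall>x. U t x = heat t u0 x + (LINT s:{0..t}|lborel. gradheat a (t - s) (\<lambda>y. f (U s y)) x))"
proof -
  have ui: "integrable lborel (u t)" if "0 \<le> t" for t
    using sol that unfolding global_solution_def by blast
  then have um[measurable]: "u t \<in> borel_measurable borel" if "0 \<le> t" for t using that by fastforce
  define ft where "ft = (\<lambda>z. f (truncate_at M z))"
  have [measurable]: "ft \<in> borel_measurable borel" unfolding ft_def by measurable
  define L' where "L' = max L 0"
  have ftL: "\<bar>ft x - ft y\<bar> \<le> L' * \<bar>x - y\<bar>" for x y
  proof -
    have "\<bar>ft x - ft y\<bar> \<le> L * \<bar>truncate_at M x - truncate_at M y\<bar>"
      unfolding ft_def using M by (intro L truncate_at_simps)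
    also have "\<dots> \<le> L' * \<bar>x - y\<bar>"
      unfolding L'_def using truncate_at_simps(3)[of M x y] by (intro mult_mono) auto
    finally show ?thesis .
  qed
  have ft0: "ft 0 = 0" using f0 M by (simp add: ft_def truncate_at_def)
  have fti: "integrable lborel (\<lambda>y. ft (g y))" if "integrable lborel g" for g :: "'a \<Rightarrow> real"
  proof (rule Bochner_Integration.integrable_bound[where f="\<lambda>y. L' * g y"])
    show "AE y in lborel. norm (ft (g y)) \<le> norm (L' * g y)"
      using ftL[of "g _" 0] ft0 by (intro AE_I2) (auto simp: abs_mult L'_def)
  qed (use that in auto)
  have ftu: "gradheat a r (\<lambda>y. f (u s y)) x = gradheat a r (\<lambda>y. ft (u s y)) x" if "0 < s" for r s x
  proof (rule gradheat_cong_AE)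
    show "AE y in lborel. f (u s y) = ft (u s y)"
      using M(2)[OF that] by eventually_elim (simp add: ft_def truncate_at_simps)
  qed (use that in auto)
  \<comment> \<open>For s >= 0, the grid point strictly to the right of s in a mesh of width 1/(n +
    1); it is positive for every s. Only countably many times are sampled, hence joint measurability
    of the step function.\<close>
  define idx where "idx = (\<lambda>n s. (real (nat \<lfloor>real (Suc n) * s\<rfloor>) + 1) / real (Suc n))"
  have idx_pos: "0 < idx n s" for n s by (simp add: idx_def)
  have idx_lim: "(\<lambda>n. idx n s) \<longlonglongrightarrow> s" if s: "0 \<le> s" for s
  proof (rule tendsto_sandwich[where f="\<lambda>_. s" and h="\<lambda>n. s + 1 / real (Suc n)"])
    have *: "s \<le> idx n s \<and> idx n s \<le> s + 1 / real (Suc n)" for n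
    proof -
      have "real (nat \<lfloor>real (Suc n) * s\<rfloor>) \<le> real (Suc n) * s" "real (Suc n) * s \<le> real (nat \<lfloor>real (Suc n) * s\<rfloor>) + 1"
      proof -
        define v where "v = real (Suc n) * s"
        have "0 \<le> v" using s by (simp add: v_def)
        then have "real (nat \<lfloor>v\<rfloor>) = of_int \<lfloor>v\<rfloor>" by simp
        then show "real (nat \<lfloor>real (Suc n) * s\<rfloor>) \<le> real (Suc n) * s" "real (Suc n) * s \<le> real (nat \<lfloor>real (Suc n) * s\<rfloor>) + 1"
          unfolding v_def[symmetric] by linarith+
      qed
      moreover have "s \<le> (F + 1) / N \<and> (F + 1) / N \<le> s + 1 / N" if "0 < N" "F \<le> N * s" "N * s \<le> F + 1" for F N :: real
        using that by (simp add: field_simps)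
      ultimately show ?thesis unfolding idx_def by simp
    qed
    show "\<forall>\<^sub>F n in sequentially. s \<le> idx n s" "\<forall>\<^sub>F n in sequentially. idx n s \<le> s + 1 / real (Suc n)"
      using * by auto
    show "(\<lambda>n. s + 1 / real (Suc n)) \<longlonglongrightarrow> s"
      using tendsto_add[OF tendsto_const LIMSEQ_inverse_real_of_nat, of s] by (simp add: inverse_eq_divide)
  qed simp
  have um_idx[measurable]: "(\<lambda>(s, y). ft (u (idx n s) y)) \<in> borel_measurable (borel \<Otimes>\<^sub>M borel)" for n
  proof -
    have "(\<lambda>z::real \<times> 'a. (\<lambda>i z. ft (u ((real i + 1) / real (Suc n)) (snd z))) (nat \<lfloor>real (Suc n) * fst z\<rfloor>) z) \<in> borel_measurable (borel \<Otimes>\<^sub>M borel)"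
    proof (rule measurable_compose_countable[where f="\<lambda>i z. ft (u ((real i + 1) / real (Suc n)) (snd z))"])
      show "(\<lambda>z::real \<times> 'a. ft (u ((real i + 1) / real (Suc n)) (snd z))) \<in> borel_measurable (borel \<Otimes>\<^sub>M borel)" for i
        by measurable
      show "(\<lambda>z::real \<times> 'a. nat \<lfloor>real (Suc n) * fst z\<rfloor>) \<in> (borel \<Otimes>\<^sub>M borel) \<rightarrow>\<^sub>M count_space UNIV" by measurable
    qed
    then show ?thesis by (simp add: idx_def case_prod_beta')
  qed
  define g where "g = (\<lambda>z. if 0 < snd z \<and> snd z < fst (fst z)
    then gradheat a (fst (fst z) - snd z) (\<lambda>y. f (u (snd z) y)) (snd (fst z)) else 0)"
  have gm[measurable]: "g \<in> borel_measurable ((borel \<Otimes>\<^sub>M borel) \<Otimes>\<^sub>M borel)"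
  proof (rule borel_measurable_LIMSEQ_real)
    show "(\<lambda>z. if 0 < snd z \<and> snd z < fst (fst z)
        then gradheat a (fst (fst z) - snd z) (\<lambda>y. ft (u (idx n (snd z)) y)) (snd (fst z)) else 0)
        \<in> borel_measurable ((borel \<Otimes>\<^sub>M borel) \<Otimes>\<^sub>M borel)" for n
      unfolding gradheat_def by measurable
    fix z :: "(real \<times> 'a) \<times> real"
    obtain t x s where z: "z = ((t, x), s)" by (metis surj_pair)
    show "(\<lambda>n. if 0 < snd z \<and> snd z < fst (fst z)
        then gradheat a (fst (fst z) - snd z) (\<lambda>y. ft (u (idx n (snd z)) y)) (snd (fst z)) else 0) \<longlonglongrightarrow> g z"
    proof (cases "0 < s \<and> s < t")
      case True
      define C where "C = gauss_const TYPE('a) * norm a * (t - s) powr (-1/2) * (2*(t - s)) powr (- real DIM('a) / 2)"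
      have C0: "0 \<le> C" using gauss_const_ge[where 'a='a] by (simp add: C_def)
      \<comment> \<open>For fixed s < t the kernel is bounded, so continuity of \<open>u\<close> in
        L1 at time s gives convergence of the integrands at every x.\<close>
      have "((\<lambda>r. Lnorm 1 (\<lambda>x. u r x - u s x)) \<longlongrightarrow> 0) (at s within {0..})"
        using sol True unfolding global_solution_def by auto
      then have "continuous (at s within {0..}) (\<lambda>r. Lnorm 1 (\<lambda>x. u r x - u s x))"
        by (simp add: continuous_within Lnorm_1)
      then have "(\<lambda>n. Lnorm 1 (\<lambda>x. u (idx n s) x - u s x)) \<longlonglongrightarrow> Lnorm 1 (\<lambda>x. u s x - u s x)"
        by (rule continuous_within_tendsto_compose'[where x="\<lambda>n. idx n s"]) (use idx_lim True idx_pos in \<open>auto intro: less_imp_le\<close>)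
      then have "(\<lambda>n. \<integral>\<^sup>+x. ennreal \<bar>u (idx n s) x - u s x\<bar> \<partial>lborel) \<longlonglongrightarrow> 0"
        by (simp add: Lnorm_1)
      moreover have "(\<integral>\<^sup>+x. ennreal \<bar>u (idx n s) x - u s x\<bar> \<partial>lborel) = ennreal (\<integral>x. \<bar>u (idx n s) x - u s x\<bar> \<partial>lborel)" for n
        by (rule nn_integral_eq_integral) (use True idx_pos[of n s] ui in \<open>auto intro!: integrable_abs Bochner_Integration.integrable_diff\<close>)
      ultimately have "(\<lambda>n. ennreal (\<integral>x. \<bar>u (idx n s) x - u s x\<bar> \<partial>lborel)) \<longlonglongrightarrow> ennreal 0" by simp
      then have "(\<lambda>n. \<integral>x. \<bar>u (idx n s) x - u s x\<bar> \<partial>lborel) \<longlonglongrightarrow> 0"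
        by (subst (asm) tendsto_ennreal_iff) auto
      then have lim: "(\<lambda>n. C * (L' * (\<integral>x. \<bar>u (idx n s) x - u s x\<bar> \<partial>lborel))) \<longlonglongrightarrow> 0"
        by (auto intro: tendsto_mult_right_zero)
      have le: "\<bar>gradheat a (t - s) (\<lambda>y. ft (u (idx n s) y)) x - gradheat a (t - s) (\<lambda>y. ft (u s y)) x\<bar>
           \<le> C * (L' * (\<integral>x. \<bar>u (idx n s) x - u s x\<bar> \<partial>lborel))" for n
      proof -
        have i: "integrable lborel (\<lambda>y. ft (u (idx n s) y))" "integrable lborel (\<lambda>y. ft (u s y))"
          using True idx_pos[of n s] ui by (auto intro!: fti)
        have d: "integrable lborel (\<lambda>y. u (idx n s) y - u s y)"
          using True idx_pos[of n s] ui by auto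
        have "\<bar>gradheat a (t - s) (\<lambda>y. ft (u (idx n s) y)) x - gradheat a (t - s) (\<lambda>y. ft (u s y)) x\<bar>
           = \<bar>gradheat a (t - s) (\<lambda>y. ft (u (idx n s) y) - ft (u s y)) x\<bar>"
          using gradheat_diff[OF _ i] True by simp
        also have "\<dots> \<le> C * (\<integral>y. \<bar>ft (u (idx n s) y) - ft (u s y)\<bar> \<partial>lborel)"
          unfolding C_def by (rule abs_gradheat_le_L1) (use True i in auto)
        also have "\<dots> \<le> C * (\<integral>y. L' * \<bar>u (idx n s) y - u s y\<bar> \<partial>lborel)"
          using i d by (intro mult_left_mono integral_mono ftL C0 integrable_abs integrable_mult_right) auto
        finally show ?thesis by simp
      qed
      have "(\<lambda>n. gradheat a (t - s) (\<lambda>y. ft (u (idx n s) y)) x - gradheat a (t - s) (\<lambda>y. ft (u s y)) x) \<longlonglongrightarrow> 0"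
        by (rule Lim_null_comparison[OF _ lim]) (use le in auto)
      then have "(\<lambda>n. gradheat a (t - s) (\<lambda>y. ft (u (idx n s) y)) x) \<longlonglongrightarrow> gradheat a (t - s) (\<lambda>y. ft (u s y)) x"
        by (simp add: LIM_zero_iff)
      then show ?thesis using True ftu[of s] by (simp add: z g_def)
    next
      case False
      show ?thesis unfolding g_def z fst_conv snd_conv if_not_P[OF False] by simp
    qed
  qed
  \<comment> \<open>The new version is read off from Duhamel's formula with source \<open>u\<close>.
    It agrees with \<open>u\<close> almost everywhere at each positive time, and
    \<open>gradheat\<close> ignores null sets, so it satisfies the formula with itself as source,
    now at every x.\<close>
  define U where "U = (\<lambda>t x. if 0 < t then heat t u0 x + (\<integral>s. g ((t, x), s) \<partial>lborel) else 0)"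
  have Um[measurable]: "case_prod U \<in> borel_measurable (borel \<Otimes>\<^sub>M borel)"
    unfolding U_def heat_def by measurable
  have duh: "(LINT s:{0..t}|lborel. G s) = (\<integral>s. g ((t, x), s) \<partial>lborel)"
    if t: "0 < t" and G: "\<And>s. 0 < s \<Longrightarrow> s < t \<Longrightarrow> G s = gradheat a (t - s) (\<lambda>y. f (u s y)) x" for t x G
    unfolding set_lebesgue_integral_def
  proof (rule integral_cong_AE)
    \<comment> \<open>At the two endpoints \<open>G\<close> is arbitrary, which affects neither
      measurability nor the integral.\<close>
    have "(\<lambda>s. indicator {0..t} s *\<^sub>R G s) = (\<lambda>s. if s = 0 then G 0 else if s = t then G t else g ((t, x), s))"
      using t G by (auto simp: fun_eq_iff g_def indicator_def)
    then show "(\<lambda>s. indicator {0..t} s *\<^sub>R G s) \<in> borel_measurable lborel" by simp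
    show "AE s in lborel. indicator {0..t} s *\<^sub>R G s = g ((t, x), s)"
      using AE_lborel_singleton[of 0] AE_lborel_singleton[of t]
      by eventually_elim (use t G in \<open>auto simp: g_def indicator_def\<close>)
  qed measurable
  have Uu: "AE x in lborel. U t x = u t x" if "0 < t" for t
  proof -
    have "AE x in lborel. u t x = heat t u0 x + duhamel a f u 0 t t x"
      using sol that unfolding global_solution_def by blast
    then show ?thesis
      by eventually_elim (use that duh[OF that] in \<open>auto simp: U_def duhamel_def\<close>)
  qed
  show ?thesis
  proof (intro exI[of _ U] conjI allI impI Um Uu)
    fix t :: real and x :: 'a assume t: "0 < t"
    have "(LINT s:{0..t}|lborel. gradheat a (t - s) (\<lambda>y. f (U s y)) x) = (\<integral>s. g ((t, x), s) \<partial>lborel)"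
    proof (rule duh[OF t])
      fix s assume s: "0 < s" "s < t"
      show "gradheat a (t - s) (\<lambda>y. f (U s y)) x = gradheat a (t - s) (\<lambda>y. f (u s y)) x"
      proof (rule gradheat_cong_AE)
        show "AE y in lborel. f (U s y) = f (u s y)" using Uu[OF s(1)] by eventually_elim simp
      qed (use s in auto)
    qed
    then show "U t x = heat t u0 x + (LINT s:{0..t}|lborel. gradheat a (t - s) (\<lambda>y. f (U s y)) x)"
      using t by (simp add: U_def)
  qed
qed

text \<open>Beyond the choice of the version, essential bounds are turned into bounds at every
  point: the heat flow over a positive time does this, and a Duhamel integral over a time of length
  at most 1 adds a fixed constant. For t > 1 the formula is restarted at t - 1.\<close>

lemma mild_solution_exists:
  fixes a :: "'a::euclidean_space"
  assumes sol: "global_solution a f u0 u"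
    and f[measurable]: "f \<in> borel_measurable borel" and f0: "f 0 = 0"
    and L: "\<And>M. 0 \<le> M \<Longrightarrow> \<exists>L\<ge>0. \<forall>x y. \<bar>x\<bar> \<le> M \<longrightarrow> \<bar>y\<bar> \<le> M \<longrightarrow> \<bar>f x - f y\<bar> \<le> L * \<bar>x - y\<bar>"
    and u0: "integrable lborel u0" and u0M: "AE x in lborel. \<bar>u0 x\<bar> \<le> M0"
  obtains U M where "0 < M" "case_prod U \<in> borel_measurable (borel \<Otimes>\<^sub>M borel)"
    "\<And>t. 0 < t \<Longrightarrow> AE x in lborel. U t x = u t x"
    "\<And>t. 0 < t \<Longrightarrow> sbound 1 (U t) M"
    "\<And>t x. 0 < t \<Longrightarrow> U t x = heat t u0 x + (LINT s:{0..t}|lborel. gradheat a (t - s) (\<lambda>y. f (U s y)) x)"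
    "\<And>T t x. 0 < T \<Longrightarrow> 0 < t \<Longrightarrow> U (T + t) x = heat t (U T) x + (LINT s:{0..t}|lborel. gradheat a (t - s) (\<lambda>y. f (U (T + s) y)) x)"
proof -
  have ui: "integrable lborel (u t)" if "0 \<le> t" for t
    using sol that unfolding global_solution_def by blast
  obtain M1' where M1': "\<And>t. 0 \<le> t \<Longrightarrow> Lnorm 1 (u t) \<le> ennreal M1'"
    using sol unfolding global_solution_def by blast
  obtain M2' where M2': "\<And>t. 0 < t \<Longrightarrow> Lnorm \<infinity> (u t) \<le> ennreal M2'"
    using sol unfolding global_solution_def by blast
  \<comment> \<open>The bounds supplied by the solution carry no sign; the 1 makes their common
    bound positive.\<close>
  define M1 where "M1 = max 1 (max M1' (max M2' M0))"
  have M1: "0 < M1" "M1' \<le> M1" "M2' \<le> M1" "M0 \<le> M1" by (auto simp: M1_def)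
  have uL1: "(\<integral>\<^sup>+x. ennreal \<bar>u t x\<bar> \<partial>lborel) \<le> ennreal M1" if "0 \<le> t" for t
    using M1'[OF that] ennreal_leI[OF M1(2)] by (simp add: Lnorm_1)
  have uLi: "AE x in lborel. \<bar>u t x\<bar> \<le> M1" if "0 < t" for t
    by (rule Lnorm_infinity_AE) (use that ui[of t] M2'[OF that] ennreal_leI[OF M1(3)] M1 in \<open>auto intro: order_trans\<close>)
  obtain L where L: "0 \<le> L" "\<And>x y. \<bar>x\<bar> \<le> M1 \<Longrightarrow> \<bar>y\<bar> \<le> M1 \<Longrightarrow> \<bar>f x - f y\<bar> \<le> L * \<bar>x - y\<bar>"
    using L[of M1] M1 by force
  have u0m: "u0 \<in> borel_measurable borel" using u0 by auto
  have ex: "\<exists>U. case_prod U \<in> borel_measurable (borel \<Otimes>\<^sub>M borel) \<and>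
    (\<forall>t>0. AE x in lborel. U t x = u t x) \<and>
    (\<forall>t>0. \<forall>x. U t x = heat t u0 x + (LINT s:{0..t}|lborel. gradheat a (t - s) (\<lambda>y. f (U s y)) x))"
    by (rule jointly_measurable_solution[OF sol f less_imp_le[OF M1(1)] uLi L(2) f0 u0m])
  obtain U where U': "case_prod U \<in> borel_measurable (borel \<Otimes>\<^sub>M borel) \<and>
    (\<forall>t>0. AE x in lborel. U t x = u t x) \<and>
    (\<forall>t>0. \<forall>x. U t x = heat t u0 x + (LINT s:{0..t}|lborel. gradheat a (t - s) (\<lambda>y. f (U s y)) x))"
    using ex by (elim exE)
  have Um[measurable]: "case_prod U \<in> borel_measurable (borel \<Otimes>\<^sub>M borel)" using U' by (elim conjE)
  have Uu: "AE x in lborel. U t x = u t x" if "0 < t" for t using conjunct1[OF conjunct2[OF U']] that by blast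
  have U: "U t x = heat t u0 x + (LINT s:{0..t}|lborel. gradheat a (t - s) (\<lambda>y. f (U s y)) x)" if "0 < t" for t x
    using conjunct2[OF conjunct2[OF U']] that by blast
  \<comment> \<open>Equal to f(U) almost everywhere and hence with the same Duhamel terms, but
    bounded at every point.\<close>
  define H where "H = (\<lambda>s y. f (truncate_at M1 (U s y)))"
  have Hm[measurable]: "case_prod H \<in> borel_measurable (borel \<Otimes>\<^sub>M borel)"
    unfolding H_def by measurable
  have UL1: "(\<integral>\<^sup>+x. ennreal \<bar>U t x\<bar> \<partial>lborel) \<le> ennreal M1" if "0 < t" for t
  proof -
    have "(\<integral>\<^sup>+x. ennreal \<bar>U t x\<bar> \<partial>lborel) = (\<integral>\<^sup>+x. ennreal \<bar>u t x\<bar> \<partial>lborel)"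
      using Uu[OF that] by (intro nn_integral_cong_AE) auto
    then show ?thesis using uL1[of t] that by simp
  qed
  have ULi: "AE x in lborel. \<bar>U t x\<bar> \<le> M1" if "0 < t" for t
    using Uu[OF that] uLi[OF that] by eventually_elim simp
  have Hb: "sbound 1 (H s) (L * M1)" if "0 < s" for s
  proof (rule sboundI)
    have le: "\<bar>H s y\<bar> \<le> L * \<bar>U s y\<bar>" for y
    proof -
      have "\<bar>H s y\<bar> \<le> L * \<bar>truncate_at M1 (U s y)\<bar>"
        using L(2)[of "truncate_at M1 (U s y)" 0] truncate_at_simps(1)[of M1] f0 M1 by (simp add: H_def)
      also have "\<dots> \<le> L * \<bar>U s y\<bar>" using L(1) M1 by (intro mult_left_mono truncate_at_simps) auto
      finally show ?thesis .
    qed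
    show "0 \<le> L * M1" using L M1 by simp
    have "(\<integral>\<^sup>+x. ennreal \<bar>H s x\<bar> \<partial>lborel) \<le> (\<integral>\<^sup>+x. ennreal L * ennreal \<bar>U s x\<bar> \<partial>lborel)"
      using le L(1) by (intro nn_integral_mono) (auto simp: ennreal_mult[symmetric] intro!: ennreal_leI)
    also have "\<dots> = ennreal L * (\<integral>\<^sup>+x. ennreal \<bar>U s x\<bar> \<partial>lborel)" by (intro nn_integral_cmult) measurable
    also have "\<dots> \<le> ennreal (L * M1)" using UL1[OF that] L M1 by (simp add: ennreal_mult mult_left_mono)
    finally show "(\<integral>\<^sup>+x. ennreal \<bar>H s x\<bar> \<partial>lborel) \<le> ennreal (L * M1)" .
    show "\<bar>H s x\<bar> \<le> L * M1 * 1 powr (- real DIM('a) / 2)" for x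
    proof -
      have "\<bar>H s x\<bar> \<le> L * \<bar>truncate_at M1 (U s x)\<bar>"
        using L(2)[of "truncate_at M1 (U s x)" 0] truncate_at_simps(1)[of M1] f0 M1 by (simp add: H_def)
      also have "\<dots> \<le> L * M1" using L(1) M1 by (intro mult_left_mono truncate_at_simps) auto
      finally show ?thesis by simp
    qed
  qed (simp add: H_def)
  have gH: "gradheat a r (\<lambda>y. f (U s y)) x = gradheat a r (H s) x" if "0 < s" for r s x
  proof (rule gradheat_cong_AE)
    show "AE y in lborel. f (U s y) = H s y"
      using ULi[OF that] by eventually_elim (simp add: H_def truncate_at_simps)
  qed (use that in \<open>auto simp: H_def\<close>)
  have duhH: "(LINT s:{0..t}|lborel. gradheat a (t - s) (\<lambda>y. f (U (T + s) y)) x) = (LINT s:{0..t}|lborel. gradheat a (t - s) (H (T + s)) x)"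
    if "0 \<le> T" for T t x
  proof -
    have "(LINT s:{0..t}|lborel. gradheat a (t - s) (\<lambda>y. f (U (T + s) y)) x) = (LINT s:{0<..<t}|lborel. gradheat a (t - s) (\<lambda>y. f (U (T + s) y)) x)"
      by (rule set_integral_closed_open) (simp add: gradheat_def)
    also have "\<dots> = (LINT s:{0<..<t}|lborel. gradheat a (t - s) (H (T + s)) x)"
      using gH that by (intro set_lebesgue_integral_cong) auto
    also have "\<dots> = (LINT s:{0..t}|lborel. gradheat a (t - s) (H (T + s)) x)"
      by (rule set_integral_closed_open[symmetric]) (simp add: gradheat_def)
    finally show ?thesis .
  qed
  have V: "U t x = heat t u0 x + (LINT s:{0..t}|lborel. gradheat a (t - s) (H s) x)" if "0 < t" for t x
    using U[OF that, of x] duhH[of 0 t x] by simp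
  have restart: "U (T + t) x = heat t (U T) x + (LINT s:{0..t}|lborel. gradheat a (t - s) (H (T + s)) x)" if "0 < T" "0 < t" for T t x
    by (rule mild_restart[OF Hm Hb u0 V that])
  define c where "c = (gauss_const TYPE('a))\<^sup>2 * norm a * (6 * (2 powr (real DIM('a) / 2) * (L * M1)))"
  have c0: "0 \<le> c" using L M1 by (simp add: c_def)
  have dsmall: "\<bar>LINT s:{0..t}|lborel. gradheat a (t - s) (H (T + s)) x\<bar> \<le> c" if "0 \<le> T" "0 < t" "t \<le> 1" for T t x
  proof -
    have b: "sbound (s + 1) (H (T + s)) (2 powr (real DIM('a) / 2) * (L * M1))" if s: "0 < s" "s < t" for s
    proof (rule sboundI)
      note d = sboundD[OF Hb[of "T + s"]]
      have le: "L * M1 \<le> 2 powr (real DIM('a) / 2) * (L * M1)"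
        using L M1 by (intro mult_le_cancel_right1[THEN iffD2]) (auto simp: ge_one_powr_ge_zero mult_less_0_iff)
      show "H (T + s) \<in> borel_measurable borel" by measurable
      show "0 \<le> 2 powr (real DIM('a) / 2) * (L * M1)" using L M1 by simp
      show "(\<integral>\<^sup>+x. ennreal \<bar>H (T + s) x\<bar> \<partial>lborel) \<le> ennreal (2 powr (real DIM('a) / 2) * (L * M1))"
        using d(3) ennreal_leI[OF le] s \<open>0 \<le> T\<close> by auto
      fix x
      have "1 \<le> (2 / (s + 1)) powr (real DIM('a) / 2)"
        using s \<open>t \<le> 1\<close> by (intro ge_one_powr_ge_zero) auto
      also have "\<dots> = 2 powr (real DIM('a) / 2) * (s + 1) powr (- real DIM('a) / 2)"
        using s by (simp add: powr_divide powr_minus divide_simps)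
      finally have "L * M1 * 1 \<le> L * M1 * (2 powr (real DIM('a) / 2) * (s + 1) powr (- real DIM('a) / 2))"
        using L M1 by (intro mult_left_mono) auto
      then show "\<bar>H (T + s) x\<bar> \<le> 2 powr (real DIM('a) / 2) * (L * M1) * (s + 1) powr (- real DIM('a) / 2)"
        using d(4)[of x] s \<open>0 \<le> T\<close> by (simp add: mult_ac)
    qed
    have "sbound (t + 1) (\<lambda>x. LINT s:{0..t}|lborel. gradheat a (t - s) (H (T + s)) x)
       ((gauss_const TYPE('a))\<^sup>2 * norm a * (6 * (2 powr (real DIM('a) / 2) * (L * M1)) * t powr (1/2)))"
    proof (rule sbound_duhamel(1)[where \<psi>="\<lambda>_. 2 powr (real DIM('a) / 2) * (L * M1)"])
      show "(\<lambda>(s, y). H (T + s) y) \<in> borel_measurable (borel \<Otimes>\<^sub>M borel)" by measurable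
      show "(\<integral>\<^sup>+s\<in>{0<..<t}. ennreal ((t - s) powr (-1/2) * (2 powr (real DIM('a) / 2) * (L * M1))) \<partial>lborel)
          \<le> ennreal (6 * (2 powr (real DIM('a) / 2) * (L * M1)) * t powr (1/2))"
        using that L M1 by (intro nn_integral_const_singular) auto
      show "sbound (s + 1) (H (T + s)) (2 powr (real DIM('a) / 2) * (L * M1))" if "0 < s" "s < t" for s
        by (rule b[OF that])
    qed (use that L M1 in auto)
    from sboundD(4)[OF this, of x]
    have "\<bar>LINT s:{0..t}|lborel. gradheat a (t - s) (H (T + s)) x\<bar> \<le> c * (t powr (1/2) * (t + 1) powr (- real DIM('a) / 2))"
      by (simp add: c_def mult_ac)
    also have "\<dots> \<le> c * (1 * 1)"
    proof (intro mult_left_mono mult_mono c0)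
      show "t powr (1/2) \<le> 1" using that by (intro powr_le1) auto
      have "(t + 1) powr (- real DIM('a) / 2) \<le> 1 powr (- real DIM('a) / 2)" using that by (intro powr_mono2') auto
      then show "(t + 1) powr (- real DIM('a) / 2) \<le> 1" by simp
    qed auto
    finally show ?thesis by simp
  qed
  define M where "M = M1 + c"
  show thesis
  proof (rule that[of M U])
    show "case_prod U \<in> borel_measurable (borel \<Otimes>\<^sub>M borel)" by (rule Um)
    show "AE x in lborel. U t x = u t x" if "0 < t" for t by (rule Uu[OF that])
    show "U t x = heat t u0 x + (LINT s:{0..t}|lborel. gradheat a (t - s) (\<lambda>y. f (U s y)) x)" if "0 < t" for t x
      by (rule U[OF that])
    show "0 < M" using M1 c0 by (simp add: M_def)
    show "sbound 1 (U t) M" if t: "0 < t" for t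
    proof (rule sboundI)
      show "U t \<in> borel_measurable borel" by measurable
      show "0 \<le> M" using M1 c0 by (simp add: M_def)
      show "(\<integral>\<^sup>+x. ennreal \<bar>U t x\<bar> \<partial>lborel) \<le> ennreal M"
        by (rule order_trans[OF UL1[OF t] ennreal_leI]) (use c0 in \<open>simp add: M_def\<close>)
      fix x
      have h: "\<bar>heat r \<phi> x\<bar> \<le> M1" if "0 < r" "\<phi> \<in> borel_measurable borel" "AE x in lborel. \<bar>\<phi> x\<bar> \<le> M1" for r and \<phi> :: "'a \<Rightarrow> real"
        using heat_kernel_dominated_sup[of "heatG r" \<phi> r 1 M1 x] that M1 by (simp add: heat_def)
      show "\<bar>U t x\<bar> \<le> M * 1 powr (- real DIM('a) / 2)"
      proof (cases "t \<le> 1")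
        case True
        have "\<bar>heat t u0 x\<bar> \<le> M1"
        proof (rule h[OF t])
          show "AE x in lborel. \<bar>u0 x\<bar> \<le> M1" using u0M by eventually_elim (use M1 in simp)
        qed (use u0 in auto)
        then show ?thesis using V[OF t, of x] dsmall[of 0 t x] t True by (simp add: M_def)
      next
        case False
        have "\<bar>heat 1 (U (t - 1)) x\<bar> \<le> M1"
          by (rule h) (use False ULi[of "t - 1"] in auto)
        then show ?thesis using restart[of "t - 1" 1 x] dsmall[of "t - 1" 1 x] False by (simp add: M_def)
      qed
    qed
    show "U (T + t) x = heat t (U T) x + (LINT s:{0..t}|lborel. gradheat a (t - s) (\<lambda>y. f (U (T + s) y)) x)" if "0 < T" "0 < t" for T t x
      using restart[OF that] duhH[of T t x] that by simp
  qed
qed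


section \<open>Lipschitz regularity under translations\<close>

text \<open>Scales up to 2 cost at most the factor 2^(n/2), which is contained in
  \<open>gauss_const\<close>. On short time intervals all estimates can thus be kept at scale
  1.\<close>

lemma sbound_raise:
  fixes \<phi> :: "'a::euclidean_space \<Rightarrow> real"
  assumes \<phi>: "sbound 1 \<phi> r" and \<theta>: "0 < \<theta>" "\<theta> \<le> 2"
  shows "sbound \<theta> \<phi> (gauss_const TYPE('a) * r)"
proof (rule sboundI)
  note d = sboundD[OF \<phi>]
  have k: "2 \<le> gauss_const TYPE('a)" by (rule gauss_const_ge)
  have le: "r \<le> gauss_const TYPE('a) * r" using k d(2) by (intro mult_le_cancel_right1[THEN iffD2]) auto
  show "0 \<le> gauss_const TYPE('a) * r" using k d(2) by simp
  show "(\<integral>\<^sup>+x. ennreal \<bar>\<phi> x\<bar> \<partial>lborel) \<le> ennreal (gauss_const TYPE('a) * r)"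
    by (rule order_trans[OF d(3) ennreal_leI[OF le]])
  fix x
  have "1 = 2 powr (real DIM('a) / 2) * 2 powr (- real DIM('a) / 2)" by (simp add: powr_add[symmetric])
  also have "\<dots> \<le> gauss_const TYPE('a) * \<theta> powr (- real DIM('a) / 2)"
    using \<theta> unfolding gauss_const_def by (intro mult_mono powr_mono2') auto
  finally have "r * 1 \<le> r * (gauss_const TYPE('a) * \<theta> powr (- real DIM('a) / 2))" using d(2) by (intro mult_left_mono) auto
  then show "\<bar>\<phi> x\<bar> \<le> gauss_const TYPE('a) * r * \<theta> powr (- real DIM('a) / 2)" using d(4)[of x] by (simp add: mult_ac)
qed (use sboundD[OF \<phi>] in auto)

text \<open>Carries an iteration with improving constants to its limit.\<close>

lemma sbound_lim:
  assumes "\<And>n. sbound \<theta> \<phi> (R n)" "R \<longlonglongrightarrow> r"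
  shows "sbound \<theta> \<phi> r"
proof (rule sboundI)
  show "0 \<le> r" by (rule LIMSEQ_le_const[OF assms(2)]) (use sboundD(2)[OF assms(1)] in auto)
  show "(\<integral>\<^sup>+x. ennreal \<bar>\<phi> x\<bar> \<partial>lborel) \<le> ennreal r"
    by (rule LIMSEQ_le_const[OF tendsto_ennrealI[OF assms(2)]]) (use sboundD(3)[OF assms(1)] in auto)
  show "\<bar>\<phi> x\<bar> \<le> r * \<theta> powr (- real DIM('a) / 2)" for x :: 'a
    by (rule LIMSEQ_le_const[OF tendsto_mult_right[OF assms(2)]]) (use sboundD(4)[OF assms(1)] in auto)
qed (rule sboundD(1)[OF assms(1)])

lemma nn_integral_beta_cmult:
  assumes \<alpha>: "0 \<le> \<alpha>" "\<alpha> < 1" and t: "0 < t" and c: "0 \<le> c"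
  shows "(\<integral>\<^sup>+s\<in>{0<..<t}. ennreal ((t - s) powr (-1/2) * (c * s powr (-\<alpha>))) \<partial>lborel) \<le> ennreal (c * (6 / (1 - \<alpha>) * t powr (1/2 - \<alpha>)))"
proof -
  have "(\<integral>\<^sup>+s\<in>{0<..<t}. ennreal ((t - s) powr (-1/2) * (c * s powr (-\<alpha>))) \<partial>lborel)
      = (\<integral>\<^sup>+s. ennreal c * (ennreal ((t - s) powr (-1/2) * s powr (-\<alpha>)) * indicator {0<..<t} s) \<partial>lborel)"
    using c by (intro nn_integral_cong) (auto simp: indicator_def ennreal_mult[symmetric] mult_ac)
  also have "\<dots> = ennreal c * (\<integral>\<^sup>+s\<in>{0<..<t}. ennreal ((t - s) powr (-1/2) * s powr (-\<alpha>)) \<partial>lborel)"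
    by (intro nn_integral_cmult) measurable
  also have "\<dots> \<le> ennreal c * ennreal (6 / (1 - \<alpha>) * t powr (1/2 - \<alpha>))"
    by (intro mult_left_mono nn_integral_beta \<alpha> t) auto
  also have "\<dots> = ennreal (c * (6 / (1 - \<alpha>) * t powr (1/2 - \<alpha>)))" using c \<alpha> by (intro ennreal_mult[symmetric]) auto
  finally show ?thesis .
qed

text \<open>Short-time variant with the scale held at 1; s + 1 <= 2 allows the use of
  \<open>sbound_raise\<close>.\<close>

lemma sbound_duhamel_unit:
  fixes h :: "real \<Rightarrow> 'a::euclidean_space \<Rightarrow> real"
  assumes h: "case_prod h \<in> borel_measurable (borel \<Otimes>\<^sub>M borel)"
    and \<psi>[measurable]: "\<psi> \<in> borel_measurable borel" and t: "0 < t" "t \<le> 1"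
    and b: "\<And>s. 0 < s \<Longrightarrow> s < t \<Longrightarrow> sbound 1 (h s) (\<psi> s)"
    and I: "0 \<le> I" "(\<integral>\<^sup>+s\<in>{0<..<t}. ennreal ((t - s) powr (-1/2) * \<psi> s) \<partial>lborel) \<le> ennreal I"
  shows "sbound 1 (\<lambda>x. LINT s:{0..t}|lborel. gradheat a (t - s) (h s) x) ((gauss_const TYPE('a))^3 * norm a * I)"
    and "set_integrable lborel {0..t} (\<lambda>s. gradheat a (t - s) (h s) x)"
proof -
  let ?k = "gauss_const TYPE('a)"
  have k: "2 \<le> ?k" by (rule gauss_const_ge)
  have b': "sbound (s + 1) (h s) (?k * \<psi> s)" if "0 < s" "s < t" for s
    by (rule sbound_raise[OF b[OF that]]) (use that t in auto)
  have I': "(\<integral>\<^sup>+s\<in>{0<..<t}. ennreal ((t - s) powr (-1/2) * (?k * \<psi> s)) \<partial>lborel) \<le> ennreal (?k * I)"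
  proof -
    have "(\<integral>\<^sup>+s\<in>{0<..<t}. ennreal ((t - s) powr (-1/2) * (?k * \<psi> s)) \<partial>lborel)
      = (\<integral>\<^sup>+s. ennreal ?k * (ennreal ((t - s) powr (-1/2) * \<psi> s) * indicator {0<..<t} s) \<partial>lborel)"
    proof (intro nn_integral_cong)
      fix s show "ennreal ((t - s) powr (-1/2) * (?k * \<psi> s)) * indicator {0<..<t} s = ennreal ?k * (ennreal ((t - s) powr (-1/2) * \<psi> s) * indicator {0<..<t} s)"
        using sboundD(2)[OF b, of s] k by (auto simp: indicator_def ennreal_mult[symmetric] mult_ac)
    qed
    also have "\<dots> = ennreal ?k * (\<integral>\<^sup>+s\<in>{0<..<t}. ennreal ((t - s) powr (-1/2) * \<psi> s) \<partial>lborel)"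
      by (intro nn_integral_cmult) measurable
    also have "\<dots> \<le> ennreal (?k * I)" using I k by (simp add: ennreal_mult mult_left_mono)
    finally show ?thesis .
  qed
  have "sbound (t + 1) (\<lambda>x. LINT s:{0..t}|lborel. gradheat a (t - s) (h s) x) (?k\<^sup>2 * norm a * (?k * I))"
    by (rule sbound_duhamel(1)[OF h _ _ _ _ b' _ I']) (use I k in auto)
  then show "sbound 1 (\<lambda>x. LINT s:{0..t}|lborel. gradheat a (t - s) (h s) x) (?k^3 * norm a * I)"
    using sbound_time[of "t + 1" _ _ 1] t by (simp add: power2_eq_square power3_eq_cube mult_ac)
  show "set_integrable lborel {0..t} (\<lambda>s. gradheat a (t - s) (h s) x)"
    by (rule sbound_duhamel(2)[OF h _ _ _ _ b' _ I']) (use I k in auto)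
qed

lemma gradheat_translate:
  fixes \<phi> :: "'a::euclidean_space \<Rightarrow> real"
  assumes [measurable]: "\<phi> \<in> borel_measurable borel"
  shows "gradheat a t \<phi> (x - y) = gradheat a t (\<lambda>z. \<phi> (z - y)) x"
  unfolding gradheat_def
  using integral_translate[of "\<lambda>z. dheatG a t (x - y - z) * \<phi> z" y] by (simp add: algebra_simps)

lemma integrable_heatG_mult:
  fixes \<phi> :: "'a::euclidean_space \<Rightarrow> real"
  assumes "0 < t" "integrable lborel \<phi>"
  shows "integrable lborel (\<lambda>z. heatG t (x - z) * \<phi> z)"
  by (rule integrable_bounded_mult) (use assms abs_heatG_bound[OF assms(1), where 'a='a] in auto)

lemma integrable_dheatG_mult:
  fixes \<phi> :: "'a::euclidean_space \<Rightarrow> real"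
  assumes "0 < t" "integrable lborel \<phi>"
  shows "integrable lborel (\<lambda>z. dheatG a t (x - z) * \<phi> z)"
  by (rule integrable_bounded_mult) (use assms abs_dheatG_bound[OF assms(1), where 'a='a] in auto)

lemma heat_measurable [measurable]:
  fixes \<phi> :: "'a::euclidean_space \<Rightarrow> real"
  assumes [measurable]: "\<phi> \<in> borel_measurable borel"
  shows "heat t \<phi> \<in> borel_measurable borel"
  unfolding heat_def[abs_def] by measurable

lemma sbound_heat_translate_diff:
  fixes \<phi> :: "'a::euclidean_space \<Rightarrow> real"
  assumes t: "0 < t" and \<tau>: "0 < \<tau>" and \<phi>: "sbound \<tau> \<phi> r"
  shows "sbound \<tau> (\<lambda>x. heat t \<phi> (x - y) - heat t \<phi> x) (2 * exp 1 * (gauss_const TYPE('a))^3 * t powr (-1/2) * norm y * r)"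
proof -
  let ?k = "gauss_const TYPE('a)"
  define C where "C = exp 1 * ?k\<^sup>2 * t powr (-1/2) * norm y"
  have C0: "0 \<le> C" by (simp add: C_def)
  \<comment> \<open>Envelope: the two-point Gaussian bound for kernel increments, integrated against
    |phi|, becomes this function at x and at x - y.\<close>
  define w where "w = heat (4*t) (\<lambda>z. \<bar>\<phi> z\<bar>)"
  note [measurable] = sboundD(1)[OF \<phi>]
  have "sbound (4*t + \<tau>) w (?k * r)" unfolding w_def by (rule sbound_heat) (use t \<tau> \<phi> in \<open>auto intro: sbound_abs\<close>)
  then have w: "sbound \<tau> w (?k * r)" by (rule sbound_time) (use t \<tau> in auto)
  have i: "integrable lborel \<phi>" by (rule sbound_integrable[OF \<phi>])
  have dom: "\<bar>heat t \<phi> (x - y) - heat t \<phi> x\<bar> \<le> C * (w x + w (x - y))" for x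
  proof -
    have "heat t \<phi> (x - y) - heat t \<phi> x = (\<integral>z. (heatG t (x - z - y) - heatG t (x - z)) * \<phi> z \<partial>lborel)"
      unfolding heat_def left_diff_distrib
      using integrable_heatG_mult[OF t i, of "x - y"] integrable_heatG_mult[OF t i, of x] by (simp add: algebra_simps)
    also have "\<bar>\<dots>\<bar> \<le> (\<integral>z. \<bar>(heatG t (x - z - y) - heatG t (x - z)) * \<phi> z\<bar> \<partial>lborel)"
      by (rule integral_abs_bound)
    also have "\<dots> \<le> (\<integral>z. C * (heatG (4*t) (x - z) * \<bar>\<phi> z\<bar> + heatG (4*t) (x - y - z) * \<bar>\<phi> z\<bar>) \<partial>lborel)"
    proof (rule integral_mono)
      show "integrable lborel (\<lambda>z. \<bar>(heatG t (x - z - y) - heatG t (x - z)) * \<phi> z\<bar>)"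
        unfolding left_diff_distrib
        using integrable_heatG_mult[OF t i, of "x - y"] integrable_heatG_mult[OF t i, of x]
        by (intro integrable_abs Bochner_Integration.integrable_diff) (simp_all add: algebra_simps)
      show "integrable lborel (\<lambda>z. C * (heatG (4*t) (x - z) * \<bar>\<phi> z\<bar> + heatG (4*t) (x - y - z) * \<bar>\<phi> z\<bar>))"
        using t i by (intro integrable_mult_right Bochner_Integration.integrable_add integrable_heatG_mult) auto
      fix z
      have "\<bar>heatG t (x - z - y) - heatG t (x - z)\<bar> * \<bar>\<phi> z\<bar> \<le> C * (heatG (4*t) (x - z) + heatG (4*t) (x - z - y)) * \<bar>\<phi> z\<bar>"
        unfolding C_def by (intro mult_right_mono heatG_diff_le t) auto
      then show "\<bar>(heatG t (x - z - y) - heatG t (x - z)) * \<phi> z\<bar> \<le> C * (heatG (4*t) (x - z) * \<bar>\<phi> z\<bar> + heatG (4*t) (x - y - z) * \<bar>\<phi> z\<bar>)"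
        unfolding abs_mult cancel_ab_semigroup_add_class.diff_right_commute[of x y z] by (simp only: distrib_left distrib_right mult.assoc)
    qed
    also have "\<dots> = C * (w x + w (x - y))"
      unfolding w_def heat_def using t i by (simp add: integrable_heatG_mult)
    finally show ?thesis .
  qed
  have "sbound \<tau> (\<lambda>x. C * (w x + w (x - y))) (\<bar>C\<bar> * (?k * r + ?k * r))"
    by (intro sbound_cmult sbound_add sbound_translate w)
  then have "sbound \<tau> (\<lambda>x. heat t \<phi> (x - y) - heat t \<phi> x) (\<bar>C\<bar> * (?k * r + ?k * r))"
    by (rule sbound_dom) (use dom in auto)
  then show ?thesis using C0 by (simp add: C_def power2_eq_square power3_eq_cube algebra_simps)
qed

text \<open>What the decay of large solutions is based on. The initial datum is absent: it acts only
  through the uniform bound and the restart from positive times, which is what makes the estimates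
  uniform for t >= 1.\<close>

locale mild_solution =
  fixes a :: "'a::euclidean_space" and f :: "real \<Rightarrow> real" and U :: "real \<Rightarrow> 'a \<Rightarrow> real" and M L :: real
  assumes U_measurable [measurable]: "case_prod U \<in> borel_measurable (borel \<Otimes>\<^sub>M borel)"
    and f_continuous: "continuous_on UNIV f" and f_zero: "f 0 = 0"
    and M_pos: "0 < M" and U_sbound: "\<And>t. 0 < t \<Longrightarrow> sbound 1 (U t) M"
    and L_nonneg: "0 \<le> L" and f_lipschitz: "\<And>x y. \<bar>x\<bar> \<le> M \<Longrightarrow> \<bar>y\<bar> \<le> M \<Longrightarrow> \<bar>f x - f y\<bar> \<le> L * \<bar>x - y\<bar>"
    and restart: "\<And>T t x. 0 < T \<Longrightarrow> 0 < t \<Longrightarrow>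
      U (T + t) x = heat t (U T) x + (LINT s:{0..t}|lborel. gradheat a (t - s) (\<lambda>y. f (U (T + s) y)) x)"
begin

lemma f_measurable [measurable]: "f \<in> borel_measurable borel"
  using f_continuous by (rule borel_measurable_continuous_onI)

lemma U_le: "0 < t \<Longrightarrow> \<bar>U t x\<bar> \<le> M"
  using sboundD(4)[OF U_sbound, of t x] by simp

lemma U_integrable: "0 < t \<Longrightarrow> integrable lborel (U t)"
  by (rule sbound_integrable[OF U_sbound])

lemma fU_le: "0 < t \<Longrightarrow> \<bar>f (U t x)\<bar> \<le> L * \<bar>U t x\<bar>"
  using f_lipschitz[of "U t x" 0] U_le[of t x] M_pos f_zero by simp

lemma fU_sbound: assumes "0 < t" shows "sbound 1 (\<lambda>y. f (U t y)) (L * M)"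
proof -
  have "sbound 1 (\<lambda>y. L * \<bar>U t y\<bar>) (\<bar>L\<bar> * M)" by (intro sbound_cmult sbound_abs U_sbound assms)
  then have "sbound 1 (\<lambda>y. f (U t y)) (\<bar>L\<bar> * M)" by (rule sbound_dom) (use fU_le[OF assms] in auto)
  then show ?thesis using L_nonneg by simp
qed

lemma fU_integrable: "0 < t \<Longrightarrow> integrable lborel (\<lambda>y. f (U t y))"
  by (rule sbound_integrable[OF fU_sbound])

lemma duhamel_sbound:
  assumes T: "0 < T" and t: "0 < t" "t \<le> 1"
  shows "sbound 1 (\<lambda>x. LINT s:{0..t}|lborel. gradheat a (t - s) (\<lambda>y. f (U (T + s) y)) x) ((gauss_const TYPE('a))^3 * norm a * (6 * (L * M) * t powr (1/2)))"
    and "set_integrable lborel {0..t} (\<lambda>s. gradheat a (t - s) (\<lambda>y. f (U (T + s) y)) x)"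
proof -
  have m: "(\<lambda>(s, y). f (U (T + s) y)) \<in> borel_measurable (borel \<Otimes>\<^sub>M borel)" by measurable
  have LM: "0 \<le> L * M" using L_nonneg M_pos by simp
  note * = sbound_duhamel_unit[where h="\<lambda>s y. f (U (T + s) y)", OF m _ t _ _ nn_integral_const_singular[OF t(1) LM]]
  show "sbound 1 (\<lambda>x. LINT s:{0..t}|lborel. gradheat a (t - s) (\<lambda>y. f (U (T + s) y)) x) ((gauss_const TYPE('a))^3 * norm a * (6 * (L * M) * t powr (1/2)))"
    by (rule *(1)) (use T LM fU_sbound in auto)
  show "set_integrable lborel {0..t} (\<lambda>s. gradheat a (t - s) (\<lambda>y. f (U (T + s) y)) x)"
    by (rule *(2)) (use T LM fU_sbound in auto)
qed

text \<open>On a short time interval Duhamel's formula turns a bound K s^(-1/2) for the increments into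
  (A |y| + K/2) s^(-1/2); iterating leaves 2 A |y| s^(-1/2).\<close>

lemma translate_lipschitz:
  obtains K where "0 \<le> K" "\<And>t y. 1 \<le> t \<Longrightarrow> sbound 1 (\<lambda>x. U t (x - y) - U t x) (K * norm y)"
proof -
  let ?k = "gauss_const TYPE('a)"
  have k: "2 \<le> ?k" by (rule gauss_const_ge)
  define A where "A = 2 * exp 1 * ?k^3 * M"
  have A0: "0 \<le> A" using k M_pos by (simp add: A_def)
  define c where "c = ?k^3 * norm a * (12 * L)"
  have c0: "0 \<le> c" using k L_nonneg by (simp add: c_def)
  \<comment> \<open>Short enough for the Duhamel term to contract: c sqrt(\<open>\<eta>\<close>) <=
    1/2. The 12 in c is 6/(1 - 1/2), from the time integral of (t - s)^(-1/2) s^(-1/2).\<close>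
  define \<eta> where "\<eta> = min (1/2) (1 / (4 * (c + 1)\<^sup>2))"
  have \<eta>: "0 < \<eta>" "\<eta> \<le> 1/2" using c0 by (auto simp: \<eta>_def)
  have c\<eta>: "c * t powr (1/2) \<le> 1/2" if t: "0 < t" "t \<le> \<eta>" for t
  proof -
    have "t powr (1/2) = sqrt t" using t by (simp add: powr_half_sqrt)
    also have "\<dots> \<le> 1 / (2 * (c + 1))"
    proof (rule real_le_lsqrt)
      have "(1 / (2 * d))\<^sup>2 = 1 / (4 * d\<^sup>2)" for d :: real by (simp add: power_divide power_mult_distrib)
      then show "t \<le> (1 / (2 * (c + 1)))\<^sup>2" using t by (simp only: \<eta>_def min.bounded_iff)
    qed (use t c0 in auto)
    finally have "c * t powr (1/2) \<le> c * (1 / (2 * (c + 1)))" using c0 by (intro mult_left_mono) auto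
    also have "\<dots> \<le> 1/2" using c0 by (simp add: field_simps)
    finally show ?thesis .
  qed
  define e where "e = (\<lambda>T y s x. U (T + s) (x - y) - U (T + s) x)"
  have step: "\<forall>t. 0 < t \<and> t \<le> \<eta> \<longrightarrow> sbound 1 (e T y t) ((A * norm y + K / 2) * t powr (-1/2))"
    if T: "0 < T" and K: "0 \<le> K" and P: "\<forall>s. 0 < s \<and> s \<le> \<eta> \<longrightarrow> sbound 1 (e T y s) (K * s powr (-1/2))" for T y K
  proof (intro allI impI)
    fix t assume t: "0 < t \<and> t \<le> \<eta>"
    define h where "h = (\<lambda>s z. f (U (T + s) (z - y)) - f (U (T + s) z))"
    have hm: "case_prod h \<in> borel_measurable (borel \<Otimes>\<^sub>M borel)" unfolding h_def by measurable
    have hb: "sbound 1 (h s) (L * K * s powr (-(1/2)))" if s: "0 < s" "s < t" for s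
    proof -
      have "sbound 1 (\<lambda>z. L * \<bar>e T y s z\<bar>) (\<bar>L\<bar> * (K * s powr (-1/2)))"
        using P s t by (intro sbound_cmult sbound_abs) auto
      then have "sbound 1 (h s) (\<bar>L\<bar> * (K * s powr (-1/2)))"
      proof (rule sbound_dom)
        show "h s \<in> borel_measurable borel" unfolding h_def by measurable
        show "\<bar>h s z\<bar> \<le> L * \<bar>e T y s z\<bar>" for z
          unfolding h_def e_def using T s by (intro f_lipschitz U_le) auto
      qed
      then show ?thesis using L_nonneg by (simp add: mult_ac)
    qed
    have hI: "(\<integral>\<^sup>+s\<in>{0<..<t}. ennreal ((t - s) powr (-1/2) * (L * K * s powr (-(1/2)))) \<partial>lborel) \<le> ennreal (12 * L * K)"
      using nn_integral_beta_cmult[of "1/2" t "L * K"] t L_nonneg K by (simp add: mult_ac)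
    have w: "sbound 1 (\<lambda>x. LINT s:{0..t}|lborel. gradheat a (t - s) (h s) x) (?k^3 * norm a * (12 * L * K))"
      by (rule sbound_duhamel_unit(1)[OF hm _ _ _ hb _ hI]) (use t \<eta> L_nonneg K in auto)
    have e1: "e T y t = (\<lambda>x. (heat t (U T) (x - y) - heat t (U T) x) + (LINT s:{0..t}|lborel. gradheat a (t - s) (h s) x))"
    proof
      fix x
      have i1: "set_integrable lborel {0..t} (\<lambda>s. gradheat a (t - s) (\<lambda>z. f (U (T + s) (z))) z)" for z
        by (rule duhamel_sbound(2)) (use T t \<eta> in auto)
      have "(LINT s:{0..t}|lborel. gradheat a (t - s) (\<lambda>z. f (U (T + s) z)) (x - y)) - (LINT s:{0..t}|lborel. gradheat a (t - s) (\<lambda>z. f (U (T + s) z)) x)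
        = (LINT s:{0..t}|lborel. gradheat a (t - s) (\<lambda>z. f (U (T + s) z)) (x - y) - gradheat a (t - s) (\<lambda>z. f (U (T + s) z)) x)"
        by (rule set_integral_diff(2)[symmetric]) (use i1 in auto)
      also have "\<dots> = (LINT s:{0<..<t}|lborel. gradheat a (t - s) (\<lambda>z. f (U (T + s) z)) (x - y) - gradheat a (t - s) (\<lambda>z. f (U (T + s) z)) x)"
        by (rule set_integral_closed_open) (simp add: gradheat_def)
      also have "\<dots> = (LINT s:{0<..<t}|lborel. gradheat a (t - s) (h s) x)"
      proof (rule set_lebesgue_integral_cong)
        show "\<forall>s. s \<in> {0<..<t} \<longrightarrow> gradheat a (t - s) (\<lambda>z. f (U (T + s) z)) (x - y) - gradheat a (t - s) (\<lambda>z. f (U (T + s) z)) x = gradheat a (t - s) (h s) x"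
        proof (intro allI impI)
          fix s assume s: "s \<in> {0<..<t}"
          have i2: "integrable lborel (\<lambda>z. f (U (T + s) z))" by (rule fU_integrable) (use s T in auto)
          have "gradheat a (t - s) (\<lambda>z. f (U (T + s) z)) (x - y) = gradheat a (t - s) (\<lambda>z. f (U (T + s) (z - y))) x"
            by (rule gradheat_translate) measurable
          then show "gradheat a (t - s) (\<lambda>z. f (U (T + s) z)) (x - y) - gradheat a (t - s) (\<lambda>z. f (U (T + s) z)) x = gradheat a (t - s) (h s) x"
            unfolding h_def using gradheat_diff[OF _ integrable_translate[OF i2, of y] i2, of "t - s" a x] s by simp
        qed
      qed auto
      also have "\<dots> = (LINT s:{0..t}|lborel. gradheat a (t - s) (h s) x)"
        by (rule set_integral_closed_open[symmetric]) (simp add: gradheat_def h_def)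
      finally show "e T y t x = (heat t (U T) (x - y) - heat t (U T) x) + (LINT s:{0..t}|lborel. gradheat a (t - s) (h s) x)"
        using restart[of T t "x - y"] restart[of T t x] T t by (simp add: e_def)
    qed
    have "sbound 1 (e T y t) (2 * exp 1 * ?k^3 * t powr (-1/2) * norm y * M + ?k^3 * norm a * (12 * L * K))"
      unfolding e1 by (intro sbound_add w sbound_heat_translate_diff U_sbound) (use T t in auto)
    then show "sbound 1 (e T y t) ((A * norm y + K / 2) * t powr (-1/2))"
    proof (rule sbound_mono)
      have "c * K = c * t powr (1/2) * K * t powr (-1/2)" using t by (simp add: powr_minus)
      also have "\<dots> \<le> (1/2) * K * t powr (-1/2)" using c\<eta>[of t] t K by (intro mult_right_mono) auto
      finally show "2 * exp 1 * ?k^3 * t powr (-1/2) * norm y * M + ?k^3 * norm a * (12 * L * K) \<le> (A * norm y + K / 2) * t powr (-1/2)"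
        by (simp add: A_def c_def algebra_simps)
    qed
  qed
  have main: "sbound 1 (e T y \<eta>) (2 * A * norm y * \<eta> powr (-1/2))" if T: "0 < T" for T y
  proof -
    \<comment> \<open>The start is the trivial bound 2M for an increment, which knows nothing of y.
      The map K -> A |y| + K/2 has the fixed point 2 A |y| and halves the distance to it, hence this
      explicit sequence.\<close>
    define R where "R = (\<lambda>m. 2 * A * norm y + 2 * M * (1/2) ^ m)"
    have R0: "0 \<le> R m" for m using A0 M_pos by (simp add: R_def)
    have all: "\<forall>s. 0 < s \<and> s \<le> \<eta> \<longrightarrow> sbound 1 (e T y s) (R m * s powr (-1/2))" for m
    proof (induction m)
      case 0
      show ?case
      proof (intro allI impI)
        fix s assume s: "0 < s \<and> s \<le> \<eta>"
        have "sbound 1 (e T y s) (M + M)"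
          unfolding e_def by (intro sbound_diff sbound_translate U_sbound) (use T s in auto)
        then show "sbound 1 (e T y s) (R 0 * s powr (-1/2))"
        proof (rule sbound_mono)
          have "1 powr (-1/2) \<le> s powr (-1/2)" using s \<eta> by (intro powr_mono2') auto
          then have "(M + M) * 1 \<le> R 0 * s powr (-1/2)" using M_pos A0 by (intro mult_mono) (auto simp: R_def)
          then show "M + M \<le> R 0 * s powr (-1/2)" by simp
        qed
      qed
    next
      case (Suc m)
      have "A * norm y + R m / 2 = R (Suc m)" by (simp add: R_def field_simps)
      then show ?case using step[OF T R0 Suc.IH] by simp
    qed
    have "(\<lambda>m. 2 * A * norm y + 2 * M * (1/2) ^ m) \<longlonglongrightarrow> 2 * A * norm y + 2 * M * 0"
      by (rule tendsto_add[OF tendsto_const tendsto_mult_left[OF LIMSEQ_power_zero]]) simp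
    then have "R \<longlonglongrightarrow> 2 * A * norm y" by (simp add: R_def)
    from tendsto_mult_right[OF this]
    have lim: "(\<lambda>m. R m * \<eta> powr (-1/2)) \<longlonglongrightarrow> 2 * A * norm y * \<eta> powr (-1/2)" .
    have "sbound 1 (e T y \<eta>) (R m * \<eta> powr (-1/2))" for m using all[of m] \<eta> by blast
    then show ?thesis using lim by (rule sbound_lim)
  qed
  show thesis
  proof
    show "0 \<le> 2 * A * \<eta> powr (-1/2)" using A0 by simp
    \<comment> \<open>Restarting at t - \<open>\<eta>\<close> > 0 makes the constant independent of
      t.\<close>
    show "sbound 1 (\<lambda>x. U t (x - y) - U t x) (2 * A * \<eta> powr (-1/2) * norm y)" if "1 \<le> t" for t y
      using main[of "t - \<eta>" y] that \<eta> by (simp add: e_def mult_ac)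
  qed
qed

end


section \<open>Energy dissipation\<close>

lemma gradheat_commute:
  fixes \<phi> :: "'a::euclidean_space \<Rightarrow> real"
  assumes [measurable]: "\<phi> \<in> borel_measurable borel"
  shows "gradheat a r \<phi> x = (\<integral>z. dheatG a r z * \<phi> (x - z) \<partial>lborel)"
  unfolding gradheat_def using integral_reflect[of "\<lambda>z. dheatG a r z * \<phi> (x - z)" x] by simp

lemma heat_commute:
  fixes \<phi> :: "'a::euclidean_space \<Rightarrow> real"
  assumes [measurable]: "\<phi> \<in> borel_measurable borel"
  shows "heat r \<phi> x = (\<integral>z. heatG r z * \<phi> (x - z) \<partial>lborel)"
  unfolding heat_def using integral_reflect[of "\<lambda>z. heatG r z * \<phi> (x - z)" x] by simp

text \<open>The kernel has integral 0, so the value at x may be subtracted. This is how regularity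
  of the source removes the time singularity of the kernel.\<close>

lemma gradheat_eq_increment:
  fixes \<phi> :: "'a::euclidean_space \<Rightarrow> real"
  assumes r: "0 < r" and [measurable]: "\<phi> \<in> borel_measurable borel" and B: "\<And>y. \<bar>\<phi> y\<bar> \<le> B"
  shows "gradheat a r \<phi> x = (\<integral>z. dheatG a r z * (\<phi> (x - z) - \<phi> x) \<partial>lborel)"
    and "integrable lborel (\<lambda>z. dheatG a r z * (\<phi> (x - z) - \<phi> x))"
proof -
  have i: "integrable lborel (\<lambda>z. dheatG a r z * \<phi> (x - z))"
    using integrable_bounded_mult[of "\<lambda>z. \<phi> (x - z)" B "dheatG a r"] integrable_dheatG[OF r, of a] B by (simp add: mult.commute)
  have j: "integrable lborel (\<lambda>z. dheatG a r z * \<phi> x)" using integrable_dheatG[OF r, of a] by simp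
  show "integrable lborel (\<lambda>z. dheatG a r z * (\<phi> (x - z) - \<phi> x))"
    unfolding right_diff_distrib by (intro Bochner_Integration.integrable_diff i j)
  show "gradheat a r \<phi> x = (\<integral>z. dheatG a r z * (\<phi> (x - z) - \<phi> x) \<partial>lborel)"
    unfolding right_diff_distrib by (simp add: gradheat_commute Bochner_Integration.integral_diff[OF i j] integral_dheatG)
qed

text \<open>An increment of size K |z| meets the first moment of the kernel, which is bounded
  uniformly in r, in place of its L1 norm of order r^(-1/2).\<close>

lemma abs_gradheat_le_lipschitz:
  fixes \<phi> :: "'a::euclidean_space \<Rightarrow> real"
  assumes r: "0 < r" and \<phi>: "\<phi> \<in> borel_measurable borel" and B: "\<And>y. \<bar>\<phi> y\<bar> \<le> B"
    and K: "0 \<le> K" "\<And>z. \<bar>\<phi> (x - z) - \<phi> x\<bar> \<le> K * norm z"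
  shows "\<bar>gradheat a r \<phi> x\<bar> \<le> 2 * (gauss_const TYPE('a))\<^sup>2 * norm a * K"
proof -
  let ?c = "2 * (gauss_const TYPE('a))\<^sup>2 * norm a"
  have "\<bar>gradheat a r \<phi> x\<bar> \<le> (\<integral>z. \<bar>dheatG a r z * (\<phi> (x - z) - \<phi> x)\<bar> \<partial>lborel)"
    unfolding gradheat_eq_increment(1)[OF r \<phi> B] by (rule integral_abs_bound)
  also have "\<dots> \<le> (\<integral>z. (?c * K) * heatG (4*r) (z::'a) \<partial>lborel)"
  proof (rule integral_mono)
    show "integrable lborel (\<lambda>z. \<bar>dheatG a r z * (\<phi> (x - z) - \<phi> x)\<bar>)"
      by (intro integrable_abs gradheat_eq_increment(2)[OF r \<phi> B])
    show "integrable lborel (\<lambda>z::'a. (?c * K) * heatG (4*r) z)"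
      using integrable_heatG[of "4*r", where 'a='a] r by simp
    fix z
    have "\<bar>dheatG a r z * (\<phi> (x - z) - \<phi> x)\<bar> \<le> \<bar>dheatG a r z\<bar> * (K * norm z)"
      unfolding abs_mult by (intro mult_left_mono K) auto
    also have "\<dots> = K * (norm z * \<bar>dheatG a r z\<bar>)" by simp
    also have "\<dots> \<le> K * (?c * heatG (4*r) z)" by (intro mult_left_mono norm_dheatG_le r K)
    finally show "\<bar>dheatG a r z * (\<phi> (x - z) - \<phi> x)\<bar> \<le> (?c * K) * heatG (4*r) z" by (simp add: mult_ac)
  qed
  also have "\<dots> = ?c * K" using integral_heatG[of "4*r", where 'a='a] r by simp
  finally show ?thesis .
qed

text \<open>The heat flow averages translates with weight G_s, whose first moment is of order sqrt
  s.\<close>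

lemma sbound_heat_minus_id:
  fixes \<phi> :: "'a::euclidean_space \<Rightarrow> real"
  assumes s: "0 < s" and \<phi>[measurable]: "\<phi> \<in> borel_measurable borel" and B: "\<And>y. \<bar>\<phi> y\<bar> \<le> B"
    and K: "0 \<le> K" "\<And>z. sbound 1 (\<lambda>x. \<phi> (x - z) - \<phi> x) (K * norm z)"
  shows "sbound 1 (\<lambda>x. heat s \<phi> x - \<phi> x) (K * gauss_const TYPE('a) * sqrt s)"
proof (rule sboundI)
  show "(\<lambda>x. heat s \<phi> x - \<phi> x) \<in> borel_measurable borel" by measurable
  show K0: "0 \<le> K * gauss_const TYPE('a) * sqrt s" using K(1) s gauss_const_ge[where 'a='a] by simp
  have le: "ennreal \<bar>heat s \<phi> x - \<phi> x\<bar> \<le> (\<integral>\<^sup>+z. ennreal (heatG s z) * ennreal \<bar>\<phi> (x - z) - \<phi> x\<bar> \<partial>lborel)" for x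
  proof -
    have i: "integrable lborel (\<lambda>z. heatG s z * \<phi> (x - z))"
      using integrable_bounded_mult[of "\<lambda>z. \<phi> (x - z)" B "heatG s"] integrable_heatG[OF s, where 'a='a] B by (simp add: mult.commute)
    have j: "integrable lborel (\<lambda>z::'a. heatG s z * \<phi> x)" using integrable_heatG[OF s, where 'a='a] by simp
    have "heat s \<phi> x - \<phi> x = (\<integral>z. heatG s z * (\<phi> (x - z) - \<phi> x) \<partial>lborel)"
      unfolding right_diff_distrib by (simp add: heat_commute Bochner_Integration.integral_diff[OF i j] integral_heatG[OF s])
    then have "ennreal \<bar>heat s \<phi> x - \<phi> x\<bar> \<le> (\<integral>\<^sup>+z. ennreal \<bar>heatG s z * (\<phi> (x - z) - \<phi> x)\<bar> \<partial>lborel)"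
      by (simp add: ennreal_abs_integral_le)
    then show ?thesis by (simp add: abs_mult ennreal_mult)
  qed
  have mom: "(\<integral>\<^sup>+z. ennreal (heatG s z) * g z \<partial>lborel) \<le> ennreal (K * gauss_const TYPE('a) * sqrt s)"
    if "\<And>z. g z \<le> ennreal (K * norm z)" for g :: "'a \<Rightarrow> ennreal"
  proof -
    have "(\<integral>\<^sup>+z. ennreal (heatG s z) * g z \<partial>lborel) \<le> (\<integral>\<^sup>+z. ennreal K * ennreal (norm z * \<bar>heatG s (z::'a)\<bar>) \<partial>lborel)"
    proof (intro nn_integral_mono)
      fix z :: 'a
      have "ennreal (heatG s z) * g z \<le> ennreal (heatG s z) * ennreal (K * norm z)"
        by (intro mult_left_mono that) auto
      then show "ennreal (heatG s z) * g z \<le> ennreal K * ennreal (norm z * \<bar>heatG s z\<bar>)"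
        using K(1) by (simp add: ennreal_mult[symmetric] mult_ac)
    qed
    also have "\<dots> = ennreal K * moment (heatG s :: 'a \<Rightarrow> real)"
      unfolding moment_def by (intro nn_integral_cmult) measurable
    also have "\<dots> \<le> ennreal K * ennreal (gauss_const TYPE('a) * sqrt s)" by (intro mult_left_mono moment_heatG s) auto
    also have "\<dots> = ennreal (K * gauss_const TYPE('a) * sqrt s)" using K(1) gauss_const_ge[where 'a='a] s by (simp add: ennreal_mult[symmetric] mult_ac)
    finally show ?thesis .
  qed
  have "(\<integral>\<^sup>+x. ennreal \<bar>heat s \<phi> x - \<phi> x\<bar> \<partial>lborel) \<le> (\<integral>\<^sup>+x. \<integral>\<^sup>+z. ennreal (heatG s z) * ennreal \<bar>\<phi> (x - z) - \<phi> x\<bar> \<partial>lborel \<partial>lborel)"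
    by (intro nn_integral_mono le)
  also have "\<dots> = (\<integral>\<^sup>+z. \<integral>\<^sup>+x. ennreal (heatG s z) * ennreal \<bar>\<phi> (x - z) - \<phi> x\<bar> \<partial>lborel \<partial>lborel)"
    by (rule lborel_pair.Fubini') measurable
  also have "\<dots> = (\<integral>\<^sup>+z. ennreal (heatG s z) * (\<integral>\<^sup>+x. ennreal \<bar>\<phi> (x - z) - \<phi> x\<bar> \<partial>lborel) \<partial>lborel)"
    by (intro nn_integral_cong nn_integral_cmult) measurable
  also have "\<dots> \<le> ennreal (K * gauss_const TYPE('a) * sqrt s)" by (intro mom sboundD(3)[OF K(2)])
  finally show "(\<integral>\<^sup>+x. ennreal \<bar>heat s \<phi> x - \<phi> x\<bar> \<partial>lborel) \<le> ennreal (K * gauss_const TYPE('a) * sqrt s)" .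
  fix x
  have "(\<integral>\<^sup>+z. ennreal (heatG s z) * ennreal \<bar>\<phi> (x - z) - \<phi> x\<bar> \<partial>lborel) \<le> ennreal (K * gauss_const TYPE('a) * sqrt s)"
    using sboundD(4)[OF K(2), of x] by (intro mom ennreal_leI) simp
  then have "ennreal \<bar>heat s \<phi> x - \<phi> x\<bar> \<le> ennreal (K * gauss_const TYPE('a) * sqrt s)" by (rule order_trans[OF le])
  then show "\<bar>heat s \<phi> x - \<phi> x\<bar> \<le> K * gauss_const TYPE('a) * sqrt s * 1 powr (- real DIM('a) / 2)" using K0 by (simp add: ennreal_le_iff)
qed

text \<open>Expanding the nonnegative squared L2 norm of phi - heat r phi. Iterated, this bounds the dissipation
  over short times from below and so takes the place of Nash's inequality.\<close>

lemma heat_dissipation_doubling: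
  fixes \<phi> :: "'a::euclidean_space \<Rightarrow> real"
  assumes \<phi>: "sbound 1 \<phi> M" and r: "0 < r"
  shows "(\<integral>x. (\<phi> x)\<^sup>2 \<partial>lborel) - (\<integral>x. \<phi> x * heat (2*r) \<phi> x \<partial>lborel) \<le> 2 * ((\<integral>x. (\<phi> x)\<^sup>2 \<partial>lborel) - (\<integral>x. \<phi> x * heat r \<phi> x \<partial>lborel))"
    and "(\<integral>x. (heat r \<phi> x)\<^sup>2 \<partial>lborel) = (\<integral>x. \<phi> x * heat (2*r) \<phi> x \<partial>lborel)"
proof -
  note m[measurable] = sboundD(1)[OF \<phi>]
  have B: "\<bar>\<phi> x\<bar> \<le> M" for x using sboundD(4)[OF \<phi>, of x] by simp
  have i: "integrable lborel \<phi>" by (rule sbound_integrable[OF \<phi>])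
  have h: "sbound (r + 1) (heat r \<phi>) (gauss_const TYPE('a) * M)" by (rule sbound_heat[OF r _ \<phi>]) simp
  have hi: "integrable lborel (heat r \<phi>)" by (rule sbound_integrable[OF h])
  have i1: "integrable lborel (\<lambda>x. \<phi> x * \<phi> x)" by (rule integrable_bounded_mult[OF m B i])
  have i2: "integrable lborel (\<lambda>x. \<phi> x * heat r \<phi> x)" by (rule integrable_bounded_mult[OF m B hi])
  have i3: "integrable lborel (\<lambda>x. heat r \<phi> x * heat r \<phi> x)"
    by (rule integrable_bounded_mult[OF _ _ hi]) (use sboundD(1,4)[OF h] in auto)
  show e: "(\<integral>x. (heat r \<phi> x)\<^sup>2 \<partial>lborel) = (\<integral>x. \<phi> x * heat (2*r) \<phi> x \<partial>lborel)"
  proof -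
    have "(\<integral>x. (heat r \<phi> x)\<^sup>2 \<partial>lborel) = (\<integral>x. heat r \<phi> x * heat r \<phi> x \<partial>lborel)" by (simp add: power2_eq_square)
    also have "\<dots> = (\<integral>x. \<phi> x * heat r (heat r \<phi>) x \<partial>lborel)" by (rule heat_adjoint[OF r i hi])
    also have "\<dots> = (\<integral>x. \<phi> x * heat (2*r) \<phi> x \<partial>lborel)" using heat_heat[OF r r i] by simp
    finally show ?thesis .
  qed
  have "0 \<le> (\<integral>x. (\<phi> x - heat r \<phi> x)\<^sup>2 \<partial>lborel)" by simp
  also have "\<dots> = (\<integral>x. \<phi> x * \<phi> x - 2 * (\<phi> x * heat r \<phi> x) + heat r \<phi> x * heat r \<phi> x \<partial>lborel)"
    by (simp add: power2_eq_square algebra_simps)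
  also have "\<dots> = (\<integral>x. \<phi> x * \<phi> x \<partial>lborel) - 2 * (\<integral>x. \<phi> x * heat r \<phi> x \<partial>lborel) + (\<integral>x. heat r \<phi> x * heat r \<phi> x \<partial>lborel)"
    using i1 i2 i3 by simp
  finally show "(\<integral>x. (\<phi> x)\<^sup>2 \<partial>lborel) - (\<integral>x. \<phi> x * heat (2*r) \<phi> x \<partial>lborel) \<le> 2 * ((\<integral>x. (\<phi> x)\<^sup>2 \<partial>lborel) - (\<integral>x. \<phi> x * heat r \<phi> x \<partial>lborel))"
    using e by (simp add: power2_eq_square)
qed

lemma heat_dissipation:
  fixes \<phi> :: "'a::euclidean_space \<Rightarrow> real"
  assumes \<phi>: "sbound 1 \<phi> M" and h: "0 < h"
  shows "(\<integral>x. (\<phi> x)\<^sup>2 \<partial>lborel) - (\<integral>x. \<phi> x * heat (2 ^ m * h) \<phi> x \<partial>lborel) \<le> 2 ^ m * ((\<integral>x. (\<phi> x)\<^sup>2 \<partial>lborel) - (\<integral>x. \<phi> x * heat h \<phi> x \<partial>lborel))"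
proof (induction m)
  case (Suc m)
  have "(\<integral>x. (\<phi> x)\<^sup>2 \<partial>lborel) - (\<integral>x. \<phi> x * heat (2 ^ Suc m * h) \<phi> x \<partial>lborel)
     \<le> 2 * ((\<integral>x. (\<phi> x)\<^sup>2 \<partial>lborel) - (\<integral>x. \<phi> x * heat (2 ^ m * h) \<phi> x \<partial>lborel))"
    using heat_dissipation_doubling(1)[OF \<phi>, of "2 ^ m * h"] h by (simp add: mult.assoc)
  with Suc show ?case by simp
qed simp

context mild_solution
begin

text \<open>The integral of F(u(x - z)) - F(u(x)) vanishes by translation invariance, so the
  expansion of F to first order leaves only its quadratic remainder. In the squared increment one
  factor is taken in the sup norm and one in L1, each at most K |z|.\<close>

lemma flux_increment_le:
  assumes t: "0 < t" and K: "0 \<le> K" "sbound 1 (\<lambda>x. U t (x - z) - U t x) (K * norm z)"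
  shows "\<bar>\<integral>x. f (U t x) * (U t (x - z) - U t x) \<partial>lborel\<bar> \<le> L * K\<^sup>2 * (norm z)\<^sup>2"
proof -
  \<comment> \<open>An antiderivative of f on [-M, M], the range of \<open>U t\<close>.\<close>
  have "\<exists>F. \<forall>x\<in>{-M..M}. (F has_vector_derivative f x) (at x within {-M..M})"
    using antiderivative_continuous[of "-M" M f] continuous_on_subset[OF f_continuous] by (metis subset_UNIV)
  then obtain F where F: "\<And>x. x \<in> {-M..M} \<Longrightarrow> (F has_vector_derivative f x) (at x within {-M..M})" by blast
  have mvt: "\<bar>F w - F v - f v * (w - v)\<bar> \<le> L * (w - v)\<^sup>2" if v: "\<bar>v\<bar> \<le> M" and w: "\<bar>w\<bar> \<le> M" for v w
  proof -
    have seg: "\<bar>v + s *\<^sub>R (w - v)\<bar> \<le> M" if s: "s \<in> {0..1}" for s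
    proof -
      have "\<bar>v + s *\<^sub>R (w - v)\<bar> = \<bar>(1 - s) * v + s * w\<bar>" by (simp add: algebra_simps)
      also have "\<dots> \<le> (1 - s) * \<bar>v\<bar> + s * \<bar>w\<bar>" using s by (intro order_trans[OF abs_triangle_ineq]) (simp add: abs_mult)
      also have "\<dots> \<le> (1 - s) * M + s * M" using s v w by (intro add_mono mult_left_mono) auto
      finally show ?thesis by (simp add: algebra_simps)
    qed
    have "norm (F w - F v - (w - v) * f v) \<le> norm (w - v) * (L * \<bar>w - v\<bar>)"
    proof (rule differentiable_bound_linearization[where f=F and f'="\<lambda>x h. h * f x" and S="closed_segment v w"])
      have par: "\<exists>s\<in>{0..1}. x = v + s *\<^sub>R (w - v)" if "x \<in> closed_segment v w" for x
        using that by (auto simp: closed_segment_def algebra_simps)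
      have sub: "closed_segment v w \<subseteq> {-M..M}" using par seg by (fastforce simp: abs_le_iff)
      show "v + s *\<^sub>R (w - v) \<in> closed_segment v w" if "s \<in> {0..1}" for s
        using that by (auto simp: closed_segment_def algebra_simps intro!: exI[of _ s])
      show "(F has_derivative (\<lambda>h. h * f x)) (at x within closed_segment v w)" if "x \<in> closed_segment v w" for x
      proof -
        have "x \<in> {-M..M}" using that sub by blast
        then show ?thesis using has_derivative_subset[OF F[unfolded has_vector_derivative_def] sub] by simp
      qed
      show "onorm ((\<lambda>h. h * f x) - (\<lambda>h. h * f v)) \<le> L * \<bar>w - v\<bar>" if x: "x \<in> closed_segment v w" for x
      proof (rule onorm_le)
        fix h
        obtain s where s: "s \<in> {0..1}" "x = v + s *\<^sub>R (w - v)" using par[OF x] by blast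
        have "\<bar>f x - f v\<bar> \<le> L * \<bar>x - v\<bar>" using seg[OF s(1)] s(2) by (intro f_lipschitz v) auto
        also have "\<dots> \<le> L * \<bar>w - v\<bar>"
          using s L_nonneg by (intro mult_left_mono) (auto simp: abs_mult mult_left_le_one_le)
        finally have "\<bar>h\<bar> * \<bar>f x - f v\<bar> \<le> \<bar>h\<bar> * (L * \<bar>w - v\<bar>)" by (intro mult_left_mono) auto
        then show "norm (((\<lambda>h. h * f x) - (\<lambda>h. h * f v)) h) \<le> (L * \<bar>w - v\<bar>) * norm h"
          by (simp add: abs_mult[symmetric] right_diff_distrib mult.commute)
      qed
    qed simp
    moreover have "\<bar>w - v\<bar> * (L * \<bar>w - v\<bar>) = L * (w - v)\<^sup>2" by (simp add: power2_eq_square)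
    ultimately show ?thesis by (simp add: mult.commute)
  qed
  \<comment> \<open>Normalised to vanish at 0, and quadratic there because f(0) = 0; this makes
    \<open>F0 (U t x)\<close> integrable over the whole space.\<close>
  define F0 where "F0 = (\<lambda>v. F v - F 0)"
  have F0_le: "\<bar>F0 v\<bar> \<le> L * M * \<bar>v\<bar>" if "\<bar>v\<bar> \<le> M" for v
  proof -
    have "\<bar>F0 v\<bar> \<le> L * v\<^sup>2" using mvt[of 0 v] that M_pos f_zero by (simp add: F0_def)
    also have "\<dots> = L * \<bar>v\<bar> * \<bar>v\<bar>" by (simp add: power2_eq_square)
    also have "\<dots> \<le> L * M * \<bar>v\<bar>" using that L_nonneg by (intro mult_right_mono mult_left_mono) auto
    finally show ?thesis .
  qed
  have Fc: "continuous_on {-M..M} F"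
    unfolding continuous_on_eq_continuous_within using has_vector_derivative_continuous[OF F] by blast
  \<comment> \<open>F is controlled only on [-M, M]; with the truncated argument it becomes
    continuous on the whole line, which settles measurability.\<close>
  define Fc' where "Fc' = (\<lambda>x. F0 (truncate_at M x))"
  have [measurable]: "Fc' \<in> borel_measurable borel"
  proof (rule borel_measurable_continuous_onI)
    show "continuous_on UNIV Fc'" unfolding Fc'_def F0_def truncate_at_def using M_pos
      by (intro continuous_intros continuous_on_compose2[OF Fc]) auto
  qed
  have U[measurable]: "U t \<in> borel_measurable borel" by measurable
  have fi: "integrable lborel (\<lambda>x. F0 (U t x))"
  proof (rule Bochner_Integration.integrable_bound[where f="\<lambda>x. L * M * U t x"])
    show "AE x in lborel. norm (F0 (U t x)) \<le> norm (L * M * U t x)"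
      using F0_le[OF U_le[OF t]] L_nonneg M_pos by (intro AE_I2) (simp add: abs_mult)
    have "(\<lambda>x. F0 (U t x)) = (\<lambda>x. Fc' (U t x))" using U_le[OF t] by (simp add: Fc'_def truncate_at_simps)
    then show "(\<lambda>x. F0 (U t x)) \<in> borel_measurable lborel" by simp
  qed (use U_integrable[OF t] in auto)
  note fi' = integrable_translate[OF fi, of z]
  have zero: "(\<integral>x. F0 (U t (x - z)) - F0 (U t x) \<partial>lborel) = 0"
    using integral_translate[of "\<lambda>x. F0 (U t x)" z] borel_measurable_integrable[OF fi] fi fi' by simp
  define D where "D = (\<lambda>x. U t (x - z) - U t x)"
  have Dm[measurable]: "D \<in> borel_measurable borel" unfolding D_def by measurable
  have Di: "integrable lborel D" unfolding D_def by (rule sbound_integrable[OF K(2)])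
  have Db: "\<bar>D x\<bar> \<le> K * norm z" for x using sboundD(4)[OF K(2), of x] by (simp add: D_def)
  have i1: "integrable lborel (\<lambda>x. f (U t x) * D x)"
    by (rule integrable_bounded_mult[OF _ _ Di]) (use sboundD(1,4)[OF fU_sbound[OF t]] in auto)
  have "\<bar>\<integral>x. f (U t x) * D x \<partial>lborel\<bar> = \<bar>\<integral>x. (F0 (U t (x - z)) - F0 (U t x)) - f (U t x) * D x \<partial>lborel\<bar>"
    using Bochner_Integration.integral_diff[OF Bochner_Integration.integrable_diff[OF fi' fi] i1] zero by simp
  also have "\<dots> \<le> (\<integral>x. \<bar>(F0 (U t (x - z)) - F0 (U t x)) - f (U t x) * D x\<bar> \<partial>lborel)"
    by (rule integral_abs_bound)
  also have "\<dots> \<le> (\<integral>x. (L * (K * norm z)) * \<bar>D x\<bar> \<partial>lborel)"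
  proof (rule integral_mono)
    show "integrable lborel (\<lambda>x. \<bar>(F0 (U t (x - z)) - F0 (U t x)) - f (U t x) * D x\<bar>)"
      by (intro integrable_abs Bochner_Integration.integrable_diff fi fi' i1)
    show "integrable lborel (\<lambda>x. (L * (K * norm z)) * \<bar>D x\<bar>)" using Di by simp
    fix x
    have "\<bar>(F0 (U t (x - z)) - F0 (U t x)) - f (U t x) * D x\<bar> \<le> L * (D x)\<^sup>2"
      using mvt[OF U_le[OF t] U_le[OF t], of "x - z" x] by (simp add: F0_def D_def)
    also have "\<dots> = L * \<bar>D x\<bar> * \<bar>D x\<bar>" by (simp add: power2_eq_square)
    also have "\<dots> \<le> L * (K * norm z) * \<bar>D x\<bar>" using Db[of x] L_nonneg by (intro mult_right_mono mult_left_mono) auto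
    finally show "\<bar>(F0 (U t (x - z)) - F0 (U t x)) - f (U t x) * D x\<bar> \<le> (L * (K * norm z)) * \<bar>D x\<bar>" .
  qed
  also have "\<dots> \<le> (L * (K * norm z)) * (K * norm z)"
    using sbound_integral[OF K(2)] L_nonneg K(1) by (simp add: D_def mult_left_mono)
  finally show ?thesis unfolding D_def by (simp add: power2_eq_square mult_ac)
qed

text \<open>The quadratic bound in |z| meets the second moment of the kernel, of order sqrt r. A
  linear bound would give only a constant, and a time step h would then contribute order h instead
  of h^(3/2).\<close>

lemma flux_gradheat_le:
  assumes t: "0 < t" and r: "0 < r" and K: "0 \<le> K" "\<And>z. sbound 1 (\<lambda>x. U t (x - z) - U t x) (K * norm z)"
  shows "\<bar>\<integral>x. f (U t x) * gradheat a r (U t) x \<partial>lborel\<bar> \<le> 4 * (gauss_const TYPE('a))^3 * norm a * L * K\<^sup>2 * sqrt r"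
proof -
  let ?c = "4 * (gauss_const TYPE('a))^3 * norm a * L * K\<^sup>2 * sqrt r"
  have c0: "0 \<le> ?c" using gauss_const_ge[where 'a='a] L_nonneg r by simp
  have U[measurable]: "U t \<in> borel_measurable borel" by measurable
  have int: "integrable (lborel \<Otimes>\<^sub>M lborel) (\<lambda>(x, z). f (U t x) * (U t (x - z) - U t x) * dheatG a r z)"
  proof (rule integrable_kernel_product[where B="2 * M"])
    show "\<bar>U t (x - z) - U t x\<bar> \<le> 2 * M" for x z using U_le[OF t, of "x - z"] U_le[OF t, of x] by linarith
  qed (use fU_integrable[OF t] integrable_dheatG[OF r] in auto)
  have "(\<integral>x. f (U t x) * gradheat a r (U t) x \<partial>lborel) = (\<integral>x. (\<integral>z. f (U t x) * (U t (x - z) - U t x) * dheatG a r z \<partial>lborel) \<partial>lborel)"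
  proof -
    have "f (U t x) * gradheat a r (U t) x = (\<integral>z. f (U t x) * (U t (x - z) - U t x) * dheatG a r z \<partial>lborel)" for x
      unfolding gradheat_eq_increment(1)[OF r U U_le[OF t]] integral_mult_right_zero[symmetric] by (simp add: mult_ac)
    then show ?thesis by simp
  qed
  also have "\<dots> = (\<integral>z. (\<integral>x. f (U t x) * (U t (x - z) - U t x) * dheatG a r z \<partial>lborel) \<partial>lborel)"
    using lborel_pair.Fubini_integral[OF int] by simp
  finally have eq: "(\<integral>x. f (U t x) * gradheat a r (U t) x \<partial>lborel) = (\<integral>z. (\<integral>x. f (U t x) * (U t (x - z) - U t x) \<partial>lborel) * dheatG a r z \<partial>lborel)" by simp
  have "ennreal \<bar>\<integral>x. f (U t x) * gradheat a r (U t) x \<partial>lborel\<bar> \<le> (\<integral>\<^sup>+z. ennreal \<bar>(\<integral>x. f (U t x) * (U t (x - z) - U t x) \<partial>lborel) * dheatG a r z\<bar> \<partial>lborel)"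
    unfolding eq by (rule ennreal_abs_integral_le)
  also have "\<dots> \<le> (\<integral>\<^sup>+z. ennreal ?c * ennreal (heatG (8*r) (z::'a)) \<partial>lborel)"
  proof (intro nn_integral_mono)
    fix z :: 'a
    have "\<bar>(\<integral>x. f (U t x) * (U t (x - z) - U t x) \<partial>lborel) * dheatG a r z\<bar> \<le> L * K\<^sup>2 * (norm z)\<^sup>2 * \<bar>dheatG a r z\<bar>"
      unfolding abs_mult by (intro mult_right_mono flux_increment_le t K) auto
    also have "\<dots> = L * K\<^sup>2 * ((norm z)\<^sup>2 * \<bar>dheatG a r z\<bar>)" by simp
    also have "\<dots> \<le> L * K\<^sup>2 * (4 * (gauss_const TYPE('a))^3 * norm a * sqrt r * heatG (8*r) z)"
      using L_nonneg by (intro mult_left_mono norm2_dheatG_le r) auto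
    also have "\<dots> = ?c * heatG (8*r) z" by simp
    finally show "ennreal \<bar>(\<integral>x. f (U t x) * (U t (x - z) - U t x) \<partial>lborel) * dheatG a r z\<bar> \<le> ennreal ?c * ennreal (heatG (8*r) z)"
      using c0 by (simp only: ennreal_mult[symmetric] heatG_nonneg ennreal_leI)
  qed
  also have "\<dots> = ennreal ?c * (\<integral>\<^sup>+z. ennreal (heatG (8*r) (z::'a)) \<partial>lborel)" by (intro nn_integral_cmult) measurable
  also have "\<dots> = ennreal ?c" using nn_integral_heatG[of "8*r", where 'a='a] r by simp
  finally show ?thesis using c0 by (simp only: ennreal_le_iff)
qed

end


context mild_solution
begin

text \<open>Both parts of the restarted formula are of order sqrt s: the heat flow by the Lipschitz
  bound under translations, the Duhamel term by integrating the kernel singularity.\<close>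

lemma time_continuity:
  obtains C where "0 \<le> C" "\<And>t s. 1 \<le> t \<Longrightarrow> 0 < s \<Longrightarrow> s \<le> 1 \<Longrightarrow> sbound 1 (\<lambda>x. U (t + s) x - U t x) (C * sqrt s)"
proof -
  obtain K where K: "0 \<le> K" "\<And>t y. 1 \<le> t \<Longrightarrow> sbound 1 (\<lambda>x. U t (x - y) - U t x) (K * norm y)"
    using translate_lipschitz by blast
  define C2 where "C2 = (gauss_const TYPE('a))^3 * norm a * (6 * (L * M))"
  have C20: "0 \<le> C2" using gauss_const_ge[where 'a='a] L_nonneg M_pos by (simp add: C2_def)
  show thesis
  proof
    show "0 \<le> K * gauss_const TYPE('a) + C2" using K(1) C20 gauss_const_ge[where 'a='a] by simp
    fix t s :: real assume t: "1 \<le> t" and s: "0 < s" "s \<le> 1"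
    have 1: "sbound 1 (\<lambda>x. heat s (U t) x - U t x) (K * gauss_const TYPE('a) * sqrt s)"
      by (rule sbound_heat_minus_id[OF s(1) _ U_le K(1) K(2)]) (use t in auto)
    have 2: "sbound 1 (\<lambda>x. LINT r:{0..s}|lborel. gradheat a (s - r) (\<lambda>y. f (U (t + r) y)) x) (C2 * sqrt s)"
      using duhamel_sbound(1)[of t s] t s by (simp add: C2_def powr_half_sqrt mult_ac)
    have "(\<lambda>x. U (t + s) x - U t x) = (\<lambda>x. (heat s (U t) x - U t x) + (LINT r:{0..s}|lborel. gradheat a (s - r) (\<lambda>y. f (U (t + r) y)) x))"
      using restart[of t s] t s by (simp add: fun_eq_iff)
    then show "sbound 1 (\<lambda>x. U (t + s) x - U t x) ((K * gauss_const TYPE('a) + C2) * sqrt s)"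
      using sbound_add[OF 1 2] by (simp add: distrib_right)
  qed
qed

lemma energy_step:
  obtains C where "0 \<le> C" "\<And>t h. 1 \<le> t \<Longrightarrow> 0 < h \<Longrightarrow> h \<le> 1 \<Longrightarrow>
    (\<integral>x. (U (t + h) x)\<^sup>2 \<partial>lborel) \<le> (\<integral>x. (heat h (U t) x)\<^sup>2 \<partial>lborel) + C * h * sqrt h"
proof -
  let ?k = "gauss_const TYPE('a)"
  have k: "2 \<le> ?k" by (rule gauss_const_ge)
  obtain K where K: "0 \<le> K" "\<And>t y. 1 \<le> t \<Longrightarrow> sbound 1 (\<lambda>x. U t (x - y) - U t x) (K * norm y)"
    using translate_lipschitz by blast
  obtain C6 where C6: "0 \<le> C6" "\<And>t s. 1 \<le> t \<Longrightarrow> 0 < s \<Longrightarrow> s \<le> 1 \<Longrightarrow> sbound 1 (\<lambda>x. U (t + s) x - U t x) (C6 * sqrt s)"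
    using time_continuity by blast
  define c1 where "c1 = 2 * ?k\<^sup>2 * norm a"
  define C2 where "C2 = ?k^3 * norm a * (6 * (L * M))"
  define C4 where "C4 = 4 * ?k^3 * norm a * L * K\<^sup>2"
  define C7 where "C7 = c1 * K * (L * C6) + C4 * 2"
  have c10: "0 \<le> c1" and C20: "0 \<le> C2" and C40: "0 \<le> C4" using k L_nonneg M_pos by (simp_all add: c1_def C2_def C4_def)
  have C70: "0 \<le> C7" using c10 C40 K(1) L_nonneg C6(1) by (simp add: C7_def)
  show thesis
  proof
    show "0 \<le> 2 * C7 + c1 * (L * K) * C2" using C70 c10 C20 K(1) L_nonneg by simp
    fix t h :: real assume t: "1 \<le> t" and h: "0 < h" "h \<le> 1"
    define u where "u = U t"
    define v where "v = heat h u"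
    define k where "k = (\<lambda>s y. gradheat a (h - s) (\<lambda>y. f (U (t + s) y)) y)"
    define W where "W = (\<lambda>x. LINT s:{0<..<h}|lborel. k s x)"
    have um[measurable]: "u \<in> borel_measurable borel" unfolding u_def by measurable
    have ub: "\<bar>u x\<bar> \<le> M" for x unfolding u_def by (rule U_le) (use t in simp)
    have ui: "integrable lborel u" unfolding u_def by (rule U_integrable) (use t in simp)
    have us: "sbound 1 u M" unfolding u_def by (rule U_sbound) (use t in simp)
    have "sbound (h + 1) v (?k * M)" unfolding v_def by (rule sbound_heat[OF h(1) _ us]) simp
    then have vs: "sbound 1 v (?k * M)" by (rule sbound_time) (use h in auto)
    note vm[measurable] = sboundD(1)[OF vs]
    have vi: "integrable lborel v" by (rule sbound_integrable[OF vs])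
    have vb: "\<bar>v x\<bar> \<le> ?k * M" for x using sboundD(4)[OF vs, of x] by simp
    have km[measurable]: "case_prod k \<in> borel_measurable (borel \<Otimes>\<^sub>M borel)"
      unfolding k_def gradheat_def by measurable
    have Wo: "W x = (LINT s:{0..h}|lborel. gradheat a (h - s) (\<lambda>y. f (U (t + s) y)) x)" for x
      unfolding W_def k_def by (rule set_integral_closed_open(1)[symmetric]) (simp add: gradheat_def)
    have Weq: "W = (\<lambda>x. LINT s:{0..h}|lborel. gradheat a (h - s) (\<lambda>y. f (U (t + s) y)) x)" by (rule ext) (rule Wo)
    have Ws: "sbound 1 W (C2 * sqrt h)"
      using duhamel_sbound(1)[of t h] t h unfolding Weq by (simp add: C2_def powr_half_sqrt mult_ac)
    have Wi: "integrable lborel W" by (rule sbound_integrable[OF Ws])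
    have kb: "\<bar>k s x\<bar> \<le> c1 * (L * K)" if s: "s \<in> {0<..<h}" for s x
      unfolding k_def c1_def
    proof (rule abs_gradheat_le_lipschitz[where B="L * M"])
      show "\<bar>f (U (t + s) y)\<bar> \<le> L * M" for y using sboundD(4)[OF fU_sbound[of "t + s"], of y] t s by simp
      show "\<bar>f (U (t + s) (x - z)) - f (U (t + s) x)\<bar> \<le> L * K * norm z" for z
      proof -
        have "\<bar>f (U (t + s) (x - z)) - f (U (t + s) x)\<bar> \<le> L * \<bar>U (t + s) (x - z) - U (t + s) x\<bar>"
          by (intro f_lipschitz U_le) (use t s in auto)
        also have "\<dots> \<le> L * (K * norm z)"
          using sboundD(4)[OF K(2), of "t + s" x z] t s L_nonneg by (intro mult_left_mono) auto
        finally show ?thesis by simp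
      qed
    qed (use s K(1) L_nonneg in auto)
    have const: "(\<integral>\<^sup>+s\<in>{0<..<h}. ennreal c \<partial>lborel) = ennreal (c * h)" if "0 \<le> c" for c
      using that h by (simp add: nn_integral_cmult_indicator ennreal_mult)
    have Wb: "\<bar>W x\<bar> \<le> c1 * (L * K) * h" for x
    proof -
      have c0: "0 \<le> c1 * (L * K)" using c10 L_nonneg K(1) by simp
      have "ennreal \<bar>W x\<bar> \<le> (\<integral>\<^sup>+s\<in>{0<..<h}. ennreal \<bar>k s x\<bar> \<partial>lborel)"
        unfolding W_def by (rule ennreal_abs_set_integral_le)
      also have "\<dots> \<le> (\<integral>\<^sup>+s\<in>{0<..<h}. ennreal (c1 * (L * K)) \<partial>lborel)"
        using kb by (intro nn_integral_mono) (auto simp: indicator_def intro!: ennreal_leI)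
      also have "\<dots> = ennreal (c1 * (L * K) * h)" by (rule const[OF c0])
      finally show ?thesis using c0 h by (simp add: ennreal_le_iff)
    qed
    have pairing: "\<bar>\<integral>y. v y * k s y \<partial>lborel\<bar> \<le> C7 * sqrt h" if s: "s \<in> {0<..<h}" for s
    proof -
      define r where "r = (h - s) + h"
      have r: "0 < r" "r \<le> 4 * h" using s h by (auto simp: r_def)
      let ?\<phi> = "\<lambda>y. f (U (t + s) y)"
      have \<phi>i: "integrable lborel ?\<phi>" by (rule fU_integrable) (use t s in auto)
      have gb: "\<bar>gradheat a r u x\<bar> \<le> c1 * K" for x unfolding c1_def
        by (rule abs_gradheat_le_lipschitz[OF r(1) um ub K(1)]) (use sboundD(4)[OF K(2), of t x] t in \<open>auto simp: u_def\<close>)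
      have gm[measurable]: "gradheat a r u \<in> borel_measurable borel" unfolding gradheat_def[abs_def] by measurable
      \<comment> \<open>Once on the other side, the kernel joins the heat flow contained in v; the
        resulting kernel time (h - s) + h exceeds h, so nothing is singular at s = h.\<close>
      have "(\<integral>y. v y * k s y \<partial>lborel) = - (\<integral>y. ?\<phi> y * gradheat a (h - s) v y \<partial>lborel)"
        unfolding k_def by (rule gradheat_adjoint[OF _ \<phi>i vi]) (use s in auto)
      also have "(\<integral>y. ?\<phi> y * gradheat a (h - s) v y \<partial>lborel) = (\<integral>y. ?\<phi> y * gradheat a r u y \<partial>lborel)"
        unfolding v_def r_def using gradheat_heat[of "h - s" h u a] s h ui by simp
      finally have e1: "\<bar>\<integral>y. v y * k s y \<partial>lborel\<bar> = \<bar>\<integral>y. ?\<phi> y * gradheat a r u y \<partial>lborel\<bar>" by simp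
      have f0i: "integrable lborel (\<lambda>y. f (u y))" unfolding u_def by (rule fU_integrable) (use t in auto)
      have i1: "integrable lborel (\<lambda>y. gradheat a r u y * (?\<phi> y - f (u y)))"
        by (rule integrable_bounded_mult[OF gm gb]) (use \<phi>i f0i in auto)
      have i2: "integrable lborel (\<lambda>y. gradheat a r u y * f (u y))"
        by (rule integrable_bounded_mult[OF gm gb f0i])
      have "(\<integral>y. ?\<phi> y * gradheat a r u y \<partial>lborel) = (\<integral>y. gradheat a r u y * (?\<phi> y - f (u y)) + gradheat a r u y * f (u y) \<partial>lborel)"
        by (simp add: algebra_simps)
      also have "\<dots> = (\<integral>y. gradheat a r u y * (?\<phi> y - f (u y)) \<partial>lborel) + (\<integral>y. gradheat a r u y * f (u y) \<partial>lborel)"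
        by (rule Bochner_Integration.integral_add[OF i1 i2])
      finally have "\<bar>\<integral>y. ?\<phi> y * gradheat a r u y \<partial>lborel\<bar> \<le> \<bar>\<integral>y. gradheat a r u y * (?\<phi> y - f (u y)) \<partial>lborel\<bar> + \<bar>\<integral>y. f (u y) * gradheat a r u y \<partial>lborel\<bar>"
        by (simp add: mult.commute)
      also have "\<bar>\<integral>y. f (u y) * gradheat a r u y \<partial>lborel\<bar> \<le> C4 * sqrt r"
        unfolding C4_def u_def by (rule flux_gradheat_le[OF _ r(1) K(1)]) (use t K(2) in auto)
      also have "\<bar>\<integral>y. gradheat a r u y * (?\<phi> y - f (u y)) \<partial>lborel\<bar> \<le> c1 * K * (L * (C6 * sqrt s))"
      proof -
        have di: "integrable lborel (\<lambda>y. U (t + s) y - u y)"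
          unfolding u_def by (rule sbound_integrable[OF C6(2)]) (use t s h in auto)
        have "\<bar>\<integral>y. gradheat a r u y * (?\<phi> y - f (u y)) \<partial>lborel\<bar> \<le> (\<integral>y. \<bar>gradheat a r u y * (?\<phi> y - f (u y))\<bar> \<partial>lborel)"
          by (rule integral_abs_bound)
        also have "\<dots> \<le> (\<integral>y. (c1 * K * L) * \<bar>U (t + s) y - u y\<bar> \<partial>lborel)"
        proof (rule integral_mono)
          fix y
          have "\<bar>?\<phi> y - f (u y)\<bar> \<le> L * \<bar>U (t + s) y - u y\<bar>"
            unfolding u_def by (intro f_lipschitz U_le) (use t s in auto)
          then have "\<bar>gradheat a r u y\<bar> * \<bar>?\<phi> y - f (u y)\<bar> \<le> (c1 * K) * (L * \<bar>U (t + s) y - u y\<bar>)"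
            using c10 K(1) by (intro mult_mono gb) auto
          then show "\<bar>gradheat a r u y * (?\<phi> y - f (u y))\<bar> \<le> (c1 * K * L) * \<bar>U (t + s) y - u y\<bar>"
            by (simp only: abs_mult mult.assoc)
        qed (use i1 di in auto)
        also have "\<dots> = (c1 * K * L) * (\<integral>y. \<bar>U (t + s) y - u y\<bar> \<partial>lborel)" by simp
        also have "\<dots> \<le> (c1 * K * L) * (C6 * sqrt s)"
          unfolding u_def by (intro mult_left_mono sbound_integral[OF C6(2)]) (use t s h c10 K(1) L_nonneg in auto)
        finally show ?thesis by (simp add: mult_ac)
      qed
      also have "c1 * K * (L * (C6 * sqrt s)) + C4 * sqrt r \<le> c1 * K * (L * (C6 * sqrt h)) + C4 * (2 * sqrt h)"
      proof (intro add_mono mult_left_mono)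
        have "sqrt r \<le> sqrt (4 * h)" using r by (intro real_sqrt_le_mono) auto
        then show "sqrt r \<le> 2 * sqrt h" by (simp add: real_sqrt_mult)
      qed (use s c10 C40 K(1) L_nonneg C6(1) in auto)
      also have "\<dots> = C7 * sqrt h" by (simp add: C7_def algebra_simps)
      finally show ?thesis using e1 by simp
    qed
    have vW: "\<bar>\<integral>y. v y * W y \<partial>lborel\<bar> \<le> C7 * sqrt h * h"
    proof -
      define \<beta> where "\<beta> = (\<lambda>s. ?k\<^sup>2 * norm a * (h - s) powr (-1/2) * (L * M))"
      have ks: "sbound 1 (k s) (\<beta> s)" if "s \<in> {0<..<h}" for s
      proof -
        have "sbound ((h - s) + 1) (k s) (\<beta> s)" unfolding k_def \<beta>_def
          by (rule sbound_gradheat) (use that t in \<open>auto intro!: fU_sbound\<close>)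
        then show ?thesis by (rule sbound_time) (use that in auto)
      qed
      have \<beta>I: "(\<integral>\<^sup>+s\<in>{0<..<h}. ennreal (\<beta> s) \<partial>lborel) < \<infinity>"
      proof -
        have "(\<integral>\<^sup>+s\<in>{0<..<h}. ennreal (\<beta> s) \<partial>lborel) = (\<integral>\<^sup>+s\<in>{0<..<h}. ennreal ((h - s) powr (-1/2) * (?k\<^sup>2 * norm a * (L * M))) \<partial>lborel)"
          by (simp add: \<beta>_def mult_ac)
        also have "\<dots> \<le> ennreal (6 * (?k\<^sup>2 * norm a * (L * M)) * h powr (1/2))"
          by (rule nn_integral_const_singular) (use h L_nonneg M_pos in auto)
        finally show ?thesis by (auto intro: le_less_trans)
      qed
      have "(\<integral>y. v y * W y \<partial>lborel) = (LINT s:{0<..<h}|lborel. \<integral>y. v y * k s y \<partial>lborel)"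
        unfolding W_def by (rule pairing_curve_integral(1)[OF km _ _ ks \<beta>I vm vb]) (auto simp: \<beta>_def)
      then have "ennreal \<bar>\<integral>y. v y * W y \<partial>lborel\<bar> \<le> (\<integral>\<^sup>+s\<in>{0<..<h}. ennreal \<bar>\<integral>y. v y * k s y \<partial>lborel\<bar> \<partial>lborel)"
        using ennreal_abs_set_integral_le[of lborel "{0<..<h}" "\<lambda>s. \<integral>y. v y * k s y \<partial>lborel"] by simp
      also have "\<dots> \<le> (\<integral>\<^sup>+s\<in>{0<..<h}. ennreal (C7 * sqrt h) \<partial>lborel)"
        using pairing by (intro nn_integral_mono) (auto simp: indicator_def intro!: ennreal_leI)
      also have "\<dots> = ennreal (C7 * sqrt h * h)" by (rule const) (use C70 h in auto)
      finally show ?thesis using C70 h by (simp add: ennreal_le_iff)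
    qed
    have i1: "integrable lborel (\<lambda>y. v y * v y)" by (rule integrable_bounded_mult[OF vm vb vi])
    have i2: "integrable lborel (\<lambda>y. v y * W y)" by (rule integrable_bounded_mult[OF vm vb Wi])
    have i3: "integrable lborel (\<lambda>y. W y * W y)" by (rule integrable_bounded_mult[OF sboundD(1)[OF Ws] Wb Wi])
    have W2: "(\<integral>y. W y * W y \<partial>lborel) \<le> c1 * (L * K) * h * (C2 * sqrt h)"
    proof -
      have c0: "0 \<le> c1 * (L * K) * h" using c10 L_nonneg K(1) h by simp
      have "(\<integral>y. W y * W y \<partial>lborel) \<le> (\<integral>y. (c1 * (L * K) * h) * \<bar>W y\<bar> \<partial>lborel)"
      proof (rule integral_mono[OF i3])
        show "W y * W y \<le> (c1 * (L * K) * h) * \<bar>W y\<bar>" for y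
          using mult_right_mono[OF Wb[of y], of "\<bar>W y\<bar>"] by (simp add: abs_mult[symmetric])
      qed (use Wi in auto)
      also have "\<dots> = (c1 * (L * K) * h) * (\<integral>y. \<bar>W y\<bar> \<partial>lborel)" by simp
      also have "\<dots> \<le> c1 * (L * K) * h * (C2 * sqrt h)" by (intro mult_left_mono sbound_integral[OF Ws] c0)
      finally show ?thesis .
    qed
    have "(\<integral>x. (U (t + h) x)\<^sup>2 \<partial>lborel) = (\<integral>x. v x * v x + 2 * (v x * W x) + W x * W x \<partial>lborel)"
    proof -
      have "U (t + h) x = v x + W x" for x using restart[of t h x] t h by (simp add: v_def u_def Wo)
      then show ?thesis by (simp add: power2_eq_square algebra_simps)
    qed
    also have "\<dots> = (\<integral>x. v x * v x \<partial>lborel) + 2 * (\<integral>x. v x * W x \<partial>lborel) + (\<integral>x. W x * W x \<partial>lborel)"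
      using i1 i2 i3 by simp
    also have "\<dots> \<le> (\<integral>x. v x * v x \<partial>lborel) + 2 * (C7 * sqrt h * h) + c1 * (L * K) * h * (C2 * sqrt h)"
      using vW W2 by linarith
    also have "\<dots> = (\<integral>x. (heat h (U t) x)\<^sup>2 \<partial>lborel) + (2 * C7 + c1 * (L * K) * C2) * h * sqrt h"
      by (simp add: v_def u_def power2_eq_square algebra_simps)
    finally show "(\<integral>x. (U (t + h) x)\<^sup>2 \<partial>lborel) \<le> (\<integral>x. (heat h (U t) x)\<^sup>2 \<partial>lborel) + (2 * C7 + c1 * (L * K) * C2) * h * sqrt h" .
  qed
qed

end


section \<open>Decay of the solution\<close>

lemma abs_integral_mult_le:
  fixes \<phi> g :: "'a::euclidean_space \<Rightarrow> real"
  assumes \<phi>: "integrable lborel \<phi>" and g: "g \<in> borel_measurable borel" "\<And>x. \<bar>g x\<bar> \<le> B"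
  shows "\<bar>\<integral>x. \<phi> x * g x \<partial>lborel\<bar> \<le> B * (\<integral>x. \<bar>\<phi> x\<bar> \<partial>lborel)"
proof -
  have "\<bar>\<integral>x. \<phi> x * g x \<partial>lborel\<bar> \<le> (\<integral>x. \<bar>\<phi> x * g x\<bar> \<partial>lborel)" by (rule integral_abs_bound)
  also have "\<dots> \<le> (\<integral>x. B * \<bar>\<phi> x\<bar> \<partial>lborel)"
  proof (rule integral_mono)
    show "integrable lborel (\<lambda>x. \<bar>\<phi> x * g x\<bar>)"
      using integrable_abs[OF integrable_bounded_mult[OF g \<phi>]] by (simp add: mult.commute)
    show "\<bar>\<phi> x * g x\<bar> \<le> B * \<bar>\<phi> x\<bar>" for x
      using mult_right_mono[OF g(2)[of x], of "\<bar>\<phi> x\<bar>"] by (simp add: abs_mult mult.commute)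
  qed (use \<phi> in auto)
  finally show ?thesis by simp
qed

lemma sbound_heat_L1:
  fixes \<phi> :: "'a::euclidean_space \<Rightarrow> real"
  assumes "0 < t" "\<phi> \<in> borel_measurable borel" "0 \<le> r" "(\<integral>\<^sup>+x. ennreal \<bar>\<phi> x\<bar> \<partial>lborel) \<le> ennreal r"
  shows "sbound t (heat t \<phi>) r"
  unfolding heat_def using heat_kernel_dominated_L1[of "heatG t" \<phi> t 1 r] assms by simp

lemma powr_neg_small:
  fixes e c \<epsilon> :: real
  assumes "0 < e" "0 < \<epsilon>"
  obtains R where "1 \<le> R" "c * R powr (-e) < \<epsilon>"
proof -
  have "((\<lambda>R. c * R powr (-e)) \<longlongrightarrow> c * 0) at_top"
    using assms by (intro tendsto_mult_left tendsto_neg_powr filterlim_ident) auto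
  then have "\<forall>\<^sub>F R in at_top. c * R powr (-e) < \<epsilon>" using assms by (simp add: order_tendstoD(2))
  then have "\<forall>\<^sub>F R in at_top. 1 \<le> R \<and> c * R powr (-e) < \<epsilon>" using eventually_ge_at_top[of 1] by eventually_elim auto
  then show ?thesis using that eventually_happens'[OF trivial_limit_at_top_linorder] by blast
qed

context mild_solution
begin

text \<open>If the energy stayed above \<open>\<delta>\<close>, each time step of a fixed length h
  would lower it by the same \<open>\<kappa>\<close> > 0, until it became negative.\<close>

lemma energy_small:
  assumes \<delta>: "0 < \<delta>"
  shows "\<exists>t\<ge>1. (\<integral>x. (U t x)\<^sup>2 \<partial>lborel) < \<delta>"
proof (rule ccontr)
  define y where "y = (\<lambda>t. \<integral>x. (U t x)\<^sup>2 \<partial>lborel)"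
  assume "\<not> (\<exists>t\<ge>1. (\<integral>x. (U t x)\<^sup>2 \<partial>lborel) < \<delta>)"
  then have y: "\<delta> \<le> y t" if "1 \<le> t" for t using that by (force simp: y_def)
  obtain C where C: "0 \<le> C" "\<And>t h. 1 \<le> t \<Longrightarrow> 0 < h \<Longrightarrow> h \<le> 1 \<Longrightarrow>
    (\<integral>x. (U (t + h) x)\<^sup>2 \<partial>lborel) \<le> (\<integral>x. (heat h (U t) x)\<^sup>2 \<partial>lborel) + C * h * sqrt h"
    using energy_step by blast
  \<comment> \<open>By time R the sup decay of the heat flow of an L1 function makes its pairing
    with \<open>U t\<close> at most \<open>\<delta>\<close>/2, so half of the energy threshold is
    certain to be lost.\<close>
  obtain R where R: "1 \<le> R" "M * M * R powr (- (real DIM('a) / 2)) < \<delta> / 2"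
    using powr_neg_small[of "real DIM('a) / 2" "\<delta> / 2" "M * M"] \<delta> by auto
  have h0: "(\<lambda>m. (R/2) * (1/2) ^ m) \<longlonglongrightarrow> (R/2) * 0"
    by (intro tendsto_mult_left LIMSEQ_power_zero) simp
  then have "(\<lambda>m. C * sqrt ((R/2) * (1/2) ^ m)) \<longlonglongrightarrow> C * sqrt ((R/2) * 0)"
    by (rule tendsto_mult_left[OF tendsto_real_sqrt])
  then have "\<forall>\<^sub>F m in sequentially. C * sqrt ((R/2) * (1/2) ^ m) < \<delta> / (2 * R)"
    using \<delta> R by (intro order_tendstoD(2)) auto
  moreover have "\<forall>\<^sub>F m in sequentially. (R/2) * (1/2) ^ m < 1"
    using order_tendstoD(2)[OF h0, of 1] by simp
  ultimately have "\<forall>\<^sub>F m in sequentially. C * sqrt ((R/2) * (1/2) ^ m) < \<delta> / (2 * R) \<and> (R/2) * (1/2) ^ m < 1"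
    by eventually_elim auto
  then obtain m where m: "C * sqrt ((R/2) * (1/2) ^ m) < \<delta> / (2 * R)" "(R/2) * (1/2) ^ m < 1"
    using eventually_happens'[OF sequentially_bot] by blast
  \<comment> \<open>m doublings lead from 2h to R. They guarantee a heat loss of
    2\<open>\<kappa>\<close> in one step, and m was taken so large that the flux error C h sqrt h is
    at most \<open>\<kappa>\<close>.\<close>
  define h where "h = (R/2) * (1/2) ^ m"
  have h: "0 < h" "h \<le> 1" "2 ^ m * (2 * h) = R" using R m by (auto simp: h_def power_one_over)
  define \<kappa> where "\<kappa> = (\<delta> / 4) / 2 ^ m"
  have \<kappa>: "0 < \<kappa>" using \<delta> by (simp add: \<kappa>_def)
  have step: "y (t + h) \<le> y t - \<kappa>" if t: "1 \<le> t" for t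
  proof -
    have us: "sbound 1 (U t) M" by (rule U_sbound) (use t in simp)
    have "\<bar>\<integral>x. U t x * heat R (U t) x \<partial>lborel\<bar> \<le> (M * R powr (- real DIM('a) / 2)) * (\<integral>x. \<bar>U t x\<bar> \<partial>lborel)"
    proof (rule abs_integral_mult_le)
      have s: "sbound R (heat R (U t)) M" by (rule sbound_heat_L1) (use R sboundD[OF us] in auto)
      show "heat R (U t) \<in> borel_measurable borel" by (rule sboundD(1)[OF s])
      show "\<bar>heat R (U t) x\<bar> \<le> M * R powr (- real DIM('a) / 2)" for x by (rule sboundD(4)[OF s])
    qed (rule sbound_integrable[OF us])
    also have "\<dots> \<le> (M * R powr (- real DIM('a) / 2)) * M"
      using M_pos by (intro mult_left_mono sbound_integral[OF us]) auto
    finally have s: "(\<integral>x. U t x * heat R (U t) x \<partial>lborel) \<le> \<delta> / 2" using R(2) by (simp add: mult_ac)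
    \<comment> \<open>The energy of the heat flow at time h is the pairing of \<open>U t\<close>
      with its heat flow at time 2h, hence the doubling starts at 2h.\<close>
    have "y t - (\<integral>x. U t x * heat R (U t) x \<partial>lborel) \<le> 2 ^ m * (y t - (\<integral>x. (heat h (U t) x)\<^sup>2 \<partial>lborel))"
      using heat_dissipation[OF us, of "2 * h" m] heat_dissipation_doubling(2)[OF us h(1)] h by (simp add: y_def)
    with s y[OF t] have "\<delta> / 2 \<le> 2 ^ m * (y t - (\<integral>x. (heat h (U t) x)\<^sup>2 \<partial>lborel))" by linarith
    then have a: "(\<integral>x. (heat h (U t) x)\<^sup>2 \<partial>lborel) \<le> y t - 2 * \<kappa>" by (simp add: \<kappa>_def field_simps)
    have "C * h * sqrt h = h * (C * sqrt h)" by simp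
    also have "\<dots> \<le> h * (\<delta> / (2 * R))" using m h unfolding h_def[symmetric] by (intro mult_left_mono) auto
    also have "\<dots> = \<kappa>" unfolding h_def \<kappa>_def using R by (simp add: power_one_over)
    finally show ?thesis using C(2)[OF t h(1,2)] a by (simp add: y_def)
  qed
  have iter: "y (1 + real i * h) \<le> y 1 - real i * \<kappa>" for i
  proof (induction i)
    case (Suc i)
    have "y (1 + real (Suc i) * h) = y ((1 + real i * h) + h)" by (simp add: algebra_simps)
    also have "\<dots> \<le> y (1 + real i * h) - \<kappa>" by (rule step) (use h in simp)
    finally show ?case using Suc by (simp add: algebra_simps)
  qed simp
  obtain i where "y 1 / \<kappa> < real i" using reals_Archimedean2 by blast
  then have "y 1 < real i * \<kappa>" using \<kappa> by (simp add: field_simps)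
  then show False using iter[of i] y[of "1 + real i * h"] h \<delta> by simp
qed

text \<open>A value above \<open>\<epsilon>\<close> persists, up to a factor 1/2, on a ball whose
  radius depends only on \<open>\<epsilon>\<close> and the Lipschitz constant, and so forces a fixed
  amount of energy.\<close>

lemma sup_small:
  assumes \<epsilon>: "0 < \<epsilon>"
  shows "\<exists>T\<ge>1. \<forall>x. \<bar>U T x\<bar> \<le> \<epsilon>"
proof -
  obtain K where K: "0 \<le> K" "\<And>t y. 1 \<le> t \<Longrightarrow> sbound 1 (\<lambda>x. U t (x - y) - U t x) (K * norm y)"
    using translate_lipschitz by blast
  \<comment> \<open>The 1 keeps the radius meaningful for K = 0.\<close>
  define \<rho> where "\<rho> = \<epsilon> / (2 * (K + 1))"
  have \<rho>: "0 < \<rho>" "K * \<rho> \<le> \<epsilon> / 2" using \<epsilon> K(1) by (auto simp: \<rho>_def field_simps)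
  define V where "V = measure lborel (ball (0::'a) \<rho>)"
  have V: "measure lborel (ball x \<rho>) = V" for x :: 'a using \<rho> by (simp add: V_def content_ball)
  have V0: "0 < V" using \<rho> by (simp add: V_def content_ball)
  obtain T where T: "1 \<le> T" "(\<integral>x. (U T x)\<^sup>2 \<partial>lborel) < (\<epsilon>/2)\<^sup>2 * V"
    using energy_small[of "(\<epsilon>/2)\<^sup>2 * V"] \<epsilon> V0 by auto
  have "\<bar>U T x\<bar> \<le> \<epsilon>" for x
  proof (rule ccontr)
    assume x: "\<not> \<bar>U T x\<bar> \<le> \<epsilon>"
    have lb: "\<epsilon> / 2 \<le> \<bar>U T z\<bar>" if "z \<in> ball x \<rho>" for z
    proof -
      have "\<bar>U T (x - (x - z)) - U T x\<bar> \<le> K * norm (x - z)" using sboundD(4)[OF K(2)[OF T(1)], of x "x - z"] by simp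
      also have "\<dots> \<le> K * \<rho>" using that K(1) by (intro mult_left_mono) (auto simp: dist_norm)
      finally show ?thesis using x \<rho> by simp
    qed
    have "(\<epsilon>/2)\<^sup>2 * V = (\<integral>z. (\<epsilon>/2)\<^sup>2 * indicator (ball x \<rho>) z \<partial>lborel)"
      by (simp add: V)
    also have "\<dots> \<le> (\<integral>z. (U T z)\<^sup>2 \<partial>lborel)"
    proof (rule integral_mono)
      show "integrable lborel (\<lambda>z. (\<epsilon>/2)\<^sup>2 * indicator (ball x \<rho>) z)"
        using emeasure_lborel_ball_finite[of x \<rho>] by (intro integrable_mult_right integrable_real_indicator) auto
      show "integrable lborel (\<lambda>z. (U T z)\<^sup>2)"
        unfolding power2_eq_square by (rule integrable_bounded_mult[OF _ U_le U_integrable]) (use T in auto)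
      show "(\<epsilon>/2)\<^sup>2 * indicator (ball x \<rho>) z \<le> (U T z)\<^sup>2" for z
        using power_mono[OF lb, of z 2] \<epsilon> by (cases "z \<in> ball x \<rho>") auto
    qed
    finally show False using T(2) by simp
  qed
  then show ?thesis using T(1) by blast
qed

end

section \<open>Power-law flux and the decay rate of the heat kernel\<close>

text \<open>\<open>d\<close> stands for n/2. It is a real parameter because f alone does not
  determine the space; lemmas about functions on the space fix it by an equation.\<close>

locale power_flux =
  fixes f :: "real \<Rightarrow> real" and p \<sigma> Cf :: real and d :: real
  assumes flux_measurable [measurable]: "f \<in> borel_measurable borel" and flux_zero: "f 0 = 0"
    and Cf_nonneg: "0 \<le> Cf"
    and flux_power: "\<And>\<xi> \<eta>. \<bar>f \<xi> - f \<eta>\<bar> \<le> Cf * (\<bar>\<xi>\<bar> powr (p - 1) + \<bar>\<eta>\<bar> powr (p - 1)) * \<bar>\<xi> - \<eta>\<bar>"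
    and d_pos: "0 < d" and exponent: "d * (p - 1) = 1/2 + \<sigma>" and \<sigma>_pos: "0 < \<sigma>" and \<sigma>_less: "\<sigma> < 1/2"
begin

lemma p_gt: "1 < p"
proof -
  have "0 < d * (p - 1)" using exponent \<sigma>_pos by simp
  then show ?thesis using d_pos by (simp add: zero_less_mult_iff)
qed

text \<open>For d = n/2 the size \<open>\<theta>\<close>^(-d) is that of the heat kernel at time
  \<open>\<theta>\<close>, and by \<open>exponent\<close> the growth bound on f turns into the
  Lipschitz constant \<open>\<theta>\<close>^(-1/2 - \<open>\<sigma>\<close>).\<close>

lemma flux_diff_le:
  assumes \<theta>: "0 < \<theta>" and K: "0 \<le> K" and "\<bar>\<xi>\<bar> \<le> K * \<theta> powr (-d)" "\<bar>\<eta>\<bar> \<le> K * \<theta> powr (-d)"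
  shows "\<bar>f \<xi> - f \<eta>\<bar> \<le> 2 * Cf * K powr (p - 1) * \<theta> powr (-1/2 - \<sigma>) * \<bar>\<xi> - \<eta>\<bar>"
proof -
  have e: "(K * \<theta> powr (-d)) powr (p - 1) = K powr (p - 1) * \<theta> powr (-1/2 - \<sigma>)"
    using exponent by (simp add: powr_mult powr_powr)
  have "\<bar>\<xi>\<bar> powr (p - 1) \<le> (K * \<theta> powr (-d)) powr (p - 1)" "\<bar>\<eta>\<bar> powr (p - 1) \<le> (K * \<theta> powr (-d)) powr (p - 1)"
    using assms p_gt by (auto intro!: powr_mono2)
  then have "\<bar>\<xi>\<bar> powr (p - 1) + \<bar>\<eta>\<bar> powr (p - 1) \<le> 2 * (K powr (p - 1) * \<theta> powr (-1/2 - \<sigma>))" unfolding e by simp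
  then have "Cf * (\<bar>\<xi>\<bar> powr (p - 1) + \<bar>\<eta>\<bar> powr (p - 1)) * \<bar>\<xi> - \<eta>\<bar> \<le> Cf * (2 * (K powr (p - 1) * \<theta> powr (-1/2 - \<sigma>))) * \<bar>\<xi> - \<eta>\<bar>"
    using Cf_nonneg by (intro mult_right_mono mult_left_mono) auto
  then show ?thesis using flux_power[of \<xi> \<eta>] by (simp add: mult_ac)
qed

lemma sbound_flux_diff:
  fixes \<phi> \<psi> :: "'a::euclidean_space \<Rightarrow> real"
  assumes d: "d = real DIM('a) / 2"
    and \<theta>: "0 < \<theta>" and K: "0 \<le> K" and \<phi>: "\<And>x. \<bar>\<phi> x\<bar> \<le> K * \<theta> powr (-d)" and \<psi>: "\<And>x. \<bar>\<psi> x\<bar> \<le> K * \<theta> powr (-d)"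
    and [measurable]: "\<phi> \<in> borel_measurable borel" "\<psi> \<in> borel_measurable borel"
    and r: "sbound \<theta> (\<lambda>x. \<phi> x - \<psi> x) r"
  shows "sbound \<theta> (\<lambda>x. f (\<phi> x) - f (\<psi> x)) (2 * Cf * K powr (p - 1) * \<theta> powr (-1/2 - \<sigma>) * r)"
proof -
  let ?c = "2 * Cf * K powr (p - 1) * \<theta> powr (-1/2 - \<sigma>)"
  have c0: "0 \<le> ?c" using Cf_nonneg by simp
  have "sbound \<theta> (\<lambda>x. ?c * \<bar>\<phi> x - \<psi> x\<bar>) (\<bar>?c\<bar> * r)" by (intro sbound_cmult sbound_abs r)
  then have "sbound \<theta> (\<lambda>x. f (\<phi> x) - f (\<psi> x)) (\<bar>?c\<bar> * r)"
    by (rule sbound_dom) (use flux_diff_le[OF \<theta> K \<phi> \<psi>] in auto)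
  then show ?thesis by (simp only: abs_of_nonneg[OF c0])
qed

lemma sbound_flux:
  fixes \<phi> :: "'a::euclidean_space \<Rightarrow> real"
  assumes d: "d = real DIM('a) / 2" and \<theta>: "0 < \<theta>" and r: "sbound \<theta> \<phi> r"
  shows "sbound \<theta> (\<lambda>x. f (\<phi> x)) (2 * Cf * r powr (p - 1) * \<theta> powr (-1/2 - \<sigma>) * r)"
  using sbound_flux_diff[OF d \<theta> sboundD(2)[OF r], of \<phi> "\<lambda>_. 0" r] sboundD[OF r] r flux_zero d by simp

lemma flux_locally_lipschitz:
  assumes "0 \<le> M" "\<bar>x\<bar> \<le> M" "\<bar>y\<bar> \<le> M"
  shows "\<bar>f x - f y\<bar> \<le> 2 * Cf * M powr (p - 1) * \<bar>x - y\<bar>"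
  using flux_diff_le[of 1 M x y] assms by simp

end


locale convection_solution = mild_solution a f U M L + power_flux f p \<sigma> Cf "real DIM('a) / 2"
  for a :: "'a::euclidean_space" and f U M L p \<sigma> Cf
begin

text \<open>A continuity argument. As long as the bound q holds, Duhamel's formula returns q/2,
  because the nonlinear term is small for large \<open>\<tau>\<close>; continuity in time then
  prevents the first violation of q.\<close>

lemma decay_after_small_time:
  obtains T \<tau> B where "1 \<le> T" "1 \<le> \<tau>" "M \<le> B" "\<And>t x. 0 \<le> t \<Longrightarrow> \<bar>U (T + t) x\<bar> \<le> B * (t + \<tau>) powr (- real DIM('a) / 2)"
proof -
  let ?k = "gauss_const TYPE('a)" and ?e = "- real DIM('a) / 2"
  have k: "2 \<le> ?k" by (rule gauss_const_ge)
  obtain C where C: "0 \<le> C" "\<And>t s. 1 \<le> t \<Longrightarrow> 0 < s \<Longrightarrow> s \<le> 1 \<Longrightarrow> sbound 1 (\<lambda>x. U (t + s) x - U t x) (C * sqrt s)"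
    using time_continuity by blast
  \<comment> \<open>The heat flow of the datum takes B/4, and \<open>\<tau>\<close> is chosen so
    that the Duhamel term takes at most another B/4. The factor 2 to spare drives the continuity
    argument.\<close>
  define B where "B = 4 * ?k * M"
  have BM: "4 * M \<le> B" "0 < B" using k M_pos by (auto simp: B_def)
  define D where "D = 2 * Cf * B powr (p - 1) * B"
  have D0: "0 \<le> D" using Cf_nonneg BM by (simp add: D_def)
  \<comment> \<open>\<open>\<tau>\<close> acts as time already elapsed: (s +
    \<open>\<tau>\<close>)^(-1/2 - \<open>\<sigma>\<close>) <= s^(-1/2)
    \<open>\<tau>\<close>^(-\<open>\<sigma>\<close>), so that \<open>\<sigma>\<close> > 0 makes the
    nonlinear term small.\<close>
  obtain \<tau> where \<tau>: "1 \<le> \<tau>" "(?k\<^sup>2 * norm a * (12 * D)) * \<tau> powr (-\<sigma>) < B / 4"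
    using powr_neg_small[of \<sigma> "B / 4" "?k\<^sup>2 * norm a * (12 * D)"] \<sigma>_pos BM by auto
  \<comment> \<open>A time at which the solution has the size that a heat flow of L1 norm M has
    after time \<open>\<tau>\<close>.\<close>
  obtain T where T: "1 \<le> T" "\<And>x. \<bar>U T x\<bar> \<le> M * \<tau> powr ?e"
    using sup_small[of "M * \<tau> powr ?e"] M_pos \<tau> by auto
  have UT: "sbound \<tau> (U T) M"
    using sboundD[OF U_sbound[of T]] T by (intro sboundI) auto
  define q where "q = (\<lambda>t. B * (t + \<tau>) powr ?e)"
  have q0: "0 < q t" if "0 \<le> t" for t using BM \<tau> that by (simp add: q_def)
  have improve: "\<bar>U (T + t) x\<bar> \<le> q t / 2" if t: "0 \<le> t" and good: "\<And>s x. 0 \<le> s \<Longrightarrow> s < t \<Longrightarrow> \<bar>U (T + s) x\<bar> \<le> q s" for t x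
  proof (cases "t = 0")
    case True
    have "M * \<tau> powr ?e \<le> (B / 2) * \<tau> powr ?e" using BM M_pos by (intro mult_right_mono) auto
    then show ?thesis using T(2)[of x] True by (simp add: q_def)
  next
    case False
    then have t: "0 < t" using t by simp
    have b: "sbound (s + \<tau>) (\<lambda>y. f (U (T + s) y)) (D * \<tau> powr (-\<sigma>) * s powr (-(1/2)))" if s: "0 < s" "s < t" for s
    proof -
      have "sbound (s + \<tau>) (U (T + s)) B"
      proof (rule sboundI)
        show "(\<integral>\<^sup>+x. ennreal \<bar>U (T + s) x\<bar> \<partial>lborel) \<le> ennreal B"
          by (rule order_trans[OF sboundD(3)[OF U_sbound] ennreal_leI]) (use T s BM M_pos in auto)
        show "\<bar>U (T + s) x\<bar> \<le> B * (s + \<tau>) powr ?e" for x using good[of s x] s by (simp add: q_def)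
      qed (use BM in auto)
      then have "sbound (s + \<tau>) (\<lambda>y. f (U (T + s) y)) (2 * Cf * B powr (p - 1) * (s + \<tau>) powr (-1/2 - \<sigma>) * B)"
        by (rule sbound_flux[rotated 2]) (use s \<tau> in auto)
      then show ?thesis
      proof (rule sbound_mono)
        have "(s + \<tau>) powr (-1/2 - \<sigma>) = (s + \<tau>) powr (-(1/2)) * (s + \<tau>) powr (-\<sigma>)" by (simp add: powr_add[symmetric])
        also have "\<dots> \<le> s powr (-(1/2)) * \<tau> powr (-\<sigma>)"
          using s \<tau> \<sigma>_pos by (intro mult_mono powr_mono2') auto
        finally have "D * (s + \<tau>) powr (-1/2 - \<sigma>) \<le> D * (s powr (-(1/2)) * \<tau> powr (-\<sigma>))" using D0 by (rule mult_left_mono)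
        then show "2 * Cf * B powr (p - 1) * (s + \<tau>) powr (-1/2 - \<sigma>) * B \<le> D * \<tau> powr (-\<sigma>) * s powr (-(1/2))"
          by (simp add: D_def mult_ac)
      qed
    qed
    have I: "(\<integral>\<^sup>+s\<in>{0<..<t}. ennreal ((t - s) powr (-1/2) * (D * \<tau> powr (-\<sigma>) * s powr (-(1/2)))) \<partial>lborel) \<le> ennreal (12 * D * \<tau> powr (-\<sigma>))"
      using nn_integral_beta_cmult[of "1/2" t "D * \<tau> powr (-\<sigma>)"] t D0 by (simp add: mult_ac)
    have m: "(\<lambda>(s, y). f (U (T + s) y)) \<in> borel_measurable (borel \<Otimes>\<^sub>M borel)" by measurable
    have "sbound (t + \<tau>) (\<lambda>x. LINT s:{0..t}|lborel. gradheat a (t - s) (\<lambda>y. f (U (T + s) y)) x) (?k\<^sup>2 * norm a * (12 * D * \<tau> powr (-\<sigma>)))"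
      by (rule sbound_duhamel(1)[where h="\<lambda>s y. f (U (T + s) y)", OF m _ _ _ _ b _ I]) (use t \<tau> D0 in auto)
    note w = sbound_add[OF sbound_heat[OF t _ UT] this]
    have Ueq: "U (T + t) = (\<lambda>x. heat t (U T) x + (LINT s:{0..t}|lborel. gradheat a (t - s) (\<lambda>y. f (U (T + s) y)) x))"
      by (rule ext, rule restart) (use T t in auto)
    have "sbound (t + \<tau>) (U (T + t)) (?k * M + ?k\<^sup>2 * norm a * (12 * D * \<tau> powr (-\<sigma>)))"
      unfolding Ueq by (rule w) (use \<tau> in simp)
    then have "sbound (t + \<tau>) (U (T + t)) (B / 2)"
      by (rule sbound_mono) (use \<tau>(2) in \<open>simp add: B_def mult_ac\<close>)
    from sboundD(4)[OF this, of x] show ?thesis by (simp add: q_def)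
  qed
  have good: "\<bar>U (T + t) x\<bar> \<le> q t" if "0 \<le> t" for t x
  proof (rule ccontr)
    assume bad: "\<not> \<bar>U (T + t) x\<bar> \<le> q t"
    \<comment> \<open>The times of violation. Strictly before the infimum q holds, so at the infimum
      q/2 holds, and the modulus C sqrt(t - t0) keeps the solution below q a little longer.\<close>
    define S where "S = {t. 0 \<le> t \<and> (\<exists>x. \<bar>U (T + t) x\<bar> > q t)}"
    have "t \<in> S" using bad that by (auto simp: S_def not_le)
    then have Sne: "S \<noteq> {}" by blast
    have Sbdd: "bdd_below S" by (rule bdd_belowI[of _ 0]) (simp add: S_def)
    define t0 where "t0 = Inf S"
    have t0: "0 \<le> t0" unfolding t0_def by (rule cInf_greatest[OF Sne]) (auto simp: S_def)
    have below: "\<bar>U (T + s) x\<bar> \<le> q s" if "0 \<le> s" "s < t0" for s x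
    proof (rule ccontr)
      assume "\<not> \<bar>U (T + s) x\<bar> \<le> q s"
      then have "s \<in> S" using that by (auto simp: S_def not_le)
      then show False using cInf_lower[OF _ Sbdd, of s] that by (simp add: t0_def)
    qed
    have at0: "\<bar>U (T + t0) x\<bar> \<le> q t0 / 2" for x by (rule improve[OF t0 below])
    have "((\<lambda>t. q t - C * sqrt (t - t0)) \<longlongrightarrow> q t0 - C * sqrt (t0 - t0)) (at_right t0)"
      unfolding q_def using t0 \<tau> by (intro tendsto_intros) auto
    then have "\<forall>\<^sub>F t in at_right t0. q t0 / 2 < q t - C * sqrt (t - t0)"
      using q0[OF t0] by (intro order_tendstoD(1)) auto
    then obtain b where b: "t0 < b" "\<And>t. t0 < t \<Longrightarrow> t < b \<Longrightarrow> q t0 / 2 < q t - C * sqrt (t - t0)"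
      unfolding eventually_at_right_field by blast
    obtain t1 where t1: "t1 \<in> S" "t1 < min b (t0 + 1)"
      using cInf_lessD[OF Sne, of "min b (t0 + 1)"] b by (auto simp: t0_def)
    have "t0 \<le> t1" unfolding t0_def by (rule cInf_lower[OF t1(1) Sbdd])
    moreover have "t1 \<noteq> t0"
    proof
      assume "t1 = t0"
      then obtain x where "q t0 < \<bar>U (T + t0) x\<bar>" using t1(1) by (auto simp: S_def)
      then show False using at0[of x] q0[OF t0] by simp
    qed
    ultimately have gt: "t0 < t1" by simp
    obtain x where x: "q t1 < \<bar>U (T + t1) x\<bar>" using t1(1) by (auto simp: S_def)
    have "\<bar>U ((T + t0) + (t1 - t0)) x - U (T + t0) x\<bar> \<le> C * sqrt (t1 - t0)"
      using sboundD(4)[OF C(2)[of "T + t0" "t1 - t0"], of x] T t0 gt t1 by simp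
    then have "\<bar>U (T + t1) x\<bar> \<le> q t0 / 2 + C * sqrt (t1 - t0)" using at0[of x] by simp
    then show False using x b(2)[OF gt] t1 by simp
  qed
  show thesis by (rule that[OF T(1) \<tau>(1) _ good[unfolded q_def]]) (use BM M_pos in auto)
qed

lemma decay:
  obtains B where "0 < B" "\<And>t. 0 < t \<Longrightarrow> sbound t (U t) B"
proof -
  let ?e = "- real DIM('a) / 2"
  obtain T \<tau> B where T: "1 \<le> T" "1 \<le> \<tau>" "M \<le> B" "\<And>t x. 0 \<le> t \<Longrightarrow> \<bar>U (T + t) x\<bar> \<le> B * (t + \<tau>) powr ?e"
    using decay_after_small_time by blast
  have B0: "0 < B" using T(3) M_pos by simp
  \<comment> \<open>Returns to the unshifted time: for t > T, (t - T) + \<open>\<tau>\<close> >= t/T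
    because T and \<open>\<tau>\<close> are at least 1, and for t <= T the ratio t/T is at most
    1.\<close>
  define B' where "B' = B * T powr (real DIM('a) / 2)"
  have BB: "B \<le> B'" unfolding B'_def using B0 T(1) by (intro mult_le_cancel_left1[THEN iffD2]) (auto simp: ge_one_powr_ge_zero)
  show thesis
  proof
    show "0 < B'" using BB B0 by simp
    fix t :: real assume t: "0 < t"
    have sc: "B * (t / T) powr ?e = B' * t powr ?e"
      using t T by (simp add: B'_def powr_divide powr_minus divide_simps)
    show "sbound t (U t) B'"
    proof (rule sboundI)
      show "(\<integral>\<^sup>+x. ennreal \<bar>U t x\<bar> \<partial>lborel) \<le> ennreal B'"
        by (rule order_trans[OF sboundD(3)[OF U_sbound[OF t]] ennreal_leI]) (use T BB in auto)
      fix x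
      have "\<bar>U t x\<bar> \<le> B * (t / T) powr ?e"
      proof (cases "t \<le> T")
        case True
        have "1 powr ?e \<le> (t / T) powr ?e" using t T True by (intro powr_mono2') auto
        then have "M * 1 \<le> B * (t / T) powr ?e" using T M_pos by (intro mult_mono) auto
        then show ?thesis using U_le[OF t, of x] by simp
      next
        case False
        have "0 \<le> (t - T) * (1 - 1 / T)" using False T by (intro mult_nonneg_nonneg) auto
        then have "t / T \<le> (t - T) + \<tau>" using T(1,2) by (simp add: algebra_simps diff_divide_distrib)
        then have "((t - T) + \<tau>) powr ?e \<le> (t / T) powr ?e" using t T by (intro powr_mono2') auto
        then have "B * ((t - T) + \<tau>) powr ?e \<le> B * (t / T) powr ?e" using B0 by (intro mult_left_mono) auto
        then show ?thesis using T(4)[of "t - T" x] False by simp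
      qed
      then show "\<bar>U t x\<bar> \<le> B' * t powr ?e" using sc by simp
    qed (use BB B0 in auto)
  qed
qed

end


section \<open>Asymptotic expansion\<close>

text \<open>The upper limit is a function of t in order to serve both Duhamel terms of
  \<open>A0k\<close>, whose upper limits are 1 and t.\<close>

lemma duhamel_measurable:
  fixes F :: "real \<Rightarrow> 'a::euclidean_space \<Rightarrow> real"
  assumes [measurable]: "case_prod F \<in> borel_measurable (borel \<Otimes>\<^sub>M borel)" "f \<in> borel_measurable borel" "b \<in> borel_measurable borel"
  shows "(\<lambda>(t, x). duhamel a f F t0 (b t) t x) \<in> borel_measurable (borel \<Otimes>\<^sub>M borel)"
proof -
  have "(\<lambda>(t, x). \<integral>s. (if t0 \<le> s \<and> s \<le> b t then gradheat a (t - s) (\<lambda>y. f (F s y)) x else 0) \<partial>lborel) \<in> borel_measurable (borel \<Otimes>\<^sub>M borel)"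
    unfolding gradheat_def by measurable
  moreover have "(\<lambda>(t, x). \<integral>s. (if t0 \<le> s \<and> s \<le> b t then gradheat a (t - s) (\<lambda>y. f (F s y)) x else 0) \<partial>lborel) = (\<lambda>(t, x). duhamel a f F t0 (b t) t x)"
    unfolding duhamel_def set_lebesgue_integral_def
    by (auto simp: fun_eq_iff indicator_def intro!: Bochner_Integration.integral_cong)
  ultimately show ?thesis by simp
qed

lemma A0k_measurable:
  fixes u0 :: "'a::euclidean_space \<Rightarrow> real"
  assumes [measurable]: "f \<in> borel_measurable borel"
  shows "case_prod (A0k a f u0 j) \<in> borel_measurable (borel \<Otimes>\<^sub>M borel)"
proof (induction j)
  case 0
  show ?case by (simp add: A0_def)
next
  case (Suc j)
  note [measurable] = Suc
  have A[measurable]: "case_prod (A0 u0) \<in> borel_measurable (borel \<Otimes>\<^sub>M borel)" unfolding A0_def by measurable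
  have [measurable]: "(\<lambda>(t, x). duhamel a f (A0 u0) 0 1 t x) \<in> borel_measurable (borel \<Otimes>\<^sub>M borel)"
    using duhamel_measurable[OF A assms, of "\<lambda>_. 1" a 0] by simp
  have [measurable]: "(\<lambda>(t, x). duhamel a f (A0k a f u0 j) 1 t t x) \<in> borel_measurable (borel \<Otimes>\<^sub>M borel)"
    using duhamel_measurable[OF Suc assms, of "\<lambda>t. t" a 1] by simp
  show ?case by simp
qed

lemma sbound_heatG:
  assumes "0 < t"
  shows "sbound t (heatG t :: 'a::euclidean_space \<Rightarrow> real) 1"
  by (rule sboundI) (use assms heatG_le[OF assms, where 'a='a] nn_integral_heatG[OF assms, where 'a='a] in auto)

lemma sbound_dheatG:
  fixes a :: "'a::euclidean_space"
  assumes t: "0 < t"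
  shows "sbound t (dheatG a t) (gauss_const TYPE('a) * norm a * t powr (-1/2))"
proof -
  let ?c = "gauss_const TYPE('a) * norm a * t powr (-1/2)"
  have c0: "0 \<le> ?c" using gauss_const_ge[where 'a='a] by simp
  have "sbound (2*t) (\<lambda>x. ?c * heatG (2*t) (x::'a)) (\<bar>?c\<bar> * 1)" using t by (intro sbound_cmult sbound_heatG) auto
  then have "sbound t (\<lambda>x. ?c * heatG (2*t) (x::'a)) (\<bar>?c\<bar> * 1)" by (rule sbound_time) (use t in auto)
  then have "sbound t (dheatG a t) (\<bar>?c\<bar> * 1)" by (rule sbound_dom) (use abs_dheatG_le[OF t, of a] in auto)
  then show ?thesis by (simp only: abs_of_nonneg[OF c0] mult_1_right)
qed

text \<open>The error is the integral of (K(x - y) - K(x)) \<open>\<phi>\<close>(y), so a Lipschitz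
  bound on K costs one first moment. The Gaussian at x factors out; the one at x - y produces the
  heat flow of |y| |\<open>\<phi>\<close>(y)|.\<close>

lemma sbound_moment_expansion:
  fixes K \<phi> :: "'a::euclidean_space \<Rightarrow> real"
  assumes K[measurable]: "K \<in> borel_measurable borel" and B: "\<And>z. \<bar>K z\<bar> \<le> B" and r: "0 < r" and c: "0 \<le> c"
    and d: "\<And>x y. \<bar>K (x - y) - K x\<bar> \<le> c * norm y * (heatG r x + heatG r (x - y))"
    and \<phi>: "integrable lborel \<phi>" and \<mu>: "0 \<le> \<mu>" "moment \<phi> \<le> ennreal \<mu>"
  shows "sbound r (\<lambda>x. (\<integral>y. K (x - y) * \<phi> y \<partial>lborel) - mass \<phi> * K x) (2 * c * \<mu>)"
proof -
  have [measurable]: "\<phi> \<in> borel_measurable borel" using \<phi> by auto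
  define \<eta> where "\<eta> = (\<lambda>y. norm y * \<bar>\<phi> y\<bar>)"
  have \<eta>m[measurable]: "\<eta> \<in> borel_measurable borel" unfolding \<eta>_def by measurable
  have \<eta>L: "(\<integral>\<^sup>+y. ennreal \<bar>\<eta> y\<bar> \<partial>lborel) \<le> ennreal \<mu>" using \<mu>(2) by (simp add: \<eta>_def moment_def abs_mult)
  have \<eta>i: "integrable lborel \<eta>"
    by (rule integrableI_bounded) (use \<eta>L in \<open>auto intro: le_less_trans\<close>)
  have \<eta>I: "(\<integral>y. \<eta> y \<partial>lborel) \<le> \<mu>"
  proof -
    have "(\<integral>y. \<bar>\<eta> y\<bar> \<partial>lborel) \<le> \<mu>" by (rule integral_abs_le[OF \<eta>L \<mu>(1)])
    then show ?thesis by (simp add: \<eta>_def abs_mult)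
  qed
  have i1: "integrable lborel (\<lambda>y. K (x - y) * \<phi> y)" for x by (rule integrable_bounded_mult[OF _ B \<phi>]) measurable
  have dom: "\<bar>(\<integral>y. K (x - y) * \<phi> y \<partial>lborel) - mass \<phi> * K x\<bar> \<le> c * (\<mu> * heatG r x + heat r \<eta> x)" for x
  proof -
    have e: "(\<integral>y. K (x - y) * \<phi> y \<partial>lborel) - mass \<phi> * K x = (\<integral>y. K (x - y) * \<phi> y - K x * \<phi> y \<partial>lborel)"
      using i1[of x] \<phi> by (simp add: mass_def mult.commute)
    have "\<bar>\<integral>y. K (x - y) * \<phi> y - K x * \<phi> y \<partial>lborel\<bar> \<le> (\<integral>y. \<bar>K (x - y) * \<phi> y - K x * \<phi> y\<bar> \<partial>lborel)"
      by (rule integral_abs_bound)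
    also have "\<dots> \<le> (\<integral>y. c * (heatG r x * \<eta> y + heatG r (x - y) * \<eta> y) \<partial>lborel)"
    proof (rule integral_mono)
      show "integrable lborel (\<lambda>y. \<bar>K (x - y) * \<phi> y - K x * \<phi> y\<bar>)" using i1[of x] \<phi> by auto
      show "integrable lborel (\<lambda>y. c * (heatG r x * \<eta> y + heatG r (x - y) * \<eta> y))"
        using integrable_heatG_mult[OF r \<eta>i, of x] \<eta>i by auto
      fix y
      have "\<bar>K (x - y) - K x\<bar> * \<bar>\<phi> y\<bar> \<le> c * norm y * (heatG r x + heatG r (x - y)) * \<bar>\<phi> y\<bar>"
        by (intro mult_right_mono d) auto
      then show "\<bar>K (x - y) * \<phi> y - K x * \<phi> y\<bar> \<le> c * (heatG r x * \<eta> y + heatG r (x - y) * \<eta> y)"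
        unfolding left_diff_distrib[symmetric] abs_mult \<eta>_def by (simp add: algebra_simps)
    qed
    also have "\<dots> = c * (heatG r x * (\<integral>y. \<eta> y \<partial>lborel) + heat r \<eta> x)"
      unfolding heat_def using integrable_heatG_mult[OF r \<eta>i, of x] \<eta>i by simp
    also have "\<dots> \<le> c * (heatG r x * \<mu> + heat r \<eta> x)" using c \<eta>I by (intro mult_left_mono add_mono) auto
    finally show ?thesis unfolding e by (simp add: mult.commute)
  qed
  have "sbound r (\<lambda>x. c * (\<mu> * heatG r x + heat r \<eta> x)) (\<bar>c\<bar> * (\<bar>\<mu>\<bar> * 1 + \<mu>))"
    by (intro sbound_cmult sbound_add sbound_heatG sbound_heat_L1 r \<eta>m \<eta>L \<mu>(1))
  then have "sbound r (\<lambda>x. (\<integral>y. K (x - y) * \<phi> y \<partial>lborel) - mass \<phi> * K x) (\<bar>c\<bar> * (\<bar>\<mu>\<bar> * 1 + \<mu>))"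
    by (rule sbound_dom) (use dom in auto)
  then show ?thesis using c \<mu>(1) by (simp add: algebra_simps)
qed

text \<open>The bookkeeping of exponents in one iteration; \<open>\<theta>\<close> < 1/2 makes the
  source integrable at s = 0. The constant 14 = 2 (1 + 6) is the one for the moment, shared with the
  L1 and sup bound, for which 6 arises.\<close>

lemma duhamel_power_bound:
  fixes h :: "real \<Rightarrow> 'a::euclidean_space \<Rightarrow> real"
  assumes h: "case_prod h \<in> borel_measurable (borel \<Otimes>\<^sub>M borel)"
    and \<theta>: "0 \<le> \<theta>" "\<theta> < 1/2" and E: "0 \<le> E" and t: "0 < t" "0 \<le> t0" "t1 \<le> t"
    and b: "\<And>s. t0 < s \<Longrightarrow> s < t1 \<Longrightarrow> sbound s (h s) (E * s powr (-1/2 - \<theta>))"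
  shows "sbound t (\<lambda>x. LINT s:{t0..t1}|lborel. gradheat a (t - s) (h s) x) ((gauss_const TYPE('a))\<^sup>2 * norm a * (14 / (1/2 - \<theta>)) * E * t powr (-\<theta>))"
    and "set_integrable lborel {t0..t1} (\<lambda>s. gradheat a (t - s) (h s) x)"
    and "(\<And>s. t0 < s \<Longrightarrow> s < t1 \<Longrightarrow> moment (h s) \<le> ennreal (E * s powr (-\<theta>))) \<Longrightarrow>
      moment (\<lambda>x. LINT s:{t0..t1}|lborel. gradheat a (t - s) (h s) x) \<le> ennreal ((gauss_const TYPE('a))\<^sup>2 * norm a * (14 / (1/2 - \<theta>)) * E * t powr (1/2 - \<theta>))"
proof -
  let ?c = "(gauss_const TYPE('a))\<^sup>2 * norm a"
  have e: "-1/2 - \<theta> = - (1/2 + \<theta>)" by simp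
  have I: "(\<integral>\<^sup>+s\<in>{t0<..<t1}. ennreal ((t - s) powr (-1/2) * (E * s powr (-1/2 - \<theta>))) \<partial>lborel) \<le> ennreal (E * (6 / (1/2 - \<theta>) * t powr (-\<theta>)))"
  proof -
    have "(\<integral>\<^sup>+s\<in>{t0<..<t1}. ennreal ((t - s) powr (-1/2) * (E * s powr (-1/2 - \<theta>))) \<partial>lborel)
      \<le> (\<integral>\<^sup>+s\<in>{0<..<t}. ennreal ((t - s) powr (-1/2) * (E * s powr (-(1/2 + \<theta>)))) \<partial>lborel)"
      unfolding e using t by (intro nn_integral_mono) (auto simp: indicator_def)
    also have "\<dots> \<le> ennreal (E * (6 / (1 - (1/2 + \<theta>)) * t powr (1/2 - (1/2 + \<theta>))))"
      by (rule nn_integral_beta_cmult) (use \<theta> E t in auto)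
    finally show ?thesis by simp
  qed
  have I0: "0 \<le> E * (6 / (1/2 - \<theta>) * t powr (-\<theta>))" using E \<theta> by simp
  have b0: "sbound (s + 0) (h s) (E * s powr (-1/2 - \<theta>))" if "t0 < s" "s < t1" for s using b[OF that] by simp
  note * = sbound_duhamel[OF h _ _ t(2,3) b0 I0 I, of a]
  have "sbound (t + 0) (\<lambda>x. LINT s:{t0..t1}|lborel. gradheat a (t - s) (h s) x) (?c * (E * (6 / (1/2 - \<theta>) * t powr (-\<theta>))))"
    by (rule *(1)) auto
  then have "sbound t (\<lambda>x. LINT s:{t0..t1}|lborel. gradheat a (t - s) (h s) x) (?c * (E * (6 / (1/2 - \<theta>) * t powr (-\<theta>))))" by simp
  then show "sbound t (\<lambda>x. LINT s:{t0..t1}|lborel. gradheat a (t - s) (h s) x) (?c * (14 / (1/2 - \<theta>)) * E * t powr (-\<theta>))"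
  proof (rule sbound_mono)
    have "?c * (E * (6 / (1/2 - \<theta>) * t powr (-\<theta>))) \<le> ?c * (E * (14 / (1/2 - \<theta>) * t powr (-\<theta>)))"
      using E \<theta> by (intro mult_left_mono mult_right_mono divide_right_mono) auto
    then show "?c * (E * (6 / (1/2 - \<theta>) * t powr (-\<theta>))) \<le> ?c * (14 / (1/2 - \<theta>)) * E * t powr (-\<theta>)" by (simp only: mult_ac)
  qed
  show "set_integrable lborel {t0..t1} (\<lambda>s. gradheat a (t - s) (h s) x)" by (rule *(2)) auto
  assume m: "\<And>s. t0 < s \<Longrightarrow> s < t1 \<Longrightarrow> moment (h s) \<le> ennreal (E * s powr (-\<theta>))"
  have I1: "(\<integral>\<^sup>+s\<in>{t0<..<t1}. ennreal (E * s powr (-1/2 - \<theta>)) \<partial>lborel) \<le> ennreal (E * (1 / (1/2 - \<theta>) * t powr (1/2 - \<theta>)))"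
  proof -
    have "(\<integral>\<^sup>+s\<in>{t0<..<t1}. ennreal (E * s powr (-1/2 - \<theta>)) \<partial>lborel) \<le> (\<integral>\<^sup>+s. ennreal E * (ennreal (s powr (-(1/2 + \<theta>))) * indicator {0<..<t} s) \<partial>lborel)"
      unfolding e using t E by (intro nn_integral_mono) (auto simp: indicator_def ennreal_mult)
    also have "\<dots> = ennreal E * (\<integral>\<^sup>+s\<in>{0<..<t}. ennreal (s powr (-(1/2 + \<theta>))) \<partial>lborel)" by (intro nn_integral_cmult) measurable
    also have "\<dots> \<le> ennreal E * ennreal (t powr (1 - (1/2 + \<theta>)) / (1 - (1/2 + \<theta>)))"
      by (intro mult_left_mono nn_integral_powr_from_0) (use \<theta> t in auto)
    also have "\<dots> = ennreal (E * (1 / (1/2 - \<theta>) * t powr (1/2 - \<theta>)))" using E \<theta> by (subst ennreal_mult[symmetric]) auto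
    finally show ?thesis .
  qed
  have J1: "(\<integral>\<^sup>+s\<in>{t0<..<t1}. ennreal ((t - s) powr (-1/2) * (E * s powr (-\<theta>))) \<partial>lborel) \<le> ennreal (E * (6 / (1/2 - \<theta>) * t powr (1/2 - \<theta>)))"
  proof -
    have "(\<integral>\<^sup>+s\<in>{t0<..<t1}. ennreal ((t - s) powr (-1/2) * (E * s powr (-\<theta>))) \<partial>lborel)
      \<le> (\<integral>\<^sup>+s\<in>{0<..<t}. ennreal ((t - s) powr (-1/2) * (E * s powr (-\<theta>))) \<partial>lborel)"
      using t by (intro nn_integral_mono) (auto simp: indicator_def)
    also have "\<dots> \<le> ennreal (E * (6 / (1 - \<theta>) * t powr (1/2 - \<theta>)))"
      by (rule nn_integral_beta_cmult) (use \<theta> E t in auto)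
    also have "\<dots> \<le> ennreal (E * (6 / (1/2 - \<theta>) * t powr (1/2 - \<theta>)))"
      using E \<theta> by (intro ennreal_leI mult_left_mono mult_right_mono divide_left_mono) auto
    finally show ?thesis .
  qed
  have "moment (\<lambda>x. LINT s:{t0..t1}|lborel. gradheat a (t - s) (h s) x) \<le>
    ennreal (2 * (gauss_const TYPE('a))\<^sup>2 * norm a * (E * (1 / (1/2 - \<theta>) * t powr (1/2 - \<theta>)) + E * (6 / (1/2 - \<theta>) * t powr (1/2 - \<theta>))))"
    by (rule moment_duhamel[OF h _ _ t(3) _ _ _ I1 _ J1]) (use b m E \<theta> in \<open>auto dest: sboundD(3)\<close>)
  also have "2 * (gauss_const TYPE('a))\<^sup>2 * norm a * (E * (1 / (1/2 - \<theta>) * t powr (1/2 - \<theta>)) + E * (6 / (1/2 - \<theta>) * t powr (1/2 - \<theta>)))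
    = ?c * (14 / (1/2 - \<theta>)) * E * t powr (1/2 - \<theta>)"
  proof -
    have "2 * A * (E * (1 / q * P) + E * (6 / q * P)) = A * (14 / q) * E * P" for A q P :: real
      by (simp add: algebra_simps)
    from this[of ?c "1/2 - \<theta>" "t powr (1/2 - \<theta>)"] show ?thesis by (simp only: mult.assoc)
  qed
  finally show "moment (\<lambda>x. LINT s:{t0..t1}|lborel. gradheat a (t - s) (h s) x) \<le> ennreal (?c * (14 / (1/2 - \<theta>)) * E * t powr (1/2 - \<theta>))" .
qed

lemma set_integral_gradheat_diff:
  fixes h g :: "real \<Rightarrow> 'a::euclidean_space \<Rightarrow> real"
  assumes [measurable]: "case_prod h \<in> borel_measurable (borel \<Otimes>\<^sub>M borel)" "case_prod g \<in> borel_measurable (borel \<Otimes>\<^sub>M borel)"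
    and t: "t1 \<le> t"
    and i: "\<And>s. t0 < s \<Longrightarrow> s < t1 \<Longrightarrow> integrable lborel (h s)" "\<And>s. t0 < s \<Longrightarrow> s < t1 \<Longrightarrow> integrable lborel (g s)"
    and si: "set_integrable lborel {t0..t1} (\<lambda>s. gradheat a (t - s) (h s) x)" "set_integrable lborel {t0..t1} (\<lambda>s. gradheat a (t - s) (g s) x)"
  shows "(LINT s:{t0..t1}|lborel. gradheat a (t - s) (h s) x) - (LINT s:{t0..t1}|lborel. gradheat a (t - s) (g s) x)
    = (LINT s:{t0..t1}|lborel. gradheat a (t - s) (\<lambda>y. h s y - g s y) x)"
proof -
  have "(LINT s:{t0..t1}|lborel. gradheat a (t - s) (h s) x) - (LINT s:{t0..t1}|lborel. gradheat a (t - s) (g s) x)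
     = (LINT s:{t0..t1}|lborel. gradheat a (t - s) (h s) x - gradheat a (t - s) (g s) x)"
    by (rule set_integral_diff(2)[symmetric, OF si])
  also have "\<dots> = (LINT s:{t0<..<t1}|lborel. gradheat a (t - s) (h s) x - gradheat a (t - s) (g s) x)"
    by (rule set_integral_closed_open) (simp add: gradheat_def)
  also have "\<dots> = (LINT s:{t0<..<t1}|lborel. gradheat a (t - s) (\<lambda>y. h s y - g s y) x)"
    by (rule set_lebesgue_integral_cong) (use i t in \<open>auto simp: gradheat_diff\<close>)
  also have "\<dots> = (LINT s:{t0..t1}|lborel. gradheat a (t - s) (\<lambda>y. h s y - g s y) x)"
    by (rule set_integral_closed_open[symmetric]) (simp add: gradheat_def)
  finally show ?thesis .
qed

lemma set_integral_split:
  fixes g :: "real \<Rightarrow> real"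
  assumes "g \<in> borel_measurable borel" "t0 \<le> t1" "t1 \<le> t2" "set_integrable lborel {t0..t1} g" "set_integrable lborel {t1..t2} g"
  shows "(LINT s:{t0..t2}|lborel. g s) = (LINT s:{t0..t1}|lborel. g s) + (LINT s:{t1..t2}|lborel. g s)"
proof -
  have u: "{t0..t2} = {t0..t1} \<union> {t1<..t2}" using assms by auto
  have "(LINT s:{t0..t2}|lborel. g s) = (LINT s:{t0..t1}|lborel. g s) + (LINT s:{t1<..t2}|lborel. g s)"
    unfolding u by (rule set_integral_Un) (auto intro: set_integrable_subset[OF assms(5)] assms(4))
  also have "(LINT s:{t1<..t2}|lborel. g s) = (LINT s:{t1..t2}|lborel. g s)"
    unfolding set_lebesgue_integral_def
    by (rule integral_cong_AE) (use AE_lborel_singleton[of t1] assms(1) in \<open>auto simp: indicator_def\<close>)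
  finally show ?thesis .
qed


text \<open>Lets a single Duhamel term be treated as a difference to the zero curve.\<close>

lemma duhamel_zero: "f 0 = 0 \<Longrightarrow> duhamel a f (\<lambda>_ _. 0) t0 t1 t x = 0"
  by (simp add: duhamel_def gradheat_def set_lebesgue_integral_def)

lemma duhamel_split:
  fixes F :: "real \<Rightarrow> 'a::euclidean_space \<Rightarrow> real"
  assumes [measurable]: "case_prod F \<in> borel_measurable (borel \<Otimes>\<^sub>M borel)" "f \<in> borel_measurable borel"
    and "t0 \<le> t1" "t1 \<le> t2" "set_integrable lborel {t0..t1} (\<lambda>s. gradheat a (t - s) (\<lambda>y. f (F s y)) x)"
    "set_integrable lborel {t1..t2} (\<lambda>s. gradheat a (t - s) (\<lambda>y. f (F s y)) x)"
  shows "duhamel a f F t0 t2 t x = duhamel a f F t0 t1 t x + duhamel a f F t1 t2 t x"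
  unfolding duhamel_def by (rule set_integral_split) (use assms in \<open>auto simp: gradheat_def\<close>)

text \<open>When the source is integrable in time, what remains is the kernel decay t^(-1/2): J
  controls the first half of (0, t), and N/t the second half, where the kernel is singular.\<close>

lemma duhamel_integrable_bound:
  fixes h :: "real \<Rightarrow> 'a::euclidean_space \<Rightarrow> real"
  assumes h: "case_prod h \<in> borel_measurable (borel \<Otimes>\<^sub>M borel)"
    and \<psi>[measurable]: "\<psi> \<in> borel_measurable borel" and t: "0 < t" "0 \<le> t0" "t1 \<le> t"
    and b: "\<And>s. t0 < s \<Longrightarrow> s < t1 \<Longrightarrow> sbound s (h s) (\<psi> s)"
    and J: "0 \<le> J" "(\<integral>\<^sup>+s\<in>{t0<..<t1}. ennreal (\<psi> s) \<partial>lborel) \<le> ennreal J"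
    and N: "0 \<le> N" "\<And>s. t0 < s \<Longrightarrow> s < t1 \<Longrightarrow> t / 2 \<le> s \<Longrightarrow> \<psi> s \<le> N / t"
  shows "sbound t (\<lambda>x. LINT s:{t0..t1}|lborel. gradheat a (t - s) (h s) x) ((gauss_const TYPE('a))\<^sup>2 * norm a * (2 * J + 2 * N) * t powr (-1/2))"
proof -
  \<comment> \<open>Extended by 0, to apply the estimate on all of (0, t).\<close>
  define \<psi>' where "\<psi>' = (\<lambda>s. if t0 < s \<and> s < t1 then \<psi> s else 0)"
  have [measurable]: "\<psi>' \<in> borel_measurable borel" unfolding \<psi>'_def by measurable
  have "(\<integral>\<^sup>+s\<in>{t0<..<t1}. ennreal ((t - s) powr (-1/2) * \<psi> s) \<partial>lborel) \<le> (\<integral>\<^sup>+s\<in>{0<..<t}. ennreal ((t - s) powr (-1/2) * \<psi>' s) \<partial>lborel)"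
    using t by (intro nn_integral_mono) (auto simp: indicator_def \<psi>'_def)
  also have "\<dots> \<le> ennreal (2 * t powr (-1/2) * J + 2 * t powr (1/2) * (N / t))"
  proof (rule nn_integral_singular_split[OF t(1)])
    have "(\<integral>\<^sup>+s\<in>{0<..<t/2}. ennreal (\<psi>' s) \<partial>lborel) \<le> (\<integral>\<^sup>+s\<in>{t0<..<t1}. ennreal (\<psi> s) \<partial>lborel)"
      by (intro nn_integral_mono) (auto simp: indicator_def \<psi>'_def)
    then show "(\<integral>\<^sup>+s\<in>{0<..<t/2}. ennreal (\<psi>' s) \<partial>lborel) \<le> ennreal J" using J(2) by (rule order_trans)
    show "\<psi>' s \<le> N / t" if "t / 2 \<le> s" "s < t" for s using N that t by (auto simp: \<psi>'_def)
  qed (use J N t in auto)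
  also have "2 * t powr (-1/2) * J + 2 * t powr (1/2) * (N / t) = (2 * J + 2 * N) * t powr (-1/2)"
  proof -
    have "t powr (1/2) / t = t powr (1/2 - 1)" using t powr_diff[of t "1/2" 1] by simp
    then have "t powr (1/2) / t = t powr (-1/2)" by simp
    then have "2 * t powr (1/2) * (N / t) = 2 * N * t powr (-1/2)" by (metis (no_types) mult.assoc mult.commute times_divide_eq_left times_divide_eq_right)
    then show ?thesis by (simp only: distrib_right distrib_left mult_ac)
  qed
  finally have I: "(\<integral>\<^sup>+s\<in>{t0<..<t1}. ennreal ((t - s) powr (-1/2) * \<psi> s) \<partial>lborel) \<le> ennreal ((2 * J + 2 * N) * t powr (-1/2))" .
  have "sbound (t + 0) (\<lambda>x. LINT s:{t0..t1}|lborel. gradheat a (t - s) (h s) x) ((gauss_const TYPE('a))\<^sup>2 * norm a * ((2 * J + 2 * N) * t powr (-1/2)))"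
    by (rule sbound_duhamel(1)[OF h _ _ t(2,3) _ _ I]) (use b J N in auto)
  then show ?thesis by (simp only: add_0_right mult.assoc)
qed

context power_flux
begin

lemma moment_flux_diff:
  fixes \<phi> \<psi> :: "'a::euclidean_space \<Rightarrow> real"
  assumes \<theta>: "0 < \<theta>" and K: "0 \<le> K" and \<phi>: "\<And>x. \<bar>\<phi> x\<bar> \<le> K * \<theta> powr (-d)" and \<psi>: "\<And>x. \<bar>\<psi> x\<bar> \<le> K * \<theta> powr (-d)"
    and [measurable]: "\<phi> \<in> borel_measurable borel" "\<psi> \<in> borel_measurable borel"
    and m: "0 \<le> m" "moment (\<lambda>x. \<phi> x - \<psi> x) \<le> ennreal m"
  shows "moment (\<lambda>x. f (\<phi> x) - f (\<psi> x)) \<le> ennreal (2 * Cf * K powr (p - 1) * \<theta> powr (-1/2 - \<sigma>) * m)"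
proof -
  let ?c = "2 * Cf * K powr (p - 1) * \<theta> powr (-1/2 - \<sigma>)"
  have c0: "0 \<le> ?c" using Cf_nonneg by simp
  have "moment (\<lambda>x. f (\<phi> x) - f (\<psi> x)) \<le> moment (\<lambda>x. ?c * (\<phi> x - \<psi> x))"
  proof (rule moment_dom)
    fix x
    have "\<bar>f (\<phi> x) - f (\<psi> x)\<bar> \<le> ?c * \<bar>\<phi> x - \<psi> x\<bar>" by (rule flux_diff_le[OF \<theta> K \<phi> \<psi>])
    then show "\<bar>f (\<phi> x) - f (\<psi> x)\<bar> \<le> \<bar>?c * (\<phi> x - \<psi> x)\<bar>" by (simp only: abs_mult[of ?c] abs_of_nonneg[OF c0])
  qed
  also have "\<dots> = ennreal ?c * moment (\<lambda>x. \<phi> x - \<psi> x)" by (rule moment_cmult[OF _ c0]) measurable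
  also have "\<dots> \<le> ennreal ?c * ennreal m" by (intro mult_left_mono m) auto
  also have "\<dots> = ennreal (?c * m)" using c0 m by (simp only: ennreal_mult)
  finally show ?thesis .
qed

text \<open>The flux multiplies a difference by s^(-1/2 - \<open>\<sigma>\<close>). By parabolic
  scaling the moment exceeds the L1 norm by s^(1/2), both before and after.\<close>

lemma flux_of_bounded_curves:
  fixes \<phi> \<psi> :: "'a::euclidean_space \<Rightarrow> real"
  assumes d: "d = real DIM('a) / 2" and s: "0 < s"
    and F: "sbound s (\<phi>) K" and G: "sbound s (\<psi>) K"
    and R: "sbound s (\<lambda>x. \<phi> x - \<psi> x) (R * s powr (-\<theta>'))"
  shows "sbound s (\<lambda>x. f (\<phi> x) - f (\<psi> x)) (2 * Cf * K powr (p - 1) * R * s powr (-1/2 - (\<sigma> + \<theta>')))"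
    and "0 \<le> R \<Longrightarrow> moment (\<lambda>x. \<phi> x - \<psi> x) \<le> ennreal (R * s powr (1/2 - \<theta>')) \<Longrightarrow>
      moment (\<lambda>x. f (\<phi> x) - f (\<psi> x)) \<le> ennreal (2 * Cf * K powr (p - 1) * R * s powr (- (\<sigma> + \<theta>')))"
proof -
  have b: "\<bar>\<phi> x\<bar> \<le> K * s powr (-d)" "\<bar>\<psi> x\<bar> \<le> K * s powr (-d)" for x
    using sboundD(4)[OF F, of x] sboundD(4)[OF G, of x] unfolding d by simp_all
  have e1: "s powr (-1/2 - \<sigma>) * s powr (-\<theta>') = s powr (-1/2 - (\<sigma> + \<theta>'))"
    using powr_add[of s "-1/2 - \<sigma>" "-\<theta>'"] by (simp add: diff_diff_eq)
  have e2: "s powr (-1/2 - \<sigma>) * s powr (1/2 - \<theta>') = s powr (- (\<sigma> + \<theta>'))"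
  proof -
    have "(-1/2 - \<sigma>) + (1/2 - \<theta>') = - (\<sigma> + \<theta>')" by simp
    then show ?thesis by (metis powr_add)
  qed
  have "sbound s (\<lambda>x. f (\<phi> x) - f (\<psi> x)) (2 * Cf * K powr (p - 1) * s powr (-1/2 - \<sigma>) * (R * s powr (-\<theta>')))"
    by (rule sbound_flux_diff[OF d s sboundD(2)[OF F] b sboundD(1)[OF F] sboundD(1)[OF G] R])
  then show "sbound s (\<lambda>x. f (\<phi> x) - f (\<psi> x)) (2 * Cf * K powr (p - 1) * R * s powr (-1/2 - (\<sigma> + \<theta>')))"
    unfolding e1[symmetric] by (simp only: mult_ac)
  assume "0 \<le> R" and m: "moment (\<lambda>x. \<phi> x - \<psi> x) \<le> ennreal (R * s powr (1/2 - \<theta>'))"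
  then have "moment (\<lambda>x. f (\<phi> x) - f (\<psi> x)) \<le> ennreal (2 * Cf * K powr (p - 1) * s powr (-1/2 - \<sigma>) * (R * s powr (1/2 - \<theta>')))"
    by (intro moment_flux_diff[OF s sboundD(2)[OF F] b sboundD(1)[OF F] sboundD(1)[OF G] _ m]) simp
  then show "moment (\<lambda>x. f (\<phi> x) - f (\<psi> x)) \<le> ennreal (2 * Cf * K powr (p - 1) * R * s powr (- (\<sigma> + \<theta>')))"
    unfolding e2[symmetric] by (simp only: mult_ac)
qed

lemma duhamel_bounded_curve:
  fixes F :: "real \<Rightarrow> 'a::euclidean_space \<Rightarrow> real"
  assumes d: "d = real DIM('a) / 2"
    and [measurable]: "case_prod F \<in> borel_measurable (borel \<Otimes>\<^sub>M borel)"
    and t: "0 < t" "0 \<le> t0" "t1 \<le> t" and b: "\<And>s. t0 < s \<Longrightarrow> s < t1 \<Longrightarrow> sbound s (F s) K"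
  shows "set_integrable lborel {t0..t1} (\<lambda>s. gradheat a (t - s) (\<lambda>y. f (F s y)) x)"
proof (cases "t0 < t1")
  case True
  have K0: "0 \<le> K" using sboundD(2)[OF b[of "(t0 + t1) / 2"]] True by simp
  have m: "(\<lambda>(s, y). f (F s y)) \<in> borel_measurable (borel \<Otimes>\<^sub>M borel)" by measurable
  have b': "sbound s (\<lambda>y. f (F s y)) ((2 * Cf * K powr (p - 1) * K) * s powr (-1/2 - \<sigma>))" if "t0 < s" "s < t1" for s
    using sbound_flux[OF d _ b[OF that]] that t by (simp add: mult_ac)
  show ?thesis
    by (rule duhamel_power_bound(2)[where h="\<lambda>s y. f (F s y)", OF m _ \<sigma>_less _ t b']) (use \<sigma>_pos Cf_nonneg K0 in auto)
next
  case False
  have "(\<lambda>s. gradheat a (t - s) (\<lambda>y. f (F s y)) x) \<in> borel_measurable borel" by (simp add: gradheat_def)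
  from set_integral_closed_open(2)[OF this, of t0 t1] show ?thesis using False by (simp add: set_integrable_def)
qed

lemma duhamel_diff_eq:
  fixes F G :: "real \<Rightarrow> 'a::euclidean_space \<Rightarrow> real"
  assumes d: "d = real DIM('a) / 2"
    and Fm[measurable]: "case_prod F \<in> borel_measurable (borel \<Otimes>\<^sub>M borel)" and Gm[measurable]: "case_prod G \<in> borel_measurable (borel \<Otimes>\<^sub>M borel)"
    and t: "0 < t" "0 \<le> t0" "t1 \<le> t"
    and F: "\<And>s. t0 < s \<Longrightarrow> s < t1 \<Longrightarrow> sbound s (F s) K" and G: "\<And>s. t0 < s \<Longrightarrow> s < t1 \<Longrightarrow> sbound s (G s) K"
  shows "duhamel a f F t0 t1 t x - duhamel a f G t0 t1 t x = (LINT s:{t0..t1}|lborel. gradheat a (t - s) (\<lambda>y. f (F s y) - f (G s y)) x)"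
proof -
  have mF: "(\<lambda>(s, y). f (F s y)) \<in> borel_measurable (borel \<Otimes>\<^sub>M borel)" by measurable
  have mG: "(\<lambda>(s, y). f (G s y)) \<in> borel_measurable (borel \<Otimes>\<^sub>M borel)" by measurable
  show ?thesis unfolding duhamel_def
    by (rule set_integral_gradheat_diff[OF mF mG t(3) _ _ duhamel_bounded_curve[OF d Fm t F] duhamel_bounded_curve[OF d Gm t G]])
       (use t sbound_integrable[OF sbound_flux[OF d _ F]] sbound_integrable[OF sbound_flux[OF d _ G]] in auto)
qed

text \<open>One iteration raises the decay rate of a difference from \<open>\<theta>'\<close> to
  \<open>\<sigma>\<close> + \<open>\<theta>'\<close>. The constant Q enters through an equation so
  that it can be fixed before t.\<close>

lemma duhamel_diff_bound:
  fixes F G :: "real \<Rightarrow> 'a::euclidean_space \<Rightarrow> real"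
  assumes d: "d = real DIM('a) / 2"
    and Fm[measurable]: "case_prod F \<in> borel_measurable (borel \<Otimes>\<^sub>M borel)" and Gm[measurable]: "case_prod G \<in> borel_measurable (borel \<Otimes>\<^sub>M borel)"
    and t: "0 < t" "0 \<le> t0" "t1 \<le> t" and \<theta>: "0 \<le> \<theta>'" "\<sigma> + \<theta>' < 1/2" and R0: "0 \<le> R"
    and F: "\<And>s. t0 < s \<Longrightarrow> s < t1 \<Longrightarrow> sbound s (F s) K" and G: "\<And>s. t0 < s \<Longrightarrow> s < t1 \<Longrightarrow> sbound s (G s) K"
    and R: "\<And>s. t0 < s \<Longrightarrow> s < t1 \<Longrightarrow> sbound s (\<lambda>x. F s x - G s x) (R * s powr (-\<theta>'))"
    and Q: "Q = (gauss_const TYPE('a))\<^sup>2 * norm a * (14 / (1/2 - (\<sigma> + \<theta>'))) * (2 * Cf * K powr (p - 1) * R)"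
  shows "sbound t (\<lambda>x. duhamel a f F t0 t1 t x - duhamel a f G t0 t1 t x) (Q * t powr (- (\<sigma> + \<theta>')))"
    and "(\<And>s. t0 < s \<Longrightarrow> s < t1 \<Longrightarrow> moment (\<lambda>x. F s x - G s x) \<le> ennreal (R * s powr (1/2 - \<theta>'))) \<Longrightarrow>
      moment (\<lambda>x. duhamel a f F t0 t1 t x - duhamel a f G t0 t1 t x) \<le> ennreal (Q * t powr (1/2 - (\<sigma> + \<theta>')))"
proof -
  have m: "(\<lambda>(s, y). f (F s y) - f (G s y)) \<in> borel_measurable (borel \<Otimes>\<^sub>M borel)" by measurable
  have eq: "duhamel a f F t0 t1 t x - duhamel a f G t0 t1 t x = (LINT s:{t0..t1}|lborel. gradheat a (t - s) (\<lambda>y. f (F s y) - f (G s y)) x)" for x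
    by (rule duhamel_diff_eq[OF d Fm Gm t F G])
  have fl: "sbound s (\<lambda>x. f (F s x) - f (G s x)) (2 * Cf * K powr (p - 1) * R * s powr (-1/2 - (\<sigma> + \<theta>')))" if "t0 < s" "s < t1" for s
    by (rule flux_of_bounded_curves(1)[OF d _ F[OF that] G[OF that] R[OF that]]) (use that t in simp)
  note * = duhamel_power_bound[where h="\<lambda>s y. f (F s y) - f (G s y)", OF m _ \<theta>(2) _ t fl]
  show "sbound t (\<lambda>x. duhamel a f F t0 t1 t x - duhamel a f G t0 t1 t x) (Q * t powr (- (\<sigma> + \<theta>')))"
    unfolding eq Q by (rule *(1)) (use \<sigma>_pos \<theta> Cf_nonneg R0 t in auto)
  assume mom: "\<And>s. t0 < s \<Longrightarrow> s < t1 \<Longrightarrow> moment (\<lambda>x. F s x - G s x) \<le> ennreal (R * s powr (1/2 - \<theta>'))"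
  show "moment (\<lambda>x. duhamel a f F t0 t1 t x - duhamel a f G t0 t1 t x) \<le> ennreal (Q * t powr (1/2 - (\<sigma> + \<theta>')))"
    unfolding eq Q
  proof (rule *(3))
    show "moment (\<lambda>x. f (F s x) - f (G s x)) \<le> ennreal (2 * Cf * K powr (p - 1) * R * s powr (- (\<sigma> + \<theta>')))" if "t0 < s" "s < t1" for s
      by (rule flux_of_bounded_curves(2)[OF d _ F[OF that] G[OF that] R[OF that] R0 mom[OF that]]) (use that t in simp)
  qed (use \<sigma>_pos \<theta> Cf_nonneg R0 in auto)
qed

end


section \<open>The iterates and their increments\<close>

declare A0k.simps [simp del]

text \<open>\<open>\<sigma>_eq\<close> expresses the choice of p: k + 1 gains of
  \<open>\<sigma>\<close> add up to 1/2. The initial datum returns here, with a finite first moment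
  and Duhamel's formula from time 0.\<close>

locale convection_asymptotics = convection_solution a f U M L p \<sigma> Cf
  for a :: "'a::euclidean_space" and f U M L p \<sigma> Cf +
  fixes u0 :: "'a \<Rightarrow> real" and k :: nat
  assumes u0_integrable: "integrable lborel u0" and u0_moment: "moment u0 < \<infinity>"
    and k_pos: "0 < k" and \<sigma>_eq: "\<sigma> = 1 / (2 * (real k + 1))"
    and U_mild: "\<And>t x. 0 < t \<Longrightarrow> U t x = heat t u0 x + (LINT s:{0..t}|lborel. gradheat a (t - s) (\<lambda>y. f (U s y)) x)"
begin

abbreviation "A \<equiv> A0k a f u0"

lemma A_measurable [measurable]: "case_prod (A j) \<in> borel_measurable (borel \<Otimes>\<^sub>M borel)"
  by (rule A0k_measurable) measurable

lemma A_0: "A 0 = A0 u0"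
  by (simp add: fun_eq_iff A0k.simps)

lemma A0_sbound: assumes "0 < t" shows "sbound t (A 0 t) \<bar>mass u0\<bar>"
  using sbound_cmult[OF sbound_heatG[OF assms], of "mass u0"] unfolding A_0 A0_def[abs_def] by simp

lemma A0_moment: assumes t: "0 < t" shows "moment (A 0 t) \<le> ennreal (\<bar>mass u0\<bar> * gauss_const TYPE('a) * t powr (1/2))"
proof -
  have "moment (A 0 t) \<le> moment (\<lambda>x::'a. \<bar>mass u0\<bar> * heatG t x)"
    unfolding A_0 A0_def[abs_def] by (rule moment_dom) (simp add: abs_mult)
  also have "\<dots> = ennreal \<bar>mass u0\<bar> * moment (heatG t :: 'a \<Rightarrow> real)" by (rule moment_cmult) auto
  also have "\<dots> \<le> ennreal \<bar>mass u0\<bar> * ennreal (gauss_const TYPE('a) * sqrt t)" by (intro mult_left_mono moment_heatG t) auto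
  also have "\<dots> = ennreal (\<bar>mass u0\<bar> * gauss_const TYPE('a) * t powr (1/2))"
    using t gauss_const_ge[where 'a='a] by (simp add: ennreal_mult[symmetric] powr_half_sqrt mult_ac)
  finally show ?thesis .
qed

text \<open>Placing the whole mass of the datum at the origin costs its first moment times
  t^(-1/2).\<close>

lemma heat_minus_A0:
  obtains C where "0 \<le> C" "\<And>t. 0 < t \<Longrightarrow> sbound t (\<lambda>x. heat t u0 x - A 0 t x) (C * t powr (-1/2))"
proof -
  obtain \<mu> where \<mu>: "0 \<le> \<mu>" "moment u0 = ennreal \<mu>" using u0_moment by (cases "moment u0") auto
  define c where "c = exp 1 * (gauss_const TYPE('a))\<^sup>2"
  have c0: "0 \<le> c" by (simp add: c_def)
  show thesis
  proof
    show "0 \<le> 2 * c * \<mu>" using c0 \<mu> by simp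
    fix t :: real assume t: "0 < t"
    have "sbound (4*t) (\<lambda>x. (\<integral>y. heatG t (x - y) * u0 y \<partial>lborel) - mass u0 * heatG t x) (2 * (c * t powr (-1/2)) * \<mu>)"
      by (rule sbound_moment_expansion[OF _ abs_heatG_bound[OF t] _ _ _ u0_integrable])
         (use t c0 \<mu> heatG_diff_le[OF t, where 'a='a] in \<open>auto simp: c_def\<close>)
    then have "sbound t (\<lambda>x. (\<integral>y. heatG t (x - y) * u0 y \<partial>lborel) - mass u0 * heatG t x) (2 * (c * t powr (-1/2)) * \<mu>)"
      by (rule sbound_time) (use t in auto)
    then show "sbound t (\<lambda>x. heat t u0 x - A 0 t x) (2 * c * \<mu> * t powr (-1/2))"
      by (simp add: A_0 A0_def heat_def mult_ac)
  qed
qed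

text \<open>From (k + 1) \<open>\<sigma>\<close> = 1/2: up to j = k the rates stay below the
  borderline 1/2.\<close>

lemma rate_less: "j \<le> k \<Longrightarrow> real j * \<sigma> < 1/2"
  unfolding \<sigma>_eq using k_pos by (simp add: field_simps)

lemma rate_half_less: "j \<le> k \<Longrightarrow> (real j + 1/2) * \<sigma> < 1/2"
  unfolding \<sigma>_eq using k_pos by (simp add: field_simps)

lemma A_Suc: "A (Suc j) t x = A 0 t x + duhamel a f (A 0) 0 1 t x + duhamel a f (A j) 1 t t x"
  by (simp add: A_0 A0k.simps)

text \<open>For j = 0 the increment consists of Duhamel terms of A_0, compared with the zero curve.
  Afterwards the contributions of (0, 1) cancel, and each iteration adds \<open>\<sigma>\<close> to
  the rate; j < k keeps it at most k \<open>\<sigma>\<close> < 1/2. The moments are carried along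
  for the final correction.\<close>

lemma approximation_increments:
  assumes "j < k"
  shows "\<exists>C\<ge>0. (\<forall>t\<ge>1. sbound t (A j t) C \<and> sbound t (A (Suc j) t) C \<and>
     sbound t (\<lambda>x. A (Suc j) t x - A j t x) (C * t powr (- (real (Suc j) * \<sigma>))) \<and>
     moment (\<lambda>x. A (Suc j) t x - A j t x) \<le> ennreal (C * t powr (1/2 - real (Suc j) * \<sigma>)))"
  using assms
proof (induction j)
  case 0
  have zero: "case_prod (\<lambda>_ _. 0) \<in> borel_measurable (borel \<Otimes>\<^sub>M (borel :: 'a measure))" by simp
  define K where "K = \<bar>mass u0\<bar> * gauss_const TYPE('a)"
  have K: "\<bar>mass u0\<bar> \<le> K" "0 \<le> K" using gauss_const_ge[where 'a='a] by (auto simp: K_def intro!: mult_le_cancel_left1[THEN iffD2])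
  define Q where "Q = (gauss_const TYPE('a))\<^sup>2 * norm a * (14 / (1/2 - (\<sigma> + 0))) * (2 * Cf * K powr (p - 1) * K)"
  have Q0: "0 \<le> Q" using Cf_nonneg K \<sigma>_less by (simp add: Q_def)
  have bK: "sbound s (A 0 s) K" if "0 < s" for s by (rule sbound_mono[OF A0_sbound[OF that] K(1)])
  have z: "sbound s (\<lambda>_::'a. 0) K" for s using K by (intro sboundI) auto
  have b0: "sbound s (\<lambda>x. A 0 s x - 0) (K * s powr (-0))" if "0 < s" for s
    using bK[OF that] that by simp
  have 1: "sbound t (duhamel a f (A 0) t0 t1 t) (Q * t powr (-\<sigma>))" if t: "0 < t" "0 \<le> t0" "t1 \<le> t" for t t0 t1
  proof -
    have "sbound t (\<lambda>x. duhamel a f (A 0) t0 t1 t x - duhamel a f (\<lambda>_ _. 0) t0 t1 t x) (Q * t powr (- (\<sigma> + 0)))"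
      by (rule duhamel_diff_bound(1)[OF refl A_measurable zero t _ _ K(2) _ z b0 Q_def]) (use \<sigma>_less bK t in auto)
    then show ?thesis by (simp add: duhamel_zero[of f, OF flux_zero])
  qed
  have 2: "moment (duhamel a f (A 0) t0 t1 t) \<le> ennreal (Q * t powr (1/2 - \<sigma>))" if t: "0 < t" "0 \<le> t0" "t1 \<le> t" for t t0 t1
  proof -
    have m: "moment (\<lambda>x. A 0 s x - 0) \<le> ennreal (K * s powr (1/2 - 0))" if "0 < s" for s
      using A0_moment[OF that] by (simp add: K_def)
    have "moment (\<lambda>x. duhamel a f (A 0) t0 t1 t x - duhamel a f (\<lambda>_ _. 0) t0 t1 t x) \<le> ennreal (Q * t powr (1/2 - (\<sigma> + 0)))"
      by (rule duhamel_diff_bound(2)[OF refl A_measurable zero t _ _ K(2) _ z b0 Q_def m]) (use \<sigma>_less bK t in auto)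
    then show ?thesis by (simp add: duhamel_zero[of f, OF flux_zero])
  qed
  have eq: "(\<lambda>x. A (Suc 0) t x - A 0 t x) = (\<lambda>x. duhamel a f (A 0) 0 1 t x + duhamel a f (A 0) 1 t t x)" for t
    by (simp add: A_Suc)
  have 3: "sbound t (\<lambda>x. A (Suc 0) t x - A 0 t x) (2 * Q * t powr (-\<sigma>))" if "1 \<le> t" for t
    using sbound_add[OF 1[of t 0 1] 1[of t 1 t]] that unfolding eq by (simp add: mult.assoc)
  have 4: "moment (\<lambda>x. A (Suc 0) t x - A 0 t x) \<le> ennreal (2 * Q * t powr (1/2 - \<sigma>))" if t: "1 \<le> t" for t
  proof -
    have "moment (\<lambda>x. A (Suc 0) t x - A 0 t x) \<le> moment (duhamel a f (A 0) 0 1 t) + moment (duhamel a f (A 0) 1 t t)"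
      unfolding eq by (rule moment_add) (use sboundD(1)[OF 1[of t 0 1]] sboundD(1)[OF 1[of t 1 t]] t in auto)
    also have "\<dots> \<le> ennreal (Q * t powr (1/2 - \<sigma>)) + ennreal (Q * t powr (1/2 - \<sigma>))"
      by (intro add_mono 2) (use t in auto)
    also have "\<dots> = ennreal (2 * Q * t powr (1/2 - \<sigma>))" using Q0 by (simp add: ennreal_plus[symmetric] del: ennreal_plus)
    finally show ?thesis .
  qed
  have 5: "sbound t (A (Suc 0) t) (K + 2 * Q)" if t: "1 \<le> t" for t
  proof -
    have "sbound t (\<lambda>x. A 0 t x + (A (Suc 0) t x - A 0 t x)) (K + 2 * Q * t powr (-\<sigma>))"
      by (intro sbound_add bK 3) (use t in auto)
    moreover have "t powr (-\<sigma>) \<le> t powr 0" using t \<sigma>_pos by (intro powr_mono) auto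
    then have "K + 2 * Q * t powr (-\<sigma>) \<le> K + 2 * Q" using Q0 t by (simp add: mult_left_le)
    ultimately have "sbound t (\<lambda>x. A 0 t x + (A (Suc 0) t x - A 0 t x)) (K + 2 * Q)" by (rule sbound_mono)
    then show ?thesis by simp
  qed
  show ?case
  proof (intro exI[of _ "K + 2 * Q"] conjI allI impI)
    fix t :: real assume t: "1 \<le> t"
    show "sbound t (A 0 t) (K + 2 * Q)" by (rule sbound_mono[OF bK]) (use t Q0 in auto)
    show "sbound t (A (Suc 0) t) (K + 2 * Q)" by (rule 5[OF t])
    show "sbound t (\<lambda>x. A (Suc 0) t x - A 0 t x) ((K + 2 * Q) * t powr (- (real (Suc 0) * \<sigma>)))"
      by (rule sbound_mono[OF 3[OF t]]) (use K in \<open>simp add: mult_right_mono\<close>)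
    show "moment (\<lambda>x. A (Suc 0) t x - A 0 t x) \<le> ennreal ((K + 2 * Q) * t powr (1/2 - real (Suc 0) * \<sigma>))"
      by (rule order_trans[OF 4[OF t]]) (use K in \<open>simp add: ennreal_leI mult_right_mono\<close>)
  qed (use K Q0 in auto)
next
  case (Suc j)
  then obtain C where C: "0 \<le> C" "\<And>t. 1 \<le> t \<Longrightarrow> sbound t (A j t) C" "\<And>t. 1 \<le> t \<Longrightarrow> sbound t (A (Suc j) t) C"
    "\<And>t. 1 \<le> t \<Longrightarrow> sbound t (\<lambda>x. A (Suc j) t x - A j t x) (C * t powr (- (real (Suc j) * \<sigma>)))"
    "\<And>t. 1 \<le> t \<Longrightarrow> moment (\<lambda>x. A (Suc j) t x - A j t x) \<le> ennreal (C * t powr (1/2 - real (Suc j) * \<sigma>))"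
    by (auto)
  have \<theta>: "0 \<le> real (Suc j) * \<sigma>" "\<sigma> + real (Suc j) * \<sigma> < 1/2" "\<sigma> + real (Suc j) * \<sigma> = real (Suc (Suc j)) * \<sigma>"
    using rate_less[of "Suc (Suc j)"] Suc.prems \<sigma>_pos by (auto simp: algebra_simps)
  define Q where "Q = (gauss_const TYPE('a))\<^sup>2 * norm a * (14 / (1/2 - (\<sigma> + real (Suc j) * \<sigma>))) * (2 * Cf * C powr (p - 1) * C)"
  have Q0: "0 \<le> Q" using Cf_nonneg C(1) \<theta> by (simp add: Q_def)
  have eq: "(\<lambda>x. A (Suc (Suc j)) t x - A (Suc j) t x) = (\<lambda>x. duhamel a f (A (Suc j)) 1 t t x - duhamel a f (A j) 1 t t x)" for t
    unfolding A_Suc[of "Suc j"] A_Suc[of j] by (simp add: fun_eq_iff)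
  have 3: "sbound t (\<lambda>x. A (Suc (Suc j)) t x - A (Suc j) t x) (Q * t powr (- (real (Suc (Suc j)) * \<sigma>)))" if t: "1 \<le> t" for t
    unfolding eq \<theta>(3)[symmetric]
    by (rule duhamel_diff_bound(1)[OF refl A_measurable A_measurable _ _ _ \<theta>(1,2) C(1) C(3,2,4) Q_def]) (use t in auto)
  have 4: "moment (\<lambda>x. A (Suc (Suc j)) t x - A (Suc j) t x) \<le> ennreal (Q * t powr (1/2 - real (Suc (Suc j)) * \<sigma>))" if t: "1 \<le> t" for t
    unfolding eq \<theta>(3)[symmetric]
    by (rule duhamel_diff_bound(2)[OF refl A_measurable A_measurable _ _ _ \<theta>(1,2) C(1) C(3,2,4) Q_def C(5)]) (use t in auto)
  have 5: "sbound t (A (Suc (Suc j)) t) (C + Q)" if t: "1 \<le> t" for t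
  proof -
    have "sbound t (\<lambda>x. A (Suc j) t x + (A (Suc (Suc j)) t x - A (Suc j) t x)) (C + Q * t powr (- (real (Suc (Suc j)) * \<sigma>)))"
      by (intro sbound_add C 3) (use t in auto)
    then have "sbound t (A (Suc (Suc j)) t) (C + Q * t powr (- (real (Suc (Suc j)) * \<sigma>)))" by simp
    moreover have "t powr (- (real (Suc (Suc j)) * \<sigma>)) \<le> t powr 0" using t \<sigma>_pos by (intro powr_mono) auto
    then have "C + Q * t powr (- (real (Suc (Suc j)) * \<sigma>)) \<le> C + Q" using Q0 t by (simp add: mult_left_le)
    ultimately show ?thesis by (rule sbound_mono)
  qed
  show ?case
  proof (intro exI[of _ "C + Q"] conjI allI impI)
    fix t :: real assume t: "1 \<le> t"
    show "sbound t (A (Suc j) t) (C + Q)" by (rule sbound_mono[OF C(3)[OF t]]) (use Q0 in simp)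
    show "sbound t (A (Suc (Suc j)) t) (C + Q)" by (rule 5[OF t])
    show "sbound t (\<lambda>x. A (Suc (Suc j)) t x - A (Suc j) t x) ((C + Q) * t powr (- (real (Suc (Suc j)) * \<sigma>)))"
      by (rule sbound_mono[OF 3[OF t]]) (use C(1) in \<open>simp add: mult_right_mono\<close>)
    show "moment (\<lambda>x. A (Suc (Suc j)) t x - A (Suc j) t x) \<le> ennreal ((C + Q) * t powr (1/2 - real (Suc (Suc j)) * \<sigma>))"
      by (rule order_trans[OF 4[OF t]]) (use C(1) in \<open>simp add: ennreal_leI mult_right_mono\<close>)
  qed (use C(1) Q0 in auto)
qed

lemma approximation_bounded:
  assumes "j \<le> k"
  shows "\<exists>C\<ge>0. \<forall>t\<ge>1. sbound t (A j t) C"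
proof (cases "j < k")
  case True
  then show ?thesis using approximation_increments[OF True] by blast
next
  case False
  then have "j = Suc (k - 1)" using assms k_pos by simp
  then show ?thesis using approximation_increments[of "k - 1"] k_pos by (metis diff_less zero_less_one)
qed

end


section \<open>The error of the iterates\<close>

lemma nn_integral_powr_tail:
  assumes "1 < e"
  shows "(\<integral>\<^sup>+s\<in>{1<..<b}. ennreal (s powr (-e)) \<partial>lborel) \<le> ennreal (1 / (e - 1))"
proof -
  have "((\<lambda>s. s powr (-e)) has_integral - (1 powr (-e + 1)) / (-e + 1)) {1..}"
    by (rule has_integral_powr_to_inf) (use assms in auto)
  then have "(\<integral>\<^sup>+s\<in>{1..}. ennreal (s powr (-e)) \<partial>lborel) = ennreal (- (1 powr (-e + 1)) / (-e + 1))"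
    by (intro nn_integral_has_integral_lebesgue') auto
  moreover have "- (1 powr (-e + 1)) / (-e + 1) = 1 / (e - 1)" using assms by (simp add: divide_simps)
  moreover have "(\<integral>\<^sup>+s\<in>{1<..<b}. ennreal (s powr (-e)) \<partial>lborel) \<le> (\<integral>\<^sup>+s\<in>{1..}. ennreal (s powr (-e)) \<partial>lborel)"
    by (intro nn_integral_mono) (auto simp: indicator_def)
  ultimately show ?thesis by simp
qed

lemma set_nn_integral_cmult:
  assumes [measurable]: "g \<in> borel_measurable borel" "S \<in> sets borel" and c: "0 \<le> c" "\<And>s. 0 \<le> g s"
  shows "(\<integral>\<^sup>+s\<in>S. ennreal (c * g s) \<partial>lborel) = ennreal c * (\<integral>\<^sup>+s\<in>S. ennreal (g s) \<partial>lborel)"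
  using c by (subst nn_integral_cmult[symmetric]) (auto simp: ennreal_mult mult.assoc)

context convection_asymptotics
begin

text \<open>The iterates have source A_0 on (0, 1) and A_j afterwards, so Duhamel's formula for
  \<open>U\<close> is cut at time 1 as well.\<close>

lemma error_split:
  assumes t: "1 \<le> t" and B: "\<And>s. 0 < s \<Longrightarrow> sbound s (U s) B"
  shows "U t x - A (Suc j) t x = (heat t u0 x - A 0 t x) + (duhamel a f U 0 1 t x - duhamel a f (A 0) 0 1 t x)
    + (duhamel a f U 1 t t x - duhamel a f (A j) 1 t t x)"
proof -
  have "duhamel a f U 0 t t x = duhamel a f U 0 1 t x + duhamel a f U 1 t t x"
    by (rule duhamel_split[OF U_measurable flux_measurable])
       (use t in \<open>auto intro!: duhamel_bounded_curve[OF refl U_measurable] B\<close>)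
  then show ?thesis using U_mild[of t x] t by (simp add: A_Suc duhamel_def)
qed

text \<open>The rate (j + 1/2) sigma is not sharp for j < k; giving up sigma/2 avoids a logarithm at j = k.\<close>

lemma error_rate:
  assumes "j \<le> k"
  shows "\<exists>C\<ge>0. \<forall>t\<ge>1. sbound t (\<lambda>x. U t x - A j t x) (C * t powr (- ((real j + 1/2) * \<sigma>)))"
  using assms
proof (induction j)
  case 0
  obtain B where B: "0 < B" "\<And>t. 0 < t \<Longrightarrow> sbound t (U t) B" using decay by blast
  obtain C0 where C0: "0 \<le> C0" "\<And>t. 0 < t \<Longrightarrow> sbound t (\<lambda>x. heat t u0 x - A 0 t x) (C0 * t powr (-1/2))"
    using heat_minus_A0 by blast
  have zero: "case_prod (\<lambda>_ _. 0) \<in> borel_measurable (borel \<Otimes>\<^sub>M (borel :: 'a measure))" by simp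
  have z: "sbound s (\<lambda>_::'a. 0) B" for s using B by (intro sboundI) auto
  have b0: "sbound s (\<lambda>x. U s x - 0) (B * s powr (-0))" if "0 < s" for s using B(2)[OF that] that by simp
  define Q where "Q = (gauss_const TYPE('a))\<^sup>2 * norm a * (14 / (1/2 - (\<sigma> + 0))) * (2 * Cf * B powr (p - 1) * B)"
  have Q0: "0 \<le> Q" using Cf_nonneg B \<sigma>_less by (simp add: Q_def)
  show ?case
  proof (intro exI[of _ "C0 + Q"] conjI allI impI)
    fix t :: real assume t: "1 \<le> t"
    have "sbound t (\<lambda>x. duhamel a f U 0 t t x - duhamel a f (\<lambda>_ _. 0) 0 t t x) (Q * t powr (- (\<sigma> + 0)))"
      by (rule duhamel_diff_bound(1)[OF refl U_measurable zero _ _ _ _ _ less_imp_le[OF B(1)] B(2) z b0 Q_def]) (use t \<sigma>_less in auto)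
    then have "sbound t (duhamel a f U 0 t t) (Q * t powr (- \<sigma>))" by (simp add: duhamel_zero[of f, OF flux_zero])
    from sbound_add[OF C0(2)[of t] this] t
    have "sbound t (\<lambda>x. (heat t u0 x - A 0 t x) + duhamel a f U 0 t t x) (C0 * t powr (-1/2) + Q * t powr (-\<sigma>))" by simp
    moreover have "(\<lambda>x. (heat t u0 x - A 0 t x) + duhamel a f U 0 t t x) = (\<lambda>x. U t x - A 0 t x)"
      using U_mild[of t] t by (simp add: fun_eq_iff duhamel_def)
    ultimately have "sbound t (\<lambda>x. U t x - A 0 t x) (C0 * t powr (-1/2) + Q * t powr (-\<sigma>))" by simp
    then show "sbound t (\<lambda>x. U t x - A 0 t x) ((C0 + Q) * t powr (- ((real 0 + 1/2) * \<sigma>)))"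
    proof (rule sbound_mono)
      have "t powr (-1/2) \<le> t powr (- ((real 0 + 1/2) * \<sigma>))" "t powr (-\<sigma>) \<le> t powr (- ((real 0 + 1/2) * \<sigma>))"
        using t \<sigma>_pos \<sigma>_less by (auto intro!: powr_mono)
      then show "C0 * t powr (-1/2) + Q * t powr (-\<sigma>) \<le> (C0 + Q) * t powr (- ((real 0 + 1/2) * \<sigma>))"
        unfolding distrib_right using C0(1) Q0 by (intro add_mono mult_left_mono)
    qed
  qed (use C0 Q0 in auto)
next
  case (Suc j)
  obtain B where B: "0 < B" "\<And>t. 0 < t \<Longrightarrow> sbound t (U t) B" using decay by blast
  obtain C0 where C0: "0 \<le> C0" "\<And>t. 0 < t \<Longrightarrow> sbound t (\<lambda>x. heat t u0 x - A 0 t x) (C0 * t powr (-1/2))"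
    using heat_minus_A0 by blast
  obtain C where C: "0 \<le> C" "\<And>t. 1 \<le> t \<Longrightarrow> sbound t (\<lambda>x. U t x - A j t x) (C * t powr (- ((real j + 1/2) * \<sigma>)))"
    using Suc by auto
  obtain CA where CA: "0 \<le> CA" "\<And>t. 1 \<le> t \<Longrightarrow> sbound t (A j t) CA"
    using approximation_bounded[of j] Suc.prems by auto
  define m where "m = \<bar>mass u0\<bar>"
  define K where "K = B + CA + m"
  define R where "R = B + C + m"
  have K: "B \<le> K" "CA \<le> K" "m \<le> K" and R: "0 \<le> R" "C \<le> R" "B + m \<le> R"
    using B CA C by (auto simp: K_def R_def m_def)
  define \<theta>' where "\<theta>' = (real j + 1/2) * \<sigma>"
  have \<theta>: "0 \<le> \<theta>'" "\<sigma> + \<theta>' < 1/2" "\<sigma> + \<theta>' = (real (Suc j) + 1/2) * \<sigma>"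
    using \<sigma>_pos rate_half_less[OF Suc.prems] by (auto simp: \<theta>'_def algebra_simps)
  define Q where "Q = (gauss_const TYPE('a))\<^sup>2 * norm a * (14 / (1/2 - (\<sigma> + \<theta>'))) * (2 * Cf * K powr (p - 1) * R)"
  have Q0: "0 \<le> Q" using Cf_nonneg R \<theta> by (simp add: Q_def)
  have UK: "sbound s (U s) K" if "0 < s" for s by (rule sbound_mono[OF B(2)[OF that] K(1)])
  have A0K: "sbound s (A 0 s) K" if "0 < s" for s by (rule sbound_mono[OF A0_sbound[OF that] K(3)[unfolded m_def]])
  have AK: "sbound s (A j s) K" if "1 < s" for s by (rule sbound_mono[OF CA(2) K(2)]) (use that in simp)
  \<comment> \<open>For s < 1 no decay is to be exploited: the sum of the two bounds suffices
    because s^(-\<open>\<theta>'\<close>) >= 1.\<close>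
  have R1: "sbound s (\<lambda>x. U s x - A 0 s x) (R * s powr (-\<theta>'))" if s: "0 < s" "s < 1" for s
  proof (rule sbound_mono[OF sbound_diff[OF B(2)[OF s(1)] A0_sbound[OF s(1)]]])
    have "1 powr (-\<theta>') \<le> s powr (-\<theta>')" using s \<theta> by (intro powr_mono2') auto
    then have "(B + m) * 1 \<le> R * s powr (-\<theta>')" using R B by (intro mult_mono) (auto simp: m_def)
    then show "B + \<bar>mass u0\<bar> \<le> R * s powr (-\<theta>')" by (simp add: m_def)
  qed
  have R2: "sbound s (\<lambda>x. U s x - A j s x) (R * s powr (-\<theta>'))" if s: "1 < s" for s
    by (rule sbound_mono[OF C(2)]) (use s R in \<open>auto simp: \<theta>'_def intro!: mult_right_mono\<close>)
  show ?case
  proof (intro exI[of _ "C0 + Q + Q"] conjI allI impI)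
    fix t :: real assume t: "1 \<le> t"
    have 1: "sbound t (\<lambda>x. duhamel a f U 0 1 t x - duhamel a f (A 0) 0 1 t x) (Q * t powr (- (\<sigma> + \<theta>')))"
      by (rule duhamel_diff_bound(1)[OF refl U_measurable A_measurable _ _ _ \<theta>(1,2) R(1) UK A0K R1 Q_def]) (use t in auto)
    have 2: "sbound t (\<lambda>x. duhamel a f U 1 t t x - duhamel a f (A j) 1 t t x) (Q * t powr (- (\<sigma> + \<theta>')))"
      by (rule duhamel_diff_bound(1)[OF refl U_measurable A_measurable _ _ _ \<theta>(1,2) R(1) UK AK R2 Q_def]) (use t in auto)
    have es: "U t x - A (Suc j) t x = (heat t u0 x - A 0 t x) + (duhamel a f U 0 1 t x - duhamel a f (A 0) 0 1 t x)
      + (duhamel a f U 1 t t x - duhamel a f (A j) 1 t t x)" for x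
      by (rule error_split[OF t B(2)])
    have "sbound t (\<lambda>x. U t x - A (Suc j) t x) (C0 * t powr (-1/2) + Q * t powr (- (\<sigma> + \<theta>')) + Q * t powr (- (\<sigma> + \<theta>')))"
      unfolding es by (intro sbound_add C0 1 2) (use t in auto)
    then show "sbound t (\<lambda>x. U t x - A (Suc j) t x) ((C0 + Q + Q) * t powr (- ((real (Suc j) + 1/2) * \<sigma>)))"
      unfolding \<theta>(3)[symmetric]
    proof (rule sbound_mono)
      have "t powr (-1/2) \<le> t powr (- (\<sigma> + \<theta>'))" using t \<theta>(2) by (intro powr_mono) auto
      then show "C0 * t powr (-1/2) + Q * t powr (- (\<sigma> + \<theta>')) + Q * t powr (- (\<sigma> + \<theta>')) \<le> (C0 + Q + Q) * t powr (- (\<sigma> + \<theta>'))"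
        unfolding distrib_right using C0(1) Q0 by (intro add_mono mult_left_mono) auto
    qed
  qed (use C0 Q0 in auto)
qed

text \<open>With the rate (k + 1/2) \<open>\<sigma>\<close> at stage k the source decays like s to
  the power -1/2 - (k + 3/2) \<open>\<sigma>\<close>, which lies below -1. It is integrable at
  infinity, and the kernel decay t^(-1/2) becomes the limiting factor.\<close>

lemma error_final:
  "\<exists>C\<ge>0. \<forall>t\<ge>2. sbound t (\<lambda>x. U t x - A (Suc k) t x) (C * t powr (-1/2))"
proof -
  obtain B where B: "0 < B" "\<And>t. 0 < t \<Longrightarrow> sbound t (U t) B" using decay by blast
  obtain C0 where C0: "0 \<le> C0" "\<And>t. 0 < t \<Longrightarrow> sbound t (\<lambda>x. heat t u0 x - A 0 t x) (C0 * t powr (-1/2))"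
    using heat_minus_A0 by blast
  obtain C where C: "0 \<le> C" "\<And>t. 1 \<le> t \<Longrightarrow> sbound t (\<lambda>x. U t x - A k t x) (C * t powr (- ((real k + 1/2) * \<sigma>)))"
    using error_rate[of k] by auto
  obtain CA where CA: "0 \<le> CA" "\<And>t. 1 \<le> t \<Longrightarrow> sbound t (A k t) CA"
    using approximation_bounded[of k] by auto
  define m where "m = \<bar>mass u0\<bar>"
  define K where "K = B + CA + m"
  have K: "B \<le> K" "CA \<le> K" "m \<le> K" "0 \<le> K" using B CA by (auto simp: K_def m_def)
  have UK: "sbound s (U s) K" if "0 < s" for s by (rule sbound_mono[OF B(2)[OF that] K(1)])
  have A0K: "sbound s (A 0 s) K" if "0 < s" for s by (rule sbound_mono[OF A0_sbound[OF that] K(3)[unfolded m_def]])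
  have AK: "sbound s (A k s) K" if "1 < s" for s by (rule sbound_mono[OF CA(2) K(2)]) (use that in simp)
  define \<theta>' where "\<theta>' = (real k + 1/2) * \<sigma>"
  have "real k * \<sigma> + \<sigma> = 1/2" using \<sigma>_eq by (simp add: divide_simps algebra_simps)
  \<comment> \<open>The surplus over 1/2 is \<open>\<sigma>\<close>/2.\<close>
  then have \<theta>: "1/2 < \<sigma> + \<theta>'" using \<sigma>_pos by (simp add: \<theta>'_def algebra_simps)
  have m1: "(\<lambda>(s, y). f (U s y) - f (A 0 s y)) \<in> borel_measurable (borel \<Otimes>\<^sub>M borel)" by measurable
  have m2: "(\<lambda>(s, y). f (U s y) - f (A k s y)) \<in> borel_measurable (borel \<Otimes>\<^sub>M borel)" by measurable
  define E where "E = 2 * Cf * K powr (p - 1) * (K + K)"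
  define E' where "E' = 2 * Cf * K powr (p - 1) * C"
  have E0: "0 \<le> E" "0 \<le> E'" using Cf_nonneg K C by (auto simp: E_def E'_def)
  have b1: "sbound s (\<lambda>y. f (U s y) - f (A 0 s y)) (E * s powr (-1/2 - (\<sigma> + 0)))" if s: "0 < s" for s
    unfolding E_def
    by (rule flux_of_bounded_curves(1)[OF refl s UK[OF s] A0K[OF s]]) (use sbound_diff[OF UK[OF s] A0K[OF s]] s in simp)
  have b2: "sbound s (\<lambda>y. f (U s y) - f (A k s y)) (E' * s powr (-1/2 - (\<sigma> + \<theta>')))" if s: "1 < s" for s
    unfolding E'_def
    by (rule flux_of_bounded_curves(1)[OF refl _ UK AK]) (use C(2)[of s] s in \<open>auto simp: \<theta>'_def\<close>)
  define J1 where "J1 = E * (1 / (1/2 - \<sigma>))"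
  define J2 where "J2 = E' * (1 / (\<sigma> + \<theta>' - 1/2))"
  have J0: "0 \<le> J1" "0 \<le> J2" using E0 \<sigma>_less \<theta> by (auto simp: J1_def J2_def)
  have I1: "(\<integral>\<^sup>+s\<in>{0<..<1}. ennreal (E * s powr (-1/2 - (\<sigma> + 0))) \<partial>lborel) \<le> ennreal J1"
  proof -
    have "(\<integral>\<^sup>+s\<in>{0<..<1}. ennreal (E * s powr (-(1/2 + \<sigma>))) \<partial>lborel) = ennreal E * (\<integral>\<^sup>+s\<in>{0<..<1}. ennreal (s powr (-(1/2 + \<sigma>))) \<partial>lborel)"
      by (rule set_nn_integral_cmult) (use E0 in auto)
    also have "\<dots> \<le> ennreal E * ennreal (1 powr (1 - (1/2 + \<sigma>)) / (1 - (1/2 + \<sigma>)))"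
      by (intro mult_left_mono nn_integral_powr_from_0) (use \<sigma>_pos \<sigma>_less in auto)
    also have "\<dots> = ennreal J1" using E0 \<sigma>_less by (simp add: J1_def ennreal_mult[symmetric])
    finally show ?thesis by simp
  qed
  have I2: "(\<integral>\<^sup>+s\<in>{1<..<t}. ennreal (E' * s powr (-1/2 - (\<sigma> + \<theta>'))) \<partial>lborel) \<le> ennreal J2" for t
  proof -
    have e: "-1/2 - (\<sigma> + \<theta>') = - (1/2 + (\<sigma> + \<theta>'))" by simp
    have "(\<integral>\<^sup>+s\<in>{1<..<t}. ennreal (E' * s powr (-(1/2 + (\<sigma> + \<theta>')))) \<partial>lborel) = ennreal E' * (\<integral>\<^sup>+s\<in>{1<..<t}. ennreal (s powr (-(1/2 + (\<sigma> + \<theta>')))) \<partial>lborel)"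
      by (rule set_nn_integral_cmult) (use E0 in auto)
    also have "\<dots> \<le> ennreal E' * ennreal (1 / ((1/2 + (\<sigma> + \<theta>')) - 1))"
      by (intro mult_left_mono nn_integral_powr_tail) (use \<theta> in auto)
    also have "\<dots> = ennreal (E' * (1 / ((1/2 + (\<sigma> + \<theta>')) - 1)))" using E0 \<theta> by (intro ennreal_mult[symmetric]) auto
    also have "(1/2 + (\<sigma> + \<theta>')) - 1 = \<sigma> + \<theta>' - 1/2" by simp
    finally show ?thesis unfolding e J2_def .
  qed
  define c where "c = (gauss_const TYPE('a))\<^sup>2 * norm a"
  have c0: "0 \<le> c" by (simp add: c_def)
  show ?thesis
  proof (intro exI[of _ "C0 + c * (2 * J1 + 2 * 0) + c * (2 * J2 + 2 * (2 * E'))"] conjI allI impI)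
    fix t :: real assume t: "2 \<le> t"
    have 1: "sbound t (\<lambda>x. duhamel a f U 0 1 t x - duhamel a f (A 0) 0 1 t x) (c * (2 * J1 + 2 * 0) * t powr (-1/2))"
    proof -
      have eq: "duhamel a f U 0 1 t x - duhamel a f (A 0) 0 1 t x = (LINT s:{0..1}|lborel. gradheat a (t - s) (\<lambda>y. f (U s y) - f (A 0 s y)) x)" for x
        by (rule duhamel_diff_eq[OF refl U_measurable A_measurable _ _ _ UK A0K]) (use t in auto)
      \<comment> \<open>N = 0: for t >= 2 the interval (0, 1) lies before t/2, so the source is
        absent from the second half.\<close>
      show ?thesis unfolding eq c_def
        by (rule duhamel_integrable_bound[where h="\<lambda>s y. f (U s y) - f (A 0 s y)", OF m1 _ _ _ _ b1 J0(1) I1]) (use t in auto)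
    qed
    have 2: "sbound t (\<lambda>x. duhamel a f U 1 t t x - duhamel a f (A k) 1 t t x) (c * (2 * J2 + 2 * (2 * E')) * t powr (-1/2))"
    proof -
      have eq: "duhamel a f U 1 t t x - duhamel a f (A k) 1 t t x = (LINT s:{1..t}|lborel. gradheat a (t - s) (\<lambda>y. f (U s y) - f (A k s y)) x)" for x
        by (rule duhamel_diff_eq[OF refl U_measurable A_measurable _ _ _ UK AK]) (use t in auto)
      show ?thesis unfolding eq c_def
      proof (rule duhamel_integrable_bound[where h="\<lambda>s y. f (U s y) - f (A k s y)", OF m2 _ _ _ _ b2 J0(2) I2])
        fix s assume s: "1 < s" "s < t" "t / 2 \<le> s"
        have "s powr (-1/2 - (\<sigma> + \<theta>')) \<le> s powr (-1)" using s \<theta> by (intro powr_mono) auto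
        also have "\<dots> = 1 / s" using s by (simp add: powr_minus_divide)
        also have "\<dots> \<le> 1 / (t / 2)" using s t by (intro divide_left_mono) auto
        finally have "E' * s powr (-1/2 - (\<sigma> + \<theta>')) \<le> E' * (1 / (t / 2))" using E0 by (intro mult_left_mono) auto
        then show "E' * s powr (-1/2 - (\<sigma> + \<theta>')) \<le> 2 * E' / t" by (simp add: mult.commute)
      qed (use t E0 in auto)
    qed
    have t1: "1 \<le> t" using t by simp
    have es: "U t x - A (Suc k) t x = (heat t u0 x - A 0 t x) + (duhamel a f U 0 1 t x - duhamel a f (A 0) 0 1 t x)
      + (duhamel a f U 1 t t x - duhamel a f (A k) 1 t t x)" for x
      by (rule error_split[OF t1 B(2)])
    have "sbound t (\<lambda>x. U t x - A (Suc k) t x) (C0 * t powr (-1/2) + c * (2 * J1 + 2 * 0) * t powr (-1/2) + c * (2 * J2 + 2 * (2 * E')) * t powr (-1/2))"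
      unfolding es by (intro sbound_add C0 1 2) (use t in auto)
    then show "sbound t (\<lambda>x. U t x - A (Suc k) t x) ((C0 + c * (2 * J1 + 2 * 0) + c * (2 * J2 + 2 * (2 * E'))) * t powr (-1/2))"
      by (simp only: distrib_right)
  next
    show "0 \<le> C0 + c * (2 * J1 + 2 * 0) + c * (2 * J2 + 2 * (2 * E'))" using C0 c0 J0 E0 by (intro add_nonneg_nonneg mult_nonneg_nonneg) auto
  qed
qed

end


section \<open>The mass term in place of the last increment\<close>

lemma heatG_scaling:
  assumes t: "0 < t"
  shows "t powr (- real DIM('a) / 2) * heatG 1 (t powr (-1/2) *\<^sub>R x) = heatG t (x::'a::euclidean_space)"
proof -
  have "(norm (t powr (-1/2) *\<^sub>R x))\<^sup>2 = (norm x)\<^sup>2 / t"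
  proof -
    have "(t powr (-1/2))\<^sup>2 = 1 / t" using t powr_powr[of t "-1/2" 2] powr_realpow[of "t powr (-1/2)" 2] by (simp add: powr_minus_divide)
    then show ?thesis by (simp add: power_mult_distrib)
  qed
  then show ?thesis using t by (simp add: heatG_def powr_mult mult_ac)
qed

text \<open>The dilation of x_j G_1 is t^(-1/2) x_j G_t, so \<open>Lam\<close> for a basis vector is
  the mass times the corresponding partial derivative of G_t; the weights a_j assemble the
  derivative in direction a.\<close>

lemma sum_Lam_eq:
  fixes a :: "'a::euclidean_space"
  assumes t: "0 < t"
  shows "(\<Sum>b\<in>Basis. (a \<bullet> b) * (LINT s:S|lborel. Lam b t (\<phi> s) x)) = (LINT s:S|lborel. mass (\<phi> s)) * dheatG a t x"
proof -
  have Lam: "Lam b t \<psi> x = mass \<psi> * (- (x \<bullet> b) / (2*t) * heatG t x)" for b and \<psi> :: "'a \<Rightarrow> real"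
  proof -
    have st: "t powr (-1/2) * t powr (-1/2) = 1 / t" using t powr_add[of t "-1/2" "-1/2"] by (simp add: powr_minus_divide)
    have "Lam b t \<psi> x = - (1/2) * t powr (-1/2) * mass \<psi> * (t powr (- real DIM('a) / 2) * ((t powr (-1/2) * (x \<bullet> b)) * heatG 1 (t powr (-1/2) *\<^sub>R x)))"
      by (simp add: Lam_def dil_def)
    also have "\<dots> = - (1/2) * mass \<psi> * (x \<bullet> b) * (t powr (-1/2) * t powr (-1/2)) * (t powr (- real DIM('a) / 2) * heatG 1 (t powr (-1/2) *\<^sub>R x))"
      by (simp only: mult_ac)
    also have "\<dots> = - (1/2) * mass \<psi> * (x \<bullet> b) * (1 / t) * heatG t x" unfolding st heatG_scaling[OF t] ..
    finally show ?thesis by simp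
  qed
  have "(LINT s:S|lborel. Lam b t (\<phi> s) x) = (LINT s:S|lborel. mass (\<phi> s)) * (- (x \<bullet> b) / (2*t) * heatG t x)" for b
  proof -
    have "(LINT s:S|lborel. Lam b t (\<phi> s) x) = (\<integral>s. (indicator S s * mass (\<phi> s)) * (- (x \<bullet> b) / (2*t) * heatG t x) \<partial>lborel)"
      unfolding set_lebesgue_integral_def Lam by (simp only: real_scaleR_def mult.assoc)
    also have "\<dots> = (\<integral>s. indicator S s * mass (\<phi> s) \<partial>lborel) * (- (x \<bullet> b) / (2*t) * heatG t x)"
      by (rule integral_mult_left_zero)
    finally show ?thesis by (simp add: set_lebesgue_integral_def)
  qed
  then have "(\<Sum>b\<in>Basis. (a \<bullet> b) * (LINT s:S|lborel. Lam b t (\<phi> s) x)) = (\<Sum>b\<in>Basis. (LINT s:S|lborel. mass (\<phi> s)) * (- heatG t x / (2*t)) * ((a \<bullet> b) * (x \<bullet> b)))"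
    by (intro sum.cong) (simp_all add: mult_ac)
  also have "\<dots> = (LINT s:S|lborel. mass (\<phi> s)) * (- heatG t x / (2*t)) * (a \<bullet> x)"
    by (simp add: sum_distrib_left euclidean_inner[of a x])
  finally show ?thesis by (simp add: dheatG_def mult_ac)
qed

text \<open>Two replacements with separate errors: the kernel time t - s becomes t, which costs s
  t^(-3/2) times the L1 norm, and the source becomes its mass at the origin, which costs the first
  moment divided by t.\<close>

lemma gradheat_near_multiple:
  fixes a :: "'a::euclidean_space"
  obtains C where "0 \<le> C" "\<And>t s \<phi> r \<mu>. 0 \<le> s \<Longrightarrow> s \<le> t / 2 \<Longrightarrow> 0 < t \<Longrightarrow> integrable lborel \<phi> \<Longrightarrow> 0 \<le> r \<Longrightarrow> 0 \<le> \<mu> \<Longrightarrow>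
    (\<integral>\<^sup>+x. ennreal \<bar>\<phi> x\<bar> \<partial>lborel) \<le> ennreal r \<Longrightarrow> moment \<phi> \<le> ennreal \<mu> \<Longrightarrow>
    sbound t (\<lambda>x. gradheat a (t - s) \<phi> x - mass \<phi> * dheatG a t x) (C * (s * t powr (-3/2) * r + \<mu> / t))"
proof -
  obtain C1 where C1: "0 \<le> C1" "\<And>t x y. 0 < t \<Longrightarrow> \<bar>dheatG a t (x - y) - dheatG a t (x::'a)\<bar> \<le> C1 / t * norm y * (heatG (8*t) x + heatG (8*t) (x - y))"
    using dheatG_diff_le[of a] by blast
  obtain C2 where C2: "0 \<le> C2" "\<And>t s x. 0 \<le> s \<Longrightarrow> s \<le> t / 2 \<Longrightarrow> 0 < t \<Longrightarrow> \<bar>dheatG a (t - s) x - dheatG a t (x::'a)\<bar> \<le> C2 * s * t powr (-3/2) * heatG (8*t) x"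
    using dheatG_time_diff_le[of a] by blast
  show thesis
  proof
    show "0 \<le> C2 + 2 * C1" using C1 C2 by simp
    fix t s r \<mu> :: real and \<phi> :: "'a \<Rightarrow> real"
    assume s: "0 \<le> s" "s \<le> t / 2" and t: "0 < t" and \<phi>: "integrable lborel \<phi>" and r: "0 \<le> r" and \<mu>: "0 \<le> \<mu>"
      and L1: "(\<integral>\<^sup>+x. ennreal \<bar>\<phi> x\<bar> \<partial>lborel) \<le> ennreal r" and mom: "moment \<phi> \<le> ennreal \<mu>"
    have [measurable]: "\<phi> \<in> borel_measurable borel" using \<phi> by auto
    have 1: "sbound (8*t) (\<lambda>x. (\<integral>y. (dheatG a (t - s) (x - y) - dheatG a t (x - y)) * \<phi> y \<partial>lborel)) (C2 * s * t powr (-3/2) * r)"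
      by (rule heat_kernel_dominated_L1[where K="\<lambda>z. dheatG a (t - s) z - dheatG a t z"]) (use t s r L1 C2 in auto)
    have 2: "sbound (8*t) (\<lambda>x. (\<integral>y. dheatG a t (x - y) * \<phi> y \<partial>lborel) - mass \<phi> * dheatG a t x) (2 * (C1 / t) * \<mu>)"
      by (rule sbound_moment_expansion[OF _ abs_dheatG_bound[OF t] _ _ C1(2)[OF t] \<phi> \<mu> mom]) (use t C1 in auto)
    have eq: "gradheat a (t - s) \<phi> x - mass \<phi> * dheatG a t x = (\<integral>y. (dheatG a (t - s) (x - y) - dheatG a t (x - y)) * \<phi> y \<partial>lborel)
        + ((\<integral>y. dheatG a t (x - y) * \<phi> y \<partial>lborel) - mass \<phi> * dheatG a t x)" for x
    proof -
      have ts: "0 < t - s" using s t by simp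
      show ?thesis unfolding gradheat_def left_diff_distrib
        using integrable_dheatG_mult[OF ts \<phi>, of a x] integrable_dheatG_mult[OF t \<phi>, of a x] by simp
    qed
    have "sbound (8*t) (\<lambda>x. gradheat a (t - s) \<phi> x - mass \<phi> * dheatG a t x) (C2 * s * t powr (-3/2) * r + 2 * (C1 / t) * \<mu>)"
      unfolding eq by (rule sbound_add[OF 1 2])
    then have "sbound t (\<lambda>x. gradheat a (t - s) \<phi> x - mass \<phi> * dheatG a t x) (C2 * s * t powr (-3/2) * r + 2 * (C1 / t) * \<mu>)"
      by (rule sbound_time) (use t in auto)
    then show "sbound t (\<lambda>x. gradheat a (t - s) \<phi> x - mass \<phi> * dheatG a t x) ((C2 + 2 * C1) * (s * t powr (-3/2) * r + \<mu> / t))"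
    proof (rule sbound_mono)
      have X: "0 \<le> s * t powr (-3/2) * r" "0 \<le> \<mu> / t" using s r \<mu> t by auto
      have "C2 * (s * t powr (-3/2) * r) + 2 * C1 * (\<mu> / t) \<le> (C2 + 2 * C1) * (s * t powr (-3/2) * r) + (C2 + 2 * C1) * (\<mu> / t)"
        using X C1(1) C2(1) by (intro add_mono mult_right_mono) auto
      then show "C2 * s * t powr (-3/2) * r + 2 * (C1 / t) * \<mu> \<le> (C2 + 2 * C1) * (s * t powr (-3/2) * r + \<mu> / t)"
        by (simp add: distrib_left mult.assoc)
    qed
  qed
qed

context convection_asymptotics
begin

text \<open>Near s = t both terms are of the claimed size separately; only for s < t/2 is the cancellation used.\<close>

lemma correction_bound:
  "\<exists>C\<ge>0. \<forall>t>2. sbound t (\<lambda>x. A (Suc k) t x - Atil a f u0 k t x) (C * t powr (-1/2))"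
proof -
  obtain j where j: "k = Suc j" using k_pos gr0_implies_Suc by blast
  obtain K where K: "0 \<le> K" "\<And>t. 1 \<le> t \<Longrightarrow> sbound t (A j t) K" "\<And>t. 1 \<le> t \<Longrightarrow> sbound t (A k t) K"
    "\<And>t. 1 \<le> t \<Longrightarrow> sbound t (\<lambda>x. A k t x - A j t x) (K * t powr (- (real k * \<sigma>)))"
    "\<And>t. 1 \<le> t \<Longrightarrow> moment (\<lambda>x. A k t x - A j t x) \<le> ennreal (K * t powr (1/2 - real k * \<sigma>))"
    using approximation_increments[of j] j by auto
  \<comment> \<open>The critical exponent: the source \<open>\<phi>\<close> defined next has L1 size
    1/s and first moment s^(-1/2).\<close>
  have half: "\<sigma> + real k * \<sigma> = 1/2" using \<sigma>_eq by (simp add: divide_simps algebra_simps)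
  define \<phi> where "\<phi> = (\<lambda>s y. f (A k s y) - f (A j s y))"
  have \<phi>m[measurable]: "case_prod \<phi> \<in> borel_measurable (borel \<Otimes>\<^sub>M borel)" unfolding \<phi>_def by measurable
  define E where "E = 2 * Cf * K powr (p - 1) * K"
  have E0: "0 \<le> E" using Cf_nonneg K(1) by (simp add: E_def)
  have \<phi>s: "sbound s (\<phi> s) (E * s powr (-1))" if s: "1 < s" for s
    using flux_of_bounded_curves(1)[OF refl, of s "A k s" K "A j s" K "real k * \<sigma>"] K s half by (simp add: \<phi>_def E_def)
  have \<phi>mom: "moment (\<phi> s) \<le> ennreal (E * s powr (-(1/2)))" if s: "1 < s" for s
    using flux_of_bounded_curves(2)[OF refl, of s "A k s" K "A j s" K "real k * \<sigma>"] K s half by (simp add: \<phi>_def E_def)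
  have mass_le: "\<bar>mass (\<phi> s)\<bar> \<le> E * s powr (-1)" if s: "1 < s" for s
    unfolding mass_def by (rule order_trans[OF integral_abs_bound sbound_integral[OF \<phi>s[OF s]]])
  have mm[measurable]: "(\<lambda>s. mass (\<phi> s)) \<in> borel_measurable borel" unfolding mass_def by measurable
  show ?thesis
  proof (rule gradheat_near_multiple[of a])
    fix C assume C: "0 \<le> C" "\<And>t s \<phi> r \<mu>. 0 \<le> s \<Longrightarrow> s \<le> t / 2 \<Longrightarrow> 0 < t \<Longrightarrow> integrable lborel \<phi> \<Longrightarrow> 0 \<le> r \<Longrightarrow> 0 \<le> \<mu> \<Longrightarrow>
      (\<integral>\<^sup>+x. ennreal \<bar>\<phi> x\<bar> \<partial>lborel) \<le> ennreal r \<Longrightarrow> moment \<phi> \<le> ennreal \<mu> \<Longrightarrow>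
      sbound t (\<lambda>x. gradheat a (t - s) \<phi> x - mass \<phi> * dheatG a t x) (C * (s * t powr (-3/2) * r + \<mu> / t))"
  define c where "c = (gauss_const TYPE('a))\<^sup>2 * norm a"
  define c' where "c' = gauss_const TYPE('a) * norm a"
  have c0: "0 \<le> c" "0 \<le> c'" using gauss_const_ge[where 'a='a] by (auto simp: c_def c'_def)
  show ?thesis
  proof (intro exI[of _ "4 * C * E + c * (2 * E + 2 * (2 * E)) + E * c'"] conjI allI impI)
    show "0 \<le> 4 * C * E + c * (2 * E + 2 * (2 * E)) + E * c'" using C(1) E0 c0 by simp
    fix t :: real assume t: "2 < t"
    have tail: "E * s powr (-1) \<le> 2 * E / t" if "t / 2 \<le> s" for s
    proof -
      have "s powr (-1) = 1 / s" using that t by (simp add: powr_minus_divide)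
      also have "\<dots> \<le> 1 / (t / 2)" using that t by (intro divide_left_mono) auto
      finally have "E * s powr (-1) \<le> E * (1 / (t / 2))" using E0 by (intro mult_left_mono) auto
      then show ?thesis by (simp add: mult.commute)
    qed
    \<comment> \<open>The integral of 1/s over (t/2, t) is bounded, so the second half of the
      interval produces no logarithm.\<close>
    have J2: "(\<integral>\<^sup>+s\<in>{t/2<..<t}. ennreal (E * s powr (-1)) \<partial>lborel) \<le> ennreal E"
    proof -
      have "(\<integral>\<^sup>+s\<in>{t/2<..<t}. ennreal (E * s powr (-1)) \<partial>lborel) \<le> (\<integral>\<^sup>+s. ennreal (2 * E / t) * indicator {t/2<..<t} s \<partial>lborel)"
        using tail by (intro nn_integral_mono) (auto simp: indicator_def intro!: ennreal_leI)
      also have "\<dots> = ennreal (2 * E / t) * ennreal (t - t / 2)" using t by (simp add: nn_integral_cmult_indicator)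
      also have "\<dots> = ennreal ((2 * E / t) * (t - t / 2))" using E0 t by (intro ennreal_mult[symmetric]) auto
      also have "(2 * E / t) * (t - t / 2) = E" using t by (simp add: field_simps)
      finally show ?thesis .
    qed
    have gm: "(\<lambda>s. gradheat a (t - s) (\<phi> s) x) \<in> borel_measurable borel" for x by (simp add: gradheat_def)
    have gi: "set_integrable lborel {t0..t1} (\<lambda>s. gradheat a (t - s) (\<phi> s) x)" if "1 \<le> t0" "t1 \<le> t" for t0 t1 x
    proof (rule duhamel_power_bound(2)[OF \<phi>m, where \<theta>=0 and E=E])
      show "sbound s (\<phi> s) (E * s powr (-1/2 - 0))" if "t0 < s" "s < t1" for s
      proof (rule sbound_mono[OF \<phi>s])
        show "E * s powr (-1) \<le> E * s powr (-1/2 - 0)"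
          using that \<open>1 \<le> t0\<close> E0 by (intro mult_left_mono powr_mono) auto
      qed (use that \<open>1 \<le> t0\<close> in auto)
    qed (use that t E0 in auto)
    have mi: "set_integrable lborel {t0..t1} (\<lambda>s. mass (\<phi> s))" if "1 \<le> t0" for t0 t1
    proof -
      have "set_integrable lborel {t0<..<t1} (\<lambda>s. mass (\<phi> s))"
      proof (rule set_integrable_bound[where f="\<lambda>_. E"])
        show "set_integrable lborel {t0<..<t1} (\<lambda>_. E)"
          by (rule set_integrable_subset[OF borel_integrable_atLeastAtMost'[of t0 t1 "\<lambda>_. E"]]) auto
        show "set_borel_measurable lborel {t0<..<t1} (\<lambda>s. mass (\<phi> s))" by (simp add: set_borel_measurable_def)
        have "\<bar>mass (\<phi> s)\<bar> \<le> \<bar>E\<bar>" if "t0 < s" for s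
        proof -
          have "s powr (-1) \<le> 1 powr (-1)" using that \<open>1 \<le> t0\<close> by (intro powr_mono2') auto
          then have "E * s powr (-1) \<le> E * 1" using E0 by (intro mult_left_mono) auto
          then show ?thesis using mass_le[of s] that \<open>1 \<le> t0\<close> E0 by simp
        qed
        then show "AE s in lborel. s \<in> {t0<..<t1} \<longrightarrow> norm (mass (\<phi> s)) \<le> norm E" by auto
      qed
      then show ?thesis using set_integral_closed_open(2)[OF mm] by simp
    qed
    define W1 where "W1 = (\<lambda>x. LINT s:{1<..<t/2}|lborel. gradheat a (t - s) (\<phi> s) x - mass (\<phi> s) * dheatG a t x)"
    define W2 where "W2 = (\<lambda>x. LINT s:{t/2..t}|lborel. gradheat a (t - s) (\<phi> s) x)"
    define m2 where "m2 = (LINT s:{t/2..t}|lborel. mass (\<phi> s))"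
    have eq: "A (Suc k) t x - Atil a f u0 k t x = W1 x + W2 x - m2 * dheatG a t x" for x
    proof -
      have "A (Suc k) t x - A k t x = duhamel a f (A k) 1 t t x - duhamel a f (A j) 1 t t x"
        unfolding A_Suc[of k] unfolding j A_Suc[of j] by simp
      also have "\<dots> = (LINT s:{1..t}|lborel. gradheat a (t - s) (\<phi> s) x)"
        unfolding \<phi>_def by (rule duhamel_diff_eq[OF refl A_measurable A_measurable _ _ _ K(3) K(2)]) (use t in auto)
      also have "\<dots> = (LINT s:{1..t/2}|lborel. gradheat a (t - s) (\<phi> s) x) + W2 x"
        unfolding W2_def by (rule set_integral_split[OF gm]) (use t gi in auto)
      finally have e1: "A (Suc k) t x - A k t x = (LINT s:{1..t/2}|lborel. gradheat a (t - s) (\<phi> s) x) + W2 x" .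
      have "Atil a f u0 k t x - A k t x = (LINT s:{1..t}|lborel. mass (\<phi> s)) * dheatG a t x"
        unfolding Atil_def \<phi>_def using sum_Lam_eq[of t a "{1..t}" \<phi> x] t j by (simp add: \<phi>_def)
      also have "(LINT s:{1..t}|lborel. mass (\<phi> s)) = (LINT s:{1..t/2}|lborel. mass (\<phi> s)) + m2"
        unfolding m2_def by (rule set_integral_split[OF mm]) (use t mi in auto)
      finally have e2: "Atil a f u0 k t x - A k t x = ((LINT s:{1..t/2}|lborel. mass (\<phi> s)) + m2) * dheatG a t x" .
      have mi': "set_integrable lborel {1..t/2} (\<lambda>s. mass (\<phi> s) * dheatG a t x)" using mi[of 1 "t/2"] by simp
      have "W1 x = (LINT s:{1..t/2}|lborel. gradheat a (t - s) (\<phi> s) x - mass (\<phi> s) * dheatG a t x)"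
        unfolding W1_def by (rule set_integral_closed_open(1)[symmetric]) (use gm mm in auto)
      also have "\<dots> = (LINT s:{1..t/2}|lborel. gradheat a (t - s) (\<phi> s) x) - (LINT s:{1..t/2}|lborel. mass (\<phi> s) * dheatG a t x)"
        by (rule set_integral_diff(2)[OF gi mi']) (use t in auto)
      also have "(LINT s:{1..t/2}|lborel. mass (\<phi> s) * dheatG a t x) = (LINT s:{1..t/2}|lborel. mass (\<phi> s)) * dheatG a t x" by simp
      finally show ?thesis using e1 e2 by (simp add: algebra_simps)
    qed
    \<comment> \<open>Both replacement errors are at most C E s^(-1/2) / t, the first because
      t^(-3/2) <= s^(-1/2) / t. Integrating s^(-1/2) up to t gives 2 sqrt t, and so the constant 4 C
      E.\<close>
    have 1: "sbound t W1 (4 * C * E * t powr (-1/2))"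
      unfolding W1_def
    proof (rule sbound_curve_integral(1)[where \<beta>="\<lambda>s. (2 * C * E / t) * s powr (-(1/2))"])
      show "(\<lambda>(s, x). gradheat a (t - s) (\<phi> s) x - mass (\<phi> s) * dheatG a t x) \<in> borel_measurable (borel \<Otimes>\<^sub>M borel)"
        unfolding gradheat_def by measurable
      fix s assume s: "s \<in> {1<..<t/2}"
      have "sbound t (\<lambda>x. gradheat a (t - s) (\<phi> s) x - mass (\<phi> s) * dheatG a t x) (C * (s * t powr (-3/2) * (E * s powr (-1)) + (E * s powr (-(1/2))) / t))"
        by (rule C(2)[OF _ _ _ sbound_integrable[OF \<phi>s] _ _ sboundD(3)[OF \<phi>s] \<phi>mom]) (use s t E0 in auto)
      then show "sbound t (\<lambda>x. gradheat a (t - s) (\<phi> s) x - mass (\<phi> s) * dheatG a t x) ((2 * C * E / t) * s powr (-(1/2)))"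
      proof (rule sbound_mono)
        have e1: "s * t powr (-3/2) * (E * s powr (-1)) = E * t powr (-3/2)" using s by (simp add: powr_minus_divide)
        have e2: "t powr (-3/2) = t powr (-(1/2)) / t" using t powr_diff[of t "-(1/2)" 1] by simp
        have "E * t powr (-3/2) \<le> E * (s powr (-(1/2)) / t)"
          unfolding e2 using s t E0 by (intro mult_left_mono divide_right_mono powr_mono2') auto
        then have "C * (s * t powr (-3/2) * (E * s powr (-1)) + (E * s powr (-(1/2))) / t) \<le> C * (E * (s powr (-(1/2)) / t) + (E * s powr (-(1/2))) / t)"
          unfolding e1 by (rule mult_left_mono[OF add_right_mono C(1)])
        then show "C * (s * t powr (-3/2) * (E * s powr (-1)) + (E * s powr (-(1/2))) / t) \<le> (2 * C * E / t) * s powr (-(1/2))"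
          by (simp add: algebra_simps)
      qed
    next
      have "(\<integral>\<^sup>+s\<in>{1<..<t/2}. ennreal ((2 * C * E / t) * s powr (-(1/2))) \<partial>lborel) = ennreal (2 * C * E / t) * (\<integral>\<^sup>+s\<in>{1<..<t/2}. ennreal (s powr (-(1/2))) \<partial>lborel)"
        by (rule set_nn_integral_cmult) (use C(1) E0 t in auto)
      also have "\<dots> \<le> ennreal (2 * C * E / t) * ennreal (t powr (1 - 1/2) / (1 - 1/2))"
      proof (rule mult_left_mono)
        have "(\<integral>\<^sup>+s\<in>{1<..<t/2}. ennreal (s powr (-(1/2))) \<partial>lborel) \<le> (\<integral>\<^sup>+s\<in>{0<..<t}. ennreal (s powr (-(1/2))) \<partial>lborel)"
          using t by (intro nn_integral_mono) (auto simp: indicator_def)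
        also have "\<dots> \<le> ennreal (t powr (1 - 1/2) / (1 - 1/2))" by (rule nn_integral_powr_from_0) (use t in auto)
        finally show "(\<integral>\<^sup>+s\<in>{1<..<t/2}. ennreal (s powr (-(1/2))) \<partial>lborel) \<le> ennreal (t powr (1 - 1/2) / (1 - 1/2))" .
      qed simp
      also have "\<dots> = ennreal ((2 * C * E / t) * (t powr (1 - 1/2) / (1 - 1/2)))" using C(1) E0 t by (intro ennreal_mult[symmetric]) auto
      also have "(2 * C * E / t) * (t powr (1 - 1/2) / (1 - 1/2)) = 4 * C * E * t powr (-1/2)"
      proof -
        have "t powr (1/2) / t = t powr (-1/2)" using t powr_diff[of t "1/2" 1] by simp
        then have "4 * C * E * (t powr (1/2) / t) = 4 * C * E * t powr (-1/2)" by (rule arg_cong)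
        then show ?thesis by (simp add: mult_ac)
      qed
      finally show "(\<integral>\<^sup>+s\<in>{1<..<t/2}. ennreal ((2 * C * E / t) * s powr (-(1/2))) \<partial>lborel) \<le> ennreal (4 * C * E * t powr (-1/2))" .
    qed (use C(1) E0 in auto)
    have 2: "sbound t W2 (c * (2 * E + 2 * (2 * E)) * t powr (-1/2))"
      unfolding W2_def c_def
      by (rule duhamel_integrable_bound[OF \<phi>m _ _ _ _ \<phi>s E0 J2]) (use t tail E0 in auto)
    have m2: "\<bar>m2\<bar> \<le> E"
    proof -
      have "ennreal \<bar>m2\<bar> = ennreal \<bar>LINT s:{t/2<..<t}|lborel. mass (\<phi> s)\<bar>" unfolding m2_def by (simp add: set_integral_closed_open(1)[OF mm])
      also have "\<dots> \<le> (\<integral>\<^sup>+s\<in>{t/2<..<t}. ennreal \<bar>mass (\<phi> s)\<bar> \<partial>lborel)" by (rule ennreal_abs_set_integral_le)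
      also have "\<dots> \<le> (\<integral>\<^sup>+s\<in>{t/2<..<t}. ennreal (E * s powr (-1)) \<partial>lborel)"
        using mass_le t by (intro nn_integral_mono) (auto simp: indicator_def intro!: ennreal_leI)
      also have "\<dots> \<le> ennreal E" by (rule J2)
      finally show ?thesis using E0 by (simp add: ennreal_le_iff)
    qed
    have "sbound t (\<lambda>x. m2 * dheatG a t x) (\<bar>m2\<bar> * (c' * t powr (-1/2)))"
      unfolding c'_def by (intro sbound_cmult sbound_dheatG) (use t in simp)
    then have 3: "sbound t (\<lambda>x. m2 * dheatG a t x) (E * c' * t powr (-1/2))"
    proof (rule sbound_mono)
      have "\<bar>m2\<bar> * (c' * t powr (-1/2)) \<le> E * (c' * t powr (-1/2))" using m2 c0 by (intro mult_right_mono) auto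
      then show "\<bar>m2\<bar> * (c' * t powr (-1/2)) \<le> E * c' * t powr (-1/2)" by (simp only: mult.assoc)
    qed
    show "sbound t (\<lambda>x. A (Suc k) t x - Atil a f u0 k t x) ((4 * C * E + c * (2 * E + 2 * (2 * E)) + E * c') * t powr (-1/2))"
      unfolding eq using sbound_diff[OF sbound_add[OF 1 2] 3] by (simp only: distrib_right)
  qed
  qed
qed

lemma asymptotics:
  "\<exists>C>0. \<forall>t>2. sbound t (\<lambda>x. U t x - Atil a f u0 k t x) (C * t powr (-1/2))"
proof -
  obtain C1 where C1: "0 \<le> C1" "\<And>t. 2 \<le> t \<Longrightarrow> sbound t (\<lambda>x. U t x - A (Suc k) t x) (C1 * t powr (-1/2))"
    using error_final by auto
  obtain C2 where C2: "0 \<le> C2" "\<And>t. 2 < t \<Longrightarrow> sbound t (\<lambda>x. A (Suc k) t x - Atil a f u0 k t x) (C2 * t powr (-1/2))"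
    using correction_bound by auto
  show ?thesis
  \<comment> \<open>The summand 1 makes the constant strictly positive.\<close>
  proof (intro exI[of _ "C1 + C2 + 1"] conjI allI impI)
    fix t :: real assume t: "2 < t"
    have "sbound t (\<lambda>x. (U t x - A (Suc k) t x) + (A (Suc k) t x - Atil a f u0 k t x)) (C1 * t powr (-1/2) + C2 * t powr (-1/2))"
      by (intro sbound_add C1 C2) (use t in auto)
    then have "sbound t (\<lambda>x. U t x - Atil a f u0 k t x) (C1 * t powr (-1/2) + C2 * t powr (-1/2))" by simp
    then show "sbound t (\<lambda>x. U t x - Atil a f u0 k t x) ((C1 + C2 + 1) * t powr (-1/2))"
      by (rule sbound_mono) (simp add: algebra_simps)
  qed (use C1 C2 in auto)
qed

end


section \<open>From the endpoint norms to L^q\<close>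

lemma Lnorm_cong_AE:
  assumes "AE x in lborel. \<phi> x = \<eta> x" "\<phi> \<in> borel_measurable borel" "\<eta> \<in> borel_measurable borel"
  shows "Lnorm q \<phi> = Lnorm q \<eta>"
proof -
  have "esssup lborel (\<lambda>x. ennreal \<bar>\<phi> x\<bar>) = esssup lborel (\<lambda>x. ennreal \<bar>\<eta> x\<bar>)"
  proof (rule antisym)
    show "esssup lborel (\<lambda>x. ennreal \<bar>\<phi> x\<bar>) \<le> esssup lborel (\<lambda>x. ennreal \<bar>\<eta> x\<bar>)"
      by (rule esssup_AE_mono) (use assms in auto)
    show "esssup lborel (\<lambda>x. ennreal \<bar>\<eta> x\<bar>) \<le> esssup lborel (\<lambda>x. ennreal \<bar>\<phi> x\<bar>)"
      by (rule esssup_AE_mono) (use assms in auto)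
  qed
  moreover have "(\<integral>\<^sup>+x. ennreal (\<bar>\<phi> x\<bar> powr r) \<partial>lborel) = (\<integral>\<^sup>+x. ennreal (\<bar>\<eta> x\<bar> powr r) \<partial>lborel)" for r
    by (rule nn_integral_cong_AE) (use assms(1) in auto)
  ultimately show ?thesis unfolding Lnorm_def by simp
qed

text \<open>Interpolation: for Q >= 1, |\<open>\<phi>\<close>|^Q is at most |\<open>\<phi>\<close>|
  times the (Q - 1)-th power of the sup bound. The Q-th root of the resulting power of t cancels the
  weight exactly.\<close>

lemma sbound_Lnorm:
  fixes \<phi> :: "'a::euclidean_space \<Rightarrow> real" and q :: ereal
  assumes \<phi>: "sbound t \<phi> r" and t: "0 < t" and r: "0 < r" and q: "1 \<le> q"
  shows "ennreal (t powr (real DIM('a) / 2 * (if q = \<infinity> then 1 else 1 - 1 / real_of_ereal q))) * Lnorm q \<phi> \<le> ennreal r"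
proof -
  let ?d = "real DIM('a) / 2"
  note [measurable] = sboundD(1)[OF \<phi>]
  have b: "\<bar>\<phi> x\<bar> \<le> r * t powr (-?d)" for x using sboundD(4)[OF \<phi>, of x] by simp
  show ?thesis
  proof (cases "q = \<infinity>")
    case True
    have "Lnorm q \<phi> \<le> ennreal (r * t powr (-?d))"
      unfolding Lnorm_def using True b by (auto intro!: esssup_I ennreal_leI)
    then have "ennreal (t powr ?d) * Lnorm q \<phi> \<le> ennreal (t powr ?d) * ennreal (r * t powr (-?d))" by (intro mult_left_mono) auto
    also have "\<dots> = ennreal (t powr ?d * (r * t powr (-?d)))" using r by (intro ennreal_mult[symmetric]) auto
    also have "t powr ?d * (r * t powr (-?d)) = r" using t by (simp add: powr_minus)
    finally show ?thesis using True by simp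
  next
    case False
    then obtain Q where Q: "q = ereal Q" "1 \<le> Q" using q by (cases q) (auto simp: one_ereal_def)
    define I where "I = (\<integral>\<^sup>+x. ennreal (\<bar>\<phi> x\<bar> powr Q) \<partial>lborel)"
    define N where "N = (r * t powr (-?d)) powr (Q - 1) * r"
    have N0: "0 \<le> N" using r by (simp add: N_def)
    have "I \<le> (\<integral>\<^sup>+x. ennreal ((r * t powr (-?d)) powr (Q - 1)) * ennreal \<bar>\<phi> x\<bar> \<partial>lborel)"
      unfolding I_def
    proof (intro nn_integral_mono)
      fix x
      have "\<bar>\<phi> x\<bar> powr Q = \<bar>\<phi> x\<bar> powr (Q - 1) * \<bar>\<phi> x\<bar>"
        by (cases "\<phi> x = 0") (auto simp: powr_diff)
      also have "\<dots> \<le> (r * t powr (-?d)) powr (Q - 1) * \<bar>\<phi> x\<bar>"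
        using b[of x] Q by (intro mult_right_mono powr_mono2) auto
      finally show "ennreal (\<bar>\<phi> x\<bar> powr Q) \<le> ennreal ((r * t powr (-?d)) powr (Q - 1)) * ennreal \<bar>\<phi> x\<bar>"
        by (simp add: ennreal_mult[symmetric] ennreal_leI)
    qed
    also have "\<dots> = ennreal ((r * t powr (-?d)) powr (Q - 1)) * (\<integral>\<^sup>+x. ennreal \<bar>\<phi> x\<bar> \<partial>lborel)" by (intro nn_integral_cmult) measurable
    also have "\<dots> \<le> ennreal ((r * t powr (-?d)) powr (Q - 1)) * ennreal r" by (intro mult_left_mono sboundD(3)[OF \<phi>]) auto
    also have "\<dots> = ennreal N" unfolding N_def using r by (intro ennreal_mult[symmetric]) auto
    finally have I: "I \<le> ennreal N" .
    then have Ifin: "I \<noteq> \<infinity>" by (auto simp: top_unique)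
    have "enn2real I \<le> N" using enn2real_mono[OF I] N0 by simp
    then have "enn2real I powr (1 / Q) \<le> N powr (1 / Q)" using Q by (intro powr_mono2) auto
    also have "\<dots> = r * t powr (- (?d * (1 - 1 / Q)))"
    proof -
      have "N = r powr Q * t powr (- ?d * (Q - 1))"
      proof -
        have "r powr (Q - 1) * r = r powr Q" using r by (simp add: powr_diff)
        then show ?thesis unfolding N_def powr_mult powr_powr by (metis mult.assoc mult.commute)
      qed
      then have "N powr (1 / Q) = r powr (Q * (1 / Q)) * t powr (- ?d * (Q - 1) * (1 / Q))"
        using r t by (simp only: powr_mult powr_powr)
      also have "Q * (1 / Q) = 1" using Q by simp
      also have "- ?d * (Q - 1) * (1 / Q) = - (?d * (1 - 1 / Q))" using Q by (simp add: field_simps)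
      finally show ?thesis using r by simp
    qed
    finally have le: "ennreal (enn2real I powr (1 / Q)) \<le> ennreal (r * t powr (- (?d * (1 - 1 / Q))))" by (rule ennreal_leI)
    have "Lnorm q \<phi> = ennreal (enn2real I powr (1 / Q))"
      unfolding Lnorm_def using Q Ifin by (simp add: I_def Let_def)
    then have "ennreal (t powr (?d * (1 - 1 / Q))) * Lnorm q \<phi> \<le> ennreal (t powr (?d * (1 - 1 / Q))) * ennreal (r * t powr (- (?d * (1 - 1 / Q))))"
      using le by (simp add: mult_left_mono)
    also have "\<dots> = ennreal (t powr (?d * (1 - 1 / Q)) * (r * t powr (- (?d * (1 - 1 / Q)))))" using r by (intro ennreal_mult[symmetric]) auto
    also have "t powr (?d * (1 - 1 / Q)) * (r * t powr (- (?d * (1 - 1 / Q)))) = r" using t by (simp add: powr_minus)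
    finally show ?thesis using Q by simp
  qed
qed

lemma moment_finite:
  fixes \<phi> :: "'a::euclidean_space \<Rightarrow> real"
  assumes \<phi>: "integrable lborel \<phi>" and b: "\<forall>b\<in>Basis. integrable lborel (\<lambda>x. (x \<bullet> b) * \<phi> x)"
  shows "moment \<phi> < \<infinity>"
proof -
  have [measurable]: "\<phi> \<in> borel_measurable borel" using \<phi> by auto
  have "moment \<phi> \<le> (\<integral>\<^sup>+x. (\<Sum>b\<in>Basis. ennreal \<bar>(x \<bullet> b) * \<phi> x\<bar>) \<partial>lborel)"
    unfolding moment_def
  proof (intro nn_integral_mono)
    fix x :: 'a
    have "norm x * \<bar>\<phi> x\<bar> \<le> (\<Sum>b\<in>Basis. \<bar>x \<bullet> b\<bar>) * \<bar>\<phi> x\<bar>" by (intro mult_right_mono norm_le_l1) auto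
    also have "\<dots> = (\<Sum>b\<in>Basis. \<bar>(x \<bullet> b) * \<phi> x\<bar>)" by (simp add: sum_distrib_right abs_mult)
    finally show "ennreal (norm x * \<bar>\<phi> x\<bar>) \<le> (\<Sum>b\<in>Basis. ennreal \<bar>(x \<bullet> b) * \<phi> x\<bar>)" by (simp add: sum_ennreal ennreal_leI)
  qed
  also have "\<dots> = (\<Sum>b\<in>Basis. \<integral>\<^sup>+x. ennreal \<bar>(x \<bullet> b) * \<phi> x\<bar> \<partial>lborel)" by (rule nn_integral_sum) measurable
  also have "\<dots> = (\<Sum>b\<in>Basis. ennreal (\<integral>x. \<bar>(x \<bullet> b) * \<phi> x\<bar> \<partial>lborel))"
    using b by (intro sum.cong nn_integral_eq_integral) auto
  also have "\<dots> < \<infinity>" by (simp add: sum_ennreal)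
  finally show ?thesis .
qed

theorem theorem2p2:
  fixes a :: "'a::euclidean_space" and f :: "real \<Rightarrow> real"
    and u0 :: "'a \<Rightarrow> real" and u :: "real \<Rightarrow> 'a \<Rightarrow> real"
    and k :: nat and p Cf :: real and q :: ereal
  assumes a_nz: "a \<noteq> 0"
    and k_pos: "k > 0"
    and p_def: "p = 1 + real (k + 2) / (real (k + 1) * real DIM('a))"
    and f_C1: "f C1_differentiable_on UNIV"
    and f_nz: "\<exists>z. f z \<noteq> 0"
    and f0: "f 0 = 0"
    and f_lip: "\<forall>\<xi> \<eta>. \<bar>f \<xi> - f \<eta>\<bar> \<le> Cf * (\<bar>\<xi>\<bar> powr (p - 1) + \<bar>\<eta>\<bar> powr (p - 1)) * \<bar>\<xi> - \<eta>\<bar>"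
    and u0_L1: "integrable lborel u0"
    and u0_L11: "\<forall>b\<in>Basis. integrable lborel (\<lambda>x. (x \<bullet> b) * u0 x)"
    and u0_Linf: "\<exists>M. AE x in lborel. \<bar>u0 x\<bar> \<le> M"
    and sol: "global_solution a f u0 u"
    and q_ge: "1 \<le> q"
  shows "\<exists>C>0. \<forall>t>2 ^ (k + 1).
           ennreal (t powr (real DIM('a) / 2 * (if q = \<infinity> then 1 else 1 - 1 / real_of_ereal q)))
             * Lnorm q (\<lambda>x. u t x - Atil a f u0 k t x)
           \<le> ennreal (C * t powr (- 1 / 2))"
proof -
  have f_cont: "continuous_on UNIV f"
    using f_C1 by (rule C1_differentiable_imp_continuous_on)
  then have f_meas: "f \<in> borel_measurable borel" by (rule borel_measurable_continuous_onI)
  define \<sigma> where "\<sigma> = 1 / (2 * (real k + 1))"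
  have \<sigma>: "0 < \<sigma>" "\<sigma> < 1/2" using k_pos by (auto simp: \<sigma>_def field_simps)
  \<comment> \<open>n(p - 1)/2 = (k + 2)/(2(k + 1)) = 1/2 + 1/(2(k + 1)).\<close>
  have ex: "real DIM('a) / 2 * (p - 1) = 1/2 + \<sigma>"
    unfolding p_def \<sigma>_def by (simp add: divide_simps) (simp add: algebra_simps)
  \<comment> \<open>\<open>Cf\<close> comes without a sign, hence its absolute value as the
    constant.\<close>
  interpret power_flux f p \<sigma> "\<bar>Cf\<bar>" "real DIM('a) / 2"
  proof
    show "\<bar>f \<xi> - f \<eta>\<bar> \<le> \<bar>Cf\<bar> * (\<bar>\<xi>\<bar> powr (p - 1) + \<bar>\<eta>\<bar> powr (p - 1)) * \<bar>\<xi> - \<eta>\<bar>" for \<xi> \<eta>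
    proof -
      have "Cf * (\<bar>\<xi>\<bar> powr (p - 1) + \<bar>\<eta>\<bar> powr (p - 1)) * \<bar>\<xi> - \<eta>\<bar> \<le> \<bar>Cf\<bar> * (\<bar>\<xi>\<bar> powr (p - 1) + \<bar>\<eta>\<bar> powr (p - 1)) * \<bar>\<xi> - \<eta>\<bar>"
        by (intro mult_right_mono) auto
      then show ?thesis using f_lip by (meson order_trans)
    qed
  qed (use f_meas f0 ex \<sigma> in auto)
  obtain M0 where M0: "AE x in lborel. \<bar>u0 x\<bar> \<le> M0" using u0_Linf by blast
  have lip: "\<exists>L\<ge>0. \<forall>x y. \<bar>x\<bar> \<le> M \<longrightarrow> \<bar>y\<bar> \<le> M \<longrightarrow> \<bar>f x - f y\<bar> \<le> L * \<bar>x - y\<bar>" if "0 \<le> M" for M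
    using flux_locally_lipschitz[OF that] by (intro exI[of _ "2 * \<bar>Cf\<bar> * M powr (p - 1)"]) auto
  show ?thesis
  proof (rule mild_solution_exists[OF sol f_meas f0 lip u0_L1 M0])
    fix U M
    assume U: "0 < M" "case_prod U \<in> borel_measurable (borel \<Otimes>\<^sub>M borel)"
      "\<And>t. 0 < t \<Longrightarrow> AE x in lborel. U t x = u t x"
      "\<And>t. 0 < t \<Longrightarrow> sbound 1 (U t) M"
      "\<And>t x. 0 < t \<Longrightarrow> U t x = heat t u0 x + (LINT s:{0..t}|lborel. gradheat a (t - s) (\<lambda>y. f (U s y)) x)"
      "\<And>T t x. 0 < T \<Longrightarrow> 0 < t \<Longrightarrow> U (T + t) x = heat t (U T) x + (LINT s:{0..t}|lborel. gradheat a (t - s) (\<lambda>y. f (U (T + s) y)) x)"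
    interpret mild_solution a f U M "2 * \<bar>Cf\<bar> * M powr (p - 1)"
    proof
      show "\<bar>f x - f y\<bar> \<le> 2 * \<bar>Cf\<bar> * M powr (p - 1) * \<bar>x - y\<bar>" if "\<bar>x\<bar> \<le> M" "\<bar>y\<bar> \<le> M" for x y
        by (rule flux_locally_lipschitz) (use U(1) that in auto)
    qed (fact U f_cont f0 | simp)+
    interpret convection_asymptotics a f U M "2 * \<bar>Cf\<bar> * M powr (p - 1)" p \<sigma> "\<bar>Cf\<bar>" u0 k
    proof
      show "moment u0 < \<infinity>" by (rule moment_finite[OF u0_L1 u0_L11])
    qed (fact u0_L1 k_pos \<sigma>_def U(5))+
    obtain C where C: "0 < C" "\<And>t. 2 < t \<Longrightarrow> sbound t (\<lambda>x. U t x - Atil a f u0 k t x) (C * t powr (-1/2))"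
      using asymptotics by blast
    show ?thesis
    proof (intro exI[of _ C] conjI allI impI C(1))
      fix t :: real assume "2 ^ (k + 1) < t"
      \<comment> \<open>Places the range t > 2^(k + 1) inside t > 2, where
        \<open>asymptotics\<close> applies.\<close>
      moreover have "(2::real) \<le> 2 ^ (k + 1)" using power_increasing[of 1 "k + 1" "2::real"] by simp
      ultimately have t: "2 < t" by (rule le_less_trans[rotated])
      have ut: "integrable lborel (u t)" using sol t unfolding global_solution_def by auto
      have Us: "sbound t (\<lambda>x. U t x - Atil a f u0 k t x) (C * t powr (-1/2))" by (rule C(2)[OF t])
      have Um: "U t \<in> borel_measurable borel" by (rule sboundD(1)[OF U(4)]) (use t in simp)
      \<comment> \<open>Measurability is read off from the estimate: \<open>Atil\<close> is the
        difference of \<open>U t\<close> and a function with an \<open>sbound\<close>, and both are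
        measurable.\<close>
      have [measurable]: "Atil a f u0 k t \<in> borel_measurable borel"
      proof -
        have "(\<lambda>x. U t x - (U t x - Atil a f u0 k t x)) \<in> borel_measurable borel"
          using Um sboundD(1)[OF Us] by (rule borel_measurable_diff)
        then show ?thesis by simp
      qed
      have "Lnorm q (\<lambda>x. u t x - Atil a f u0 k t x) = Lnorm q (\<lambda>x. U t x - Atil a f u0 k t x)"
        by (rule Lnorm_cong_AE) (use U(3)[of t] t ut Um in auto)
      then show "ennreal (t powr (real DIM('a) / 2 * (if q = \<infinity> then 1 else 1 - 1 / real_of_ereal q)))
             * Lnorm q (\<lambda>x. u t x - Atil a f u0 k t x) \<le> ennreal (C * t powr (- 1 / 2))"
        using sbound_Lnorm[OF Us _ _ q_ge] t C(1) by simp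
    qed
  qed
qed

end
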